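(* As $N\to\infty$, the following convergences in law hold: \[ \big(c_N^{-1}\mathcal X_N(\lfloor t\log_2 N\rfloor)\big)_{t\ge 0}\Longrightarrow (\mathcal R^\alpha(t))_{t\ge0}\quad\text{in the } J_1\text{-topology}, \] \[ \big(c_N^{-1}\mathcal X_N(\lfloor t\log_2 N\rfloor),\,c_N^{-1}\mathcal X_1(\lfloor t\log_2 N\rfloor)\big)_{t\ge 0}\Longrightarrow (\mathcal R^\alpha(t),\mathcal R^\alpha(t-1))_{t\ge0}\quad\text{in the } SM_1\text{-topology}. \]
   Context: Let $X$ be a random variable with values in $[0,\infty)$ and define $h$ by $\mathbb P(X>x)=1/h(x)$ for $x\ge0$. Assume $h$ is regularly varying at $+\infty$ with index $\alpha>0$. Let $h^{-1}(y)=\inf\{x\ge0:h(x)>y\}$ be the generalized inverse and $c_N=h^{-1}(2N\log_2 N)$ (which is positive for all large $N$). $N$-BRW ($N$-branching random walk): Let $(X_{n,i})_{n\ge0,\,i\in[2N]}$ be i.i.d. copies of $X$, where $[k]=\{1,\dots,k\}$. Set $\mathcal X_i(0)=0$ for $i\in[N]$. Inductively, for $n\ge0$, $\mathcal X_1(n+1)\le\dots\le\mathcal X_N(n+1)$ are the $N$ largest numbers (with multiplicity) of the collection $(\mathcal X_i(n)+X_{n,2i-j})_{i\in[N],\,j\in\{0,1\}}$, sorted in ascending order. Stairs process: A stairs measure is a non-zero measure $\mu$ on $(0,\infty)$ with $\mu([a,\infty))<\infty$ for every $a>0$. Given a Poisson point process on $\{(t,x):t,x>0\}$ with intensity $\mathrm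 dt\otimes\mu$, set $\xi_t=x$ if $(t,x)$ is an atom and $\xi_t=0$ otherwise (in particular $\xi_t=0$ for $t\le0$). The $\mu$-stairs process $\mathcal R$ is defined by $\mathcal R(t)=0$ for $t\le0$ and, inductively for $n=0,1,2,\dots$ and $t\in(n,n+1]$, $\mathcal R(t)=\max_{s\in[0,1]}(\mathcal R(t-s-1)+\xi_{t-s})$. It is non-decreasing and càdlàg. $\mathcal R^\alpha$ denotes the $\mu_\alpha$-stairs process, where $\mu_\alpha([x,\infty))=x^{-\alpha}$ for $x>0$. Topologies: $J_1$ is the usual Skorokhod topology on $D([0,\infty),\mathbb R)$. $SM_1$ is the strong $M_1$ topology on $D([0,\infty),\mathbb R^2)$ (Whitt, Stochastic-Process Limits, Chapter 12): for $x\in D([0,T],\mathbb R^k)$ let $\Gamma_x=\{(z,t)\in\mathbb R^k\times[0,T]: z\in[x(t-),x(t)]\}$, where $[a,b]$ is the line segment joining $a,b\in\mathbb R^k$ and $x(0-):=x(0)$, ordered by $(z_1,t_1)\le(z_2,t_2)$ iff $t_1<t_2$, or $t_1=t_2=t$ and $|x(t-)-z_1|\le|x(t-)-z_2|$. A parametric representation of $x$ is a continuous non-decreasing map $(u,r)$ from $[0,1]$ onto $\Gamma_x$. The $SM_1$ distance of $x_1,x_2$ is the infimum of $\max(\|u_1-u_2\|_\infty,\|r_1-r_2\|_\infty)$ over parametric representations $(u_i,r_i)$ of $x_i$. Convergence in $D([0,\infty),\mathbb R^k)$ means convergence of the restrictions to $[0,T]$ for every continuity point $T$ of the limit. *)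

theory Defs
  imports "HOL-Probability.Probability"
begin

section \<open>Regular variation and generalized inverse\<close>

definition regularly_varying :: "(real \<Rightarrow> real) \<Rightarrow> real \<Rightarrow> bool" where
  "regularly_varying f \<rho> \<longleftrightarrow>
     (\<exists>a. f \<in> borel_measurable (restrict_space borel {a..}) \<and> (\<forall>x\<ge>a. 0 < f x)) \<and>
     (\<forall>c>0. ((\<lambda>x. f (c * x) / f x) \<longlongrightarrow> c powr \<rho>) at_top)"

definition gen_inverse :: "(real \<Rightarrow> real) \<Rightarrow> real \<Rightarrow> real" where
  "gen_inverse f y = Inf {x. 0 \<le> x \<and> y < f x}"

definition scaling :: "(real \<Rightarrow> real) \<Rightarrow> nat \<Rightarrow> real" where
  "scaling h N = gen_inverse h (2 * real N * log 2 (real N))"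

section \<open>The N-branching random walk\<close>

text \<open>The displacement array \<open>x n i\<close> is used for \<open>i = 1, \<dots>, 2 * N\<close>. The \<open>N\<close> positions at
  time \<open>n\<close> form a list in ascending order, so that dropping the first \<open>N\<close> entries of the sorted
  list of the \<open>2 * N\<close> children keeps the \<open>N\<close> largest ones.\<close>

primrec brw_list :: "nat \<Rightarrow> (nat \<Rightarrow> nat \<Rightarrow> real) \<Rightarrow> nat \<Rightarrow> real list" where
  "brw_list N x 0 = replicate N 0"
| "brw_list N x (Suc n) =
     drop N (sort [brw_list N x n ! (i - 1) + x n (2 * i - j). i \<leftarrow> [1..<Suc N], j \<leftarrow> [0, 1]])"

text \<open>Particles are numbered from \<open>1\<close>, list entries from \<open>0\<close>.\<close>

definition brw :: "nat \<Rightarrow> (nat \<Rightarrow> nat \<Rightarrow> real) \<Rightarrow> nat \<Rightarrow> nat \<Rightarrow> real" where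
  "brw N x i n = brw_list N x n ! (i - 1)"

section \<open>Poisson point processes\<close>

text \<open>A point process is represented by its random counting measure. The Poisson probabilities are
  written out because \<^const>\<open>poisson_pmf\<close> is only specified for a strictly positive rate.\<close>

definition poisson_point_process ::
    "'w measure \<Rightarrow> 'b measure \<Rightarrow> ('w \<Rightarrow> 'b measure) \<Rightarrow> bool" where
  "poisson_point_process M \<Lambda> \<eta> \<longleftrightarrow>
     (\<forall>\<omega>\<in>space M. sets (\<eta> \<omega>) = sets \<Lambda>) \<and>
     (\<forall>B\<in>sets \<Lambda>. (\<lambda>\<omega>. emeasure (\<eta> \<omega>) B) \<in> borel_measurable M) \<and>
     (\<forall>B\<in>sets \<Lambda>. emeasure \<Lambda> B < \<infinity> \<longrightarrow>
        (\<forall>k. measure M {\<omega> \<in> space M. emeasure (\<eta> \<omega>) B = of_nat k} =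
             measure \<Lambda> B ^ k / fact k * exp (- measure \<Lambda> B))) \<and>
     (\<forall>B :: nat \<Rightarrow> 'b set. disjoint_family B \<and> range B \<subseteq> sets \<Lambda> \<longrightarrow>
        prob_space.indep_vars M (\<lambda>_. borel) (\<lambda>i \<omega>. emeasure (\<eta> \<omega>) (B i)) UNIV)"

section \<open>Stairs processes\<close>

definition stairs_measure :: "real measure \<Rightarrow> bool" where
  "stairs_measure \<mu> \<longleftrightarrow>
     sets \<mu> = sets (restrict_space borel {0<..}) \<and>
     emeasure \<mu> {0<..} \<noteq> 0 \<and>
     (\<forall>a>0. emeasure \<mu> {a..} < \<infinity>)"

text \<open>Intensity on \<open>{(t, x). t, x > 0}\<close>.\<close>

definition stairs_intensity :: "real measure \<Rightarrow> (real \<times> real) measure" where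
  "stairs_intensity \<mu> = restrict_space lborel {0<..} \<Otimes>\<^sub>M \<mu>"

text \<open>Almost surely there is at most one atom above each time \<open>t\<close>, so the choice is immaterial.
  For \<open>t \<le> 0\<close> the singleton is not measurable, so its measure, hence the jump, is \<open>0\<close>.\<close>

definition jump :: "(real \<times> real) measure \<Rightarrow> real \<Rightarrow> real" where
  "jump \<nu> t = (if \<exists>x. emeasure \<nu> {(t, x)} \<noteq> 0 then SOME x. emeasure \<nu> {(t, x)} \<noteq> 0 else 0)"

text \<open>The recursion is over the unit intervals \<open>(n, n + 1]\<close>. Only finitely many atoms in a bounded
  time window lie above any positive level, so almost surely the supremum is attained, i.e. it is
  a maximum.\<close>

function stairs :: "(real \<Rightarrow> real) \<Rightarrow> real \<Rightarrow> real" where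
  "stairs \<xi> t =
     (if t \<le> 0 then 0 else (SUP s\<in>{0..1}. stairs \<xi> (t - s - 1) + \<xi> (t - s)))"
  by auto
termination
proof (relation "Wellfounded.measure (\<lambda>(\<xi>, t). nat \<lceil>t\<rceil>)")
  fix \<xi> :: "real \<Rightarrow> real" and t s :: real
  assume t: "\<not> t \<le> 0" and s: "s \<in> {0..1}"
  have "\<lceil>t - s - 1\<rceil> \<le> \<lceil>t - 1\<rceil>"
    by (rule ceiling_mono) (use s in auto)
  then have "\<lceil>t - s - 1\<rceil> < \<lceil>t\<rceil>"
    by simp
  moreover have "0 < \<lceil>t\<rceil>"
    using t by simp
  ultimately show "((\<xi>, t - s - 1), (\<xi>, t)) \<in> Wellfounded.measure (\<lambda>(\<xi>, t). nat \<lceil>t\<rceil>)"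
    by simp
qed simp

declare stairs.simps [simp del]

section \<open>Topologies on Skorokhod space\<close>

text \<open>A path on \<open>[0, \<infinity>)\<close> is an element of \<^term>\<open>extensional {0::real..}\<close>, so that equality
  of paths is equality on \<open>[0, \<infinity>)\<close>.\<close>

definition skorokhod_space :: "(real \<Rightarrow> 'a::topological_space) set" where
  "skorokhod_space = {x \<in> extensional {0..}.
     (\<forall>t\<ge>0. (x \<longlongrightarrow> x t) (at_right t)) \<and>
     (\<forall>t>0. \<exists>l. (x \<longlongrightarrow> l) (at_left t))}"

subsection \<open>The J1 distance on a bounded interval\<close>

definition time_changes :: "real \<Rightarrow> (real \<Rightarrow> real) set" where
  "time_changes T = {l. strict_mono_on {0..T} l \<and> l ` {0..T} = {0..T}}"

definition J1_dist :: "real \<Rightarrow> (real \<Rightarrow> 'a::metric_space) \<Rightarrow> (real \<Rightarrow> 'a) \<Rightarrow> real" where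
  "J1_dist T x y =
     (INF l\<in>time_changes T.
        max (SUP t\<in>{0..T}. \<bar>l t - t\<bar>) (SUP t\<in>{0..T}. dist (x (l t)) (y t)))"

subsection \<open>The strong M1 distance on a bounded interval\<close>

definition left_limit :: "(real \<Rightarrow> 'a::t2_space) \<Rightarrow> real \<Rightarrow> 'a" where
  "left_limit x t = (if t \<le> 0 then x 0 else Lim (at_left t) x)"

definition completed_graph :: "real \<Rightarrow> (real \<Rightarrow> 'a::real_normed_vector) \<Rightarrow> ('a \<times> real) set" where
  "completed_graph T x = {(z, t). t \<in> {0..T} \<and> z \<in> closed_segment (left_limit x t) (x t)}"

definition graph_le ::
    "(real \<Rightarrow> 'a::real_normed_vector) \<Rightarrow> 'a \<times> real \<Rightarrow> 'a \<times> real \<Rightarrow> bool" where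
  "graph_le x p q \<longleftrightarrow> snd p < snd q \<or>
     (snd p = snd q \<and>
      norm (left_limit x (snd p) - fst p) \<le> norm (left_limit x (snd p) - fst q))"

definition parametric_reps ::
    "real \<Rightarrow> (real \<Rightarrow> 'a::real_normed_vector) \<Rightarrow> ((real \<Rightarrow> 'a) \<times> (real \<Rightarrow> real)) set" where
  "parametric_reps T x = {(u, r).
     continuous_on {0..1} u \<and> continuous_on {0..1} r \<and>
     (\<lambda>s. (u s, r s)) ` {0..1} = completed_graph T x \<and>
     (\<forall>s\<in>{0..1}. \<forall>s'\<in>{0..1}. s \<le> s' \<longrightarrow> graph_le x (u s, r s) (u s', r s'))}"

definition SM1_dist ::
    "real \<Rightarrow> (real \<Rightarrow> 'a::real_normed_vector) \<Rightarrow> (real \<Rightarrow> 'a) \<Rightarrow> real" where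
  "SM1_dist T x y =
     Inf {max (SUP s\<in>{0..1}. norm (u1 s - u2 s)) (SUP s\<in>{0..1}. \<bar>r1 s - r2 s\<bar>) | u1 r1 u2 r2.
            (u1, r1) \<in> parametric_reps T x \<and> (u2, r2) \<in> parametric_reps T y}"

subsection \<open>Topologies on the half-line\<close>

definition skorokhod_converges ::
    "(real \<Rightarrow> (real \<Rightarrow> 'a::topological_space) \<Rightarrow> (real \<Rightarrow> 'a) \<Rightarrow> real) \<Rightarrow>
     (nat \<Rightarrow> real \<Rightarrow> 'a) \<Rightarrow> (real \<Rightarrow> 'a) \<Rightarrow> bool" where
  "skorokhod_converges d xs x \<longleftrightarrow>
     (\<forall>T>0. isCont x T \<longrightarrow> (\<lambda>n. d T (xs n) x) \<longlonglongrightarrow> 0)"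

text \<open>The topologies on \<open>D([0, \<infinity>))\<close> are given through their convergent sequences. As they are
  metrizable, open sets coincide with sequentially open sets.\<close>

definition skorokhod_topology ::
    "(real \<Rightarrow> (real \<Rightarrow> 'a::topological_space) \<Rightarrow> (real \<Rightarrow> 'a) \<Rightarrow> real) \<Rightarrow> (real \<Rightarrow> 'a) topology" where
  "skorokhod_topology d = topology (\<lambda>U. U \<subseteq> skorokhod_space \<and>
     (\<forall>x\<in>U. \<forall>xs. range xs \<subseteq> skorokhod_space \<and> skorokhod_converges d xs x \<longrightarrow>
        (\<forall>\<^sub>F n in sequentially. xs n \<in> U)))"

lemma openin_skorokhod_topology:
  "openin (skorokhod_topology d) U \<longleftrightarrow> U \<subseteq> skorokhod_space \<and>
     (\<forall>x\<in>U. \<forall>xs. range xs \<subseteq> skorokhod_space \<and> skorokhod_converges d xs x \<longrightarrow>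
        (\<forall>\<^sub>F n in sequentially. xs n \<in> U))"
proof -
  have "istopology (\<lambda>U. U \<subseteq> skorokhod_space \<and>
     (\<forall>x\<in>U. \<forall>xs. range xs \<subseteq> skorokhod_space \<and> skorokhod_converges d xs x \<longrightarrow>
        (\<forall>\<^sub>F n in sequentially. xs n \<in> U)))" (is "istopology ?L")
    unfolding istopology_def
  proof (intro conjI allI impI)
    fix U V assume "?L U" and "?L V"
    then show "U \<inter> V \<subseteq> skorokhod_space"
      by blast
    from \<open>?L U\<close> \<open>?L V\<close> show "\<forall>x\<in>U \<inter> V. \<forall>xs.
        range xs \<subseteq> skorokhod_space \<and> skorokhod_converges d xs x \<longrightarrow>
        (\<forall>\<^sub>F n in sequentially. xs n \<in> U \<inter> V)"
      unfolding Int_iff eventually_conj_iff by blast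
  next
    fix K assume K: "\<forall>U\<in>K. ?L U"
    show "\<Union> K \<subseteq> skorokhod_space"
      using K by blast
    show "\<forall>x\<in>\<Union> K. \<forall>xs. range xs \<subseteq> skorokhod_space \<and> skorokhod_converges d xs x \<longrightarrow>
        (\<forall>\<^sub>F n in sequentially. xs n \<in> \<Union> K)"
    proof (intro ballI allI impI)
      fix x xs
      assume "x \<in> \<Union> K" and c: "range xs \<subseteq> skorokhod_space \<and> skorokhod_converges d xs x"
      then obtain U where "U \<in> K" "x \<in> U"
        by blast
      then have "\<forall>\<^sub>F n in sequentially. xs n \<in> U"
        using K c by blast
      then show "\<forall>\<^sub>F n in sequentially. xs n \<in> \<Union> K"
        by (rule eventually_mono) (use \<open>U \<in> K\<close> in blast)
    qed
  qed
  then show ?thesis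
    by (simp add: skorokhod_topology_def topology_inverse')
qed

lemma topspace_skorokhod_topology: "topspace (skorokhod_topology d) = skorokhod_space"
proof
  show "topspace (skorokhod_topology d) \<subseteq> skorokhod_space"
    using openin_topspace[of "skorokhod_topology d"] unfolding openin_skorokhod_topology by blast
  show "skorokhod_space \<subseteq> topspace (skorokhod_topology d)"
    by (rule openin_subset) (simp add: openin_skorokhod_topology image_subset_iff)
qed

definition J1_topology :: "(real \<Rightarrow> 'a::metric_space) topology" where
  "J1_topology = skorokhod_topology J1_dist"

definition SM1_topology :: "(real \<Rightarrow> 'a::real_normed_vector) topology" where
  "SM1_topology = skorokhod_topology SM1_dist"

section \<open>Convergence in law\<close>

text \<open>Random elements only need to be defined up to null sets; the paths of a stairs process, for
  instance, are cadlag only almost surely. This is why the completed measure is used.\<close>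

definition random_element :: "'b topology \<Rightarrow> 'w measure \<Rightarrow> ('w \<Rightarrow> 'b) \<Rightarrow> bool" where
  "random_element S M Z \<longleftrightarrow>
     (AE \<omega> in M. Z \<omega> \<in> topspace S) \<and>
     (\<forall>U. openin S U \<longrightarrow> {\<omega> \<in> space M. Z \<omega> \<in> U} \<in> sets (completion M))"

definition converges_in_law ::
    "'b topology \<Rightarrow> (nat \<Rightarrow> 'w measure) \<Rightarrow> (nat \<Rightarrow> 'w \<Rightarrow> 'b) \<Rightarrow> 'v measure \<Rightarrow> ('v \<Rightarrow> 'b) \<Rightarrow> bool" where
  "converges_in_law S Ms Zs M Z \<longleftrightarrow>
     (\<forall>\<^sub>F n in sequentially. random_element S (Ms n) (Zs n)) \<and>
     random_element S M Z \<and>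
     (\<forall>f. continuous_map S euclideanreal f \<and> bounded (f ` topspace S) \<longrightarrow>
        (\<lambda>n. \<integral>\<omega>. f (Zs n \<omega>) \<partial>completion (Ms n)) \<longlonglongrightarrow> (\<integral>\<omega>. f (Z \<omega>) \<partial>completion M))"

end

theory Submission
  imports Defs "HOL-Real_Asymp.Real_Asymp"
begin

text \<open>Measure time in units of \<open>log 2 N\<close> generations and space in units of \<open>c\<^sub>N\<close>, cut time into cells of
  length \<open>1 / m\<close>, and record for each cell its largest displacement, rounded down to a multiple of
  \<open>\<delta>\<close>. For the stairs process and, with high probability, for the \<open>N\<close>-BRW, the displacements above
  \<open>\<delta>\<close> are so well separated that this record determines the path up to a small error: after a large
  displacement in cell \<open>i\<close> the height is the height one time unit earlier plus the displacement. For
  the \<open>N\<close>-BRW the lower bound holds because the offspring of the leader fills the population within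
  \<open>log 2 N\<close> generations. The upper bound comes from exponential moments of truncated displacements:
  sums of small displacements are negligible, and only few particles lie far above the position that
  the leader had almost one time unit earlier, so that none of them makes a large displacement.

  Two monotone paths with the same record are close in the \<open>J\<^sub>1\<close> distance, and in the \<open>SM\<^sub>1\<close> distance
  together with their delayed copies. The record takes finitely many values, and its law is
  determined by void probabilities, which converge to those of the Poisson process by regular
  variation. Letting the mesh go to \<open>0\<close> gives convergence in law.\<close>

section \<open>Convergence in law through discrete data\<close>

text \<open>The walks live on unrelated probability spaces, and the topologies are given through
  convergent sequences. Laws are therefore compared through finite records: a bounded continuous
  function is replaced by its supremum over all paths compatible with a record.

  The decisive exponent is that of the lag. In \<open>(1 - 1 / m) * log 2 N\<close> generations,
  slightly less than one time unit, a particle has about \<open>N powr (1 - 1 / m)\<close>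
  descendants, polynomially fewer than \<open>N\<close>. Exponential moments cost only a smaller
  power, so outliers form a fraction of order \<open>N powr (- 1 / (2 * m))\<close> of the
  population. The mean number of displacements above \<open>\<delta> * c N\<close> per time unit
  stays bounded, so it is unlikely that an outlier makes one of them. A lag of the full time unit
  would leave no such gain. The price is that the lag is known only up to one cell in either
  direction. This is why a jump must keep away from other jumps and also from their copies one time
  unit later.\<close>

lemma completion_sets_AE_iff:
  assumes "A \<in> sets M" "AE \<omega> in M. \<omega> \<in> A \<longleftrightarrow> P \<omega>"
  shows "{\<omega> \<in> space M. P \<omega>} \<in> sets (completion M)"
proof (rule completion.in_sets_AE)
  show "AE \<omega> in completion M. \<omega> \<in> A \<longleftrightarrow> \<omega> \<in> {\<omega> \<in> space M. P \<omega>}"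
    using AE_completion[OF assms(2)] AE_space[of "completion M"] by eventually_elim simp
qed (use assms(1) in auto)

text \<open>The set \<open>B j e\<close> collects the paths compatible with the data \<open>e\<close> at resolution \<open>j\<close>. As every open
  set containing the path contains \<open>B j (D j)\<close> for large \<open>j\<close>, this gives measurability as well as
  convergence in law.\<close>

definition discretely_approximated ::
    "(real \<Rightarrow> (real \<Rightarrow> 'a::topological_space) \<Rightarrow> (real \<Rightarrow> 'a) \<Rightarrow> real) \<Rightarrow>
     (nat \<Rightarrow> 'd \<Rightarrow> (real \<Rightarrow> 'a) set) \<Rightarrow> (nat \<Rightarrow> 'd) \<Rightarrow> (real \<Rightarrow> 'a) \<Rightarrow> bool" where
  "discretely_approximated d B D z \<longleftrightarrow>
     z \<in> skorokhod_space \<and> (\<forall>\<^sub>F j in sequentially. z \<in> B j (D j)) \<and>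
     (\<forall>xs. range xs \<subseteq> skorokhod_space \<longrightarrow> (\<forall>\<^sub>F j in sequentially. xs j \<in> B j (D j)) \<longrightarrow>
        skorokhod_converges d xs z)"

text \<open>If \<open>B j (D j)\<close> were not contained in \<open>U\<close> for infinitely many
  \<open>j\<close>, a point outside \<open>U\<close> could be chosen for each such \<open>j\<close>.
  Completed by \<open>z\<close> at the other indices, these points converge to \<open>z\<close> and
  so eventually lie in the sequentially open set \<open>U\<close>. The converse uses that
  \<open>z\<close> itself lies in \<open>B j (D j)\<close> for large \<open>j\<close>.\<close>

lemma discretely_approximated_open_iff:
  assumes "discretely_approximated d B D z" "openin (skorokhod_topology d) U"
    and B: "\<And>j e. B j e \<subseteq> skorokhod_space"
  shows "z \<in> U \<longleftrightarrow> (\<forall>\<^sub>F j in sequentially. B j (D j) \<subseteq> U)"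
proof
  assume "\<forall>\<^sub>F j in sequentially. B j (D j) \<subseteq> U"
  then have "\<forall>\<^sub>F j in sequentially. z \<in> U"
    using conjunct1[OF conjunct2[OF assms(1)[unfolded discretely_approximated_def]]]
    by eventually_elim blast
  then show "z \<in> U"
    by simp
next
  assume z: "z \<in> U"
  define xs where "xs j = (if B j (D j) \<subseteq> U then z else SOME x. x \<in> B j (D j) - U)" for j
  have xs: "xs j \<in> B j (D j) - U" if "\<not> B j (D j) \<subseteq> U" for j
    using that someI_ex[of "\<lambda>x. x \<in> B j (D j) - U"] by (auto simp: xs_def)
  have zB: "\<forall>\<^sub>F j in sequentially. z \<in> B j (D j)" and zs: "z \<in> skorokhod_space"
    using assms(1) by (auto simp: discretely_approximated_def)
  have "\<forall>\<^sub>F j in sequentially. xs j \<in> B j (D j)"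
    using zB by eventually_elim (use xs in \<open>auto simp: xs_def\<close>)
  moreover have "range xs \<subseteq> skorokhod_space"
    using xs B zs by (auto simp: xs_def image_subset_iff split: if_splits)
  ultimately have "skorokhod_converges d xs z"
    using assms(1) by (auto simp: discretely_approximated_def)
  then have "\<forall>\<^sub>F j in sequentially. xs j \<in> U"
    using assms(2) z \<open>range xs \<subseteq> skorokhod_space\<close> unfolding openin_skorokhod_topology by blast
  then show "\<forall>\<^sub>F j in sequentially. B j (D j) \<subseteq> U"
    by eventually_elim (use xs in blast)
qed

text \<open>Up to a null set, \<open>Z \<omega> \<in> U\<close> is the event that
  \<open>B j (D j \<omega>) \<subseteq> U\<close> for all large \<open>j\<close>. This event is
  built from countably many conditions on countably valued data, so it is measurable although
  \<open>U\<close> is an arbitrary open set of paths.\<close>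

lemma random_element_discretely_approximated:
  fixes D :: "nat \<Rightarrow> 'w \<Rightarrow> 'd::countable"
  assumes D: "\<And>j. D j \<in> measurable M (count_space UNIV)"
    and B: "\<And>j e. B j e \<subseteq> skorokhod_space"
    and app: "AE \<omega> in M. discretely_approximated d B (\<lambda>j. D j \<omega>) (Z \<omega>)"
  shows "random_element (skorokhod_topology d) M Z"
  unfolding random_element_def topspace_skorokhod_topology
proof (intro conjI allI impI)
  show "AE \<omega> in M. Z \<omega> \<in> skorokhod_space"
    using app by eventually_elim (simp add: discretely_approximated_def)
  fix U assume U: "openin (skorokhod_topology d) U"
  let ?A = "{\<omega> \<in> space M. \<forall>\<^sub>F j in sequentially. B j (D j \<omega>) \<subseteq> U}"
  have [measurable]: "Measurable.pred M (\<lambda>\<omega>. B j (D j \<omega>) \<subseteq> U)" for j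
    by (rule measurable_compose[OF D]) simp
  have "?A \<in> sets M"
    unfolding eventually_sequentially by measurable
  moreover have "AE \<omega> in M. \<omega> \<in> ?A \<longleftrightarrow> Z \<omega> \<in> U"
    using app AE_space by eventually_elim (simp add: discretely_approximated_open_iff[OF _ U B])
  ultimately show "{\<omega> \<in> space M. Z \<omega> \<in> U} \<in> sets (completion M)"
    by (rule completion_sets_AE_iff)
qed

text \<open>Preimages under a continuous function are open relative to \<open>topspace S\<close>,
  while \<open>Z\<close> may leave that space on a null set; the completed measure absorbs the
  difference.\<close>

lemma random_element_comp_measurable:
  assumes Z: "random_element S M Z" and f: "continuous_map S euclideanreal f"
  shows "(\<lambda>\<omega>. f (Z \<omega>)) \<in> borel_measurable (completion M)"
proof (rule borel_measurableI)
  fix V :: "real set" assume "open V"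
  let ?U = "{x \<in> topspace S. f x \<in> V}"
  have "openin S ?U"
    using f \<open>open V\<close> by (simp add: continuous_map_def)
  then have 1: "{\<omega> \<in> space M. Z \<omega> \<in> ?U} \<in> sets (completion M)"
    using Z by (auto simp: random_element_def)
  have "{\<omega> \<in> space M. f (Z \<omega>) \<in> V} \<in> sets (completion M)"
  proof (rule completion.in_sets_AE[OF _ 1])
    show "AE \<omega> in completion M. \<omega> \<in> {\<omega> \<in> space M. Z \<omega> \<in> ?U} \<longleftrightarrow>
        \<omega> \<in> {\<omega> \<in> space M. f (Z \<omega>) \<in> V}"
      using AE_completion[OF conjunct1[OF Z[unfolded random_element_def]]]
      by eventually_elim simp
  qed simp
  then show "(\<lambda>\<omega>. f (Z \<omega>)) -` V \<inter> space (completion M) \<in> sets (completion M)"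
    by (simp add: vimage_def Int_def conj_commute)
qed

lemma (in prob_space) expectation_finite_valued:
  fixes u :: "'d \<Rightarrow> real"
  assumes D: "D \<in> measurable M (count_space UNIV)" and F: "finite F" "\<And>\<omega>. \<omega> \<in> space M \<Longrightarrow> D \<omega> \<in> F"
  shows "expectation (\<lambda>\<omega>. u (D \<omega>)) = (\<Sum>e\<in>F. u e * prob {\<omega> \<in> space M. D \<omega> = e})"
proof -
  have sets: "{\<omega> \<in> space M. D \<omega> = e} \<in> events" for e
    using measurable_sets[OF D, of "{e}"] by (simp add: vimage_def Int_def conj_commute)
  have "expectation (\<lambda>\<omega>. u (D \<omega>)) =
      expectation (\<lambda>\<omega>. \<Sum>e\<in>F. u e * indicator {\<omega> \<in> space M. D \<omega> = e} \<omega>)"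
    using F by (intro Bochner_Integration.integral_cong) (auto simp: indicator_def sum.delta)
  also have "\<dots> = (\<Sum>e\<in>F. u e * prob {\<omega> \<in> space M. D \<omega> = e})"
    using sets by (subst Bochner_Integration.integral_sum) (auto simp: less_top[symmetric] intro!: integrable_mult_right integrable_real_indicator)
  finally show ?thesis .
qed

text \<open>For fixed \<open>j\<close>, \<open>f (Zs N \<omega>)\<close> is at most the supremum of
  \<open>f\<close> over \<open>B j (Dn j N \<omega>)\<close>, except on an event of measure at most
  \<open>b j\<close>. The mean of this supremum converges as \<open>N\<close> grows because the data
  are finitely valued, and its limit tends to the mean of \<open>f (Z \<omega>)\<close> as
  \<open>j\<close> grows. So \<open>N\<close> goes to infinity before \<open>j\<close>.\<close>

lemma converges_in_law_discretely_approximated: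
  fixes D :: "nat \<Rightarrow> 'v \<Rightarrow> 'd::countable" and Dn :: "nat \<Rightarrow> nat \<Rightarrow> 'w \<Rightarrow> 'd"
  assumes M: "prob_space M" and Ms: "\<forall>\<^sub>F N in sequentially. prob_space (Ms N)"
    and D: "\<And>j. D j \<in> measurable M (count_space UNIV)"
    and Dn: "\<And>j. \<forall>\<^sub>F N in sequentially. Dn j N \<in> measurable (Ms N) (count_space UNIV)"
    and F: "\<And>j. finite (F j)" "\<And>j \<omega>. \<omega> \<in> space M \<Longrightarrow> D j \<omega> \<in> F j"
      "\<And>j. \<forall>\<^sub>F N in sequentially. \<forall>\<omega>\<in>space (Ms N). Dn j N \<omega> \<in> F j"
    and B: "\<And>j e. B j e \<subseteq> skorokhod_space"
    and app: "AE \<omega> in M. discretely_approximated d B (\<lambda>j. D j \<omega>) (Z \<omega>)"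
    and re: "\<forall>\<^sub>F N in sequentially. random_element (skorokhod_topology d) (Ms N) (Zs N)"
    and law: "\<And>j e. e \<in> F j \<Longrightarrow> (\<lambda>N. measure (Ms N) {\<omega> \<in> space (Ms N). Dn j N \<omega> = e})
      \<longlonglongrightarrow> measure M {\<omega> \<in> space M. D j \<omega> = e}"
    and bad: "\<And>j. \<forall>\<^sub>F N in sequentially. \<exists>A\<in>sets (Ms N). measure (Ms N) A \<le> b j \<and>
      (AE \<omega> in Ms N. \<omega> \<notin> A \<longrightarrow> Zs N \<omega> \<in> B j (Dn j N \<omega>))"
    and b: "b \<longlonglongrightarrow> 0"
  shows "converges_in_law (skorokhod_topology d) Ms Zs M Z"
proof -
  let ?S = "skorokhod_topology d"
  interpret CM: prob_space "completion M"
    by (rule prob_space.prob_space_completion[OF M])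
  have reZ: "random_element ?S M Z"
    by (rule random_element_discretely_approximated[OF D B app])
  \<comment> \<open>Only the upper estimate is proved; applying it to \<open>- f\<close> as well
    gives convergence.\<close>
  have upper: "\<forall>\<^sub>F N in sequentially. (\<integral>\<omega>. f (Zs N \<omega>) \<partial>completion (Ms N)) \<le> (\<integral>\<omega>. f (Z \<omega>) \<partial>completion M) + \<epsilon>"
    if f: "continuous_map ?S euclideanreal f" and C: "\<And>x. x \<in> skorokhod_space \<Longrightarrow> \<bar>f x\<bar> \<le> C"
      and C0: "0 \<le> C" and \<epsilon>: "0 < \<epsilon>" for f \<epsilon> C
  proof -
    \<comment> \<open>The supremum of an empty set of reals is unspecified; the value 0 keeps
      \<open>u\<close> within the bound \<open>C\<close>.\<close>
    define u where "u j e = (if B j e = {} then 0 else Sup (f ` B j e))" for j e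
    have bdd: "bdd_above (f ` B j e)" for j e
    proof (rule bdd_aboveI2)
      show "f x \<le> C" if "x \<in> B j e" for x
        using C[of x] B that by fastforce
    qed
    have fu: "f x \<le> u j e" if "x \<in> B j e" for x j e
      using that bdd by (auto simp: u_def intro!: cSup_upper)
    have uC: "\<bar>u j e\<bar> \<le> C" for j e
    proof (cases "B j e = {}")
      case False
      then obtain x where x: "x \<in> B j e" by blast
      have "u j e \<le> C"
        unfolding u_def using False C B by (auto intro!: cSup_least dest!: subsetD[OF B] C)
      moreover have "- C \<le> u j e"
        using fu[OF x] C[of x] x B by fastforce
      ultimately show ?thesis by simp
    qed (simp add: u_def C0)
    have conv: "(\<lambda>j. u j (D' j)) \<longlonglongrightarrow> f z" if z: "discretely_approximated d B D' z" for D' z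
    proof (rule tendstoI)
      fix r :: real assume r: "0 < r"
      let ?U = "{y \<in> skorokhod_space. f y \<in> ball (f z) (r/2)}"
      have "openin ?S ?U"
        using f open_ball[of "f z" "r/2"]
        by (simp only: continuous_map_def topspace_skorokhod_topology open_openin[symmetric])
      moreover have "z \<in> ?U"
        using z r by (simp add: discretely_approximated_def)
      ultimately have 1: "\<forall>\<^sub>F j in sequentially. B j (D' j) \<subseteq> ?U"
        using discretely_approximated_open_iff[OF z _ B] by blast
      have 2: "\<forall>\<^sub>F j in sequentially. z \<in> B j (D' j)"
        using z by (simp add: discretely_approximated_def)
      show "\<forall>\<^sub>F j in sequentially. dist (u j (D' j)) (f z) < r"
        using 1 2
      proof eventually_elim
        case (elim j)
        have "f y \<le> f z + r/2" if "y \<in> B j (D' j)" for y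
        proof -
          have "\<bar>f z - f y\<bar> < r / 2"
            using subsetD[OF elim(1) that] unfolding mem_ball dist_real_def by blast
          then show ?thesis by linarith
        qed
        then have "u j (D' j) \<le> f z + r/2"
          unfolding u_def using elim(2) by (auto intro!: cSup_least)
        moreover have "f z \<le> u j (D' j)"
          using fu elim(2) .
        ultimately show ?case
          using r by (simp add: dist_real_def)
      qed
    qed
    have Dc: "D j \<in> measurable (completion M) (count_space UNIV)" for j
      using D by (rule measurable_completion)
    have "(\<lambda>j. \<integral>\<omega>. u j (D j \<omega>) \<partial>completion M) \<longlonglongrightarrow> (\<integral>\<omega>. f (Z \<omega>) \<partial>completion M)"
    proof (rule integral_dominated_convergence[where w = "\<lambda>_. C"])
      show "(\<lambda>\<omega>. f (Z \<omega>)) \<in> borel_measurable (completion M)"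
        by (rule random_element_comp_measurable[OF reZ f])
      show "(\<lambda>\<omega>. u j (D j \<omega>)) \<in> borel_measurable (completion M)" for j
        by (rule measurable_compose[OF Dc]) simp
      show "AE \<omega> in completion M. (\<lambda>j. u j (D j \<omega>)) \<longlonglongrightarrow> f (Z \<omega>)"
        using AE_completion[OF app] by eventually_elim (rule conv)
      show "AE \<omega> in completion M. norm (u j (D j \<omega>)) \<le> C" for j
        using uC by simp
    qed simp
    moreover have "(\<lambda>j. 2 * C * b j) \<longlonglongrightarrow> 2 * C * 0"
      by (intro tendsto_intros b)
    ultimately have "\<forall>\<^sub>F j in sequentially. (\<integral>\<omega>. u j (D j \<omega>) \<partial>completion M) < (\<integral>\<omega>. f (Z \<omega>) \<partial>completion M) + \<epsilon>/3
        \<and> 2 * C * b j < \<epsilon>/3"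
      using \<epsilon> by (intro eventually_conj order_tendstoD(2)) auto
    then obtain j where j: "(\<integral>\<omega>. u j (D j \<omega>) \<partial>completion M) < (\<integral>\<omega>. f (Z \<omega>) \<partial>completion M) + \<epsilon>/3"
        "2 * C * b j < \<epsilon>/3"
      by (auto simp: eventually_sequentially)
    have meas: "measure (completion K) {\<omega> \<in> space K. E \<omega> = e} = measure K {\<omega> \<in> space K. E \<omega> = e}"
      if "E \<in> measurable K (count_space UNIV)" for K :: "'z measure" and E :: "'z \<Rightarrow> 'd" and e
    proof (rule measure_completion)
      show "{\<omega> \<in> space K. E \<omega> = e} \<in> sets K"
        using measurable_sets[OF that, of "{e}"] by (simp add: vimage_def Int_def conj_commute)
    qed
    have EM: "(\<integral>\<omega>. u j (D j \<omega>) \<partial>completion M) = (\<Sum>e\<in>F j. u j e * measure M {\<omega> \<in> space M. D j \<omega> = e})"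
      using CM.expectation_finite_valued[OF Dc F(1), of j j "u j"] F(2) meas[OF D] by simp
    have "(\<lambda>N. \<Sum>e\<in>F j. u j e * measure (Ms N) {\<omega> \<in> space (Ms N). Dn j N \<omega> = e})
        \<longlonglongrightarrow> (\<Sum>e\<in>F j. u j e * measure M {\<omega> \<in> space M. D j \<omega> = e})"
      by (intro tendsto_intros law)
    then have "\<forall>\<^sub>F N in sequentially. (\<Sum>e\<in>F j. u j e * measure (Ms N) {\<omega> \<in> space (Ms N). Dn j N \<omega> = e})
        < (\<integral>\<omega>. u j (D j \<omega>) \<partial>completion M) + \<epsilon>/3"
      using \<epsilon> EM by (intro order_tendstoD(2)) auto
    then show ?thesis
      using Ms Dn[of j] F(3)[of j] re bad[of j]
    proof eventually_elim
      case (elim N)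
      interpret N: prob_space "completion (Ms N)"
        by (rule prob_space.prob_space_completion) (rule elim)
      obtain A where A: "A \<in> sets (Ms N)" "measure (Ms N) A \<le> b j"
          "AE \<omega> in Ms N. \<omega> \<notin> A \<longrightarrow> Zs N \<omega> \<in> B j (Dn j N \<omega>)"
        using elim(6) by blast
      have fm: "(\<lambda>\<omega>. f (Zs N \<omega>)) \<in> borel_measurable (completion (Ms N))"
        by (rule random_element_comp_measurable[OF elim(5) f])
      have Zsk: "AE \<omega> in completion (Ms N). Zs N \<omega> \<in> skorokhod_space"
        using elim(5) by (intro AE_completion) (simp add: random_element_def topspace_skorokhod_topology)
      have Dm: "Dn j N \<in> measurable (completion (Ms N)) (count_space UNIV)"
        by (rule measurable_completion) (rule elim)
      have um: "(\<lambda>\<omega>. u j (Dn j N \<omega>)) \<in> borel_measurable (completion (Ms N))"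
        by (rule measurable_compose[OF Dm]) simp
      have iu: "integrable (completion (Ms N)) (\<lambda>\<omega>. u j (Dn j N \<omega>))"
        using uC um by (intro N.integrable_const_bound[of _ C]) auto
      have Ac: "A \<in> sets (completion (Ms N))"
        using A(1) by auto
      have iA: "integrable (completion (Ms N)) (\<lambda>\<omega>. 2 * C * indicator A \<omega>)"
        using Ac by (intro integrable_mult_right integrable_real_indicator)
          (simp_all add: N.emeasure_finite less_top[symmetric] del: emeasure_completion)
      \<comment> \<open>On the exceptional event \<open>A\<close> two values bounded by
        \<open>C\<close> differ by at most \<open>2 * C\<close>, which costs at most
        \<open>2 * C * b j\<close> in the mean.\<close>
      have "(\<integral>\<omega>. f (Zs N \<omega>) \<partial>completion (Ms N)) \<le>
          (\<integral>\<omega>. u j (Dn j N \<omega>) + 2 * C * indicator A \<omega> \<partial>completion (Ms N))"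
      proof (rule integral_mono_AE)
        show "integrable (completion (Ms N)) (\<lambda>\<omega>. f (Zs N \<omega>))"
          by (rule N.integrable_const_bound[of _ C]) (use Zsk C fm in \<open>auto elim!: eventually_mono\<close>)
        show "integrable (completion (Ms N)) (\<lambda>\<omega>. u j (Dn j N \<omega>) + 2 * C * indicator A \<omega>)"
          by (rule Bochner_Integration.integrable_add[OF iu iA])
        show "AE \<omega> in completion (Ms N). f (Zs N \<omega>) \<le> u j (Dn j N \<omega>) + 2 * C * indicator A \<omega>"
          using Zsk AE_completion[OF A(3)]
        proof eventually_elim
          case (elim \<omega>)
          then show ?case
            using fu[of "Zs N \<omega>" j "Dn j N \<omega>"] C[of "Zs N \<omega>"] uC[of j "Dn j N \<omega>"]
            by (cases "\<omega> \<in> A") auto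
        qed
      qed
      also have "\<dots> = (\<integral>\<omega>. u j (Dn j N \<omega>) \<partial>completion (Ms N)) + 2 * C * measure (Ms N) A"
        using Ac A(1) by (subst Bochner_Integration.integral_add[OF iu iA]) simp
      also have "(\<integral>\<omega>. u j (Dn j N \<omega>) \<partial>completion (Ms N)) =
          (\<Sum>e\<in>F j. u j e * measure (Ms N) {\<omega> \<in> space (Ms N). Dn j N \<omega> = e})"
        using N.expectation_finite_valued[OF Dm F(1), of j "u j"] elim(4) meas[OF elim(3)] by simp
      also have "2 * C * measure (Ms N) A \<le> 2 * C * b j"
        using A(2) C0 by (simp add: mult_left_mono)
      finally show ?case
        using elim(1) j by simp
    qed
  qed
  show ?thesis
    unfolding converges_in_law_def
  proof (intro conjI allI impI re reZ)
    fix f assume f: "continuous_map ?S euclideanreal f \<and> bounded (f ` topspace ?S)"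
    then obtain C where "\<And>x. x \<in> skorokhod_space \<Longrightarrow> \<bar>f x\<bar> \<le> C"
      by (auto simp: bounded_iff topspace_skorokhod_topology)
    then have C: "\<bar>f x\<bar> \<le> \<bar>C\<bar>" if "x \<in> skorokhod_space" for x
      using that by fastforce
    have nf: "continuous_map ?S euclideanreal (\<lambda>x. - f x)"
      using f by (intro continuous_map_minus) auto
    show "(\<lambda>N. \<integral>\<omega>. f (Zs N \<omega>) \<partial>completion (Ms N)) \<longlonglongrightarrow> (\<integral>\<omega>. f (Z \<omega>) \<partial>completion M)"
    proof (rule tendstoI)
      fix \<epsilon> :: real assume \<epsilon>: "0 < \<epsilon>"
      have "\<forall>\<^sub>F N in sequentially. (\<integral>\<omega>. - f (Zs N \<omega>) \<partial>completion (Ms N)) \<le> (\<integral>\<omega>. - f (Z \<omega>) \<partial>completion M) + \<epsilon>/2"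
        by (rule upper[OF nf, of "\<bar>C\<bar>"]) (use C \<epsilon> in auto)
      moreover have "\<forall>\<^sub>F N in sequentially. (\<integral>\<omega>. f (Zs N \<omega>) \<partial>completion (Ms N)) \<le> (\<integral>\<omega>. f (Z \<omega>) \<partial>completion M) + \<epsilon>/2"
        by (rule upper[OF conjunct1[OF f], of "\<bar>C\<bar>"]) (use C \<epsilon> in auto)
      ultimately show "\<forall>\<^sub>F N in sequentially. dist (\<integral>\<omega>. f (Zs N \<omega>) \<partial>completion (Ms N)) (\<integral>\<omega>. f (Z \<omega>) \<partial>completion M) < \<epsilon>"
        by eventually_elim (use \<epsilon> in \<open>auto simp: dist_real_def abs_less_iff\<close>)
    qed
  qed
qed

section \<open>Near-staircases and the J1 distance\<close>

text \<open>The value \<open>heights m d k\<close> is the height, in multiples of \<open>\<delta>\<close>, after the cells \<open>0, \<dots>, k - 1\<close>. A jump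
  in cell \<open>n\<close> is added to the height after cell \<open>n - m\<close>, one time unit earlier; the truncated
  subtraction gives height \<open>0\<close> in the first time unit.\<close>

fun heights :: "nat \<Rightarrow> (nat \<Rightarrow> nat) \<Rightarrow> nat \<Rightarrow> nat" where
  "heights m d 0 = 0"
| "heights m d (Suc n) = max (heights m d n) (if d n = 0 then 0 else heights m d (n - (m - 1)) + d n)"

text \<open>In a cell with \<open>d i = 0\<close> both heights agree, so that the position \<open>s i\<close> is immaterial there.\<close>

definition near_staircase :: "nat \<Rightarrow> nat \<Rightarrow> (nat \<Rightarrow> nat) \<Rightarrow> real \<Rightarrow> real \<Rightarrow> (real \<Rightarrow> real) \<Rightarrow> bool" where
  "near_staircase m n d \<delta> \<epsilon> x \<longleftrightarrow> x 0 = 0 \<and> mono_on {0..} x \<and>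
     (\<exists>s. \<forall>i<n. s i \<in> {real i / m<..real (Suc i) / m} \<and>
        (\<forall>t\<in>{real i / m<..real (Suc i) / m}.
           \<bar>x t - \<delta> * heights m d (if s i \<le> t then Suc i else i)\<bar> \<le> \<epsilon>))"

lemma near_staircase_mono:
  "near_staircase m n d \<delta> \<epsilon> x \<Longrightarrow> 0 \<le> t \<Longrightarrow> t \<le> u \<Longrightarrow> x t \<le> x u"
  unfolding near_staircase_def using mono_onD[of "{0..}" x t u] by simp

lemma mono_heights: "mono (heights m d)"
  by (rule incseq_SucI) simp

text \<open>Cells are open on the left and \<open>s k\<close> lies in its cell, so at the right end
  of a cell the jump has already happened, wherever \<open>s k\<close> is. This makes the grid
  values independent of the unknown positions.\<close>

lemma near_staircase_grid:
  assumes "near_staircase m n d \<delta> \<epsilon> x" "i \<le> n" "0 < m" "0 \<le> \<epsilon>"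
  shows "\<bar>x (real i / m) - \<delta> * heights m d i\<bar> \<le> \<epsilon>"
proof (cases i)
  case 0
  then show ?thesis
    using assms by (simp add: near_staircase_def)
next
  case (Suc k)
  obtain s where s: "\<forall>i<n. s i \<in> {real i / m<..real (Suc i) / m} \<and>
        (\<forall>t\<in>{real i / m<..real (Suc i) / m}.
           \<bar>x t - \<delta> * heights m d (if s i \<le> t then Suc i else i)\<bar> \<le> \<epsilon>)"
    using assms(1) unfolding near_staircase_def by blast
  have "real (Suc k) / m \<in> {real k / m<..real (Suc k) / m}"
    using assms(3) by (auto simp: divide_strict_right_mono)
  then have "\<bar>x (real (Suc k) / m) - \<delta> * heights m d (if s k \<le> real (Suc k) / m then Suc k else k)\<bar> \<le> \<epsilon>"
    using s[rule_format, of k] Suc assms(2) by (meson Suc_le_lessD)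
  moreover have "s k \<le> real (Suc k) / m"
    using s[rule_format, of k] Suc assms(2) by auto
  ultimately show ?thesis
    using Suc by simp
qed

text \<open>The second supremum may range over an unbounded set, where its value is unspecified. The
  first one ranges over a set bounded by \<open>T\<close> and alone keeps the maximum
  nonnegative.\<close>

lemma J1_dist_nonneg:
  assumes "0 \<le> T"
  shows "0 \<le> J1_dist T x y"
  unfolding J1_dist_def
proof (rule cINF_greatest)
  have "id \<in> time_changes T"
    by (auto simp: time_changes_def strict_mono_on_def)
  then show "time_changes T \<noteq> {}"
    by blast
  fix l assume l: "l \<in> time_changes T"
  have "bdd_above ((\<lambda>t. \<bar>l t - t\<bar>) ` {0..T})"
  proof (rule bdd_aboveI2)
    fix t assume "t \<in> {0..T}"
    moreover from this have "l t \<in> {0..T}"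
      using l by (auto simp: time_changes_def)
    ultimately show "\<bar>l t - t\<bar> \<le> T" by auto
  qed
  then have "\<bar>l 0 - 0\<bar> \<le> (SUP t\<in>{0..T}. \<bar>l t - t\<bar>)"
    using assms by (intro cSUP_upper) auto
  then show "0 \<le> max (SUP t\<in>{0..T}. \<bar>l t - t\<bar>) (SUP t\<in>{0..T}. dist (x (l t)) (y t))"
    by auto
qed

lemma J1_dist_le:
  assumes T: "0 \<le> T" and l: "l \<in> time_changes T"
    and le: "\<And>t. t \<in> {0..T} \<Longrightarrow> \<bar>l t - t\<bar> \<le> e" "\<And>t. t \<in> {0..T} \<Longrightarrow> dist (x (l t)) (y t) \<le> e"
  shows "J1_dist T x y \<le> e"
proof -
  have "J1_dist T x y \<le> max (SUP t\<in>{0..T}. \<bar>l t - t\<bar>) (SUP t\<in>{0..T}. dist (x (l t)) (y t))"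
    unfolding J1_dist_def
  proof (rule cINF_lower[OF _ l], rule bdd_belowI2)
    fix l assume l: "l \<in> time_changes T"
    have "bdd_above ((\<lambda>t. \<bar>l t - t\<bar>) ` {0..T})"
    proof (rule bdd_aboveI2)
      fix t assume "t \<in> {0..T}"
      moreover from this have "l t \<in> {0..T}"
        using l by (auto simp: time_changes_def)
      ultimately show "\<bar>l t - t\<bar> \<le> T" by auto
    qed
    then have "\<bar>l 0 - 0\<bar> \<le> (SUP t\<in>{0..T}. \<bar>l t - t\<bar>)"
      using T by (intro cSUP_upper) auto
    then show "0 \<le> max (SUP t\<in>{0..T}. \<bar>l t - t\<bar>) (SUP t\<in>{0..T}. dist (x (l t)) (y t))"
      by auto
  qed
  also have "\<dots> \<le> e"
    using T le by (auto intro!: cSUP_least)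
  finally show ?thesis .
qed

text \<open>A \<open>J1\<close> comparison confined to \<open>{a..b}\<close>. The time change maps
  the interval onto itself, so that comparisons on adjacent intervals can be glued.\<close>

definition time_matched :: "real \<Rightarrow> real \<Rightarrow> real \<Rightarrow> (real \<Rightarrow> real) \<Rightarrow> (real \<Rightarrow> real) \<Rightarrow> bool" where
  "time_matched a b e x y \<longleftrightarrow> (\<exists>l. strict_mono_on {a..b} l \<and> l ` {a..b} = {a..b} \<and>
     (\<forall>t\<in>{a..b}. \<bar>l t - t\<bar> \<le> e \<and> \<bar>x (l t) - y t\<bar> \<le> e))"

text \<open>A strictly increasing map of a closed interval onto itself fixes the end points. So both
  time changes fix \<open>b\<close>, and their concatenation is again strictly increasing and
  onto.\<close>

lemma time_matched_trans:
  assumes "a \<le> b" "b \<le> c" "time_matched a b e x y" "time_matched b c e x y"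
  shows "time_matched a c e x y"
proof -
  obtain l where l: "strict_mono_on {a..b} l" "l ` {a..b} = {a..b}"
      "\<And>t. t \<in> {a..b} \<Longrightarrow> \<bar>l t - t\<bar> \<le> e \<and> \<bar>x (l t) - y t\<bar> \<le> e"
    using assms(3) unfolding time_matched_def by blast
  obtain k where k: "strict_mono_on {b..c} k" "k ` {b..c} = {b..c}"
      "\<And>t. t \<in> {b..c} \<Longrightarrow> \<bar>k t - t\<bar> \<le> e \<and> \<bar>x (k t) - y t\<bar> \<le> e"
    using assms(4) unfolding time_matched_def by blast
  define g where "g t = (if t \<le> b then l t else k t)" for t
  have kb: "k b = b"
  proof -
    obtain t where "t \<in> {b..c}" "k t = b"
      using k(2) assms by (metis atLeastAtMost_iff imageE order_refl)
    moreover have "b \<le> k b"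
      using k(2) assms by (metis atLeastAtMost_iff imageI order_refl)
    ultimately show ?thesis
      using k(1)[THEN strict_mono_onD, of b t] by (cases "t = b") auto
  qed
  have lb: "l b = b"
  proof -
    obtain t where "t \<in> {a..b}" "l t = b"
      using l(2) assms by (metis atLeastAtMost_iff imageE order_refl)
    moreover have "l b \<le> b"
      using l(2) assms by (metis atLeastAtMost_iff imageI order_refl)
    ultimately show ?thesis
      using l(1)[THEN strict_mono_onD, of t b] by (cases "t = b") auto
  qed
  have gl: "g ` {a..b} = {a..b}" and gk: "g ` {b..c} = {b..c}"
  proof -
    show "g ` {a..b} = {a..b}"
      using l(2) by (simp add: g_def image_def)
    have "g t = k t" if "t \<in> {b..c}" for t
      using that kb lb by (auto simp: g_def)
    then show "g ` {b..c} = {b..c}"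
      using k(2) by (metis (no_types, lifting) image_cong)
  qed
  have "strict_mono_on {a..c} g"
  proof (rule strict_mono_onI)
    fix r t assume rt: "r \<in> {a..c}" "t \<in> {a..c}" "r < t"
    consider "t \<le> b" | "r \<le> b" "b < t" | "b < r"
      by linarith
    then show "g r < g t"
    proof cases
      case 2
      then have "l r \<le> b" "b < k t"
        using l(2) rt strict_mono_onD[OF k(1), of b t] kb by auto
      then show ?thesis
        using 2 by (simp add: g_def)
    qed (use rt strict_mono_onD[OF l(1), of r t] strict_mono_onD[OF k(1), of r t] in \<open>auto simp: g_def\<close>)
  qed
  moreover have "g ` {a..c} = {a..c}"
    using gl gk assms(1,2) by (metis image_Un ivl_disj_un_two_touch(4))
  moreover have "\<bar>g t - t\<bar> \<le> e \<and> \<bar>x (g t) - y t\<bar> \<le> e" if "t \<in> {a..c}" for t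
    using that l(3) k(3) by (auto simp: g_def)
  ultimately show ?thesis
    unfolding time_matched_def by blast
qed

lemma time_matched_id:
  assumes "\<And>t. t \<in> {a..b} \<Longrightarrow> \<bar>x t - y t\<bar> \<le> e" "0 \<le> e"
  shows "time_matched a b e x y"
  unfolding time_matched_def
  by (rule exI[of _ "\<lambda>t. t"]) (use assms in \<open>auto simp: strict_mono_on_def\<close>)

text \<open>The piecewise linear time change that fixes \<open>a\<close> and \<open>b\<close> and
  carries the jump time \<open>s\<close> of \<open>y\<close> to the jump time \<open>s'\<close> of
  \<open>x\<close> pairs times before one jump with times before the other.\<close>

lemma time_matched_jump:
  fixes a b s s' :: real
  assumes s: "a < s" "s < b" "a < s'" "s' < b" and e: "b - a \<le> e"
    and before: "\<And>t r. a \<le> t \<Longrightarrow> t < s \<Longrightarrow> a \<le> r \<Longrightarrow> r < s' \<Longrightarrow> \<bar>x r - y t\<bar> \<le> e"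
    and after: "\<And>t r. s \<le> t \<Longrightarrow> t \<le> b \<Longrightarrow> s' \<le> r \<Longrightarrow> r \<le> b \<Longrightarrow> \<bar>x r - y t\<bar> \<le> e"
  shows "time_matched a b e x y"
proof -
  define p where "p t = a + (t - a) * ((s' - a) / (s - a))" for t
  define q where "q t = b - (b - t) * ((b - s') / (b - s))" for t
  define l where "l t = (if t \<le> s then p t else q t)" for t
  have pos: "0 < (s' - a) / (s - a)" "0 < (b - s') / (b - s)"
    using s by simp_all
  have pm: "p r < p t" if "r < t" for r t
    using mult_strict_right_mono[OF _ pos(1), of "r - a" "t - a"] that by (simp add: p_def)
  have qm: "q r < q t" if "r < t" for r t
    using mult_strict_right_mono[OF _ pos(2), of "b - t" "b - r"] that by (simp add: q_def)
  have ends: "p a = a" "p s = s'" "q s = s'" "q b = b"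
    using s by (simp_all add: p_def q_def)
  have sm: "strict_mono_on {a..b} l"
  proof (rule strict_mono_onI)
    fix r t :: real assume rt: "r < t"
    show "l r < l t"
      using pm[OF rt] qm[OF rt] pm[of r s] qm[of s t] rt ends
      by (cases "r = s") (auto simp: l_def)
  qed
  have lb: "a \<le> l t" "l t \<le> b" if "t \<in> {a..b}" for t
    using strict_mono_onD[OF sm, of a t] strict_mono_onD[OF sm, of t b] that s ends
    by (cases "a = t"; cases "t = b"; force simp: l_def)+
  have "{a..b} \<subseteq> l ` {a..b}"
  proof
    fix r assume r: "r \<in> {a..b}"
    show "r \<in> l ` {a..b}"
    proof (cases "r \<le> s'")
      case True
      define t where "t = a + (r - a) * ((s - a) / (s' - a))"
      have "p t = r"
        using s by (simp add: t_def p_def)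
      moreover have "t \<le> s"
      proof (rule ccontr)
        assume "\<not> t \<le> s" then show False using pm[of s t] ends \<open>p t = r\<close> True by simp
      qed
      moreover have "a \<le> t"
        using r s by (auto simp: t_def)
      ultimately have "l t = r" "t \<in> {a..b}" using s by (auto simp: l_def)
      then show ?thesis by blast
    next
      case False
      define t where "t = b - (b - r) * ((b - s) / (b - s'))"
      have "q t = r"
        using s by (simp add: t_def q_def)
      moreover have "s < t"
      proof (rule ccontr)
        assume "\<not> s < t" then show False using qm[of t s] ends \<open>q t = r\<close> False by (cases "t = s") auto
      qed
      moreover have "t \<le> b"
        using r s by (auto simp: t_def)
      ultimately have "l t = r" "t \<in> {a..b}" using s by (auto simp: l_def)
      then show ?thesis by blast
    qed
  qed
  then have "l ` {a..b} = {a..b}"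
    using lb by auto
  moreover have "\<bar>l t - t\<bar> \<le> e \<and> \<bar>x (l t) - y t\<bar> \<le> e" if t: "t \<in> {a..b}" for t
  proof
    show "\<bar>l t - t\<bar> \<le> e"
      using lb[OF t] t e by auto
    show "\<bar>x (l t) - y t\<bar> \<le> e"
    proof (cases "t < s")
      case True
      then show ?thesis
        using before[of t "l t"] lb[OF t] t pm[of t s] ends by (auto simp: l_def)
    next
      case False
      then show ?thesis
        using after[of t "l t"] lb[OF t] t qm[of s t] ends by (cases "t = s") (auto simp: l_def)
    qed
  qed
  ultimately show ?thesis
    using sm unfolding time_matched_def by blast
qed

text \<open>The time change is assembled from left to right over grid points whose preceding cell is
  flat. A jump may sit at the very right end of its cell and then cannot be moved inside that cell
  alone; its block therefore includes the next cell, which is flat by separation.\<close>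

lemma near_staircase_time_matched:
  assumes x: "near_staircase m n d \<delta> \<epsilon> x" and y: "near_staircase m n d \<delta> \<epsilon> y"
    and m: "0 < m" and sep: "\<And>i. Suc i < n \<Longrightarrow> d i \<noteq> 0 \<Longrightarrow> d (Suc i) = 0"
    and e: "2 / m \<le> e" "2 * \<epsilon> \<le> e" and \<epsilon>: "0 \<le> \<epsilon>"
  shows "k < n \<Longrightarrow> k = 0 \<or> d (k - 1) = 0 \<Longrightarrow> time_matched 0 (real k / m) e x y"
proof (induction k rule: less_induct)
  case (less k)
  obtain sx where sx: "\<And>i. i < n \<Longrightarrow> sx i \<in> {real i / m<..real (Suc i) / m}"
      "\<And>i t. i < n \<Longrightarrow> t \<in> {real i / m<..real (Suc i) / m} \<Longrightarrow>
        \<bar>x t - \<delta> * heights m d (if sx i \<le> t then Suc i else i)\<bar> \<le> \<epsilon>"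
    using x unfolding near_staircase_def by blast
  obtain sy where sy: "\<And>i. i < n \<Longrightarrow> sy i \<in> {real i / m<..real (Suc i) / m}"
      "\<And>i t. i < n \<Longrightarrow> t \<in> {real i / m<..real (Suc i) / m} \<Longrightarrow>
        \<bar>y t - \<delta> * heights m d (if sy i \<le> t then Suc i else i)\<bar> \<le> \<epsilon>"
    using y unfolding near_staircase_def by blast
  have flat: "\<bar>x t - \<delta> * heights m d i\<bar> \<le> \<epsilon>" "\<bar>y t - \<delta> * heights m d i\<bar> \<le> \<epsilon>"
    if i: "i < n" "d i = 0" and t: "t \<in> {real i / m..real (Suc i) / m}" for i t
  proof -
    have eq: "heights m d (if P then Suc i else i) = heights m d i" for P
      using i(2) by simp
    show "\<bar>x t - \<delta> * heights m d i\<bar> \<le> \<epsilon>" "\<bar>y t - \<delta> * heights m d i\<bar> \<le> \<epsilon>"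
      using near_staircase_grid[OF x less_imp_le[OF i(1)] m \<epsilon>]
        near_staircase_grid[OF y less_imp_le[OF i(1)] m \<epsilon>]
        sx(2)[OF i(1), of t, unfolded eq] sy(2)[OF i(1), of t, unfolded eq] t
      by (cases "t = real i / m", simp, simp del: of_nat_Suc)+
  qed
  have step: "real i / m \<le> real (Suc i) / m" for i
    by (simp add: divide_right_mono)
  show ?case
  proof (cases "k = 0")
    case True
    then show ?thesis
      using x y e \<epsilon> by (intro time_matched_id) (auto simp: near_staircase_def)
  next
    case k0: False
    then obtain i where i: "k = Suc i"
      using not0_implies_Suc by blast
    have di: "d i = 0" and iN: "Suc i < n"
      using less.prems i by simp_all
    have tail: "time_matched (real i / m) (real (Suc i) / m) e x y"
    proof (rule time_matched_id)
      show "\<bar>x t - y t\<bar> \<le> e" if "t \<in> {real i / m..real (Suc i) / m}" for t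
        using flat(1)[OF _ di that] flat(2)[OF _ di that] iN e by linarith
    qed (use e \<epsilon> in linarith)
    show ?thesis
    proof (cases "i = 0 \<or> d (i - 1) = 0")
      case True
      then have "time_matched 0 (real i / m) e x y"
        using less.IH[of i] i iN by (simp del: neq0_conv)
      from time_matched_trans[OF _ step this tail] show ?thesis
        unfolding i by simp
    next
      case False
      then obtain j where j: "i = Suc j" "d j \<noteq> 0"
        using not0_implies_Suc[of i] by auto
      have dj: "j = 0 \<or> d (j - 1) = 0"
      proof (rule ccontr)
        assume "\<not> ?thesis"
        then show False
          using sep[of "j - 1"] j iN by simp
      qed
      have 1: "time_matched 0 (real j / m) e x y"
        by (rule less.IH) (use i j dj iN in simp_all)
      have jn: "j < n" "Suc j < n"
        using iN j by simp_all
      have lt: "real (Suc j) / m < real (Suc (Suc j)) / m"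
        using m by (simp add: divide_strict_right_mono)
      have "time_matched (real j / m) (real (Suc (Suc j)) / m) e x y"
      proof (rule time_matched_jump[of _ "sy j" _ "sx j"])
        show "real j / m < sy j" "real j / m < sx j" "sy j < real (Suc (Suc j)) / m"
             "sx j < real (Suc (Suc j)) / m"
          using sx(1)[OF jn(1)] sy(1)[OF jn(1)] lt by auto
        show "real (Suc (Suc j)) / m - real j / m \<le> e"
          using e(1) by (simp add: diff_divide_distrib[symmetric])
        have before: "\<bar>x t - \<delta> * heights m d j\<bar> \<le> \<epsilon>" if "real j / m \<le> t" "t < sx j" for t
          using near_staircase_grid[OF x, of j] sx(2)[of j t] sx(1)[of j] jn m \<epsilon> that
          by (cases "t = real j / m") auto
        have before': "\<bar>y t - \<delta> * heights m d j\<bar> \<le> \<epsilon>" if "real j / m \<le> t" "t < sy j" for t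
          using near_staircase_grid[OF y, of j] sy(2)[of j t] sy(1)[of j] jn m \<epsilon> that
          by (cases "t = real j / m") auto
        show "\<bar>x r - y t\<bar> \<le> e" if "real j / m \<le> t" "t < sy j" "real j / m \<le> r" "r < sx j" for t r
          using before[of r] before'[of t] that e(2) by linarith
        have after: "\<bar>x t - \<delta> * heights m d (Suc j)\<bar> \<le> \<epsilon>" if "sx j \<le> t" "t \<le> real (Suc (Suc j)) / m" for t
          using sx(2)[of j t] sx(1)[of j] flat(1)[of "Suc j" t] di j jn that
          by (cases "t \<le> real (Suc j) / m") auto
        have after': "\<bar>y t - \<delta> * heights m d (Suc j)\<bar> \<le> \<epsilon>" if "sy j \<le> t" "t \<le> real (Suc (Suc j)) / m" for t
          using sy(2)[of j t] sy(1)[of j] flat(2)[of "Suc j" t] di j jn that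
          by (cases "t \<le> real (Suc j) / m") auto
        show "\<bar>x r - y t\<bar> \<le> e" if "sy j \<le> t" "t \<le> real (Suc (Suc j)) / m"
            "sx j \<le> r" "r \<le> real (Suc (Suc j)) / m" for t r
          using after[of r] after'[of t] that e(2) by linarith
      qed
      from time_matched_trans[OF _ _ 1 this] show ?thesis
        unfolding i j(1) by (simp add: divide_right_mono)
    qed
  qed
qed

text \<open>The final time \<open>T\<close> need not be a grid point. On the last stretch before
  \<open>T\<close> time is left unchanged: by monotonicity \<open>x\<close> is caught between its
  values at the surrounding grid points, which are close to those of \<open>y\<close>, and
  \<open>y\<close> moves by at most \<open>\<omega>\<close> there.\<close>

lemma J1_dist_near_staircase:
  assumes x: "near_staircase m n d \<delta> \<epsilon> x" and y: "near_staircase m n d \<delta> \<epsilon> y"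
    and m: "0 < m" and sep: "\<And>i. Suc i < n \<Longrightarrow> d i \<noteq> 0 \<Longrightarrow> d (Suc i) = 0"
    and e: "2 / m \<le> e" "2 * \<epsilon> + \<omega> \<le> e" and \<epsilon>: "0 \<le> \<epsilon>"
    and T: "0 \<le> T" "T * m < real n - 1"
    and \<omega>: "\<And>t u. 0 \<le> t \<Longrightarrow> 0 \<le> u \<Longrightarrow> \<bar>t - T\<bar> \<le> 2 / m \<Longrightarrow> \<bar>u - T\<bar> \<le> 2 / m \<Longrightarrow> \<bar>y t - y u\<bar> \<le> \<omega>"
  shows "J1_dist T x y \<le> e"
proof -
  define k0 where "k0 = nat \<lfloor>T * m\<rfloor>"
  have k0: "real k0 \<le> T * m" "T * m < real k0 + 1"
    using T by (auto simp: k0_def)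
  have k0n: "Suc k0 < n"
    using k0 T by linarith
  \<comment> \<open>If the last cell before the grid point carries a jump, it is assigned to the
    final stretch. By separation the cell before it is flat, as the induction over grid points
    requires.\<close>
  define k where "k = (if k0 = 0 \<or> d (k0 - 1) = 0 then k0 else k0 - 1)"
  have k: "k = 0 \<or> d (k - 1) = 0"
  proof (rule ccontr)
    assume "\<not> ?thesis"
    then show False
      using sep[of "k0 - 2"] k0n by (cases "k0 = 0 \<or> d (k0 - 1) = 0") (auto simp: k_def numeral_2_eq_2 Suc_diff_Suc less_imp_diff_less)
  qed
  have kk: "k \<le> k0" "real k0 \<le> real k + 1"
    by (auto simp: k_def)
  have \<omega>0: "0 \<le> \<omega>"
    using \<omega>[of T T] T m by auto
  have a: "time_matched 0 (real k / m) e x y"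
    using kk k0n k e \<epsilon> \<omega>0 by (intro near_staircase_time_matched[OF x y m sep _ _ \<epsilon>]) auto
  let ?a = "real k / m" and ?b = "real (Suc k0) / m"
  have "T \<le> (real k + 2) / m" "real (Suc k0) / m \<le> (T * m + 1) / m"
    using k0 kk m by (simp_all add: pos_le_divide_eq divide_right_mono)
  moreover have "(T * m + 1) / m = T + 1 / m" "1 / m \<le> 2 / real m"
    using m by (simp_all add: add_divide_distrib divide_right_mono)
  moreover have "?a \<le> T" "T \<le> ?b"
    using k0 kk m by (simp_all add: pos_le_divide_eq pos_divide_le_eq)
  ultimately have ab: "0 \<le> ?a" "?a \<le> T" "T \<le> ?b" "T - 2 / m \<le> ?a" "?b \<le> T + 2 / m"
    unfolding add_divide_distrib by (simp_all del: of_nat_Suc)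
  have "time_matched ?a T e x y"
  proof (rule time_matched_id)
    fix t assume t: "t \<in> {?a..T}"
    have mx: "x ?a \<le> x t" "x t \<le> x ?b" and my: "y ?a \<le> y t" "y t \<le> y ?b"
      using t ab order_trans[OF ab(1), of t]
      by (auto intro!: near_staircase_mono[OF x] near_staircase_mono[OF y] simp del: of_nat_Suc)
    have 1: "\<bar>x ?a - \<delta> * heights m d k\<bar> \<le> \<epsilon>" "\<bar>y ?a - \<delta> * heights m d k\<bar> \<le> \<epsilon>"
      using kk k0n by (auto intro!: near_staircase_grid[OF x _ m \<epsilon>] near_staircase_grid[OF y _ m \<epsilon>])
    have 2: "\<bar>x ?b - \<delta> * heights m d (Suc k0)\<bar> \<le> \<epsilon>" "\<bar>y ?b - \<delta> * heights m d (Suc k0)\<bar> \<le> \<epsilon>"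
      using kk k0n by (auto intro!: near_staircase_grid[OF x _ m \<epsilon>] near_staircase_grid[OF y _ m \<epsilon>]
        simp del: of_nat_Suc heights.simps)
    have "\<bar>y ?a - y ?b\<bar> \<le> \<omega>"
      by (rule \<omega>) (use ab T in auto)
    then show "\<bar>x t - y t\<bar> \<le> e"
      using 1 2 mx my e by linarith
  qed (use e \<epsilon> \<omega>0 in simp)
  from time_matched_trans[OF ab(1,2) a this] obtain l where l:
      "strict_mono_on {0..T} l" "l ` {0..T} = {0..T}"
      "\<And>t. t \<in> {0..T} \<Longrightarrow> \<bar>l t - t\<bar> \<le> e \<and> \<bar>x (l t) - y t\<bar> \<le> e"
    unfolding time_matched_def by blast
  have "l \<in> time_changes T"
    using l(1,2) by (simp add: time_changes_def)
  then show ?thesis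
    using T(1) l(3) by (intro J1_dist_le[of T l]) (simp_all add: dist_real_def)
qed

section \<open>The SM1 distance of monotone paths\<close>

definition monotone_path :: "(real \<Rightarrow> real \<times> real) \<Rightarrow> bool" where
  "monotone_path z \<longleftrightarrow> z \<in> skorokhod_space \<and> z 0 = 0 \<and>
     mono_on {0..} (\<lambda>t. fst (z t)) \<and> mono_on {0..} (\<lambda>t. snd (z t))"

lemma monotone_path_mono:
  assumes "monotone_path z" "0 \<le> r" "r \<le> t"
  shows "fst (z r) \<le> fst (z t)" "snd (z r) \<le> snd (z t)"
  using assms mono_onD[of "{0..}" "\<lambda>t. fst (z t)" r t] mono_onD[of "{0..}" "\<lambda>t. snd (z t)" r t]
  by (simp_all add: monotone_path_def)

lemma left_limit_tendsto:
  fixes z :: "real \<Rightarrow> 'a::t2_space"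
  assumes "z \<in> skorokhod_space" "0 < t"
  shows "(z \<longlongrightarrow> left_limit z t) (at_left t)"
proof -
  obtain l where "(z \<longlongrightarrow> l) (at_left t)"
    using assms by (auto simp: skorokhod_space_def)
  then show ?thesis
    using assms(2) tendsto_Lim[OF trivial_limit_at_left_real, of z l t] by (simp add: left_limit_def)
qed

lemma left_limit_le:
  assumes z: "monotone_path z" and t: "0 \<le> t"
  shows "fst (left_limit z t) \<le> fst (z t)" "snd (left_limit z t) \<le> snd (z t)"
proof -
  have "fst (left_limit z t) \<le> fst (z t) \<and> snd (left_limit z t) \<le> snd (z t)"
  proof (cases "t = 0")
    case False
    have lim: "(z \<longlongrightarrow> left_limit z t) (at_left t)"
      using z t False by (intro left_limit_tendsto) (auto simp: monotone_path_def)
    have ev: "\<forall>\<^sub>F r in at_left t. 0 < r \<and> r < t"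
      using eventually_at_left_real[of 0 t] t False by simp
    have mono: "fst (z r) \<le> fst (z t)" "snd (z r) \<le> snd (z t)" if "0 < r \<and> r < t" for r
      using that monotone_path_mono[OF z, of r t] by simp_all
    have "\<forall>\<^sub>F r in at_left t. fst (z r) \<le> fst (z t)" "\<forall>\<^sub>F r in at_left t. snd (z r) \<le> snd (z t)"
      by (rule eventually_mono[OF ev], rule mono, assumption)+
    from tendsto_upperbound[OF tendsto_fst[OF lim] this(1)] tendsto_upperbound[OF tendsto_snd[OF lim] this(2)]
    show ?thesis by simp
  qed (simp add: left_limit_def)
  then show "fst (left_limit z t) \<le> fst (z t)" "snd (left_limit z t) \<le> snd (z t)"
    by auto
qed

lemma le_left_limit:
  assumes z: "monotone_path z" and t: "0 \<le> r" "r < t"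
  shows "fst (z r) \<le> fst (left_limit z t)" "snd (z r) \<le> snd (left_limit z t)"
proof -
  have lim: "(z \<longlongrightarrow> left_limit z t) (at_left t)"
    using z t by (intro left_limit_tendsto) (auto simp: monotone_path_def)
  have ev: "\<forall>\<^sub>F q in at_left t. r < q \<and> q < t"
    using eventually_at_left_real[of r t] t by simp
  have mono: "fst (z r) \<le> fst (z q)" "snd (z r) \<le> snd (z q)" if "r < q \<and> q < t" for q
    using t that monotone_path_mono[OF z, of r q] by simp_all
  have "\<forall>\<^sub>F q in at_left t. fst (z r) \<le> fst (z q)" "\<forall>\<^sub>F q in at_left t. snd (z r) \<le> snd (z q)"
    by (rule eventually_mono[OF ev], rule mono, assumption)+
  from tendsto_lowerbound[OF tendsto_fst[OF lim] this(1)] tendsto_lowerbound[OF tendsto_snd[OF lim] this(2)]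
  show "fst (z r) \<le> fst (left_limit z t)" "snd (z r) \<le> snd (left_limit z t)"
    by simp_all
qed

lemma left_limit_0: "monotone_path z \<Longrightarrow> left_limit z 0 = 0"
  by (simp add: left_limit_def monotone_path_def)

text \<open>The completed graph of a path with monotone coordinates is parametrized by the sum of the three
  coordinates.\<close>

definition graph_sum :: "(real \<times> real) \<times> real \<Rightarrow> real" where
  "graph_sum p = fst (fst p) + snd (fst p) + snd p"

definition graph_below :: "(real \<times> real) \<times> real \<Rightarrow> (real \<times> real) \<times> real \<Rightarrow> bool" where
  "graph_below p q \<longleftrightarrow> fst (fst p) \<le> fst (fst q) \<and> snd (fst p) \<le> snd (fst q) \<and> snd p \<le> snd q"

lemma completed_graphE:
  assumes z: "monotone_path z" and p: "p \<in> completed_graph T z"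
  obtains \<theta> where "0 \<le> \<theta>" "\<theta> \<le> 1" "0 \<le> snd p" "snd p \<le> T"
    "fst (fst p) = fst (left_limit z (snd p)) + \<theta> * (fst (z (snd p)) - fst (left_limit z (snd p)))"
    "snd (fst p) = snd (left_limit z (snd p)) + \<theta> * (snd (z (snd p)) - snd (left_limit z (snd p)))"
proof -
  from p obtain \<theta> where \<theta>: "0 \<le> \<theta>" "\<theta> \<le> 1" "0 \<le> snd p" "snd p \<le> T"
    "fst p = (1 - \<theta>) *\<^sub>R left_limit z (snd p) + \<theta> *\<^sub>R z (snd p)"
    by (auto simp: completed_graph_def closed_segment_def)
  then show thesis
    by (intro that[of \<theta>]) (simp_all add: \<theta>(5) left_diff_distrib right_diff_distrib)
qed

lemma completed_graph_bounds:
  assumes z: "monotone_path z" and p: "p \<in> completed_graph T z"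
  shows "fst (left_limit z (snd p)) \<le> fst (fst p)" "fst (fst p) \<le> fst (z (snd p))"
    "snd (left_limit z (snd p)) \<le> snd (fst p)" "snd (fst p) \<le> snd (z (snd p))"
proof -
  have between: "a \<le> a + \<theta> * (b - a) \<and> a + \<theta> * (b - a) \<le> b"
    if "a \<le> b" "0 \<le> \<theta>" "\<theta> \<le> 1" for a b \<theta> :: real
    using mult_nonneg_nonneg[of \<theta> "b - a"] mult_right_mono[of \<theta> 1 "b - a"] that by simp
  from z p obtain \<theta> where \<theta>: "0 \<le> \<theta>" "\<theta> \<le> 1" "0 \<le> snd p"
    "fst (fst p) = fst (left_limit z (snd p)) + \<theta> * (fst (z (snd p)) - fst (left_limit z (snd p)))"
    "snd (fst p) = snd (left_limit z (snd p)) + \<theta> * (snd (z (snd p)) - snd (left_limit z (snd p)))"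
    by (rule completed_graphE)
  show "fst (left_limit z (snd p)) \<le> fst (fst p)" "fst (fst p) \<le> fst (z (snd p))"
    "snd (left_limit z (snd p)) \<le> snd (fst p)" "snd (fst p) \<le> snd (z (snd p))"
    unfolding \<theta>(4,5)
    using between[OF left_limit_le(1)[OF z \<theta>(3)] \<theta>(1,2)] between[OF left_limit_le(2)[OF z \<theta>(3)] \<theta>(1,2)]
    by auto
qed

text \<open>At different times monotonicity compares the points. At a common time both lie on the
  segment from the left limit to the value, along which neither coordinate decreases; this is where
  the straight segments of the strong topology enter.\<close>

lemma graph_below_total:
  assumes z: "monotone_path z" and p: "p \<in> completed_graph T z" and q: "q \<in> completed_graph T z"
  shows "graph_below p q \<or> graph_below q p"
proof -
  have less: "graph_below p q" if "p \<in> completed_graph T z" "q \<in> completed_graph T z" "snd p < snd q" for p q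
  proof -
    have "0 \<le> snd p"
      using that(1) by (auto simp: completed_graph_def)
    then show ?thesis
      using completed_graph_bounds[OF z that(1)] completed_graph_bounds[OF z that(2)]
        le_left_limit[OF z _ that(3)] that(3) unfolding graph_below_def by linarith
  qed
  show ?thesis
  proof (cases "snd p = snd q")
    case True
    obtain \<theta> where \<theta>: "0 \<le> \<theta>" "\<theta> \<le> 1" "0 \<le> snd p"
      "fst (fst p) = fst (left_limit z (snd p)) + \<theta> * (fst (z (snd p)) - fst (left_limit z (snd p)))"
      "snd (fst p) = snd (left_limit z (snd p)) + \<theta> * (snd (z (snd p)) - snd (left_limit z (snd p)))"
      using z p by (rule completed_graphE)
    obtain \<kappa> where \<kappa>: "0 \<le> \<kappa>" "\<kappa> \<le> 1" "0 \<le> snd q"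
      "fst (fst q) = fst (left_limit z (snd q)) + \<kappa> * (fst (z (snd q)) - fst (left_limit z (snd q)))"
      "snd (fst q) = snd (left_limit z (snd q)) + \<kappa> * (snd (z (snd q)) - snd (left_limit z (snd q)))"
      using z q by (rule completed_graphE)
    show ?thesis
      using left_limit_le[OF z \<theta>(3)] True unfolding graph_below_def \<theta>(4,5) \<kappa>(4,5)
      by (cases "\<theta> \<le> \<kappa>") (auto simp: mult_right_mono)
  next
    case False
    then show ?thesis
      using less[OF p q] less[OF q p] by (cases "snd p < snd q") auto
  qed
qed

text \<open>The three coordinate differences have the same sign, so each is bounded by the absolute
  value of their sum.\<close>

lemma graph_below_dist:
  assumes "graph_below p q \<or> graph_below q p"
  shows "\<bar>fst (fst p) - fst (fst q)\<bar> \<le> \<bar>graph_sum p - graph_sum q\<bar>"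
    "\<bar>snd (fst p) - snd (fst q)\<bar> \<le> \<bar>graph_sum p - graph_sum q\<bar>"
    "\<bar>snd p - snd q\<bar> \<le> \<bar>graph_sum p - graph_sum q\<bar>"
  using assms unfolding graph_below_def graph_sum_def by linarith+

lemma path_in_completed_graph: "t \<in> {0..T} \<Longrightarrow> (z t, t) \<in> completed_graph T z"
  by (simp add: completed_graph_def)

text \<open>The time \<open>\<tau>\<close> is the infimum of the times at which the sum along the
  path is at least \<open>s\<close>. By right continuity \<open>s\<close> is reached at
  \<open>\<tau>\<close>, the left limit has sum at most \<open>s\<close>, and on the segment joining
  the two the intermediate value theorem applies.\<close>

lemma graph_sum_surj:
  assumes z: "monotone_path z" and T: "0 \<le> T" and s: "0 \<le> s" "s \<le> graph_sum (z T, T)"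
  shows "\<exists>p\<in>completed_graph T z. graph_sum p = s"
proof -
  define \<tau> where "\<tau> = Inf {t \<in> {0..T}. s \<le> graph_sum (z t, t)}"
  let ?A = "{t \<in> {0..T}. s \<le> graph_sum (z t, t)}"
  have TA: "T \<in> ?A"
    using T s by simp
  have bdd: "bdd_below ?A"
    by (rule bdd_belowI[of _ 0]) auto
  have \<tau>: "0 \<le> \<tau>" "\<tau> \<le> T"
    using cInf_lower[OF TA bdd] TA by (auto simp: \<tau>_def intro!: cInf_greatest)
  have above: "s \<le> graph_sum (z t, t)" if t: "\<tau> < t" "t \<le> T" for t
  proof -
    obtain r where r: "r \<in> ?A" "r < t"
      using cInf_lessD[of ?A t] TA t(1) by (auto simp: \<tau>_def)
    then have "fst (z r) \<le> fst (z t)" "snd (z r) \<le> snd (z t)"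
      using monotone_path_mono[OF z, of r t] by simp_all
    then show ?thesis
      using r by (auto simp: graph_sum_def)
  qed
  have 1: "s \<le> graph_sum (z \<tau>, \<tau>)"
  proof (cases "\<tau> = T")
    case False
    have "(z \<longlongrightarrow> z \<tau>) (at_right \<tau>)"
      using z \<tau> by (auto simp: monotone_path_def skorokhod_space_def)
    then have "((\<lambda>t. graph_sum (z t, t)) \<longlongrightarrow> graph_sum (z \<tau>, \<tau>)) (at_right \<tau>)"
      unfolding graph_sum_def by (auto intro!: tendsto_intros)
    moreover have "\<forall>\<^sub>F t in at_right \<tau>. s \<le> graph_sum (z t, t)"
    proof (rule eventually_mono)
      show "\<forall>\<^sub>F t in at_right \<tau>. t \<in> {\<tau><..<T}"
        using eventually_at_right_real[of \<tau> T] False \<tau> by auto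
    qed (use above in auto)
    ultimately show ?thesis
      by (rule tendsto_lowerbound) simp
  qed (use s in simp)
  have 2: "graph_sum (left_limit z \<tau>, \<tau>) \<le> s"
  proof (cases "\<tau> = 0")
    case True
    then show ?thesis
      using s left_limit_0[OF z] by (simp add: graph_sum_def)
  next
    case False
    have "(z \<longlongrightarrow> left_limit z \<tau>) (at_left \<tau>)"
      using z \<tau> False by (intro left_limit_tendsto) (auto simp: monotone_path_def)
    then have "((\<lambda>t. graph_sum (z t, t)) \<longlongrightarrow> graph_sum (left_limit z \<tau>, \<tau>)) (at_left \<tau>)"
      unfolding graph_sum_def by (auto intro!: tendsto_intros)
    moreover have "\<forall>\<^sub>F t in at_left \<tau>. graph_sum (z t, t) \<le> s"
    proof (rule eventually_mono)
      show "\<forall>\<^sub>F t in at_left \<tau>. t \<in> {0<..<\<tau>}"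
        using eventually_at_left_real[of 0 \<tau>] False \<tau> by auto
      fix t assume "t \<in> {0<..<\<tau>}"
      then show "graph_sum (z t, t) \<le> s"
        using cInf_lower[of t ?A] bdd \<tau> by (cases "s \<le> graph_sum (z t, t)") (auto simp: \<tau>_def)
    qed
    ultimately show ?thesis
      by (rule tendsto_upperbound) simp
  qed
  have "\<exists>\<theta>\<in>{0..1}. graph_sum ((1 - \<theta>) *\<^sub>R left_limit z \<tau> + \<theta> *\<^sub>R z \<tau>, \<tau>) = s"
  proof -
    have "continuous_on {0..1} (\<lambda>\<theta>. graph_sum ((1 - \<theta>) *\<^sub>R left_limit z \<tau> + \<theta> *\<^sub>R z \<tau>, \<tau>))"
      unfolding graph_sum_def by (auto intro!: continuous_intros)
    from IVT'[OF _ _ _ this, of s] show ?thesis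
      using 1 2 by auto
  qed
  then obtain \<theta> where \<theta>: "\<theta> \<in> {0..1}" "graph_sum ((1 - \<theta>) *\<^sub>R left_limit z \<tau> + \<theta> *\<^sub>R z \<tau>, \<tau>) = s"
    by blast
  moreover have "((1 - \<theta>) *\<^sub>R left_limit z \<tau> + \<theta> *\<^sub>R z \<tau>, \<tau>) \<in> completed_graph T z"
    using \<theta>(1) \<tau> by (auto simp: completed_graph_def closed_segment_def)
  ultimately show ?thesis
    by blast
qed

text \<open>The inverse of \<open>graph_sum\<close> on the completed graph of a monotone
  path.\<close>

definition graph_point :: "real \<Rightarrow> (real \<Rightarrow> real \<times> real) \<Rightarrow> real \<Rightarrow> (real \<times> real) \<times> real" where
  "graph_point T z s = (SOME p. p \<in> completed_graph T z \<and> graph_sum p = s)"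

lemma graph_point:
  assumes "monotone_path z" "0 \<le> T" "0 \<le> s" "s \<le> graph_sum (z T, T)"
  shows "graph_point T z s \<in> completed_graph T z" "graph_sum (graph_point T z s) = s"
  using someI_ex[of "\<lambda>p. p \<in> completed_graph T z \<and> graph_sum p = s"] graph_sum_surj[OF assms]
  unfolding graph_point_def by auto

lemma graph_point_unique:
  assumes "monotone_path z" "0 \<le> T" "p \<in> completed_graph T z"
  shows "0 \<le> graph_sum p" "graph_sum p \<le> graph_sum (z T, T)" "graph_point T z (graph_sum p) = p"
proof -
  note z = assms(1)
  have 0: "(z 0, 0) \<in> completed_graph T z" and T: "(z T, T) \<in> completed_graph T z"
    using assms(2) by (auto intro!: path_in_completed_graph)
  have p: "0 \<le> snd p" "snd p \<le> T"
    using assms(3) by (auto simp: completed_graph_def)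
  have le: "graph_sum q \<le> graph_sum r" if "q \<in> completed_graph T z" "r \<in> completed_graph T z" "graph_below q r" for q r
    using that unfolding graph_below_def graph_sum_def by linarith
  have nn: "0 \<le> fst (left_limit z t)" "0 \<le> snd (left_limit z t)" if "0 \<le> t" for t
    using le_left_limit[OF z, of 0 t] left_limit_0[OF z] that z
    by (cases "t = 0"; auto simp: monotone_path_def)+
  show 1: "0 \<le> graph_sum p"
    using completed_graph_bounds[OF z assms(3)] nn[OF p(1)] p unfolding graph_sum_def by linarith
  have "fst (z (snd p)) \<le> fst (z T)" "snd (z (snd p)) \<le> snd (z T)"
    using monotone_path_mono[OF z p] by simp_all
  then show 2: "graph_sum p \<le> graph_sum (z T, T)"
    using completed_graph_bounds[OF z assms(3)] p unfolding graph_sum_def by auto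
  show "graph_point T z (graph_sum p) = p"
    using graph_below_dist[OF graph_below_total[OF z graph_point(1)[OF z assms(2) 1 2] assms(3)]]
      graph_point(2)[OF z assms(2) 1 2] by (auto simp: prod_eq_iff)
qed

lemma graph_point_dist:
  assumes z: "monotone_path z" "0 \<le> T" and s: "0 \<le> s" "s \<le> graph_sum (z T, T)"
    and p: "p \<in> completed_graph T z"
  shows "\<bar>fst (fst (graph_point T z s)) - fst (fst p)\<bar> \<le> \<bar>s - graph_sum p\<bar>"
    "\<bar>snd (fst (graph_point T z s)) - snd (fst p)\<bar> \<le> \<bar>s - graph_sum p\<bar>"
    "\<bar>snd (graph_point T z s) - snd p\<bar> \<le> \<bar>s - graph_sum p\<bar>"
  using graph_below_dist[OF graph_below_total[OF z(1) graph_point(1)[OF z s] p]]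
    graph_point(2)[OF z s] by simp_all

lemma graph_point_below:
  assumes z: "monotone_path z" "0 \<le> T" and s: "0 \<le> s" "s \<le> t" "t \<le> graph_sum (z T, T)"
  shows "graph_below (graph_point T z s) (graph_point T z t)"
proof -
  have ts: "0 \<le> t" "s \<le> graph_sum (z T, T)"
    using s by linarith+
  have swap: "graph_below p q" if "graph_below q p" "graph_sum p \<le> graph_sum q" for p q
    using that unfolding graph_below_def graph_sum_def by linarith
  show ?thesis
    using swap[of "graph_point T z t" "graph_point T z s"] graph_below_total[OF z(1) graph_point(1)[OF z s(1) ts(2)] graph_point(1)[OF z ts(1) s(3)]]
      graph_point(2)[OF z s(1) ts(2)] graph_point(2)[OF z ts(1) s(3)] s(2) by auto
qed

lemma norm_prod_mono:
  fixes a b :: "real \<times> real"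
  assumes "\<bar>fst a\<bar> \<le> \<bar>fst b\<bar>" "\<bar>snd a\<bar> \<le> \<bar>snd b\<bar>"
  shows "norm a \<le> norm b"
  using assms by (auto simp: norm_prod_def abs_le_square_iff intro!: add_mono)

text \<open>As functions of the coordinate sum all coordinates are 1-Lipschitz, because the graph is
  a chain; hence the parametrization is continuous. Its order agrees with \<open>graph_le\<close>
  since, at a fixed time, moving up in both coordinates does not decrease the distance from the left
  limit.\<close>

lemma parametric_reps_graph_point:
  assumes z: "monotone_path z" "0 \<le> T"
  defines "g \<equiv> \<lambda>s. graph_point T z (graph_sum (z T, T) * s)"
  shows "(\<lambda>s. fst (g s), \<lambda>s. snd (g s)) \<in> parametric_reps T z"
proof -
  let ?S = "graph_sum (z T, T)"
  have S: "0 \<le> ?S"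
    using z by (intro graph_point_unique(1)[OF z] path_in_completed_graph) auto
  have range: "0 \<le> ?S * s" "?S * s \<le> ?S" if "s \<in> {0..1}" for s
    using that S mult_left_mono[of s 1 ?S] by auto
  have lip: "\<bar>fst (fst (g s)) - fst (fst (g t))\<bar> \<le> ?S * \<bar>s - t\<bar>" "\<bar>snd (fst (g s)) - snd (fst (g t))\<bar> \<le> ?S * \<bar>s - t\<bar>"
      "\<bar>snd (g s) - snd (g t)\<bar> \<le> ?S * \<bar>s - t\<bar>" if "s \<in> {0..1}" "t \<in> {0..1}" for s t
  proof -
    have "\<bar>?S * s - ?S * t\<bar> = ?S * \<bar>s - t\<bar>"
      using S by (simp add: right_diff_distrib[symmetric] abs_mult)
    then show "\<bar>fst (fst (g s)) - fst (fst (g t))\<bar> \<le> ?S * \<bar>s - t\<bar>" "\<bar>snd (fst (g s)) - snd (fst (g t))\<bar> \<le> ?S * \<bar>s - t\<bar>"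
      "\<bar>snd (g s) - snd (g t)\<bar> \<le> ?S * \<bar>s - t\<bar>"
      using graph_point_dist[OF z range[OF that(1)] graph_point(1)[OF z range[OF that(2)]]]
        graph_point(2)[OF z range[OF that(2)]] by (simp_all add: g_def)
  qed
  have cont: "continuous_on {0..1} f" if "\<And>s t. s \<in> {0..1} \<Longrightarrow> t \<in> {0..1} \<Longrightarrow> \<bar>f s - f t\<bar> \<le> ?S * \<bar>s - t\<bar>" for f :: "real \<Rightarrow> real"
    using that S by (intro lipschitz_on_continuous_on[of ?S] lipschitz_onI) (auto simp: dist_real_def)
  have c1: "continuous_on {0..1} (\<lambda>s. fst (fst (g s)))" and c2: "continuous_on {0..1} (\<lambda>s. snd (fst (g s)))"
      and c3: "continuous_on {0..1} (\<lambda>s. snd (g s))"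
    using lip by (auto intro!: cont)
  have c: "continuous_on {0..1} (\<lambda>s. fst (g s))"
    using continuous_on_Pair[OF c1 c2] by simp
  have im: "g ` {0..1} = completed_graph T z"
  proof
    show "g ` {0..1} \<subseteq> completed_graph T z"
      using range graph_point(1)[OF z] by (auto simp: g_def)
    show "completed_graph T z \<subseteq> g ` {0..1}"
    proof
      fix p assume p: "p \<in> completed_graph T z"
      note u = graph_point_unique[OF z p]
      show "p \<in> g ` {0..1}"
      \<comment> \<open>If the total sum is 0, the graph is a single point and the parameter cannot
        be recovered by division.\<close>
      proof (cases "?S = 0")
        case True
        then have "g 0 = p"
          using u by (simp add: g_def)
        then show ?thesis by force
      next
        case False
        then have "g (graph_sum p / ?S) = p" "graph_sum p / ?S \<in> {0..1}"
          using u S by (auto simp: g_def field_simps)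
        then show ?thesis by force
      qed
    qed
  qed
  have le: "graph_le z (g s) (g t)" if st: "s \<in> {0..1}" "t \<in> {0..1}" "s \<le> t" for s t
  proof -
    have "?S * s \<le> ?S * t"
      using st S by (simp add: mult_left_mono)
    then have below: "graph_below (g s) (g t)"
      unfolding g_def using range[OF st(1)] range[OF st(2)] by (intro graph_point_below[OF z])
    have gs: "g s \<in> completed_graph T z"
      using im st(1) by blast
    show ?thesis
    proof (cases "snd (g s) = snd (g t)")
      case True
      have "norm (left_limit z (snd (g s)) - fst (g s)) \<le> norm (left_limit z (snd (g s)) - fst (g t))"
        using completed_graph_bounds[OF z(1) gs] below
        by (intro norm_prod_mono) (auto simp: graph_below_def)
      then show ?thesis
        using True by (simp add: graph_le_def)
    qed (use below in \<open>auto simp: graph_le_def graph_below_def\<close>)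
  qed
  show ?thesis
    unfolding parametric_reps_def using c c3 im le by auto
qed

lemma parametric_reps_max_nonneg:
  assumes "(u1, r1) \<in> parametric_reps T x" "(u2, r2) \<in> parametric_reps T y"
  shows "0 \<le> max (SUP s\<in>{0..1}. norm (u1 s - u2 s)) (SUP s\<in>{0..1}. \<bar>r1 s - r2 s\<bar>)"
proof -
  have "(\<lambda>s. (u1 s, r1 s)) ` {0..1} = completed_graph T x" "(\<lambda>s. (u2 s, r2 s)) ` {0..1} = completed_graph T y"
    using assms by (simp_all add: parametric_reps_def)
  then have "(u1 s, r1 s) \<in> completed_graph T x" "(u2 s, r2 s) \<in> completed_graph T y" if "s \<in> {0..1}" for s
    using that by (metis (no_types, lifting) imageI)+
  then have "\<bar>r1 s - r2 s\<bar> \<le> T" if "s \<in> {0..1}" for s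
    using that by (fastforce simp: completed_graph_def abs_le_iff)
  then have "bdd_above ((\<lambda>s. \<bar>r1 s - r2 s\<bar>) ` {0..1})"
    by (intro bdd_aboveI2[of _ _ T])
  then have "\<bar>r1 0 - r2 0\<bar> \<le> (SUP s\<in>{0..1}. \<bar>r1 s - r2 s\<bar>)"
    by (intro cSUP_upper) auto
  then show ?thesis
    by auto
qed

text \<open>The infimum of an empty set is unspecified, so it matters that monotone paths possess a
  parametric representation.\<close>

lemma SM1_dist_nonneg:
  assumes "monotone_path x" "monotone_path y" "0 \<le> T"
  shows "0 \<le> SM1_dist T x y"
  unfolding SM1_dist_def
proof (rule cInf_greatest)
  show "{max (SUP s\<in>{0..1}. norm (u1 s - u2 s)) (SUP s\<in>{0..1}. \<bar>r1 s - r2 s\<bar>) | u1 r1 u2 r2.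
      (u1, r1) \<in> parametric_reps T x \<and> (u2, r2) \<in> parametric_reps T y} \<noteq> {}"
    using parametric_reps_graph_point[OF assms(1,3)] parametric_reps_graph_point[OF assms(2,3)] by blast
  fix v assume "v \<in> {max (SUP s\<in>{0..1}. norm (u1 s - u2 s)) (SUP s\<in>{0..1}. \<bar>r1 s - r2 s\<bar>) | u1 r1 u2 r2.
      (u1, r1) \<in> parametric_reps T x \<and> (u2, r2) \<in> parametric_reps T y}"
  then show "0 \<le> v"
    using parametric_reps_max_nonneg by blast
qed

text \<open>Both graphs are parametrized by the proportion of their total sums. The point
  \<open>q\<close> of the second graph near \<open>gx s\<close> has a sum within
  \<open>3 * e\<close> of that of \<open>gx s\<close>, hence within \<open>5 * e\<close> of that of
  \<open>gy s\<close>, as the totals differ by at most \<open>2 * e\<close>. So each coordinate of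
  \<open>gy s\<close> is within \<open>5 * e\<close> of that of \<open>q\<close> and within
  \<open>6 * e\<close> of that of \<open>gx s\<close>; the norm of the plane at most doubles
  this.\<close>

lemma SM1_dist_le:
  assumes x: "monotone_path x" and y: "monotone_path y" and T: "0 \<le> T" and e: "0 \<le> e"
    and near: "\<And>p. p \<in> completed_graph T x \<Longrightarrow> \<exists>q\<in>completed_graph T y.
      \<bar>fst (fst p) - fst (fst q)\<bar> \<le> e \<and> \<bar>snd (fst p) - snd (fst q)\<bar> \<le> e \<and> \<bar>snd p - snd q\<bar> \<le> e"
    and endpoint: "\<bar>fst (x T) - fst (y T)\<bar> \<le> e" "\<bar>snd (x T) - snd (y T)\<bar> \<le> e"
  shows "SM1_dist T x y \<le> 12 * e"
proof -
  define Sx Sy where "Sx = graph_sum (x T, T)" and "Sy = graph_sum (y T, T)"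
  have S: "0 \<le> Sx" "0 \<le> Sy" "\<bar>Sx - Sy\<bar> \<le> 2 * e"
    using graph_point_unique(1)[OF x T path_in_completed_graph, of T]
      graph_point_unique(1)[OF y T path_in_completed_graph, of T] T endpoint
    by (auto simp: Sx_def Sy_def graph_sum_def)
  define gx gy where "gx s = graph_point T x (Sx * s)" and "gy s = graph_point T y (Sy * s)" for s
  have close: "\<bar>fst (fst (gx s)) - fst (fst (gy s))\<bar> \<le> 6 * e \<and> \<bar>snd (fst (gx s)) - snd (fst (gy s))\<bar> \<le> 6 * e
      \<and> \<bar>snd (gx s) - snd (gy s)\<bar> \<le> 6 * e" if s: "s \<in> {0..1}" for s
  proof -
    have rx: "0 \<le> Sx * s" "Sx * s \<le> Sx" and ry: "0 \<le> Sy * s" "Sy * s \<le> Sy"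
      using s S mult_left_mono[of s 1 Sx] mult_left_mono[of s 1 Sy] by auto
    have ry2: "Sy * s \<le> graph_sum (y T, T)"
      using ry(2) by (simp add: Sy_def)
    have px: "gx s \<in> completed_graph T x" "graph_sum (gx s) = Sx * s"
      using graph_point[OF x T rx(1)] rx(2) by (auto simp: gx_def Sx_def)
    obtain q where q: "q \<in> completed_graph T y" "\<bar>fst (fst (gx s)) - fst (fst q)\<bar> \<le> e"
        "\<bar>snd (fst (gx s)) - snd (fst q)\<bar> \<le> e" "\<bar>snd (gx s) - snd q\<bar> \<le> e"
      using near[OF px(1)] by blast
    have "\<bar>graph_sum (gx s) - graph_sum q\<bar> \<le> 3 * e"
      using q unfolding graph_sum_def by linarith
    moreover have "\<bar>Sx * s - Sy * s\<bar> \<le> 2 * e"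
    proof -
      have "\<bar>Sx * s - Sy * s\<bar> = \<bar>Sx - Sy\<bar> * s"
        using s by (simp add: left_diff_distrib[symmetric] abs_mult)
      also have "\<dots> \<le> \<bar>Sx - Sy\<bar> * 1"
        using s by (intro mult_left_mono) auto
      finally show ?thesis using S(3) by simp
    qed
    ultimately have "\<bar>Sy * s - graph_sum q\<bar> \<le> 5 * e"
      using px(2) by linarith
    moreover note graph_point_dist[OF y T ry(1) ry2 q(1), folded gy_def]
    ultimately show ?thesis
      using q(2-4) unfolding abs_le_iff by linarith
  qed
  have "norm (fst (gx s) - fst (gy s)) \<le> 12 * e" if "s \<in> {0..1}" for s
  proof -
    have "norm (fst (gx s) - fst (gy s)) \<le> \<bar>fst (fst (gx s)) - fst (fst (gy s))\<bar> + \<bar>snd (fst (gx s)) - snd (fst (gy s))\<bar>"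
      using norm_Pair_le[of "fst (fst (gx s) - fst (gy s))" "snd (fst (gx s) - fst (gy s))"]
      unfolding prod.collapse by simp
    then show ?thesis
      using close[OF that] by linarith
  qed
  then have 1: "(SUP s\<in>{0..1}. norm (fst (gx s) - fst (gy s))) \<le> 12 * e"
    by (intro cSUP_least) auto
  have "\<bar>snd (gx s) - snd (gy s)\<bar> \<le> 12 * e" if "s \<in> {0..1}" for s
    using close[OF that] e by linarith
  then have 2: "(SUP s\<in>{0..1}. \<bar>snd (gx s) - snd (gy s)\<bar>) \<le> 12 * e"
    by (intro cSUP_least) auto
  have "SM1_dist T x y \<le> max (SUP s\<in>{0..1}. norm (fst (gx s) - fst (gy s))) (SUP s\<in>{0..1}. \<bar>snd (gx s) - snd (gy s)\<bar>)"
    unfolding SM1_dist_def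
  proof (rule cInf_lower)
    show "bdd_below {max (SUP s\<in>{0..1}. norm (u1 s - u2 s)) (SUP s\<in>{0..1}. \<bar>r1 s - r2 s\<bar>) | u1 r1 u2 r2.
      (u1, r1) \<in> parametric_reps T x \<and> (u2, r2) \<in> parametric_reps T y}"
      by (rule bdd_belowI[of _ 0]) (use parametric_reps_max_nonneg in blast)
    have "(\<lambda>s. fst (gx s), \<lambda>s. snd (gx s)) \<in> parametric_reps T x"
      using parametric_reps_graph_point[OF x T] by (simp add: gx_def Sx_def)
    moreover have "(\<lambda>s. fst (gy s), \<lambda>s. snd (gy s)) \<in> parametric_reps T y"
      using parametric_reps_graph_point[OF y T] by (simp add: gy_def Sy_def)
    ultimately show "max (SUP s\<in>{0..1}. norm (fst (gx s) - fst (gy s))) (SUP s\<in>{0..1}. \<bar>snd (gx s) - snd (gy s)\<bar>) \<in>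
      {max (SUP s\<in>{0..1}. norm (u1 s - u2 s)) (SUP s\<in>{0..1}. \<bar>r1 s - r2 s\<bar>) | u1 r1 u2 r2.
      (u1, r1) \<in> parametric_reps T x \<and> (u2, r2) \<in> parametric_reps T y}"
      by (intro CollectI exI[of _ "\<lambda>s. fst (gx s)"] exI[of _ "\<lambda>s. snd (gx s)"]
        exI[of _ "\<lambda>s. fst (gy s)"] exI[of _ "\<lambda>s. snd (gy s)"] conjI refl)
  qed
  then show ?thesis
    using 1 2 by simp
qed

text \<open>A one-sided comparison of the graphs suffices, since points of a monotone graph are determined
  up to the deviation of their coordinate sum. The two paths have to agree only outside the window
  \<open>(a, b)\<close>, provided that at most one coordinate of the limit moves inside it.\<close>

lemma SM1_dist_le_windows:
  assumes x: "monotone_path x" and y: "monotone_path y" and T: "0 \<le> T" and e: "0 \<le> e"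
    and win: "\<And>t. 0 < t \<Longrightarrow> t \<le> T \<Longrightarrow> \<exists>a b. 0 \<le> a \<and> a < t \<and> t \<le> b \<and> b \<le> T \<and> b - a \<le> e \<and>
      \<bar>fst (x a) - fst (y a)\<bar> \<le> e \<and> \<bar>snd (x a) - snd (y a)\<bar> \<le> e \<and>
      \<bar>fst (x b) - fst (y b)\<bar> \<le> e \<and> \<bar>snd (x b) - snd (y b)\<bar> \<le> e \<and>
      (fst (y b) - fst (y a) \<le> e \<or> snd (y b) - snd (y a) \<le> e)"
  shows "SM1_dist T x y \<le> 24 * e"
proof -
  have "SM1_dist T x y \<le> 12 * (2 * e)"
  proof (rule SM1_dist_le[OF x y T])
    show "0 \<le> 2 * e" using e by simp
    have endp: "\<bar>fst (x T) - fst (y T)\<bar> \<le> e \<and> \<bar>snd (x T) - snd (y T)\<bar> \<le> e"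
    proof (cases "T = 0")
      case True
      then show ?thesis using x y e by (simp add: monotone_path_def)
    next
      case False
      then obtain b where "T \<le> b" "b \<le> T" "\<bar>fst (x b) - fst (y b)\<bar> \<le> e" "\<bar>snd (x b) - snd (y b)\<bar> \<le> e"
        using win[of T] T by auto
      then show ?thesis by simp
    qed
    show "\<bar>fst (x T) - fst (y T)\<bar> \<le> 2 * e" "\<bar>snd (x T) - snd (y T)\<bar> \<le> 2 * e"
      using endp e by linarith+
    fix p assume p: "p \<in> completed_graph T x"
    define t where "t = snd p"
    have t: "0 \<le> t" "t \<le> T"
      using p by (auto simp: t_def completed_graph_def)
    show "\<exists>q\<in>completed_graph T y. \<bar>fst (fst p) - fst (fst q)\<bar> \<le> 2 * e \<and> \<bar>snd (fst p) - snd (fst q)\<bar> \<le> 2 * e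
        \<and> \<bar>snd p - snd q\<bar> \<le> 2 * e"
    proof (cases "t = 0")
      case True
      then have "fst (fst p) = 0" "snd (fst p) = 0"
        using completed_graph_bounds[OF x p] left_limit_0[OF x] x by (auto simp: t_def monotone_path_def)
      moreover have "(y 0, 0) \<in> completed_graph T y"
        using T by (intro path_in_completed_graph) auto
      ultimately show ?thesis
        using True y e by (intro bexI[of _ "(y 0, 0)"]) (auto simp: t_def monotone_path_def)
    next
      case False
      then obtain a b where ab: "0 \<le> a" "a < t" "t \<le> b" "b \<le> T" "b - a \<le> e"
        "\<bar>fst (x a) - fst (y a)\<bar> \<le> e" "\<bar>snd (x a) - snd (y a)\<bar> \<le> e"
        "\<bar>fst (x b) - fst (y b)\<bar> \<le> e" "\<bar>snd (x b) - snd (y b)\<bar> \<le> e"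
        "fst (y b) - fst (y a) \<le> e \<or> snd (y b) - snd (y a) \<le> e"
        using win[of t] t by auto
      have p12: "fst (x a) \<le> fst (fst p)" "fst (fst p) \<le> fst (x b)" "snd (x a) \<le> snd (fst p)" "snd (fst p) \<le> snd (x b)"
        using completed_graph_bounds[OF x p, folded t_def] le_left_limit[OF x ab(1,2)]
          monotone_path_mono[OF x t(1) ab(3)] by linarith+
      define pa pb where "pa = (y a, a)" and "pb = (y b, b)"
      have pab: "pa \<in> completed_graph T y" "pb \<in> completed_graph T y"
        using ab t by (auto simp: pa_def pb_def intro!: path_in_completed_graph)
      have yab: "fst (y a) \<le> fst (y b)" "snd (y a) \<le> snd (y b)"
        using monotone_path_mono[OF y ab(1), of b] ab by auto
      have S: "0 \<le> graph_sum pa" "graph_sum pa \<le> graph_sum pb" "graph_sum pb \<le> graph_sum (y T, T)"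
        using graph_point_unique(1)[OF y T pab(1)] graph_point_unique(2)[OF y T pab(2)] yab ab
        by (auto simp: graph_sum_def pa_def pb_def)
      have range: "0 \<le> s \<and> s \<le> graph_sum (y T, T)" if "s \<in> {graph_sum pa..graph_sum pb}" for s
        using that S by auto
      have gab: "graph_point T y (graph_sum pa) = pa" "graph_point T y (graph_sum pb) = pb"
        using graph_point_unique(3)[OF y T] pab by auto
      have between: "graph_point T y s \<in> completed_graph T y \<and> graph_below pa (graph_point T y s) \<and> graph_below (graph_point T y s) pb"
        if s: "s \<in> {graph_sum pa..graph_sum pb}" for s
        using graph_point_below[OF y T, of "graph_sum pa" s] graph_point_below[OF y T, of s "graph_sum pb"]
          graph_point(1)[OF y T, of s] range[OF s] s S gab by auto
      have lip: "\<bar>fst (fst (graph_point T y s)) - fst (fst (graph_point T y r))\<bar> \<le> 1 * \<bar>s - r\<bar>"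
          "\<bar>snd (fst (graph_point T y s)) - snd (fst (graph_point T y r))\<bar> \<le> 1 * \<bar>s - r\<bar>"
        if "s \<in> {graph_sum pa..graph_sum pb}" "r \<in> {graph_sum pa..graph_sum pb}" for s r
        using graph_point_dist[OF y T, of s "graph_point T y r"] graph_point[OF y T, of r]
          range[OF that(1)] range[OF that(2)] by auto
      have cont: "continuous_on {graph_sum pa..graph_sum pb} f"
        if "\<And>s r. s \<in> {graph_sum pa..graph_sum pb} \<Longrightarrow> r \<in> {graph_sum pa..graph_sum pb} \<Longrightarrow> \<bar>f s - f r\<bar> \<le> 1 * \<bar>s - r\<bar>"
        for f :: "real \<Rightarrow> real"
        using that by (intro lipschitz_on_continuous_on[of 1] lipschitz_onI) (auto simp: dist_real_def)
      have tq: "\<bar>snd p - snd q\<bar> \<le> 2 * e" if "graph_below pa q" "graph_below q pb" for q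
        using that ab e unfolding t_def[symmetric] by (auto simp: graph_below_def pa_def pb_def)
      from ab(10) show ?thesis
      proof
        assume small: "snd (y b) - snd (y a) \<le> e"
        \<comment> \<open>The first coordinate of \<open>p\<close> is clamped to the range of
          \<open>y\<close> on the window, and the intermediate value theorem finds a graph point of
          \<open>y\<close> with this coordinate. The second coordinate is close automatically, since
          that of \<open>y\<close> moves by at most \<open>e\<close> on the window.\<close>
        define w where "w = max (fst (y a)) (min (fst (y b)) (fst (fst p)))"
        have w: "fst (y a) \<le> w" "w \<le> fst (y b)" "\<bar>fst (fst p) - w\<bar> \<le> e"
          using yab p12 ab by (auto simp: w_def)
        have "\<exists>s\<ge>graph_sum pa. s \<le> graph_sum pb \<and> fst (fst (graph_point T y s)) = w"
          by (rule IVT') (use w S gab lip in \<open>auto simp: pa_def[symmetric] pb_def[symmetric] intro!: cont, auto simp: pa_def pb_def\<close>)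
        then obtain s where s: "s \<in> {graph_sum pa..graph_sum pb}" "fst (fst (graph_point T y s)) = w"
          by auto
        have "\<bar>snd (fst p) - snd (fst (graph_point T y s))\<bar> \<le> 2 * e"
          using between[OF s(1)] small p12 ab yab by (auto simp: graph_below_def pa_def pb_def)
        then show ?thesis
          using between[OF s(1)] s(2) w(3) tq e by (intro bexI[of _ "graph_point T y s"]) auto
      next
        assume small: "fst (y b) - fst (y a) \<le> e"
        define w where "w = max (snd (y a)) (min (snd (y b)) (snd (fst p)))"
        have w: "snd (y a) \<le> w" "w \<le> snd (y b)" "\<bar>snd (fst p) - w\<bar> \<le> e"
          using yab p12 ab by (auto simp: w_def)
        have "\<exists>s\<ge>graph_sum pa. s \<le> graph_sum pb \<and> snd (fst (graph_point T y s)) = w"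
          by (rule IVT') (use w S gab lip in \<open>auto simp: pa_def[symmetric] pb_def[symmetric] intro!: cont, auto simp: pa_def pb_def\<close>)
        then obtain s where s: "s \<in> {graph_sum pa..graph_sum pb}" "snd (fst (graph_point T y s)) = w"
          by auto
        have "\<bar>fst (fst p) - fst (fst (graph_point T y s))\<bar> \<le> 2 * e"
          using between[OF s(1)] small p12 ab yab by (auto simp: graph_below_def pa_def pb_def)
        then show ?thesis
          using between[OF s(1)] s(2) w(3) tq e by (intro bexI[of _ "graph_point T y s"]) auto
      qed
    qed
  qed
  then show ?thesis by simp
qed

text \<open>The same parameter \<open>\<theta>\<close> on the two segments at a common time gives
  near points, since uniformly close paths have close left limits.\<close>

lemma SM1_dist_le_uniform:
  assumes x: "monotone_path x" and y: "monotone_path y" and T: "0 \<le> T" and e: "0 \<le> e"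
    and close: "\<And>t. 0 \<le> t \<Longrightarrow> t \<le> T \<Longrightarrow> \<bar>fst (x t) - fst (y t)\<bar> \<le> e \<and> \<bar>snd (x t) - snd (y t)\<bar> \<le> e"
  shows "SM1_dist T x y \<le> 12 * e"
proof (rule SM1_dist_le[OF x y T e])
  show "\<bar>fst (x T) - fst (y T)\<bar> \<le> e" "\<bar>snd (x T) - snd (y T)\<bar> \<le> e"
    using close[of T] T by auto
  fix p assume p: "p \<in> completed_graph T x"
  define t where "t = snd p"
  have t: "0 \<le> t" "t \<le> T"
    using p by (auto simp: t_def completed_graph_def)
  obtain \<theta> where \<theta>: "0 \<le> \<theta>" "\<theta> \<le> 1" "0 \<le> snd p"
    "fst (fst p) = fst (left_limit x (snd p)) + \<theta> * (fst (x (snd p)) - fst (left_limit x (snd p)))"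
    "snd (fst p) = snd (left_limit x (snd p)) + \<theta> * (snd (x (snd p)) - snd (left_limit x (snd p)))"
    using x p by (rule completed_graphE)
  have L: "\<bar>fst (left_limit x t) - fst (left_limit y t)\<bar> \<le> e" "\<bar>snd (left_limit x t) - snd (left_limit y t)\<bar> \<le> e"
  proof -
    have "\<bar>fst (left_limit x t) - fst (left_limit y t)\<bar> \<le> e \<and> \<bar>snd (left_limit x t) - snd (left_limit y t)\<bar> \<le> e"
    proof (cases "t = 0")
      case False
      have lim: "(x \<longlongrightarrow> left_limit x t) (at_left t)" "(y \<longlongrightarrow> left_limit y t) (at_left t)"
        using x y t False by (auto intro!: left_limit_tendsto simp: monotone_path_def)
      have ev: "\<forall>\<^sub>F r in at_left t. r \<in> {0<..<t}"
        using eventually_at_left_real[of 0 t] t False by simp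
      have "\<forall>\<^sub>F r in at_left t. \<bar>fst (x r) - fst (y r)\<bar> \<le> e" "\<forall>\<^sub>F r in at_left t. \<bar>snd (x r) - snd (y r)\<bar> \<le> e"
        by (rule eventually_mono[OF ev], use close t in force)+
      from tendsto_upperbound[OF tendsto_rabs[OF tendsto_diff[OF tendsto_fst[OF lim(1)] tendsto_fst[OF lim(2)]]] this(1)]
        tendsto_upperbound[OF tendsto_rabs[OF tendsto_diff[OF tendsto_snd[OF lim(1)] tendsto_snd[OF lim(2)]]] this(2)]
      show ?thesis by simp
    qed (use left_limit_0[OF x] left_limit_0[OF y] e in simp)
    then show "\<bar>fst (left_limit x t) - fst (left_limit y t)\<bar> \<le> e" "\<bar>snd (left_limit x t) - snd (left_limit y t)\<bar> \<le> e"
      by auto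
  qed
  have mix: "\<bar>(a + \<theta> * (b - a)) - (a' + \<theta> * (b' - a'))\<bar> \<le> e" if "\<bar>a - a'\<bar> \<le> e" "\<bar>b - b'\<bar> \<le> e" for a a' b b'
  proof -
    have "(a + \<theta> * (b - a)) - (a' + \<theta> * (b' - a')) = (1 - \<theta>) * (a - a') + \<theta> * (b - b')"
      by (simp add: algebra_simps)
    also have "\<bar>\<dots>\<bar> \<le> (1 - \<theta>) * \<bar>a - a'\<bar> + \<theta> * \<bar>b - b'\<bar>"
      using \<theta> by (intro order_trans[OF abs_triangle_ineq]) (simp add: abs_mult)
    also have "\<dots> \<le> (1 - \<theta>) * e + \<theta> * e"
      using \<theta> that by (intro add_mono mult_left_mono) auto
    finally show ?thesis by (simp add: algebra_simps)
  qed
  let ?q = "((1 - \<theta>) *\<^sub>R left_limit y t + \<theta> *\<^sub>R y t, t)"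
  have "?q \<in> completed_graph T y"
    using \<theta> t by (auto simp: completed_graph_def closed_segment_def)
  moreover have "fst (fst ?q) = fst (left_limit y t) + \<theta> * (fst (y t) - fst (left_limit y t))"
    "snd (fst ?q) = snd (left_limit y t) + \<theta> * (snd (y t) - snd (left_limit y t))"
    by (simp_all add: left_diff_distrib right_diff_distrib)
  ultimately show "\<exists>q\<in>completed_graph T y. \<bar>fst (fst p) - fst (fst q)\<bar> \<le> e \<and> \<bar>snd (fst p) - snd (fst q)\<bar> \<le> e
      \<and> \<bar>snd p - snd q\<bar> \<le> e"
    using \<theta>(4,5)[folded t_def] mix[OF L(1), of "fst (x t)" "fst (y t)"] mix[OF L(2), of "snd (x t)" "snd (y t)"]
      close[OF t] e by (intro bexI[of _ ?q]) (simp_all add: t_def)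
qed

text \<open>Besides adjacent cells, cells at distance close to \<open>m\<close> must not both carry a jump, because the
  delayed coordinate jumps one time unit later.\<close>

definition well_separated :: "nat \<Rightarrow> nat \<Rightarrow> (nat \<Rightarrow> nat) \<Rightarrow> bool" where
  "well_separated m n d \<longleftrightarrow> (\<forall>i j. i < j \<longrightarrow> j < n \<longrightarrow> d i \<noteq> 0 \<longrightarrow> d j \<noteq> 0 \<longrightarrow>
     i + 2 < j \<and> (j + 2 < i + m \<or> i + m + 2 < j))"

lemma well_separatedD:
  assumes "well_separated m n d" "i < j" "j < n" "d i \<noteq> 0" "d j \<noteq> 0"
  shows "i + 2 < j" "j + 2 < i + m \<or> i + m + 2 < j"
  using assms unfolding well_separated_def by auto

text \<open>A criterion meant for both processes. The lower bound adds a marked jump to the height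
  slightly more than one time unit earlier; the upper bound traces a height back to an earlier one.
  The slack of one cell in the lags is harmless because, by separation, the cells it could include
  or omit carry no jump. The error \<open>e\<close> occurs only in the upper bound, once per step
  back of at least half a time unit, which gives the factor
  \<open>2 * (real n / m) + 1\<close>.\<close>

lemma near_staircaseI:
  fixes x :: "real \<Rightarrow> real"
  assumes m: "3 \<le> m" and \<delta>: "0 \<le> \<delta>" and e: "0 \<le> e"
    and x0: "\<And>t. t \<le> 0 \<Longrightarrow> x t = 0" and mono: "mono x"
    and s: "\<And>i. i < n \<Longrightarrow> s i \<in> {real i / m<..real (Suc i) / m}"
    and sep: "well_separated m n d"
    and lower: "\<And>i. i < n \<Longrightarrow> d i \<noteq> 0 \<Longrightarrow> x (s i - 1 - 1 / m) + \<delta> * d i \<le> x (s i)"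
    and upper: "\<And>t. 0 < t \<Longrightarrow> t \<le> real n / m \<Longrightarrow> x t \<le> x (t - 1/2) + e \<or>
      (\<exists>i<n. d i \<noteq> 0 \<and> s i \<le> t \<and> x t \<le> x (s i - 1 + 1 / m) + \<delta> * d i + e)"
  shows "near_staircase m n d \<delta> ((2 * (real n / m) + 1) * e) x"
proof -
  have m0: "0 < real m" using m by simp
  have xnn: "0 \<le> x t" for t
    using monoD[OF mono, of "min t 0" t] x0[of "min t 0"] by simp
  have hm: "real (heights m d k) \<le> real (heights m d l)" if "k \<le> l" for k l
    using monoD[OF mono_heights that] by simp
  \<comment> \<open>The lower bound holds without error, provided that the marked jumps of the first
    \<open>k\<close> cells have occurred by time \<open>t\<close>.\<close>
  have low: "\<delta> * heights m d k \<le> x t" if "k \<le> n" "\<And>i. i < k \<Longrightarrow> d i \<noteq> 0 \<Longrightarrow> s i \<le> t" for k t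
    using that
  proof (induction k arbitrary: t rule: less_induct)
    case (less k)
    show ?case
    proof (cases k)
      case 0
      then show ?thesis using xnn by simp
    next
      case (Suc j)
      have IHj: "\<delta> * heights m d j \<le> x t"
        using less.IH[of j t] less.prems Suc by simp
      show ?thesis
      proof (cases "d j = 0")
        case True
        then show ?thesis using IHj Suc by simp
      next
        case False
        have jn: "j < n" using less.prems Suc by simp
        have "\<delta> * heights m d (j - (m - 1)) \<le> x (s j - 1 - 1 / m)"
        proof (rule less.IH)
          fix i assume i: "i < j - (m - 1)" "d i \<noteq> 0"
          then have "i + m + 2 < j"
            using well_separatedD[OF sep, of i j] False jn m by force
          then have "real (Suc i) / m \<le> (real j - real m - 1) / m"
            by (intro divide_right_mono) auto
          also have "\<dots> = real j / m - 1 - 1 / m"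
            using m0 by (simp add: diff_divide_distrib)
          finally have "real (Suc i) / m \<le> real j / m - 1 - 1 / m" .
          moreover have "s i \<le> real (Suc i) / m"
            using s[of i] i jn by auto
          moreover have "real j / m < s j"
            using s[OF jn] by simp
          ultimately show "s i \<le> s j - 1 - 1 / m"
            by linarith
        qed (use Suc m jn in auto)
        then have "\<delta> * (heights m d (j - (m - 1)) + d j) \<le> x (s j)"
          using lower[OF jn False] by (simp add: distrib_left)
        also have "\<dots> \<le> x t"
          using less.prems(2)[of j] Suc False by (intro monoD[OF mono]) simp
        finally show ?thesis
          using IHj Suc False by (simp add: max_def)
      qed
    qed
  qed
  \<comment> \<open>Here \<open>j\<close> counts half time units: each step back costs
    \<open>e\<close> and goes back by at least one half, and up to time 0 the path vanishes.\<close>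
  have up: "x t \<le> \<delta> * heights m d k + real j * e"
    if "t \<le> real n / m" "t \<le> real j / 2" "k \<le> n" "\<And>i. k \<le> i \<Longrightarrow> i < n \<Longrightarrow> d i \<noteq> 0 \<Longrightarrow> t < s i" for j t k
    using that
  proof (induction j arbitrary: t k)
    case 0
    then show ?case using x0[of t] \<delta> by simp
  next
    case (Suc j)
    show ?case
    proof (cases "t \<le> 0")
      case True
      then show ?thesis using x0[of t] \<delta> e by simp
    next
      case False
      from upper[of t] False Suc.prems(1) consider "x t \<le> x (t - 1/2) + e"
        | i where "i < n" "d i \<noteq> 0" "s i \<le> t" "x t \<le> x (s i - 1 + 1 / m) + \<delta> * d i + e"
        by auto
      then show ?thesis
      proof cases
        case 1
        have "x (t - 1/2) \<le> \<delta> * heights m d k + real j * e"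
          by (rule Suc.IH) (use Suc.prems in \<open>force+\<close>)
        then show ?thesis
          using 1 by (simp add: distrib_right)
      next
        case 2
        have ik: "i < k"
          using Suc.prems(4)[of i] 2 by (meson not_le)
        \<comment> \<open>So the lag \<open>1 - 1 / m\<close> is at least one half.\<close>
        have m2: "1 / real m \<le> 1/2"
          using m by (simp add: divide_le_eq)
        have "x (s i - 1 + 1 / m) \<le> \<delta> * heights m d (i - (m - 1)) + real j * e"
        proof (rule Suc.IH)
          show "s i - 1 + 1 / m \<le> real n / m" "s i - 1 + 1 / m \<le> real j / 2"
            using 2(3) Suc.prems(1,2) m2 by auto
          show "i - (m - 1) \<le> n" using 2(1) by simp
          fix l assume l: "i - (m - 1) \<le> l" "l < n" "d l \<noteq> 0"
          \<comment> \<open>Separation forbids a jump cell about \<open>m\<close> cells before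
            \<open>i\<close>. This improves \<open>i - (m - 1) \<le> l\<close> by the two cells
            needed for the lagged time to precede cell \<open>l\<close>.\<close>
          have "i + 3 \<le> l + m"
          proof (cases l i rule: linorder_cases)
            case less
            then show ?thesis
              using well_separatedD[OF sep less 2(1) l(3) 2(2)] l(1) m by linarith
          qed (use m in auto)
          then have "(real i + 2 - m) / m < real l / m"
            using m0 by (intro divide_strict_right_mono) auto
          moreover have "s i - 1 + 1 / m \<le> (real i + 2 - m) / m"
            using s[OF 2(1)] m0 by (simp add: add_divide_distrib diff_divide_distrib)
          ultimately show "s i - 1 + 1 / m < s l"
            using s[OF l(2)] by simp
        qed
        then have "x t \<le> \<delta> * (heights m d (i - (m - 1)) + d i) + real (Suc j) * e"
          using 2(4) by (simp add: distrib_left distrib_right)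
        also have "\<dots> \<le> \<delta> * heights m d (Suc i) + real (Suc j) * e"
          using 2(2) \<delta> by (intro add_right_mono mult_left_mono) auto
        also have "\<dots> \<le> \<delta> * heights m d k + real (Suc j) * e"
          using \<delta> hm[of "Suc i" k] ik by (intro add_right_mono mult_left_mono) (auto simp del: heights.simps)
        finally show ?thesis .
      qed
    qed
  qed
  show ?thesis
    unfolding near_staircase_def
  proof (intro conjI exI[of _ s] allI impI ballI s)
    show "x 0 = 0" using x0[of 0] by simp
    show "mono_on {0..} x" using mono by (auto simp: mono_on_def mono_def)
    fix i t assume i: "i < n" and t: "t \<in> {real i / m<..real (Suc i) / m}"
    define k where "k = (if s i \<le> t then Suc i else i)"
    have k: "k \<le> n" using i by (auto simp: k_def)
    have below: "s j \<le> t" if "j < k" for j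
    proof (cases "j = i")
      case True
      then show ?thesis using that by (auto simp: k_def split: if_splits)
    next
      case False
      then have "j < i" using that by (auto simp: k_def split: if_splits)
      then have "real (Suc j) / m \<le> real i / m"
        by (intro divide_right_mono) auto
      then show ?thesis
        using s[of j] \<open>j < i\<close> i t by auto
    qed
    have above: "t < s j" if "k \<le> j" "j < n" for j
    proof (cases "j = i")
      case True
      then show ?thesis using that by (auto simp: k_def split: if_splits)
    next
      case False
      then have "i < j" using that by (auto simp: k_def split: if_splits)
      then have "real (Suc i) / m \<le> real j / m"
        by (intro divide_right_mono) auto
      then show ?thesis
        using s[of j] that t by auto
    qed
    have "real (Suc i) / m \<le> real n / m"
      using i by (intro divide_right_mono) auto
    then have tn: "t \<le> real n / m" using t by auto
    define j where "j = nat \<lceil>2 * (real n / m)\<rceil>"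
    have j: "2 * (real n / m) \<le> real j" "real j \<le> 2 * (real n / m) + 1"
      using m0 by (auto simp: j_def)
    have "x t \<le> \<delta> * heights m d k + real j * e"
      by (rule up) (use tn j k above in auto)
    also have "\<dots> \<le> \<delta> * heights m d k + (2 * (real n / m) + 1) * e"
      using j e by (intro add_left_mono mult_right_mono) auto
    finally have "x t \<le> \<delta> * heights m d k + (2 * (real n / m) + 1) * e" .
    moreover have "\<delta> * heights m d k \<le> x t"
      by (rule low) (use k below in auto)
    moreover have "0 \<le> (2 * (real n / m) + 1) * e"
      using e m0 by simp
    ultimately show "\<bar>x t - \<delta> * heights m d (if s i \<le> t then Suc i else i)\<bar> \<le> (2 * (real n / m) + 1) * e"
      unfolding k_def[symmetric] by linarith
  qed
qed

text \<open>The delay of one time unit is imposed only up to one cell in either direction, which is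
  how closely the last particle is known to follow the leader; \<open>max 0\<close> keeps the
  arguments in the domain of the paths.\<close>

definition near_staircase_pair ::
    "nat \<Rightarrow> nat \<Rightarrow> (nat \<Rightarrow> nat) \<Rightarrow> real \<Rightarrow> real \<Rightarrow> (real \<Rightarrow> real \<times> real) \<Rightarrow> bool" where
  "near_staircase_pair m n d \<delta> \<epsilon> z \<longleftrightarrow> monotone_path z \<and> near_staircase m n d \<delta> \<epsilon> (\<lambda>t. fst (z t)) \<and>
     (\<forall>t\<in>{0..real n / m}. fst (z (max 0 (t - 1 - 1 / m))) \<le> snd (z t) \<and>
        snd (z t) \<le> fst (z (max 0 (t - 1 + 1 / m))) + \<epsilon>)"

text \<open>The heights at \<open>k - (m + 1)\<close> and \<open>k + 1 - m\<close> differ only by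
  the jumps of two cells, at distances \<open>m + 1\<close> and \<open>m\<close> before
  \<open>k\<close>. The assumption on \<open>k\<close> says that neither carries a jump, so both
  sides of the sandwich have the same height.\<close>

lemma near_staircase_pair_grid:
  assumes z: "near_staircase_pair m n d \<delta> \<epsilon> z" and m: "1 \<le> m" and \<epsilon>: "0 \<le> \<epsilon>" and k: "k \<le> n"
    and good: "\<And>f. f < n \<Longrightarrow> d f \<noteq> 0 \<Longrightarrow> k \<noteq> f + m \<and> k \<noteq> f + m + 1"
  shows "\<delta> * heights m d (k + 1 - m) - \<epsilon> \<le> snd (z (real k / m))"
    "snd (z (real k / m)) \<le> \<delta> * heights m d (k + 1 - m) + 2 * \<epsilon>"
    "heights m d (k + 1 - m) = heights m d (k - (m + 1))"
proof -
  have m0: "0 < real m" using m by simp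
  have st: "near_staircase m n d \<delta> \<epsilon> (\<lambda>t. fst (z t))"
    using z by (simp add: near_staircase_pair_def)
  have 1: "max 0 (real k / m - 1 - 1 / m) = real (k - (m + 1)) / m"
  proof (cases "m + 1 \<le> k")
    case True
    then have "real (k - (m + 1)) / m = real k / m - 1 - 1 / m"
      using m0 by (simp add: of_nat_diff diff_divide_distrib add_divide_distrib)
    moreover have "0 \<le> real (k - (m + 1)) / m"
      by simp
    ultimately show ?thesis
      by linarith
  next
    case False
    then have "real k / m \<le> (real m + 1) / m"
      by (intro divide_right_mono) auto
    also have "\<dots> = 1 + 1 / m"
      using m0 by (simp add: add_divide_distrib)
    finally show ?thesis
      using False by simp
  qed
  have 2: "max 0 (real k / m - 1 + 1 / m) = real (k + 1 - m) / m"
  proof (cases "m \<le> k + 1")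
    case True
    then have "real (k + 1 - m) = real k + 1 - real m"
      by linarith
    then have "real (k + 1 - m) / m = real k / m - 1 + 1 / m"
      using m0 by (simp add: diff_divide_distrib add_divide_distrib)
    moreover have "0 \<le> real (k + 1 - m) / m"
      by simp
    ultimately show ?thesis
      by linarith
  next
    case False
    then have "(real k + 1) / m \<le> m / m"
      by (intro divide_right_mono) auto
    also have "\<dots> = 1"
      using m0 by simp
    finally have "real k / m - 1 + 1 / m \<le> 0"
      by (simp add: add_divide_distrib)
    then show ?thesis
      using False by simp
  qed
  show eq: "heights m d (k + 1 - m) = heights m d (k - (m + 1))"
  proof -
    have flat: "d f = 0" if "f < n" "k = f + m \<or> k = f + m + 1" for f
      using good[OF that(1)] that(2) by auto
    consider "k + 1 \<le> m" | "k = m" | f where "k = f + m + 1"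
      by atomize_elim presburger
    then show ?thesis
    proof cases
      case 2
      then have "d 0 = 0"
        using flat[of 0] k m by auto
      then show ?thesis
        using 2 by simp
    next
      case (3 f)
      then have "d f = 0" "d (Suc f) = 0"
        using flat[of f] flat[of "Suc f"] k m by auto
      then show ?thesis
        using 3 by simp
    qed simp
  qed
  have kn: "real k / m \<in> {0..real n / m}"
    using k by (auto intro!: divide_right_mono)
  have b: "fst (z (real (k - (m + 1)) / m)) \<le> snd (z (real k / m))"
      "snd (z (real k / m)) \<le> fst (z (real (k + 1 - m) / m)) + \<epsilon>"
    using z kn unfolding near_staircase_pair_def 1[symmetric] 2[symmetric] by auto
  have g: "\<bar>fst (z (real (k - (m + 1)) / m)) - \<delta> * heights m d (k - (m + 1))\<bar> \<le> \<epsilon>"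
      "\<bar>fst (z (real (k + 1 - m) / m)) - \<delta> * heights m d (k + 1 - m)\<bar> \<le> \<epsilon>"
    using k m \<epsilon> by (auto intro!: near_staircase_grid[OF st] simp del: of_nat_diff)
  show "\<delta> * heights m d (k + 1 - m) - \<epsilon> \<le> snd (z (real k / m))"
    using b(1) g(1) unfolding eq by linarith
  show "snd (z (real k / m)) \<le> \<delta> * heights m d (k + 1 - m) + 2 * \<epsilon>"
    using b(2) g(2) by linarith
qed

text \<open>Near the delayed copy of a jump in cell \<open>f\<close> the window consists of the
  cells from \<open>f + m - 1\<close> to \<open>f + m + 1\<close>, on which the first coordinate is
  almost constant by separation. Elsewhere it is the single cell of \<open>t\<close>, on which the
  second coordinate is almost constant. A window reaching beyond \<open>T\<close> is cut at
  \<open>T\<close>, where the modulus \<open>\<omega>\<close> of \<open>y\<close> takes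
  over.\<close>

lemma SM1_dist_near_staircase_pair:
  assumes x: "near_staircase_pair m n d \<delta> \<epsilon> x" and y: "near_staircase_pair m n d \<delta> \<epsilon> y"
    and m3: "3 \<le> m" and \<delta>: "0 \<le> \<delta>" and sep: "well_separated m n d"
    and e: "3 / m \<le> e" "3 * \<epsilon> + \<omega> \<le> e" and \<epsilon>: "0 \<le> \<epsilon>"
    and T: "0 \<le> T" "T * m + 3 \<le> real n"
    and \<omega>: "\<And>t u. 0 \<le> t \<Longrightarrow> t \<le> u \<Longrightarrow> T - 3 / m \<le> t \<Longrightarrow> u \<le> T + 3 / m \<Longrightarrow>
      fst (y u) - fst (y t) \<le> \<omega> \<and> snd (y u) - snd (y t) \<le> \<omega>"
  shows "SM1_dist T x y \<le> 24 * e"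
proof -
  have m: "1 \<le> m" and m0: "0 < real m" using m3 by simp_all
  have px: "monotone_path x" and py: "monotone_path y"
      and sx: "near_staircase m n d \<delta> \<epsilon> (\<lambda>t. fst (x t))" and sy: "near_staircase m n d \<delta> \<epsilon> (\<lambda>t. fst (y t))"
    using x y by (simp_all add: near_staircase_pair_def)
  have \<omega>0: "0 \<le> \<omega>"
    using \<omega>[of T T] T m0 by auto
  define good where "good k \<longleftrightarrow> (\<forall>f<n. d f \<noteq> 0 \<longrightarrow> k \<noteq> f + m \<and> k \<noteq> f + m + 1)" for k
  have gr1: "\<bar>fst (x (real k / m)) - fst (y (real k / m))\<bar> \<le> 2 * \<epsilon>" if "k \<le> n" for k
    using near_staircase_grid[OF sx that] near_staircase_grid[OF sy that] m \<epsilon> by linarith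
  have gr2: "\<bar>snd (x (real k / m)) - snd (y (real k / m))\<bar> \<le> 3 * \<epsilon>" if "k \<le> n" "good k" for k
    using near_staircase_pair_grid(1,2)[OF x m \<epsilon> that(1)] near_staircase_pair_grid(1,2)[OF y m \<epsilon> that(1)] that(2)
    unfolding good_def by (smt (verit))
  show ?thesis
  proof (rule SM1_dist_le_windows[OF px py T(1)])
    show "0 \<le> e" using e \<epsilon> \<omega>0 by linarith
    fix t assume t: "0 < t" "t \<le> T"
    have grid: "\<exists>a b. 0 \<le> a \<and> a < t \<and> t \<le> b \<and> b \<le> T \<and> b - a \<le> e \<and>
      \<bar>fst (x a) - fst (y a)\<bar> \<le> e \<and> \<bar>snd (x a) - snd (y a)\<bar> \<le> e \<and>
      \<bar>fst (x b) - fst (y b)\<bar> \<le> e \<and> \<bar>snd (x b) - snd (y b)\<bar> \<le> e \<and>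
      (fst (y b) - fst (y a) \<le> e \<or> snd (y b) - snd (y a) \<le> e)"
      if k: "real k / m < t" "t \<le> real l / m" "l \<le> k + 3" "good k" "good l"
        and still: "fst (y (real l / m)) - fst (y (real k / m)) \<le> 3 * \<epsilon> \<or> snd (y (real l / m)) - snd (y (real k / m)) \<le> 3 * \<epsilon>"
      for k l
    proof -
      let ?a = "real k / m" and ?b = "real l / m"
      have kT: "real k < T * m"
        using k(1) t(2) m0 by (simp add: pos_divide_less_eq) (meson less_le_trans mult_right_mono m0 less_imp_le)
      have n: "k \<le> n" "l \<le> n"
        using kT k(3) T(2) by linarith+
      have ab: "0 \<le> ?a" "?a \<le> ?b" "?b - ?a \<le> 3 / m"
        using k m0 by (auto simp: diff_divide_distrib[symmetric] intro!: divide_right_mono)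
      show ?thesis
      proof (cases "?b \<le> T")
        case True
        then show ?thesis
          using ab k still gr1[OF n(1)] gr1[OF n(2)] gr2[OF n(1) k(4)] gr2[OF n(2) k(5)] e \<epsilon> \<omega>0
          by (intro exI[of _ ?a] exI[of _ ?b] conjI) linarith+
      next
        case False
        have w: "fst (y ?b) - fst (y ?a) \<le> \<omega>" "snd (y ?b) - snd (y ?a) \<le> \<omega>"
          using \<omega>[of ?a ?b] ab False k t by auto
        have mx: "fst (x ?a) \<le> fst (x T)" "snd (x ?a) \<le> snd (x T)" "fst (x T) \<le> fst (x ?b)" "snd (x T) \<le> snd (x ?b)"
          using monotone_path_mono[OF px ab(1), of T] monotone_path_mono[OF px T(1), of ?b] k t False by auto
        have my: "fst (y ?a) \<le> fst (y T)" "snd (y ?a) \<le> snd (y T)" "fst (y T) \<le> fst (y ?b)" "snd (y T) \<le> snd (y ?b)"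
          using monotone_path_mono[OF py ab(1), of T] monotone_path_mono[OF py T(1), of ?b] k t False by auto
        show ?thesis
          using ab k t w mx my False gr1[OF n(1)] gr1[OF n(2)] gr2[OF n(1) k(4)] gr2[OF n(2) k(5)] e \<epsilon> \<omega>0
          by (intro exI[of _ ?a] exI[of _ T] conjI) linarith+
      qed
    qed
    define i where "i = nat (\<lceil>t * m\<rceil> - 1)"
    have "0 < t * m" using t m0 by simp
    then have "1 \<le> \<lceil>t * m\<rceil>" by linarith
    then have "real i = of_int \<lceil>t * m\<rceil> - 1"
      by (simp add: i_def)
    then have "real i < t * m" "t * m \<le> real (Suc i)"
      by linarith+
    then have i: "real i / m < t" "t \<le> real (Suc i) / m"
      using m0 by (simp_all add: pos_divide_less_eq pos_le_divide_eq)
    have iT: "real i < T * m"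
      using \<open>real i < t * m\<close> mult_right_mono[OF t(2), of "real m"] by simp
    show "\<exists>a b. 0 \<le> a \<and> a < t \<and> t \<le> b \<and> b \<le> T \<and> b - a \<le> e \<and>
      \<bar>fst (x a) - fst (y a)\<bar> \<le> e \<and> \<bar>snd (x a) - snd (y a)\<bar> \<le> e \<and>
      \<bar>fst (x b) - fst (y b)\<bar> \<le> e \<and> \<bar>snd (x b) - snd (y b)\<bar> \<le> e \<and>
      (fst (y b) - fst (y a) \<le> e \<or> snd (y b) - snd (y a) \<le> e)"
    proof (cases "\<exists>f<n. d f \<noteq> 0 \<and> f + m \<le> i + 1 \<and> i \<le> f + m + 1")
      case True
      then obtain f where f: "f < n" "d f \<noteq> 0" "f + m \<le> i + 1" "i \<le> f + m + 1"
        by blast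
      have fn: "f + m + 2 \<le> n"
        using f iT T(2) by linarith
      have flat: "d j = 0" if "j \<in> {f + m - 1, f + m, f + m + 1}" for j
      proof (rule ccontr)
        assume "d j \<noteq> 0"
        moreover have "j < n" using that fn m by auto
        moreover have "f < j" using that m3 by auto
        ultimately show False
          using well_separatedD(2)[OF sep, of f j] f that by auto
      qed
      have g: "good (f + m - 1)" "good (f + m + 2)"
      proof -
        have "f' = f" if "f' < n" "d f' \<noteq> 0" "f' \<le> f + 2" "f \<le> f' + 2" for f'
          using well_separatedD(1)[OF sep, of f f'] well_separatedD(1)[OF sep, of f' f] that f
          by (cases f f' rule: linorder_cases) auto
        then show "good (f + m - 1)" "good (f + m + 2)"
          unfolding good_def using m by fastforce+
      qed
      define g where "g = f + m - 1"
      have fg: "f + m = Suc g" "f + m - 1 = g"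
        using m by (auto simp: g_def)
      have eq: "heights m d (f + m + 2) = heights m d (f + m - 1)"
        using flat unfolding fg by simp
      have "\<bar>fst (y (real (f + m + 2) / m)) - \<delta> * heights m d (f + m + 2)\<bar> \<le> \<epsilon>"
        by (rule near_staircase_grid[OF sy fn]) (use m \<epsilon> in auto)
      moreover have "\<bar>fst (y (real (f + m - 1) / m)) - \<delta> * heights m d (f + m - 1)\<bar> \<le> \<epsilon>"
        by (rule near_staircase_grid[OF sy]) (use fn m \<epsilon> in auto)
      ultimately have "fst (y (real (f + m + 2) / m)) - fst (y (real (f + m - 1) / m)) \<le> 2 * \<epsilon>"
        unfolding eq by linarith
      moreover have "real (f + m - 1) / m < t"
        by (rule le_less_trans[OF _ i(1)]) (use f m in \<open>auto intro!: divide_right_mono\<close>)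
      moreover have "t \<le> real (f + m + 2) / m"
        by (rule order_trans[OF i(2)]) (use f m in \<open>auto intro!: divide_right_mono\<close>)
      ultimately show ?thesis
        using g \<epsilon> by (intro grid[of "f + m - 1" "f + m + 2"]) auto
    next
      case False
      have g: "good i" "good (Suc i)"
        unfolding good_def using False by fastforce+
      have n: "i \<le> n" "Suc i \<le> n"
        using iT T(2) by linarith+
      have "heights m d (Suc i + 1 - m) = heights m d (i - m)"
        using near_staircase_pair_grid(3)[OF y m \<epsilon> n(2)] g(2) unfolding good_def by auto
      moreover have "heights m d (i - m) \<le> heights m d (i + 1 - m)"
        by (intro monoD[OF mono_heights]) simp
      ultimately have "\<delta> * heights m d (Suc i + 1 - m) \<le> \<delta> * heights m d (i + 1 - m)"
        using \<delta> by (intro mult_left_mono) auto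
      moreover have "snd (y (real (Suc i) / m)) \<le> \<delta> * heights m d (Suc i + 1 - m) + 2 * \<epsilon>"
        using g(2) by (intro near_staircase_pair_grid(2)[OF y m \<epsilon> n(2)]) (simp add: good_def)
      moreover have "\<delta> * heights m d (i + 1 - m) - \<epsilon> \<le> snd (y (real i / m))"
        using g(1) by (intro near_staircase_pair_grid(1)[OF y m \<epsilon> n(1)]) (simp add: good_def)
      ultimately have "snd (y (real (Suc i) / m)) - snd (y (real i / m)) \<le> 3 * \<epsilon>"
        by linarith
      then show ?thesis
        using g i by (intro grid[of i "Suc i"]) auto
    qed
  qed
qed

section \<open>Heavy tails\<close>

locale heavy_tail =
  fixes h :: "real \<Rightarrow> real" and \<alpha> :: real
  assumes \<alpha>: "0 < \<alpha>"
    and h_pos: "0 \<le> x \<Longrightarrow> 0 < h x"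
    and h_mono: "0 \<le> x \<Longrightarrow> x \<le> y \<Longrightarrow> h x \<le> h y"
    and h_at_top: "filterlim h at_top at_top"
    and h_RV: "0 < u \<Longrightarrow> ((\<lambda>x. h (u * x) / h x) \<longlongrightarrow> u powr \<alpha>) at_top"
begin

text \<open>A coarse form of Potter's bound. Regular variation at the single factor 2 gives
  \<open>h (2 * x) \<le> 2 powr (\<alpha> + 1) * h x\<close> for large \<open>x\<close>; iteration
  covers the powers of 2, and monotonicity the factors between them at the cost of a
  constant.\<close>

lemma potter_bound:
  obtains C x0 where "0 < C" "0 < x0"
    "\<And>x u. x0 \<le> x \<Longrightarrow> 1 \<le> u \<Longrightarrow> h (u * x) \<le> C * u powr (\<alpha> + 1) * h x"
proof -
  have "(2::real) powr \<alpha> < 2 powr (\<alpha> + 1)"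
    by (intro powr_less_mono) auto
  then have "\<forall>\<^sub>F x in at_top. h (2 * x) / h x < 2 powr (\<alpha> + 1)"
    using order_tendstoD(2)[OF h_RV[of 2]] by simp
  then obtain x1 where x1: "\<And>x. x1 \<le> x \<Longrightarrow> h (2 * x) / h x < 2 powr (\<alpha> + 1)"
    by (auto simp: eventually_at_top_linorder)
  define x0 where "x0 = max x1 1"
  have x0: "0 < x0" "x1 \<le> x0"
    by (auto simp: x0_def)
  have step: "h (2 * x) \<le> 2 powr (\<alpha> + 1) * h x" if "x0 \<le> x" for x
    using x1[of x] h_pos[of x] that x0 by (simp add: pos_divide_less_eq)
  have iter: "h (2 ^ k * x) \<le> (2 ^ k) powr (\<alpha> + 1) * h x" if "x0 \<le> x" for x k
  proof (induction k)
    case (Suc k)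
    have "x0 \<le> 2 ^ k * x"
      using that x0 mult_right_mono[of 1 "2 ^ k" x] one_le_power[of "2::real" k] by linarith
    then have "h (2 ^ Suc k * x) \<le> 2 powr (\<alpha> + 1) * h (2 ^ k * x)"
      using step[of "2 ^ k * x"] by (simp add: mult.assoc)
    also have "\<dots> \<le> 2 powr (\<alpha> + 1) * ((2 ^ k) powr (\<alpha> + 1) * h x)"
      using Suc.IH by (intro mult_left_mono) auto
    also have "\<dots> = (2 ^ Suc k) powr (\<alpha> + 1) * h x"
      by (simp add: powr_mult)
    finally show ?case .
  qed simp
  show thesis
  proof (rule that[of "2 powr (\<alpha> + 1)" x0])
    fix x u :: real assume x: "x0 \<le> x" and u: "1 \<le> u"
    define k where "k = nat \<lceil>log 2 u\<rceil>"
    have "0 \<le> log 2 u"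
      using u by simp
    then have "log 2 u \<le> real k" "real k \<le> log 2 u + 1"
      by (auto simp: k_def)
    then have "2 powr (log 2 u) \<le> 2 powr (real k)" "2 powr (real k) \<le> 2 powr (log 2 u + 1)"
      by (auto intro!: powr_mono)
    then have k: "u \<le> 2 ^ k" "2 ^ k \<le> 2 * u"
      using u by (auto simp: powr_realpow powr_add mult.commute)
    have "h (u * x) \<le> h (2 ^ k * x)"
      using k u x x0 by (intro h_mono mult_right_mono) auto
    also have "\<dots> \<le> (2 ^ k) powr (\<alpha> + 1) * h x"
      by (rule iter[OF x])
    also have "\<dots> \<le> (2 * u) powr (\<alpha> + 1) * h x"
      using k \<alpha> h_pos[of x] x x0 by (intro mult_right_mono powr_mono2) auto
    finally show "h (u * x) \<le> 2 powr (\<alpha> + 1) * u powr (\<alpha> + 1) * h x"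
      using u by (simp add: powr_mult)
  qed (use x0 in auto)
qed

text \<open>The number of displacements drawn during one time unit, up to rounding.\<close>

definition level :: "nat \<Rightarrow> real" where "level N = 2 * real N * log 2 (real N)"

lemma level_at_top: "filterlim level at_top sequentially"
  unfolding level_def by real_asymp

lemma exceed_nonempty: "\<exists>x\<ge>0. y < h x"
proof -
  have "\<forall>\<^sub>F x in at_top. y < h x"
    using h_at_top by (simp add: filterlim_at_top_dense)
  then have "\<forall>\<^sub>F x in at_top. 0 \<le> x \<and> y < h x"
    using eventually_ge_at_top by (rule eventually_conj[rotated])
  then show ?thesis
    by (auto simp: eventually_at_top_linorder)
qed

text \<open>As \<open>h\<close> may jump, its value at the generalized inverse is not known; this
  lemma and \<open>h_le\<close> control the points strictly on either side.\<close>

lemma less_h: "0 \<le> x \<Longrightarrow> gen_inverse h y < x \<Longrightarrow> y < h x"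
proof -
  assume x: "0 \<le> x" "gen_inverse h y < x"
  then obtain z where "0 \<le> z" "y < h z" "z < x"
    using exceed_nonempty[of y] unfolding gen_inverse_def by (auto dest!: cInf_lessD[rotated])
  then show "y < h x"
    using h_mono[of z x] by simp
qed

lemma h_le: "0 \<le> x \<Longrightarrow> x < gen_inverse h y \<Longrightarrow> h x \<le> y"
proof (rule ccontr)
  assume x: "0 \<le> x" "x < gen_inverse h y" "\<not> h x \<le> y"
  then have "gen_inverse h y \<le> x"
    unfolding gen_inverse_def by (intro cInf_lower bdd_belowI[of _ 0]) auto
  then show False
    using x by simp
qed

lemma scaling_at_top: "filterlim (scaling h) at_top sequentially"
  unfolding filterlim_at_top
proof
  fix Z :: real
  have "\<forall>\<^sub>F N in sequentially. h (max Z 0) \<le> level N"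
    using level_at_top by (simp add: filterlim_at_top)
  then show "\<forall>\<^sub>F N in sequentially. Z \<le> scaling h N"
  proof eventually_elim
    case (elim N)
    show ?case
    proof (rule ccontr)
      assume "\<not> Z \<le> scaling h N"
      then have "level N < h (max Z 0)"
        using less_h[of "max Z 0" "level N"] by (auto simp: scaling_def level_def)
      then show False
        using elim by simp
    qed
  qed
qed

lemma h_ratio_scaling:
  assumes "0 < u" "0 < v"
  shows "(\<lambda>N. h (u * scaling h N) / h (v * scaling h N)) \<longlonglongrightarrow> (u / v) powr \<alpha>"
proof -
  have "(\<lambda>N. (h (u * scaling h N) / h (scaling h N)) / (h (v * scaling h N) / h (scaling h N)))
      \<longlonglongrightarrow> u powr \<alpha> / v powr \<alpha>"
    using assms by (intro tendsto_divide filterlim_compose[OF h_RV scaling_at_top]) auto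
  moreover have "\<forall>\<^sub>F N in sequentially. (h (u * scaling h N) / h (scaling h N)) / (h (v * scaling h N) / h (scaling h N))
      = h (u * scaling h N) / h (v * scaling h N)"
    using scaling_at_top[unfolded filterlim_at_top, rule_format, of 0]
    by eventually_elim (use h_pos in \<open>force simp: field_simps\<close>)
  ultimately show ?thesis
    using assms by (auto simp: powr_divide elim: Lim_transform_eventually)
qed

text \<open>For \<open>u < 1 < u'\<close>, \<open>level N\<close> lies between
  \<open>h (u * scaling h N)\<close> and \<open>h (u' * scaling h N)\<close>. After division by
  \<open>h (x * scaling h N)\<close> these bounds tend to \<open>(u / x) powr \<alpha>\<close> and
  \<open>(u' / x) powr \<alpha>\<close>, and \<open>u\<close>, \<open>u'\<close> may be taken close
  to 1.\<close>

lemma tail_limit: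
  assumes x: "0 < x"
  shows "(\<lambda>N. level N / h (x * scaling h N)) \<longlonglongrightarrow> x powr - \<alpha>"
proof -
  have pos: "\<forall>\<^sub>F N in sequentially. 0 < scaling h N"
    using scaling_at_top by (simp add: filterlim_at_top_dense)
  have lim: "((\<lambda>u. (u / x) powr \<alpha>) \<longlongrightarrow> (1 / x) powr \<alpha>) (at 1)"
    using x by (intro tendsto_intros) auto
  have eq: "(1 / x) powr \<alpha> = x powr - \<alpha>"
    using x by (simp add: powr_divide powr_minus_divide)
  show ?thesis
  proof (rule order_tendstoI)
    fix a assume "a < x powr - \<alpha>"
    then have "\<forall>\<^sub>F u in at_left 1. a < (u / x) powr \<alpha>"
      using lim unfolding eq filterlim_at_split by (auto dest: order_tendstoD(1))
    then have "\<forall>\<^sub>F u in at_left 1. a < (u / x) powr \<alpha> \<and> u \<in> {0<..<1::real}"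
      using eventually_at_left_real[of 0 "1::real"] by (intro eventually_conj) auto
    then obtain u where u: "a < (u / x) powr \<alpha>" "0 < u" "u < 1"
      using eventually_happens[of _ "at_left (1::real)"] by (auto simp: trivial_limit_at_left_real)
    have "\<forall>\<^sub>F N in sequentially. a < h (u * scaling h N) / h (x * scaling h N)"
      using h_ratio_scaling[OF u(2) x] u(1) by (rule order_tendstoD(1))
    then show "\<forall>\<^sub>F N in sequentially. a < level N / h (x * scaling h N)"
      using pos
    proof eventually_elim
      case (elim N)
      have "h (u * scaling h N) \<le> level N"
        using h_le[of "u * scaling h N" "level N"] u elim by (simp add: scaling_def level_def)
      then show ?case
        using elim h_pos[of "x * scaling h N"] x by (meson divide_right_mono less_le_trans less_imp_le mult_nonneg_nonneg)
    qed
  next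
    fix a assume "x powr - \<alpha> < a"
    then have "\<forall>\<^sub>F u in at_right 1. (u / x) powr \<alpha> < a"
      using lim unfolding eq filterlim_at_split by (auto dest: order_tendstoD(2))
    then have "\<forall>\<^sub>F u in at_right 1. (u / x) powr \<alpha> < a \<and> u \<in> {1<..<2::real}"
      using eventually_at_right_real[of 1 "2::real"] by (intro eventually_conj) auto
    then obtain u where u: "(u / x) powr \<alpha> < a" "1 < u"
      using eventually_happens[of _ "at_right (1::real)"] by (auto simp: trivial_limit_at_right_real)
    then have u0: "0 < u" by simp
    have "\<forall>\<^sub>F N in sequentially. h (u * scaling h N) / h (x * scaling h N) < a"
      using h_ratio_scaling[OF u0 x] u(1) by (rule order_tendstoD(2))
    then show "\<forall>\<^sub>F N in sequentially. level N / h (x * scaling h N) < a"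
      using pos
    proof eventually_elim
      case (elim N)
      have "level N < h (u * scaling h N)"
        using less_h[of "u * scaling h N" "level N"] u elim by (simp add: scaling_def level_def)
      then show ?case
        using elim h_pos[of "x * scaling h N"] x
        by (meson divide_right_mono le_less_trans less_imp_le mult_nonneg_nonneg)
    qed
  qed
qed

text \<open>Raised to the power \<open>\<alpha> + 1\<close>, the exponent of
  \<open>potter_bound\<close>, the factor of \<open>N\<close> becomes \<open>N powr (- 1/2)\<close>.
  This leaves \<open>h (cut N)\<close> at least of order \<open>N powr (1/2)\<close>.\<close>

definition cut :: "nat \<Rightarrow> real" where "cut N = scaling h N * real N powr (- 1 / (2 * (\<alpha> + 1)))"

text \<open>The two terms bound the exponential moment, with parameter
  \<open>K * ln N / scaling h N\<close>, of a displacement truncated at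
  \<open>\<delta> * scaling h N\<close>. Displacements up to \<open>cut N\<close> have a weight
  tending to 1; the others have a weight of at most \<open>N powr (1/4)\<close> and a probability of
  order at most \<open>N powr (- 1/2)\<close>.\<close>

lemma small_jumps_mgf_limit:
  assumes K: "0 \<le> K" "K * \<delta> \<le> 1/4"
  shows "(\<lambda>N. exp (K * ln (real N) * real N powr (- 1 / (2 * (\<alpha> + 1)))) + real N powr (K * \<delta>) / h (cut N)) \<longlonglongrightarrow> 1"
    and "\<forall>\<^sub>F N in sequentially. 0 \<le> cut N"
proof -
  obtain C x0 where C: "0 < C" "0 < x0"
    "\<And>x u. x0 \<le> x \<Longrightarrow> 1 \<le> u \<Longrightarrow> h (u * x) \<le> C * u powr (\<alpha> + 1) * h x"
    by (rule potter_bound) blast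
  define \<gamma> where "\<gamma> = 1 / (2 * (\<alpha> + 1))"
  have \<gamma>: "0 < \<gamma>" "\<gamma> * (\<alpha> + 1) = 1/2" "- 1 / (2 * (\<alpha> + 1)) = - \<gamma>"
    using \<alpha> by (auto simp: \<gamma>_def field_simps)
  have N1: "\<forall>\<^sub>F N in sequentially. (2::nat) \<le> N"
    by (rule eventually_ge_at_top)
  have big: "\<forall>\<^sub>F N in sequentially. max 1 x0 \<le> scaling h N"
    using scaling_at_top[unfolded filterlim_at_top] by blast
  have level_ge: "real N \<le> level N" if "2 \<le> N" for N
  proof -
    have "log 2 2 \<le> log 2 (real N)"
      using that by (subst log_le_cancel_iff) auto
    then have "real N * 1 \<le> real N * (2 * log 2 (real N))"
      by (intro mult_left_mono) auto
    then show ?thesis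
      by (simp add: level_def mult_ac)
  qed
  have less2: "level N < h (2 * scaling h N)" if "1 \<le> scaling h N" for N
    using less_h[of "2 * scaling h N" "level N"] that by (simp add: scaling_def level_def)
  define B where "B = C * (2 / x0) powr (\<alpha> + 1) * h x0"
  have B: "0 < B"
    using C h_pos[of x0] by (simp add: B_def)
  \<comment> \<open>Potter's bound from the fixed point \<open>x0\<close> shows that the scaling
    grows at least like \<open>N powr (1 / (\<alpha> + 1))\<close>. Hence \<open>cut N\<close>
    eventually exceeds \<open>x0\<close>, and the bound applies from \<open>cut N\<close> on as
    well.\<close>
  have grow: "real N \<le> B * scaling h N powr (\<alpha> + 1)" if N: "2 \<le> N" "max 1 x0 \<le> scaling h N" for N
  proof -
    have "real N \<le> h (2 * scaling h N)"
      using level_ge[OF N(1)] less2[of N] N(2) by simp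
    also have "2 * scaling h N = (2 * scaling h N / x0) * x0"
      using C by simp
    also have "h \<dots> \<le> C * (2 * scaling h N / x0) powr (\<alpha> + 1) * h x0"
      using C(2) N(2) by (intro C(3)) (auto simp: pos_le_divide_eq)
    also have "(2 * scaling h N / x0) powr (\<alpha> + 1) = (2 / x0) powr (\<alpha> + 1) * scaling h N powr (\<alpha> + 1)"
      using N(2) C(2) by (subst powr_mult[symmetric]) auto
    finally show ?thesis
      by (simp add: B_def mult_ac)
  qed
  have cut_large: "\<forall>\<^sub>F N in sequentially. x0 \<le> cut N"
  proof -
    have "\<forall>\<^sub>F N in sequentially. B * x0 powr (\<alpha> + 1) \<le> real N powr (1/2)"
      by (rule filterlim_at_top[THEN iffD1, rule_format]) real_asymp
    then show ?thesis
      using N1 big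
    proof eventually_elim
      case (elim N)
      have "cut N powr (\<alpha> + 1) = scaling h N powr (\<alpha> + 1) * real N powr (- (\<gamma> * (\<alpha> + 1)))"
        unfolding cut_def \<gamma>(3) using elim by (simp add: powr_mult powr_powr)
      also have "\<dots> = scaling h N powr (\<alpha> + 1) * real N powr (- 1/2)"
        unfolding \<gamma>(2) by simp
      also have "\<dots> \<ge> (real N / B) * real N powr (- 1/2)"
        using grow[OF elim(2,3)] B by (intro mult_right_mono) (auto simp: pos_divide_le_eq mult.commute)
      finally have "(real N / B) * real N powr (- 1/2) \<le> cut N powr (\<alpha> + 1)" .
      moreover have "real N * real N powr (- 1/2) = real N powr (1/2)"
        using elim by (simp add: powr_mult_base)
      ultimately have "real N powr (1/2) / B \<le> cut N powr (\<alpha> + 1)"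
        by simp
      then have le: "x0 powr (\<alpha> + 1) \<le> cut N powr (\<alpha> + 1)"
        using elim(1) B by (smt (verit) mult.commute pos_le_divide_eq)
      show ?case
      proof (rule ccontr)
        assume "\<not> x0 \<le> cut N"
        moreover have "0 \<le> cut N"
          using elim by (simp add: cut_def)
        ultimately show False
          using powr_less_mono2[of "\<alpha> + 1" "cut N" x0] \<alpha> le by simp
      qed
    qed
  qed
  then show "\<forall>\<^sub>F N in sequentially. 0 \<le> cut N"
    by eventually_elim (use C(2) in simp)
  have "(\<lambda>N. real N powr (K * \<delta>) / h (cut N)) \<longlonglongrightarrow> 0"
  proof (rule tendsto_sandwich)
    show "\<forall>\<^sub>F N in sequentially. 0 \<le> real N powr (K * \<delta>) / h (cut N)"
      using cut_large by eventually_elim (use C h_pos in \<open>force intro!: divide_nonneg_pos\<close>)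
    show "\<forall>\<^sub>F N in sequentially. real N powr (K * \<delta>) / h (cut N) \<le> C * 2 powr (\<alpha> + 1) * real N powr (- 1/4)"
      using cut_large N1 big
    proof eventually_elim
      case (elim N)
      have Npos: "0 < real N" using elim by simp
      have cutpos: "0 < h (cut N)"
        using elim C h_pos[of "cut N"] by simp
      have "1 \<le> real N powr \<gamma>"
        using elim \<gamma>(1) by (intro ge_one_powr_ge_zero) auto
      then have u: "1 \<le> 2 * real N powr \<gamma>" by simp
      have "2 * scaling h N = (2 * real N powr \<gamma>) * cut N"
        using Npos \<gamma>(3) by (simp add: cut_def powr_minus)
      then have "real N \<le> h ((2 * real N powr \<gamma>) * cut N)"
        using level_ge[of N] less2[of N] elim by (simp add: mult.assoc)
      also have "\<dots> \<le> C * (2 * real N powr \<gamma>) powr (\<alpha> + 1) * h (cut N)"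
        by (rule C(3)[OF elim(1) u])
      also have "(2 * real N powr \<gamma>) powr (\<alpha> + 1) = 2 powr (\<alpha> + 1) * real N powr (1/2)"
        unfolding \<gamma>(2)[symmetric] by (simp add: powr_mult powr_powr)
      finally have 1: "real N / h (cut N) \<le> C * 2 powr (\<alpha> + 1) * real N powr (1/2)"
        using cutpos by (simp add: pos_divide_le_eq mult_ac)
      have "real N powr (K * \<delta>) / h (cut N) \<le> real N powr (1/4) / h (cut N)"
        using elim K cutpos by (intro divide_right_mono powr_mono) auto
      also have "\<dots> = real N powr (- 3/4) * (real N / h (cut N))"
        using powr_add[of "real N" "-3/4" 1] Npos by simp
      also have "\<dots> \<le> real N powr (- 3/4) * (C * 2 powr (\<alpha> + 1) * real N powr (1/2))"
        using 1 by (intro mult_left_mono) auto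
      also have "\<dots> = C * 2 powr (\<alpha> + 1) * real N powr (- 1/4)"
        using powr_add[of "real N" "-3/4" "1/2"] by simp
      finally show ?case .
    qed
    show "(\<lambda>N. C * 2 powr (\<alpha> + 1) * real N powr (- 1/4)) \<longlonglongrightarrow> 0"
      by real_asymp
  qed simp
  moreover have "(\<lambda>N. K * ln (real N) * real N powr (- \<gamma>)) \<longlonglongrightarrow> 0"
    using \<gamma>(1) by real_asymp
  ultimately show "(\<lambda>N. exp (K * ln (real N) * real N powr (- 1 / (2 * (\<alpha> + 1)))) + real N powr (K * \<delta>) / h (cut N)) \<longlonglongrightarrow> 1"
    unfolding \<gamma>(3) using tendsto_add[OF tendsto_exp] by fastforce
qed

end

text \<open>Regular variation gives positivity of \<open>h\<close> only near infinity. It extends to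
  all \<open>x \<ge> 0\<close> because the tail decreases, so \<open>1 / h x\<close> is at least a
  later, positive value. Divergence of \<open>h\<close> holds because \<open>X\<close> is
  finite.\<close>

lemma (in prob_space) heavy_tailI:
  assumes X: "X \<in> borel_measurable M"
    and tail: "\<And>x. 0 \<le> x \<Longrightarrow> prob {\<omega> \<in> space M. x < X \<omega>} = 1 / h x"
    and \<alpha>: "0 < \<alpha>" and RV: "regularly_varying h \<alpha>"
  shows "heavy_tail h \<alpha>"
proof
  obtain a where a: "\<And>x. a \<le> x \<Longrightarrow> 0 < h x"
    using RV by (auto simp: regularly_varying_def)
  have anti: "1 / h y \<le> 1 / h x" if "0 \<le> x" "x \<le> y" for x y
    using that X unfolding tail[OF that(1), symmetric] tail[OF order_trans[OF that], symmetric]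
    by (intro finite_measure_mono) auto
  show pos: "0 < h x" if "0 \<le> x" for x
  proof -
    have "0 < 1 / h (max x a)"
      using a[of "max x a"] by simp
    also have "\<dots> \<le> 1 / h x"
      using that by (intro anti) auto
    finally show ?thesis
      by simp
  qed
  show mono: "h x \<le> h y" if "0 \<le> x" "x \<le> y" for x y
    using anti[OF that] pos[of x] pos[of y] that by (simp add: frac_le field_simps)
  show "filterlim h at_top at_top"
    unfolding filterlim_at_top
  proof
    fix Z :: real
    have "(\<lambda>n. prob {\<omega> \<in> space M. real n < X \<omega>}) \<longlonglongrightarrow> prob (\<Inter>n. {\<omega> \<in> space M. real n < X \<omega>})"
      using X by (intro finite_Lim_measure_decseq) (auto simp: decseq_def)
    moreover have "(\<Inter>n. {\<omega> \<in> space M. real n < X \<omega>}) = {}"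
    proof -
      have False if "\<forall>n. real n < X \<omega>" for \<omega>
        using that reals_Archimedean2[of "X \<omega>"] less_asym by blast
      then show ?thesis by auto
    qed
    ultimately have "(\<lambda>n. prob {\<omega> \<in> space M. real n < X \<omega>}) \<longlonglongrightarrow> 0"
      by simp
    then have "\<forall>\<^sub>F n in sequentially. prob {\<omega> \<in> space M. real n < X \<omega>} < 1 / max Z 1"
      by (rule order_tendstoD(2)) simp
    then obtain n where "prob {\<omega> \<in> space M. real n < X \<omega>} < 1 / max Z 1"
      by (auto simp: eventually_sequentially)
    then have n: "Z \<le> h (real n)"
      using tail[of "real n"] pos[of "real n"] by (auto simp: field_simps max_def split: if_splits)
    show "\<forall>\<^sub>F x in at_top. Z \<le> h x"
      using eventually_ge_at_top[of "real n"]
      by eventually_elim (use n mono[of "real n"] in force)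
  qed
  show "((\<lambda>x. h (u * x) / h x) \<longlongrightarrow> u powr \<alpha>) at_top" if "0 < u" for u
    using RV that by (simp add: regularly_varying_def)
qed (rule \<alpha>)

section \<open>The branching random walk\<close>

definition brw_children :: "nat \<Rightarrow> (nat \<Rightarrow> nat \<Rightarrow> real) \<Rightarrow> nat \<Rightarrow> real list" where
  "brw_children N x n = [brw_list N x n ! (i - 1) + x n (2 * i - j). i \<leftarrow> [1..<Suc N], j \<leftarrow> [0, 1]]"

lemma brw_list_Suc: "brw_list N x (Suc n) = drop N (sort (brw_children N x n))"
  by (simp add: brw_children_def)

declare brw_list.simps(2) [simp del]

lemma brw_children_conv:
  "brw_children N x n =
    concat (map (\<lambda>i. [brw_list N x n ! i + x n (2 * i + 2), brw_list N x n ! i + x n (2 * i + 1)]) [0..<N])"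
proof -
  have "concat (map (\<lambda>i. [g (i - 1) + x n (2 * i), g (i - 1) + x n (2 * i - 1)]) [1..<Suc M]) =
      concat (map (\<lambda>i. [g i + x n (2 * i + 2), g i + x n (2 * i + 1)]) [0..<M])" for g :: "nat \<Rightarrow> real" and M
    by (induction M) auto
  from this[of "\<lambda>i. brw_list N x n ! i" N] show ?thesis
    by (simp add: brw_children_def)
qed

lemma length_brw_children [simp]: "length (brw_children N x n) = 2 * N"
proof -
  have "length (concat (map (\<lambda>i. [g i, g' i]) [0..<M])) = 2 * M" for g g' :: "nat \<Rightarrow> real" and M
    by (induction M) auto
  then show ?thesis
    by (simp add: brw_children_conv)
qed

lemma length_brw_list [simp]: "length (brw_list N x n) = N"
  by (cases n) (simp_all add: brw_list_Suc)

lemma sorted_brw_list: "sorted (brw_list N x n)"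
  by (cases n) (simp_all add: brw_list_Suc sorted_wrt_drop)

lemma sum_list_brw_children:
  fixes f :: "real \<Rightarrow> 'a::comm_monoid_add"
  shows "sum_list (map f (brw_children N x n)) =
    (\<Sum>i<N. f (brw_list N x n ! i + x n (2 * i + 2)) + f (brw_list N x n ! i + x n (2 * i + 1)))"
proof -
  have "sum_list (map f (concat (map (\<lambda>i. [g i, g' i]) [0..<M]))) = (\<Sum>i<M. f (g i) + f (g' i))"
    for g g' :: "nat \<Rightarrow> real" and M
    by (induction M) (auto simp: algebra_simps)
  then show ?thesis
    by (simp add: brw_children_conv)
qed

lemma brw_childrenI:
  "i < N \<Longrightarrow> k = 2 * i + 1 \<or> k = 2 * i + 2 \<Longrightarrow> brw_list N x n ! i + x n k \<in> set (brw_children N x n)"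
  unfolding brw_children_conv by auto

lemma brw_childrenE:
  assumes "v \<in> set (brw_children N x n)"
  obtains i k where "i < N" "k = 2 * i + 1 \<or> k = 2 * i + 2" "v = brw_list N x n ! i + x n k"
proof -
  obtain i where "i < N" "v = brw_list N x n ! i + x n (2 * i + 2) \<or> v = brw_list N x n ! i + x n (2 * i + 1)"
    using assms unfolding brw_children_conv by auto
  then show thesis
    using that[of i "2 * i + 2"] that[of i "2 * i + 1"] by auto
qed

lemma sum_list_sort:
  fixes f :: "'b::linorder \<Rightarrow> 'a::comm_monoid_add"
  shows "sum_list (map f (sort xs)) = sum_list (map f xs)"
  by (metis mset_map mset_sort sum_mset_sum_list)

text \<open>Selection only removes nonnegative terms. Thus first moments can be estimated as for a
  branching random walk that keeps all children.\<close>

lemma sum_brw_list_Suc_le: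
  fixes f :: "real \<Rightarrow> 'a::{ordered_comm_monoid_add, canonically_ordered_monoid_add}"
  shows "(\<Sum>i<N. f (brw_list N x (Suc n) ! i)) \<le>
    (\<Sum>i<N. f (brw_list N x n ! i + x n (2 * i + 2)) + f (brw_list N x n ! i + x n (2 * i + 1)))"
proof -
  have "(\<Sum>i<N. f (brw_list N x (Suc n) ! i)) = sum_list (map f (brw_list N x (Suc n)))"
    by (simp add: sum_list_sum_nth lessThan_atLeast0)
  also have "\<dots> \<le> sum_list (map f (take N (sort (brw_children N x n)))) + sum_list (map f (drop N (sort (brw_children N x n))))"
    unfolding brw_list_Suc by (rule add_increasing) simp_all
  also have "\<dots> = sum_list (map f (sort (brw_children N x n)))"
    unfolding sum_list_append[symmetric] map_append[symmetric] append_take_drop_id ..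
  finally show ?thesis
    unfolding sum_list_sort sum_list_brw_children .
qed

section \<open>Leader and last particle\<close>

definition brw_top :: "nat \<Rightarrow> (nat \<Rightarrow> nat \<Rightarrow> real) \<Rightarrow> nat \<Rightarrow> real" where
  "brw_top N x n = brw_list N x n ! (N - 1)"

definition brw_bottom :: "nat \<Rightarrow> (nat \<Rightarrow> nat \<Rightarrow> real) \<Rightarrow> nat \<Rightarrow> real" where
  "brw_bottom N x n = brw_list N x n ! 0"

lemma brw_eq: "brw N x N n = brw_top N x n" "brw N x 1 n = brw_bottom N x n"
  by (simp_all add: brw_def brw_top_def brw_bottom_def)

lemma brw_top_0 [simp]: "1 \<le> N \<Longrightarrow> brw_top N x 0 = 0"
  and brw_bottom_0 [simp]: "1 \<le> N \<Longrightarrow> brw_bottom N x 0 = 0"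
  by (simp_all add: brw_top_def brw_bottom_def)

lemma brw_list_bounds:
  assumes "i < N"
  shows "brw_bottom N x n \<le> brw_list N x n ! i" "brw_list N x n ! i \<le> brw_top N x n"
  unfolding brw_bottom_def brw_top_def
  by (rule sorted_nth_mono[OF sorted_brw_list]; use assms in simp)+

lemma brw_top_Suc:
  assumes N: "1 \<le> N"
  shows "brw_top N x (Suc n) \<in> set (brw_children N x n)"
    and "v \<in> set (brw_children N x n) \<Longrightarrow> v \<le> brw_top N x (Suc n)"
proof -
  let ?s = "sort (brw_children N x n)"
  have top: "brw_top N x (Suc n) = ?s ! (2 * N - 1)"
    using N by (simp add: brw_top_def brw_list_Suc) (metis Nat.add_diff_assoc mult_2)
  then show "brw_top N x (Suc n) \<in> set (brw_children N x n)"
    using N nth_mem[of "2 * N - 1" ?s] by simp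
  assume "v \<in> set (brw_children N x n)"
  then have "v \<in> set ?s" by simp
  then obtain i where "i < 2 * N" "v = ?s ! i"
    unfolding in_set_conv_nth by auto
  then show "v \<le> brw_top N x (Suc n)"
    unfolding top using N by (auto intro!: sorted_nth_mono)
qed

text \<open>Wherever in the population a displacement occurs, its parent is at least as high as the
  last particle.\<close>

lemma brw_top_Suc_ge:
  assumes N: "1 \<le> N" and k: "k \<in> {1..2 * N}"
  shows "brw_bottom N x n + x n k \<le> brw_top N x (Suc n)"
proof -
  define i where "i = (k - 1) div 2"
  have i: "i < N" "k = 2 * i + 1 \<or> k = 2 * i + 2"
    using k by (auto simp: i_def)
  then have "brw_list N x n ! i + x n k \<in> set (brw_children N x n)"
    by (rule brw_childrenI)
  then have "brw_list N x n ! i + x n k \<le> brw_top N x (Suc n)"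
    by (rule brw_top_Suc(2)[OF N])
  then show ?thesis
    using brw_list_bounds(1)[OF i(1), of x n] by simp
qed

lemma brw_bottom_mono:
  assumes N: "1 \<le> N" and x: "\<And>n k. k \<in> {1..2 * N} \<Longrightarrow> 0 \<le> x n k"
  shows "mono (brw_bottom N x)"
proof (rule incseq_SucI)
  fix n
  have "brw_list N x (Suc n) ! 0 \<in> set (brw_list N x (Suc n))"
    using N by (intro nth_mem) simp
  then have "brw_bottom N x (Suc n) \<in> set (brw_children N x n)"
    unfolding brw_bottom_def by (auto simp: brw_list_Suc dest: in_set_dropD)
  then obtain i k where "i < N" "k = 2 * i + 1 \<or> k = 2 * i + 2" "brw_bottom N x (Suc n) = brw_list N x n ! i + x n k"
    by (rule brw_childrenE)
  moreover from this have "0 \<le> x n k"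
    by (intro x) auto
  ultimately show "brw_bottom N x n \<le> brw_bottom N x (Suc n)"
    using brw_list_bounds(1)[of i N x n] by simp
qed

lemma brw_top_mono:
  assumes N: "1 \<le> N" and x: "\<And>n k. k \<in> {1..2 * N} \<Longrightarrow> 0 \<le> x n k"
  shows "mono (brw_top N x)"
proof (rule incseq_SucI)
  fix n
  have "brw_list N x n ! (N - 1) + x n (2 * (N - 1) + 1) \<in> set (brw_children N x n)"
    using N by (intro brw_childrenI) auto
  then have "brw_list N x n ! (N - 1) + x n (2 * (N - 1) + 1) \<le> brw_top N x (Suc n)"
    by (rule brw_top_Suc(2)[OF N])
  moreover have "0 \<le> x n (2 * (N - 1) + 1)"
    using N by (intro x) auto
  ultimately show "brw_top N x n \<le> brw_top N x (Suc n)"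
    by (simp add: brw_top_def)
qed

section \<open>Growth of the number of particles above a level\<close>

definition brw_count :: "nat \<Rightarrow> (nat \<Rightarrow> nat \<Rightarrow> real) \<Rightarrow> nat \<Rightarrow> real \<Rightarrow> nat" where
  "brw_count N x n a = length (filter (\<lambda>v. a \<le> v) (brw_list N x n))"

text \<open>If one of the dropped entries is at least \<open>a\<close>, so are all \<open>N\<close>
  entries that are kept; otherwise none of the counted entries is dropped.\<close>

lemma length_filter_drop_sorted:
  fixes l :: "real list"
  assumes "sorted l" "length l = 2 * N"
  shows "min N (length (filter (\<lambda>v. a \<le> v) l)) \<le> length (filter (\<lambda>v. a \<le> v) (drop N l))"
proof (cases "\<exists>v\<in>set (take N l). a \<le> v")
  case True
  have "sorted (take N l @ drop N l)"
    using assms(1) by simp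
  then have "\<forall>v\<in>set (drop N l). a \<le> v"
    using True unfolding sorted_append by fastforce
  then have "filter (\<lambda>v. a \<le> v) (drop N l) = drop N l"
    by simp
  then show ?thesis
    using assms(2) by simp
next
  case False
  then have "filter (\<lambda>v. a \<le> v) (take N l) = []"
    by (simp add: filter_empty_conv)
  then have "filter (\<lambda>v. a \<le> v) l = filter (\<lambda>v. a \<le> v) (drop N l)"
    by (metis append_Nil append_take_drop_id filter_append)
  then show ?thesis
    by simp
qed

lemma length_filter_conv_sum_list:
  "length (filter P l) = sum_list (map (\<lambda>v. if P v then 1 else 0) l)"
  by (induction l) auto

text \<open>Both children of a particle at or above \<open>a\<close> stay there, as displacements
  are nonnegative. Selection removes such a child only if all survivors are at or above
  \<open>a\<close>.\<close>

lemma brw_count_Suc: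
  assumes x: "\<And>n k. k \<in> {1..2 * N} \<Longrightarrow> 0 \<le> x n k"
  shows "min N (2 * brw_count N x n a) \<le> brw_count N x (Suc n) a"
proof -
  let ?ind = "\<lambda>v. if a \<le> v then 1 else 0 :: nat"
  have le: "?ind (brw_list N x n ! i) \<le> ?ind (brw_list N x n ! i + x n (2 * i + j))" if "i < N" "j \<in> {1, 2}" for i j
  proof -
    have "0 \<le> x n (2 * i + j)"
      using that by (intro x) auto
    then show ?thesis
      by auto
  qed
  have "2 * brw_count N x n a = (\<Sum>i<N. ?ind (brw_list N x n ! i) + ?ind (brw_list N x n ! i))"
    by (simp add: brw_count_def length_filter_conv_sum_list sum_list_sum_nth lessThan_atLeast0 sum.distrib mult_2)
  also have "\<dots> \<le> (\<Sum>i<N. ?ind (brw_list N x n ! i + x n (2 * i + 2)) + ?ind (brw_list N x n ! i + x n (2 * i + 1)))"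
    by (intro sum_mono add_mono le) auto
  also have "\<dots> = length (filter (\<lambda>v. a \<le> v) (sort (brw_children N x n)))"
    unfolding length_filter_conv_sum_list sum_list_sort sum_list_brw_children ..
  finally show ?thesis
    using length_filter_drop_sorted[of "sort (brw_children N x n)" N a]
    unfolding brw_count_def brw_list_Suc by simp
qed

text \<open>After \<open>k\<close> generations the offspring of the leader fills the whole population if \<open>N \<le> 2 ^ k\<close>.\<close>

lemma brw_bottom_ge_top:
  assumes N: "1 \<le> N" and x: "\<And>n k. k \<in> {1..2 * N} \<Longrightarrow> 0 \<le> x n k" and k: "N \<le> 2 ^ k"
  shows "brw_top N x n \<le> brw_bottom N x (n + k)"
proof -
  let ?a = "brw_top N x n"
  have "?a \<in> set (filter (\<lambda>v. ?a \<le> v) (brw_list N x n))"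
    using N nth_mem[of "N - 1" "brw_list N x n"] by (simp add: brw_top_def)
  then have "0 < brw_count N x n ?a"
    unfolding brw_count_def by (rule length_pos_if_in_set)
  then have "min N (2 ^ j) \<le> brw_count N x (n + j) ?a" for j
  proof (induction j)
    case (Suc j)
    then have "min N (2 * min N (2 ^ j)) \<le> min N (2 * brw_count N x (n + j) ?a)"
      by (intro min.mono mult_left_mono) auto
    also have "\<dots> \<le> brw_count N x (n + Suc j) ?a"
      using brw_count_Suc[OF x] by simp
    finally show ?case
      by simp
  qed simp
  from this[of k] have "N \<le> brw_count N x (n + k) ?a"
    using k by simp
  then have "length (filter (\<lambda>v. ?a \<le> v) (brw_list N x (n + k))) = length (brw_list N x (n + k))"
    using length_filter_le[of "\<lambda>v. ?a \<le> v" "brw_list N x (n + k)"] by (simp add: brw_count_def)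
  then have "\<forall>v\<in>set (brw_list N x (n + k)). ?a \<le> v"
    by (metis length_filter_less linorder_neq_iff)
  then show ?thesis
    using N nth_mem[of 0 "brw_list N x (n + k)"] by (simp add: brw_bottom_def)
qed

text \<open>Order statistics are expressed through counts, which makes their measurability
  accessible.\<close>

lemma sort_nth_le_iff:
  fixes xs :: "real list"
  assumes "k < length xs"
  shows "sort xs ! k \<le> a \<longleftrightarrow> k < length (filter (\<lambda>v. v \<le> a) xs)"
proof -
  let ?l = "sort xs"
  have len: "length (filter (\<lambda>v. v \<le> a) xs) = length (filter (\<lambda>v. v \<le> a) ?l)"
    by (metis filter_sort length_sort)
  show ?thesis
    unfolding len
  proof
    assume le: "?l ! k \<le> a"
    have "v \<le> a" if v: "v \<in> set (take (Suc k) ?l)" for v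
    proof -
      obtain i where "i < Suc k" "v = ?l ! i"
        using v assms unfolding in_set_conv_nth by auto
      then show ?thesis
        using sorted_nth_mono[of ?l i k] assms le by simp
    qed
    then have "filter (\<lambda>v. v \<le> a) (take (Suc k) ?l) = take (Suc k) ?l"
      by simp
    then have "Suc k \<le> length (filter (\<lambda>v. v \<le> a) (take (Suc k) ?l))"
      using assms by simp
    also have "\<dots> \<le> length (filter (\<lambda>v. v \<le> a) (take (Suc k) ?l @ drop (Suc k) ?l))"
      by (simp only: filter_append length_append le_add1)
    finally show "k < length (filter (\<lambda>v. v \<le> a) ?l)"
      by simp
  next
    assume less: "k < length (filter (\<lambda>v. v \<le> a) ?l)"
    show "?l ! k \<le> a"
    proof (rule ccontr)
      assume gt: "\<not> ?l ! k \<le> a"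
      have "\<not> v \<le> a" if v: "v \<in> set (drop k ?l)" for v
      proof -
        obtain i where i: "i < length (drop k ?l)" "v = ?l ! (k + i)"
          using v assms unfolding in_set_conv_nth by auto
        then have "k + i < length xs"
          by simp
        then show ?thesis
          using sorted_nth_mono[of ?l k "k + i"] gt i(2) by simp
      qed
      then have "filter (\<lambda>v. v \<le> a) (drop k ?l) = []"
        by (simp add: filter_empty_conv)
      then have "filter (\<lambda>v. v \<le> a) ?l = filter (\<lambda>v. v \<le> a) (take k ?l)"
        by (metis append_Nil2 append_take_drop_id filter_append)
      then show False
        using less length_filter_le[of "\<lambda>v. v \<le> a" "take k ?l"] by simp
    qed
  qed
qed

lemma borel_measurable_sort_nth:
  fixes fs :: "('w \<Rightarrow> real) list"
  assumes fs: "\<And>f. f \<in> set fs \<Longrightarrow> f \<in> borel_measurable M" and k: "k < length fs"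
  shows "(\<lambda>\<omega>. sort (map (\<lambda>f. f \<omega>) fs) ! k) \<in> borel_measurable M"
  unfolding borel_measurable_iff_le
proof
  fix a
  have "(\<lambda>\<omega>. length (filter (\<lambda>v. v \<le> a) (map (\<lambda>f. f \<omega>) fs))) \<in> measurable M (count_space UNIV)"
    using fs
  proof (induction fs)
    case (Cons f fs)
    have [measurable]: "f \<in> borel_measurable M"
      using Cons.prems by simp
    have [measurable]: "(\<lambda>\<omega>. length (filter (\<lambda>v. v \<le> a) (map (\<lambda>f. f \<omega>) fs))) \<in> measurable M (count_space UNIV)"
      using Cons by simp
    have "(\<lambda>\<omega>. length (filter (\<lambda>v. v \<le> a) (map (\<lambda>f. f \<omega>) (f # fs)))) =
        (\<lambda>\<omega>. if f \<omega> \<le> a then Suc (length (filter (\<lambda>v. v \<le> a) (map (\<lambda>f. f \<omega>) fs)))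
          else length (filter (\<lambda>v. v \<le> a) (map (\<lambda>f. f \<omega>) fs)))"
      by (auto simp: fun_eq_iff)
    then show ?case
      by simp
  qed simp
  then have "{\<omega> \<in> space M. k < length (filter (\<lambda>v. v \<le> a) (map (\<lambda>f. f \<omega>) fs))} \<in> sets M"
    by measurable
  then show "{\<omega> \<in> space M. sort (map (\<lambda>f. f \<omega>) fs) ! k \<le> a} \<in> sets M"
    using k by (simp add: sort_nth_le_iff)
qed

lemma borel_measurable_brw_list:
  assumes "\<And>m k. m < n \<Longrightarrow> k \<in> {1..2 * N} \<Longrightarrow> Y m k \<in> borel_measurable M" "i < N"
  shows "(\<lambda>\<omega>. brw_list N (\<lambda>m k. Y m k \<omega>) n ! i) \<in> borel_measurable M"
  using assms
proof (induction n arbitrary: i)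
  case (Suc n)
  define fs where "fs = concat (map (\<lambda>i. [\<lambda>\<omega>. brw_list N (\<lambda>m k. Y m k \<omega>) n ! i + Y n (2 * i + 2) \<omega>,
      \<lambda>\<omega>. brw_list N (\<lambda>m k. Y m k \<omega>) n ! i + Y n (2 * i + 1) \<omega>]) [0..<N])"
  have fs: "map (\<lambda>f. f \<omega>) fs = brw_children N (\<lambda>m k. Y m k \<omega>) n" for \<omega>
    by (simp add: fs_def brw_children_conv map_concat comp_def)
  have "f \<in> borel_measurable M" if f: "f \<in> set fs" for f
  proof -
    obtain i where "i < N" "f = (\<lambda>\<omega>. brw_list N (\<lambda>m k. Y m k \<omega>) n ! i + Y n (2 * i + 2) \<omega>) \<or>
        f = (\<lambda>\<omega>. brw_list N (\<lambda>m k. Y m k \<omega>) n ! i + Y n (2 * i + 1) \<omega>)"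
      using f by (auto simp: fs_def)
    then obtain k where i: "i < N" "k = 2 * i + 2 \<or> k = 2 * i + 1"
        "f = (\<lambda>\<omega>. brw_list N (\<lambda>m k. Y m k \<omega>) n ! i + Y n k \<omega>)"
      by blast
    have "Y n k \<in> borel_measurable M"
      using i by (intro Suc.prems) auto
    moreover have "(\<lambda>\<omega>. brw_list N (\<lambda>m k. Y m k \<omega>) n ! i) \<in> borel_measurable M"
      by (rule Suc.IH) (use Suc.prems i in auto)
    ultimately show ?thesis
      unfolding i(3) by simp
  qed
  moreover have "length fs = 2 * N"
    using arg_cong[OF fs, of length] by simp
  ultimately have "(\<lambda>\<omega>. sort (map (\<lambda>f. f \<omega>) fs) ! (N + i)) \<in> borel_measurable M"
    using Suc.prems by (intro borel_measurable_sort_nth) auto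
  then show ?case
    using Suc.prems by (simp add: fs brw_list_Suc)
qed simp

section \<open>Upper bound for the branching random walk\<close>

lemma (in prob_space) nn_integral_indep_var_mult:
  fixes F G :: "'a \<Rightarrow> ennreal"
  assumes "indep_var borel F borel G"
  shows "(\<integral>\<^sup>+\<omega>. F \<omega> * G \<omega> \<partial>M) = (\<integral>\<^sup>+\<omega>. F \<omega> \<partial>M) * (\<integral>\<^sup>+\<omega>. G \<omega> \<partial>M)"
proof -
  have "indep_vars (\<lambda>_. borel) (case_bool F G) UNIV"
    using assms unfolding indep_var_def by (rule indep_vars_cong[THEN iffD1, rotated -1]) (auto split: bool.split)
  from indep_vars_nn_integral[OF _ this] show ?thesis
    by (simp add: UNIV_bool mult.commute)
qed

locale brw_model = prob_space M for M :: "'q measure" +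
  fixes N :: nat and Y :: "nat \<Rightarrow> nat \<Rightarrow> 'q \<Rightarrow> real" and D :: "real measure"
  assumes N: "1 \<le> N"
    and indep: "indep_vars (\<lambda>_. borel) (\<lambda>(n, i). Y n i) (UNIV \<times> {1..2 * N})"
    and distr_Y: "\<And>n i. i \<in> {1..2 * N} \<Longrightarrow> distr M borel (Y n i) = D"
begin

section \<open>Independence of the past and the present displacements\<close>

lemma Y_measurable: "i \<in> {1..2 * N} \<Longrightarrow> Y n i \<in> borel_measurable M"
  using indep by (auto simp: indep_vars_def)

lemma prob_space_D: "prob_space D"
  using distr_Y[of 1 0] N prob_space_distr[OF Y_measurable[of 1 0]] by auto

lemma sets_D [simp, measurable_cong]: "sets D = sets borel"
proof -
  have "D = distr M borel (Y 0 1)"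
    using distr_Y[of 1 0] N by simp
  then show ?thesis
    by (metis sets_distr)
qed

text \<open>The sigma-algebra of the displacements of all generations before \<open>n\<close>.
  Generating it by the restricted family matches the form of
  \<open>indep_var_restrict\<close>.\<close>

definition past :: "nat \<Rightarrow> 'q measure" where
  "past n = vimage_algebra (space M) (\<lambda>\<omega>. restrict (\<lambda>p. (case p of (m, i) \<Rightarrow> Y m i) \<omega>) ({..<n} \<times> {1..2 * N}))
     (PiM ({..<n} \<times> {1..2 * N}) (\<lambda>_. borel))"

lemma space_past [simp]: "space (past n) = space M"
  by (simp add: past_def)

lemma restrict_measurable:
  assumes "\<And>p. p \<in> A \<Longrightarrow> (\<lambda>\<omega>. f p \<omega>) \<in> borel_measurable K"
  shows "(\<lambda>\<omega>. restrict (\<lambda>p. f p \<omega>) A) \<in> measurable K (PiM A (\<lambda>_. borel))"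
  by (rule measurable_restrict) (rule assms)

lemma Y_past: "m < n \<Longrightarrow> i \<in> {1..2 * N} \<Longrightarrow> Y m i \<in> borel_measurable (past n)"
proof -
  assume mi: "m < n" "i \<in> {1..2 * N}"
  let ?A = "{..<n} \<times> {1..2 * N}"
  let ?R = "\<lambda>\<omega>. restrict (\<lambda>p. (case p of (m, i) \<Rightarrow> Y m i) \<omega>) ?A"
  have "?R \<in> measurable (past n) (PiM ?A (\<lambda>_. borel))"
    unfolding past_def by (rule measurable_vimage_algebra1) (auto simp: space_PiM)
  then have "(\<lambda>\<omega>. ?R \<omega> (m, i)) \<in> borel_measurable (past n)"
    by (rule measurable_compose[OF _ measurable_component_singleton]) (use mi in auto)
  then show ?thesis
    using mi by simp
qed

lemma measurable_past_mono:
  assumes "F \<in> measurable (past m) K" "m \<le> n"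
  shows "F \<in> measurable (past n) K"
proof -
  have "sets (past m) \<subseteq> sets (past n)"
    unfolding past_def[of m]
    by (intro sets_image_in_sets restrict_measurable) (use assms(2) in \<open>auto intro!: Y_past\<close>)
  then show ?thesis
    using assms(1) by (auto simp: measurable_def)
qed

lemma measurable_past:
  assumes "F \<in> measurable (past m) K"
  shows "F \<in> measurable M K"
proof -
  have "sets (past m) \<subseteq> sets M"
    unfolding past_def
    by (intro sets_image_in_sets restrict_measurable) (auto intro!: Y_measurable)
  then show ?thesis
    using assms(1) by (auto simp: measurable_def)
qed

text \<open>The index sets of the generations before \<open>n\<close> and of \<open>Y n i\<close>
  are disjoint, so a fresh displacement is independent of everything measurable with respect to the
  past.\<close>

lemma nn_integral_past_mult:
  fixes F :: "'q \<Rightarrow> ennreal"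
  assumes F: "F \<in> borel_measurable (past n)" and i: "i \<in> {1..2 * N}" and \<psi>: "\<psi> \<in> borel_measurable borel"
  shows "(\<integral>\<^sup>+\<omega>. F \<omega> * \<psi> (Y n i \<omega>) \<partial>M) = (\<integral>\<^sup>+\<omega>. F \<omega> \<partial>M) * (\<integral>\<^sup>+y. \<psi> y \<partial>D)"
proof -
  let ?A = "{..<n} \<times> {1..2 * N}"
  let ?R = "\<lambda>A \<omega>. restrict (\<lambda>p. (case p of (m, i) \<Rightarrow> Y m i) \<omega>) A"
  let ?V = "\<lambda>A. vimage_algebra (space M) (?R A) (PiM A (\<lambda>_. borel))"
  have "indep_var (PiM ?A (\<lambda>_. borel)) (?R ?A) (PiM {(n, i)} (\<lambda>_. borel)) (?R {(n, i)})"
    by (rule indep_var_restrict[OF indep]) (use i in auto)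
  then have ind: "indep_set (sets (?V ?A)) (sets (?V {(n, i)}))"
    unfolding indep_var_eq sets_vimage_algebra by blast
  have sub: "sigma_sets (space M) {f -` B \<inter> space M |B. B \<in> sets borel} \<subseteq> sets (?V A)"
    if "f \<in> borel_measurable (?V A)" for f :: "'q \<Rightarrow> ennreal" and A
    using that sets.top[of "?V A"] by (intro sets.sigma_sets_subset') (auto simp: measurable_def)
  have "?R {(n, i)} \<in> measurable (?V {(n, i)}) (PiM {(n, i)} (\<lambda>_. borel))"
    by (rule measurable_vimage_algebra1) (auto simp: space_PiM)
  from measurable_compose[OF measurable_compose[OF this measurable_component_singleton] \<psi>, of "(n, i)"]
  have G: "(\<lambda>\<omega>. \<psi> (Y n i \<omega>)) \<in> borel_measurable (?V {(n, i)})"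
    by simp
  have "indep_var borel F borel (\<lambda>\<omega>. \<psi> (Y n i \<omega>))"
    unfolding indep_var_eq indep_set_def
  proof (intro conjI indep_sets_mono_sets[OF ind[unfolded indep_set_def]])
    show "F \<in> borel_measurable M" "(\<lambda>\<omega>. \<psi> (Y n i \<omega>)) \<in> borel_measurable M"
      using measurable_past[OF F] measurable_compose[OF Y_measurable[OF i] \<psi>] by auto
    show "(case b of True \<Rightarrow> sigma_sets (space M) {F -` A \<inter> space M |A. A \<in> sets borel}
        | False \<Rightarrow> sigma_sets (space M) {(\<lambda>\<omega>. \<psi> (Y n i \<omega>)) -` A \<inter> space M |A. A \<in> sets borel})
      \<subseteq> (case b of True \<Rightarrow> sets (?V ?A) | False \<Rightarrow> sets (?V {(n, i)}))" for b
      using sub[OF F[unfolded past_def]] sub[OF G] by (cases b) simp_all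
  qed
  then have "(\<integral>\<^sup>+\<omega>. F \<omega> * \<psi> (Y n i \<omega>) \<partial>M) = (\<integral>\<^sup>+\<omega>. F \<omega> \<partial>M) * (\<integral>\<^sup>+\<omega>. \<psi> (Y n i \<omega>) \<partial>M)"
    by (rule nn_integral_indep_var_mult)
  also have "(\<integral>\<^sup>+\<omega>. \<psi> (Y n i \<omega>) \<partial>M) = (\<integral>\<^sup>+y. \<psi> y \<partial>D)"
    using nn_integral_distr[OF Y_measurable[OF i], of \<psi> n] \<psi> distr_Y[OF i] by simp
  finally show ?thesis .
qed

definition pos :: "nat \<Rightarrow> nat \<Rightarrow> 'q \<Rightarrow> real" where
  "pos n i \<omega> = brw_list N (\<lambda>m k. Y m k \<omega>) n ! i"

definition top_pos :: "nat \<Rightarrow> 'q \<Rightarrow> real" where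
  "top_pos n \<omega> = brw_top N (\<lambda>m k. Y m k \<omega>) n"

definition bottom_pos :: "nat \<Rightarrow> 'q \<Rightarrow> real" where
  "bottom_pos n \<omega> = brw_bottom N (\<lambda>m k. Y m k \<omega>) n"

lemma pos_past: "i < N \<Longrightarrow> n \<le> n' \<Longrightarrow> pos n i \<in> borel_measurable (past n')"
  unfolding pos_def by (rule borel_measurable_brw_list) (auto intro!: Y_past)

lemma top_pos_eq: "top_pos n \<omega> = pos n (N - 1) \<omega>"
  by (simp add: top_pos_def pos_def brw_top_def)

lemma bottom_pos_eq: "bottom_pos n \<omega> = pos n 0 \<omega>"
  by (simp add: bottom_pos_def pos_def brw_bottom_def)

lemma pos_bounds: "i < N \<Longrightarrow> bottom_pos n \<omega> \<le> pos n i \<omega>" "i < N \<Longrightarrow> pos n i \<omega> \<le> top_pos n \<omega>"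
  using brw_list_bounds[of i N "\<lambda>m k. Y m k \<omega>" n] by (auto simp: pos_def top_pos_def bottom_pos_def)

lemma top_pos_past: "n \<le> n' \<Longrightarrow> top_pos n \<in> borel_measurable (past n')"
  using pos_past[of "N - 1" n n'] N by (simp add: top_pos_eq[abs_def])

lemma pos_0 [simp]: "i < N \<Longrightarrow> pos 0 i \<omega> = 0" and top_pos_0 [simp]: "top_pos 0 \<omega> = 0"
  using N by (auto simp: pos_def top_pos_eq)

lemma sum_pos_Suc_le:
  fixes f :: "real \<Rightarrow> ennreal"
  shows "(\<Sum>i<N. f (pos (Suc n) i \<omega>)) \<le> (\<Sum>i<N. \<Sum>j\<in>{1, 2}. f (pos n i \<omega> + Y n (2 * i + j) \<omega>))"
  using sum_brw_list_Suc_le[where N = N and f = f and x = "\<lambda>m k. Y m k \<omega>" and n = n] by (simp add: pos_def add.commute)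

lemma child_index: "i < N \<Longrightarrow> j \<in> {1, 2} \<Longrightarrow> 2 * i + j \<in> {1..2 * N}"
  by auto

text \<open>Each of the \<open>N\<close> parents has two children with fresh displacements, hence
  the factor 2 and the mean of \<open>\<psi>\<close> under \<open>D\<close>.\<close>

lemma nn_integral_children:
  fixes F :: "nat \<Rightarrow> 'q \<Rightarrow> ennreal"
  assumes F: "\<And>i. i < N \<Longrightarrow> F i \<in> borel_measurable (past n)" and \<psi>: "\<psi> \<in> borel_measurable borel"
  shows "(\<integral>\<^sup>+\<omega>. (\<Sum>i<N. \<Sum>j\<in>{1, 2}. F i \<omega> * \<psi> (Y n (2 * i + j) \<omega>)) \<partial>M) =
    2 * (\<integral>\<^sup>+\<omega>. (\<Sum>i<N. F i \<omega>) \<partial>M) * (\<integral>\<^sup>+y. \<psi> y \<partial>D)"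
proof -
  have meas: "(\<lambda>\<omega>. F i \<omega> * \<psi> (Y n (2 * i + j) \<omega>)) \<in> borel_measurable M" if "i < N" "j \<in> {1, 2}" for i j
    using measurable_past[OF F[OF that(1)]] measurable_compose[OF Y_measurable[OF child_index[OF that]] \<psi>]
    by (intro borel_measurable_times_ennreal)
  have "(\<integral>\<^sup>+\<omega>. (\<Sum>i<N. \<Sum>j\<in>{1, 2}. F i \<omega> * \<psi> (Y n (2 * i + j) \<omega>)) \<partial>M) =
      (\<Sum>i<N. \<integral>\<^sup>+\<omega>. (\<Sum>j\<in>{1, 2}. F i \<omega> * \<psi> (Y n (2 * i + j) \<omega>)) \<partial>M)"
    by (rule nn_integral_sum) (intro borel_measurable_sum meas, auto)
  also have "\<dots> = (\<Sum>i<N. \<Sum>j\<in>{1, 2}. \<integral>\<^sup>+\<omega>. F i \<omega> * \<psi> (Y n (2 * i + j) \<omega>) \<partial>M)"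
    by (intro sum.cong refl nn_integral_sum meas) auto
  also have "\<dots> = (\<Sum>i<N. \<Sum>j\<in>{1, 2 :: nat}. (\<integral>\<^sup>+\<omega>. F i \<omega> \<partial>M) * (\<integral>\<^sup>+y. \<psi> y \<partial>D))"
    by (intro sum.cong refl nn_integral_past_mult F \<psi> child_index) auto
  also have "\<dots> = 2 * (\<Sum>i<N. \<integral>\<^sup>+\<omega>. F i \<omega> \<partial>M) * (\<integral>\<^sup>+y. \<psi> y \<partial>D)"
    by (simp add: mult_2 distrib_right sum.distrib sum_distrib_right)
  also have "(\<Sum>i<N. \<integral>\<^sup>+\<omega>. F i \<omega> \<partial>M) = (\<integral>\<^sup>+\<omega>. (\<Sum>i<N. F i \<omega>) \<partial>M)"
    by (rule nn_integral_sum[symmetric]) (rule measurable_past[OF F], auto)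
  finally show ?thesis .
qed

section \<open>Exponential moments of truncated displacements\<close>

context
  fixes \<Lambda> A H q p :: real
  assumes \<Lambda>: "0 \<le> \<Lambda>" and H: "0 \<le> H" and q: "1 \<le> q"
    and mgf: "(\<integral>\<^sup>+y. ennreal (exp (\<Lambda> * (if y \<le> A then max 0 y else 0))) \<partial>D) \<le> ennreal q"
    and tail: "measure D {A<..} \<le> p"
begin

text \<open>Displacements above \<open>A\<close> get weight 1, being accounted for separately. In
  the application \<open>A\<close> is \<open>\<delta> * c N\<close>, \<open>H\<close> is
  \<open>\<eta> * c N\<close>, \<open>\<Lambda> * H\<close> is of order \<open>ln N\<close>, and
  \<open>q\<close> is a constant slightly above 1.\<close>

abbreviation tilt :: "real \<Rightarrow> ennreal" where
  "tilt y \<equiv> ennreal (exp (\<Lambda> * (if y \<le> A then max 0 y else 0)))"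

lemma p_nonneg: "0 \<le> p"
  using tail measure_nonneg order_trans by blast

lemma tail_emeasure: "emeasure D {A<..} \<le> ennreal p"
  using tail by (simp add: finite_measure.emeasure_eq_measure[OF prob_space.finite_measure[OF prob_space_D]] ennreal_leI)

lemma tilt_measurable [measurable]: "tilt \<in> borel_measurable borel"
  by measurable

text \<open>The cap makes a displacement above \<open>A\<close> contribute at most \<open>exp (\<Lambda> * H)\<close>, which still detects
  particles that are more than \<open>H\<close> above the reference position.\<close>

definition capped :: "real \<Rightarrow> ennreal" where
  "capped x = ennreal (min (exp (\<Lambda> * max 0 x)) (exp (\<Lambda> * H)))"

lemma capped_measurable [measurable]: "capped \<in> borel_measurable borel"
  unfolding capped_def[abs_def] by measurable

text \<open>A displacement up to \<open>A\<close> multiplies the capped weight by at most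
  \<open>tilt\<close>; a larger one lifts it at most to the cap.\<close>

lemma capped_add: "capped (x + y) \<le> capped x * tilt y + ennreal (exp (\<Lambda> * H)) * indicator {A<..} y"
proof (cases "y \<le> A")
  case True
  have "exp (\<Lambda> * max 0 (x + y)) \<le> exp (\<Lambda> * max 0 x) * exp (\<Lambda> * max 0 y)"
    using \<Lambda> by (auto simp: exp_add[symmetric] distrib_left[symmetric] intro!: mult_left_mono)
  moreover have "exp (\<Lambda> * H) * 1 \<le> exp (\<Lambda> * H) * exp (\<Lambda> * max 0 y)"
    using \<Lambda> by (intro mult_left_mono) auto
  ultimately have 1: "min (exp (\<Lambda> * max 0 (x + y))) (exp (\<Lambda> * H)) \<le> min (exp (\<Lambda> * max 0 x)) (exp (\<Lambda> * H)) * exp (\<Lambda> * max 0 y)"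
  proof (cases "exp (\<Lambda> * max 0 x) \<le> exp (\<Lambda> * H)")
    case True
    then have "min (exp (\<Lambda> * max 0 x)) (exp (\<Lambda> * H)) = exp (\<Lambda> * max 0 x)"
      by (rule min_absorb1)
    then show ?thesis
      using order_trans[OF min.cobounded1 \<open>exp (\<Lambda> * max 0 (x + y)) \<le> _\<close>] by simp
  next
    case False
    then have "min (exp (\<Lambda> * max 0 x)) (exp (\<Lambda> * H)) = exp (\<Lambda> * H)"
      by (intro min_absorb2) linarith
    moreover have "min (exp (\<Lambda> * max 0 (x + y))) (exp (\<Lambda> * H)) \<le> exp (\<Lambda> * H) * exp (\<Lambda> * max 0 y)"
      using order_trans[OF min.cobounded2] \<open>exp (\<Lambda> * H) * 1 \<le> _\<close> by (metis mult.right_neutral)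
    ultimately show ?thesis
      by simp
  qed
  then show ?thesis
    using True by (simp add: capped_def ennreal_mult[symmetric] ennreal_leI)
next
  case False
  then show ?thesis
    by (auto simp: capped_def intro!: add_increasing ennreal_leI)
qed

text \<open>The total weight starts with at most \<open>N\<close>, no particle being above the
  leader. In each generation its mean is multiplied by at most \<open>2 * q\<close> and increased by
  at most the cap times \<open>2 * real N * p\<close>, a bound for the mean number of displacements
  above \<open>A\<close>.\<close>

lemma expect_capped:
  "(\<integral>\<^sup>+\<omega>. (\<Sum>i<N. capped (pos (m + k) i \<omega> - top_pos m \<omega>)) \<partial>M) \<le>
     ennreal ((2 * q) ^ k * (real N + 2 * real N * exp (\<Lambda> * H) * p * real k))"
proof (induction k)
  case 0
  have "capped (pos m i \<omega> - top_pos m \<omega>) \<le> 1" if "i < N" for i \<omega>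
    using pos_bounds(2)[OF that, of m \<omega>] by (auto simp: capped_def)
  then have "(\<integral>\<^sup>+\<omega>. (\<Sum>i<N. capped (pos (m + 0) i \<omega> - top_pos m \<omega>)) \<partial>M) \<le> (\<integral>\<^sup>+\<omega>. (\<Sum>i<N. 1) \<partial>M)"
    by (intro nn_integral_mono sum_mono) auto
  then show ?case
    by (simp add: emeasure_space_1 ennreal_of_nat_eq_real_of_nat)
next
  case (Suc k)
  let ?Z = "\<lambda>k \<omega>. \<Sum>i<N. capped (pos (m + k) i \<omega> - top_pos m \<omega>)"
  have meas: "(\<lambda>\<omega>. capped (pos (m + k) i \<omega> - top_pos m \<omega>)) \<in> borel_measurable (past (m + k))" if "i < N" for i
    by (intro measurable_compose[OF _ capped_measurable] borel_measurable_diff pos_past top_pos_past) (use that in auto)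
  have ind: "indicator {A<..} \<in> borel_measurable (borel :: real measure)"
    by measurable
  have "(\<integral>\<^sup>+\<omega>. ?Z (Suc k) \<omega> \<partial>M) \<le> (\<integral>\<^sup>+\<omega>. (\<Sum>i<N. \<Sum>j\<in>{1, 2}.
      capped (pos (m + k) i \<omega> - top_pos m \<omega>) * tilt (Y (m + k) (2 * i + j) \<omega>)
      + ennreal (exp (\<Lambda> * H)) * indicator {A<..} (Y (m + k) (2 * i + j) \<omega>)) \<partial>M)"
  proof (rule nn_integral_mono)
    fix \<omega>
    have "?Z (Suc k) \<omega> \<le> (\<Sum>i<N. \<Sum>j\<in>{1, 2}. capped (pos (m + k) i \<omega> + Y (m + k) (2 * i + j) \<omega> - top_pos m \<omega>))"
      using sum_pos_Suc_le[of "\<lambda>x. capped (x - top_pos m \<omega>)" "m + k" \<omega>] by simp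
    also have "\<dots> = (\<Sum>i<N. \<Sum>j\<in>{1, 2}. capped ((pos (m + k) i \<omega> - top_pos m \<omega>) + Y (m + k) (2 * i + j) \<omega>))"
      by (simp add: algebra_simps)
    also have "\<dots> \<le> (\<Sum>i<N. \<Sum>j\<in>{1, 2}.
      capped (pos (m + k) i \<omega> - top_pos m \<omega>) * tilt (Y (m + k) (2 * i + j) \<omega>)
      + ennreal (exp (\<Lambda> * H)) * indicator {A<..} (Y (m + k) (2 * i + j) \<omega>))"
      by (intro sum_mono capped_add)
    finally show "?Z (Suc k) \<omega> \<le> \<dots>" .
  qed
  also have "\<dots> = (\<integral>\<^sup>+\<omega>. (\<Sum>i<N. \<Sum>j\<in>{1, 2}.
      capped (pos (m + k) i \<omega> - top_pos m \<omega>) * tilt (Y (m + k) (2 * i + j) \<omega>)) \<partial>M)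
      + (\<integral>\<^sup>+\<omega>. (\<Sum>i<N. \<Sum>j\<in>{1, 2}. ennreal (exp (\<Lambda> * H)) * indicator {A<..} (Y (m + k) (2 * i + j) \<omega>)) \<partial>M)"
    unfolding sum.distrib
    by (intro nn_integral_add borel_measurable_sum borel_measurable_times_ennreal measurable_past[OF meas]
      measurable_compose[OF Y_measurable[OF child_index] tilt_measurable] measurable_const
      measurable_compose[OF Y_measurable[OF child_index] ind]) auto
  also have "\<dots> = 2 * (\<integral>\<^sup>+\<omega>. ?Z k \<omega> \<partial>M) * (\<integral>\<^sup>+y. tilt y \<partial>D)
      + 2 * (\<integral>\<^sup>+\<omega>. (\<Sum>i<N. ennreal (exp (\<Lambda> * H))) \<partial>M) * (\<integral>\<^sup>+y. indicator {A<..} y \<partial>D)"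
    by (intro arg_cong2[where f = "(+)"] nn_integral_children meas tilt_measurable ind measurable_const) auto
  also have "\<dots> \<le> 2 * (\<integral>\<^sup>+\<omega>. ?Z k \<omega> \<partial>M) * ennreal q
      + 2 * (\<integral>\<^sup>+\<omega>. (\<Sum>i<N. ennreal (exp (\<Lambda> * H))) \<partial>M) * ennreal p"
    using tail_emeasure mgf by (intro add_mono mult_left_mono) auto
  also have "\<dots> = (\<integral>\<^sup>+\<omega>. ?Z k \<omega> \<partial>M) * ennreal (2 * q) + ennreal (2 * real N * exp (\<Lambda> * H) * p)"
    using q p_nonneg
    by (simp add: emeasure_space_1 ennreal_of_nat_eq_real_of_nat ennreal_mult ennreal_mult' mult_ac)
  also have "\<dots> \<le> ennreal ((2 * q) ^ k * (real N + 2 * real N * exp (\<Lambda> * H) * p * real k)) * ennreal (2 * q)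
      + ennreal (2 * real N * exp (\<Lambda> * H) * p)"
    by (intro add_mono mult_right_mono Suc.IH) auto
  also have "\<dots> = ennreal ((2 * q) ^ Suc k * (real N + 2 * real N * exp (\<Lambda> * H) * p * real k) + 2 * real N * exp (\<Lambda> * H) * p)"
    using q p_nonneg by (simp add: ennreal_mult[symmetric] ennreal_plus[symmetric] mult_ac del: ennreal_plus)
  also have "\<dots> \<le> ennreal ((2 * q) ^ Suc k * (real N + 2 * real N * exp (\<Lambda> * H) * p * real (Suc k)))"
  proof (rule ennreal_leI)
    have "1 * (2 * real N * exp (\<Lambda> * H) * p) \<le> (2 * q) ^ Suc k * (2 * real N * exp (\<Lambda> * H) * p)"
      using q p_nonneg by (intro mult_right_mono one_le_power) auto
    then show "(2 * q) ^ Suc k * (real N + 2 * real N * exp (\<Lambda> * H) * p * real k) + 2 * real N * exp (\<Lambda> * H) * p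
      \<le> (2 * q) ^ Suc k * (real N + 2 * real N * exp (\<Lambda> * H) * p * real (Suc k))"
      by (simp add: algebra_simps)
  qed
  finally show ?case .
qed

text \<open>Markov's bound for the mean number of outliers: the estimate of
  \<open>expect_capped\<close> divided by the cap \<open>exp (\<Lambda> * H)\<close>.\<close>

definition outlier_bound :: "nat \<Rightarrow> real" where
  "outlier_bound r = (2 * q) ^ r * (real N * exp (- (\<Lambda> * H)) + 2 * real N * p * real r)"

lemma outlier_bound_nonneg: "0 \<le> outlier_bound r"
  using q p_nonneg by (simp add: outlier_bound_def)

text \<open>For \<open>n < r\<close> the truncated subtraction makes generation 0 the reference,
  where all particles are at 0.\<close>

definition outlier :: "nat \<Rightarrow> nat \<Rightarrow> nat \<Rightarrow> 'q \<Rightarrow> ennreal" where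
  "outlier r n i \<omega> = indicator {H<..} (pos n i \<omega> - top_pos (n - r) \<omega>)"

lemma outlier_past: "i < N \<Longrightarrow> outlier r n i \<in> borel_measurable (past n)"
proof -
  have [measurable]: "indicator {H<..} \<in> borel_measurable (borel :: real measure)"
    by measurable
  show "i < N \<Longrightarrow> outlier r n i \<in> borel_measurable (past n)"
    unfolding outlier_def[abs_def]
    by (intro measurable_compose[OF borel_measurable_diff[OF pos_past top_pos_past]]) auto
qed

text \<open>An outlier has reached the cap, so its capped weight times
  \<open>exp (- (\<Lambda> * H))\<close> is 1. For \<open>n < r\<close> fewer than \<open>r\<close>
  generations have passed, and the bound is increasing in their number.\<close>

lemma expect_outliers: "(\<integral>\<^sup>+\<omega>. (\<Sum>i<N. outlier r n i \<omega>) \<partial>M) \<le> ennreal (outlier_bound r)"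
proof -
  define m k where "m = n - r" and "k = n - m"
  have mk: "n = m + k" "k \<le> r"
    by (auto simp: m_def k_def)
  have meas: "(\<lambda>\<omega>. \<Sum>i<N. capped (pos (m + k) i \<omega> - top_pos m \<omega>)) \<in> borel_measurable M"
    by (intro borel_measurable_sum measurable_past[where m = "m + k"] measurable_compose[OF _ capped_measurable]
      borel_measurable_diff pos_past top_pos_past) auto
  have le: "outlier r n i \<omega> \<le> capped (pos (m + k) i \<omega> - top_pos m \<omega>) * ennreal (exp (- (\<Lambda> * H)))" for i \<omega>
  proof (cases "H < pos n i \<omega> - top_pos m \<omega>")
    case True
    then have "exp (\<Lambda> * H) \<le> exp (\<Lambda> * max 0 (pos n i \<omega> - top_pos m \<omega>))"
      using \<Lambda> by (auto intro!: mult_left_mono)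
    then have "capped (pos (m + k) i \<omega> - top_pos m \<omega>) = ennreal (exp (\<Lambda> * H))"
      using mk(1) by (simp add: capped_def min_absorb2)
    then have "capped (pos (m + k) i \<omega> - top_pos m \<omega>) * ennreal (exp (- (\<Lambda> * H))) = 1"
      by (simp add: ennreal_mult[symmetric] exp_add[symmetric] ennreal_1[symmetric] del: ennreal_1)
    then show ?thesis
      by (simp add: outlier_def indicator_def)
  next
    case False
    then show ?thesis
      by (simp add: outlier_def m_def)
  qed
  have "(\<integral>\<^sup>+\<omega>. (\<Sum>i<N. outlier r n i \<omega>) \<partial>M) \<le>
      (\<integral>\<^sup>+\<omega>. (\<Sum>i<N. capped (pos (m + k) i \<omega> - top_pos m \<omega>)) * ennreal (exp (- (\<Lambda> * H))) \<partial>M)"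
    unfolding sum_distrib_right by (intro nn_integral_mono sum_mono le)
  also have "\<dots> = (\<integral>\<^sup>+\<omega>. (\<Sum>i<N. capped (pos (m + k) i \<omega> - top_pos m \<omega>)) \<partial>M) * ennreal (exp (- (\<Lambda> * H)))"
    by (rule nn_integral_multc[OF meas])
  also have "\<dots> \<le> ennreal ((2 * q) ^ k * (real N + 2 * real N * exp (\<Lambda> * H) * p * real k)) * ennreal (exp (- (\<Lambda> * H)))"
    by (intro mult_right_mono expect_capped) auto
  also have "\<dots> = ennreal ((2 * q) ^ k * (real N * exp (- (\<Lambda> * H)) + 2 * real N * p * real k * (exp (\<Lambda> * H) * exp (- (\<Lambda> * H)))))"
    using q p_nonneg by (simp add: ennreal_mult[symmetric] algebra_simps)
  also have "exp (\<Lambda> * H) * exp (- (\<Lambda> * H)) = 1"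
    by (simp add: exp_add[symmetric])
  also have "ennreal ((2 * q) ^ k * (real N * exp (- (\<Lambda> * H)) + 2 * real N * p * real k * 1)) \<le> ennreal (outlier_bound r)"
    unfolding outlier_bound_def
  proof (intro ennreal_leI mult_mono)
    show "(2 * q) ^ k \<le> (2 * q) ^ r"
      using q mk(2) by (intro power_increasing) auto
    have "2 * real N * p * real k \<le> 2 * real N * p * real r"
      using p_nonneg mk(2) by (intro mult_left_mono) auto
    then show "real N * exp (- (\<Lambda> * H)) + 2 * real N * p * real k * 1 \<le> real N * exp (- (\<Lambda> * H)) + 2 * real N * p * real r"
      by simp
  qed (use q p_nonneg in auto)
  finally show ?thesis .
qed

definition bad_row :: "nat \<Rightarrow> nat \<Rightarrow> 'q \<Rightarrow> bool" where
  "bad_row r n \<omega> \<longleftrightarrow> (\<exists>i\<in>{..<N}. \<exists>j\<in>{1, 2}. H < pos n i \<omega> - top_pos (n - r) \<omega> \<and> A < Y n (2 * i + j) \<omega>)"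

lemma bad_row_past: "n < n' \<Longrightarrow> Measurable.pred (past n') (bad_row r n)"
proof -
  assume n: "n < n'"
  have "Measurable.pred (past n') (\<lambda>\<omega>. H < pos n i \<omega> - top_pos (n - r) \<omega> \<and> A < Y n (2 * i + j) \<omega>)"
    if "i < N" "j \<in> {1, 2}" for i j
  proof -
    have [measurable]: "pos n i \<in> borel_measurable (past n')" "top_pos (n - r) \<in> borel_measurable (past n')"
        "Y n (2 * i + j) \<in> borel_measurable (past n')"
      using n by (intro pos_past top_pos_past Y_past child_index that; simp)+
    show ?thesis
      by measurable
  qed
  then show ?thesis
    unfolding bad_row_def[abs_def] by (intro pred_intros_finite) auto
qed

text \<open>Outliers are determined by the past of their generation and hence independent of its
  displacements. The mean number of outliers is thus multiplied by at most
  \<open>2 * p\<close>.\<close>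

lemma prob_bad_row: "emeasure M {\<omega> \<in> space M. bad_row r n \<omega>} \<le> ennreal (2 * outlier_bound r * p)"
proof -
  have ind: "indicator {A<..} \<in> borel_measurable (borel :: real measure)"
    by measurable
  have ev: "{\<omega> \<in> space M. bad_row r n \<omega>} \<in> events"
    using measurable_past[OF bad_row_past[of n "Suc n" r]] by (simp add: pred_def)
  have "emeasure M {\<omega> \<in> space M. bad_row r n \<omega>} = (\<integral>\<^sup>+\<omega>. indicator {\<omega> \<in> space M. bad_row r n \<omega>} \<omega> \<partial>M)"
    using ev by simp
  also have "\<dots> \<le> (\<integral>\<^sup>+\<omega>. (\<Sum>i<N. \<Sum>j\<in>{1, 2}. outlier r n i \<omega> * indicator {A<..} (Y n (2 * i + j) \<omega>)) \<partial>M)"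
  proof (rule nn_integral_mono)
    fix \<omega>
    show "indicator {\<omega> \<in> space M. bad_row r n \<omega>} \<omega> \<le> (\<Sum>i<N. \<Sum>j\<in>{1, 2}. outlier r n i \<omega> * indicator {A<..} (Y n (2 * i + j) \<omega>))"
    proof (cases "\<omega> \<in> space M \<and> bad_row r n \<omega>")
      case True
      then obtain i j where ij: "i < N" "j \<in> {1, 2}" "H < pos n i \<omega> - top_pos (n - r) \<omega>" "A < Y n (2 * i + j) \<omega>"
        unfolding bad_row_def by blast
      have "1 = outlier r n i \<omega> * indicator {A<..} (Y n (2 * i + j) \<omega>)"
        using ij by (simp add: outlier_def)
      also have "\<dots> \<le> (\<Sum>j\<in>{1, 2}. outlier r n i \<omega> * indicator {A<..} (Y n (2 * i + j) \<omega>))"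
        using ij(2) by (intro member_le_sum) auto
      also have "\<dots> \<le> (\<Sum>i<N. \<Sum>j\<in>{1, 2}. outlier r n i \<omega> * indicator {A<..} (Y n (2 * i + j) \<omega>))"
        using ij(1) by (intro member_le_sum[where f = "\<lambda>i. \<Sum>j\<in>{1, 2}. outlier r n i \<omega> * indicator {A<..} (Y n (2 * i + j) \<omega>)"]) auto
      finally show ?thesis
        using True by simp
    qed simp
  qed
  also have "\<dots> = 2 * (\<integral>\<^sup>+\<omega>. (\<Sum>i<N. outlier r n i \<omega>) \<partial>M) * (\<integral>\<^sup>+y. indicator {A<..} y \<partial>D)"
    by (intro nn_integral_children outlier_past ind)
  also have "\<dots> \<le> 2 * ennreal (outlier_bound r) * ennreal p"
    using expect_outliers tail_emeasure by (intro mult_mono) auto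
  also have "\<dots> = ennreal (2 * outlier_bound r * p)"
    using outlier_bound_nonneg p_nonneg by (simp add: ennreal_mult ennreal_mult')
  finally show ?thesis .
qed

text \<open>If even the last particle is more than \<open>H\<close> above the reference, all
  \<open>N\<close> particles are outliers, so Markov's inequality gains a factor
  \<open>N\<close>.\<close>

lemma prob_bottom_outlier:
  "emeasure M {\<omega> \<in> space M. H < bottom_pos n \<omega> - top_pos (n - r) \<omega>} \<le> ennreal (outlier_bound r / real N)"
proof -
  let ?E = "{\<omega> \<in> space M. H < bottom_pos n \<omega> - top_pos (n - r) \<omega>}"
  have [measurable]: "pos n 0 \<in> borel_measurable M" "top_pos (n - r) \<in> borel_measurable M"
    using N by (intro measurable_past[OF pos_past] measurable_past[OF top_pos_past]; auto)+
  have ev: "?E \<in> events"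
    unfolding bottom_pos_eq by measurable
  have "ennreal (real N) * emeasure M ?E = (\<integral>\<^sup>+\<omega>. ennreal (real N) * indicator ?E \<omega> \<partial>M)"
    using ev by (simp add: nn_integral_cmult_indicator)
  also have "\<dots> \<le> (\<integral>\<^sup>+\<omega>. (\<Sum>i<N. outlier r n i \<omega>) \<partial>M)"
  proof (rule nn_integral_mono)
    fix \<omega>
    show "ennreal (real N) * indicator ?E \<omega> \<le> (\<Sum>i<N. outlier r n i \<omega>)"
    proof (cases "\<omega> \<in> ?E")
      case True
      have "outlier r n i \<omega> = 1" if "i < N" for i
        using True pos_bounds(1)[OF that, of n \<omega>] by (simp add: outlier_def)
      then show ?thesis
        using True by (simp add: ennreal_of_nat_eq_real_of_nat)
    qed simp
  qed
  also have "\<dots> \<le> ennreal (outlier_bound r)"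
    by (rule expect_outliers)
  finally have "ennreal (real N) * ennreal (prob ?E) \<le> ennreal (outlier_bound r)"
    by (simp add: emeasure_eq_measure)
  then have "real N * prob ?E \<le> outlier_bound r"
    using outlier_bound_nonneg by (simp add: ennreal_mult[symmetric])
  then show ?thesis
    using N by (simp add: emeasure_eq_measure pos_le_divide_eq mult.commute ennreal_leI)
qed

text \<open>Only displacements above \<open>A\<close> raise the envelope. As long as they start at most \<open>H\<close> above the leader
  of generation \<open>n - r\<close>, particles exceed the envelope through small displacements only.\<close>

primrec envelope :: "nat \<Rightarrow> nat \<Rightarrow> 'q \<Rightarrow> real" where
  "envelope r 0 \<omega> = 0"
| "envelope r (Suc n) \<omega> = Max (insert (envelope r n \<omega>)
     ((\<lambda>k. if A < Y n k \<omega> then top_pos (n - r) \<omega> + H + Y n k \<omega> else envelope r n \<omega>) ` {1..2 * N}))"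

declare envelope.simps(2) [simp del]

lemma envelope_past: "envelope r n \<in> borel_measurable (past n)"
proof (induction n)
  case (Suc n)
  \<comment> \<open>The index 0 stands for the inherited value, so that the maximum runs over a
    fixed finite family of measurable functions.\<close>
  let ?f = "\<lambda>k \<omega>. if k = 0 then envelope r n \<omega> else if A < Y n k \<omega> then top_pos (n - r) \<omega> + H + Y n k \<omega> else envelope r n \<omega>"
  have [measurable]: "envelope r n \<in> borel_measurable (past (Suc n))"
    by (rule measurable_past_mono[OF Suc]) simp
  have [measurable]: "top_pos (n - r) \<in> borel_measurable (past (Suc n))"
    by (rule top_pos_past) simp
  have "?f k \<in> borel_measurable (past (Suc n))" if "k \<in> {0..2 * N}" for k
  proof (cases "k = 0")
    case False
    then have [measurable]: "Y n k \<in> borel_measurable (past (Suc n))"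
      using that by (intro Y_past) auto
    show ?thesis
      using False by simp
  qed simp
  then have "(\<lambda>\<omega>. Max ((\<lambda>k. ?f k \<omega>) ` {0..2 * N})) \<in> borel_measurable (past (Suc n))"
    by (intro borel_measurable_Max) auto
  also have "(\<lambda>\<omega>. Max ((\<lambda>k. ?f k \<omega>) ` {0..2 * N})) = envelope r (Suc n)"
  proof
    fix \<omega>
    have ins: "{0..2 * N} = insert 0 {1..2 * N}"
      by auto
    have "(\<lambda>k. ?f k \<omega>) ` {0..2 * N} = insert (?f 0 \<omega>) ((\<lambda>k. ?f k \<omega>) ` {1..2 * N})"
      unfolding ins by (rule image_insert)
    also have "\<dots> = insert (envelope r n \<omega>)
        ((\<lambda>k. if A < Y n k \<omega> then top_pos (n - r) \<omega> + H + Y n k \<omega> else envelope r n \<omega>) ` {1..2 * N})"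
      by (intro arg_cong2[where f = insert] image_cong) auto
    finally show "Max ((\<lambda>k. ?f k \<omega>) ` {0..2 * N}) = envelope r (Suc n) \<omega>"
      unfolding envelope.simps by (rule arg_cong)
  qed
  finally show ?case .
qed (simp add: envelope.simps(1)[abs_def])

lemma envelope_mono: "envelope r n \<omega> \<le> envelope r (Suc n) \<omega>"
  unfolding envelope.simps by (rule Max_ge) auto

lemma envelope_ge:
  "k \<in> {1..2 * N} \<Longrightarrow> A < Y n k \<omega> \<Longrightarrow> top_pos (n - r) \<omega> + H + Y n k \<omega> \<le> envelope r (Suc n) \<omega>"
  unfolding envelope.simps by (rule Max_ge) (auto intro!: image_eqI[of _ _ k])

lemma envelope_cases:
  "envelope r n \<omega> = 0 \<or> (\<exists>m<n. \<exists>k\<in>{1..2 * N}. A < Y m k \<omega> \<and> envelope r n \<omega> = top_pos (m - r) \<omega> + H + Y m k \<omega>)"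
proof (induction n)
  case (Suc n)
  have "envelope r (Suc n) \<omega> \<in> insert (envelope r n \<omega>)
     ((\<lambda>k. if A < Y n k \<omega> then top_pos (n - r) \<omega> + H + Y n k \<omega> else envelope r n \<omega>) ` {1..2 * N})"
    unfolding envelope.simps by (rule Max_in) auto
  then consider "envelope r (Suc n) \<omega> = envelope r n \<omega>"
    | k where "k \<in> {1..2 * N}" "A < Y n k \<omega>" "envelope r (Suc n) \<omega> = top_pos (n - r) \<omega> + H + Y n k \<omega>"
    by (auto split: if_splits)
  then show ?case
  proof cases
    case 1
    then show ?thesis
      using Suc.IH less_SucI by metis
  next
    case 2
    then show ?thesis
      by blast
  qed
qed simp

definition good_past :: "nat \<Rightarrow> nat \<Rightarrow> 'q \<Rightarrow> ennreal" where
  "good_past r n \<omega> = (if \<forall>m\<in>{..<n}. \<not> bad_row r m \<omega> then 1 else 0)"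

lemma good_past_past: "good_past r n \<in> borel_measurable (past n)"
proof -
  have "Measurable.pred (past n) (\<lambda>\<omega>. \<forall>m\<in>{..<n}. \<not> bad_row r m \<omega>)"
    by (intro pred_intros_finite pred_intros_logic bad_row_past) auto
  then show ?thesis
    unfolding good_past_def[abs_def] by (intro measurable_If) (auto simp: pred_def)
qed

definition excess :: "real \<Rightarrow> ennreal" where
  "excess x = ennreal (exp (\<Lambda> * max 0 x))"

lemma excess_past: "i < N \<Longrightarrow> (\<lambda>\<omega>. good_past r n \<omega> * excess (pos n i \<omega> - envelope r n \<omega>)) \<in> borel_measurable (past n)"
proof -
  assume "i < N"
  then have [measurable]: "pos n i \<in> borel_measurable (past n)" "envelope r n \<in> borel_measurable (past n)"
      "good_past r n \<in> borel_measurable (past n)"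
    by (auto intro!: pos_past envelope_past good_past_past)
  show ?thesis
    unfolding excess_def by measurable
qed

text \<open>A large displacement that starts at most \<open>H\<close> above the reference raises the
  envelope at least to the new position, so the excess vanishes. Otherwise the excess grows only by
  a small displacement. Hence the mean weight gains at most a factor \<open>2 * q\<close> per
  generation; \<open>good_past\<close> removes the histories in which a large displacement starts
  higher.\<close>

lemma expect_excess:
  "(\<integral>\<^sup>+\<omega>. (\<Sum>i<N. good_past r n \<omega> * excess (pos n i \<omega> - envelope r n \<omega>)) \<partial>M) \<le> ennreal (real N * (2 * q) ^ n)"
proof (induction n)
  case 0
  have "(\<integral>\<^sup>+\<omega>. (\<Sum>i<N. good_past r 0 \<omega> * excess (pos 0 i \<omega> - envelope r 0 \<omega>)) \<partial>M) = (\<integral>\<^sup>+\<omega>. (\<Sum>i<N. 1) \<partial>M)"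
    by (intro nn_integral_cong sum.cong) (auto simp: good_past_def excess_def)
  then show ?case
    by (simp add: emeasure_space_1 ennreal_of_nat_eq_real_of_nat)
next
  case (Suc n)
  have step: "good_past r (Suc n) \<omega> * excess (pos n i \<omega> + Y n (2 * i + j) \<omega> - envelope r (Suc n) \<omega>) \<le>
      good_past r n \<omega> * excess (pos n i \<omega> - envelope r n \<omega>) * tilt (Y n (2 * i + j) \<omega>)"
    if i: "i < N" "j \<in> {1, 2}" for i j \<omega>
  proof (cases "\<forall>m\<in>{..<Suc n}. \<not> bad_row r m \<omega>")
    case True
    then have good: "good_past r (Suc n) \<omega> = 1" "good_past r n \<omega> = 1" "\<not> bad_row r n \<omega>"
      by (auto simp: good_past_def)
    let ?y = "Y n (2 * i + j) \<omega>"
    have "exp (\<Lambda> * max 0 (pos n i \<omega> + ?y - envelope r (Suc n) \<omega>)) \<le>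
        exp (\<Lambda> * max 0 (pos n i \<omega> - envelope r n \<omega>)) * exp (\<Lambda> * (if ?y \<le> A then max 0 ?y else 0))"
    proof -
      have "max 0 (pos n i \<omega> + ?y - envelope r (Suc n) \<omega>) \<le> max 0 (pos n i \<omega> - envelope r n \<omega>) + (if ?y \<le> A then max 0 ?y else 0)"
      proof (cases "?y \<le> A")
        case True
        then show ?thesis
          using envelope_mono[of r n \<omega>] by auto
      next
        case False
        then have "pos n i \<omega> - top_pos (n - r) \<omega> \<le> H"
          using good(3) i by (force simp: bad_row_def)
        then show ?thesis
          using False envelope_ge[OF child_index[OF i], of n \<omega> r] by auto
      qed
      then show ?thesis
        using \<Lambda> by (simp add: exp_add[symmetric] distrib_left[symmetric] mult_left_mono)
    qed
    then show ?thesis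
      using good by (simp add: excess_def ennreal_mult[symmetric] ennreal_leI)
  next
    case False
    then have "good_past r (Suc n) \<omega> = 0"
      unfolding good_past_def by (rule if_not_P)
    then show ?thesis
      by simp
  qed
  have "(\<integral>\<^sup>+\<omega>. (\<Sum>i<N. good_past r (Suc n) \<omega> * excess (pos (Suc n) i \<omega> - envelope r (Suc n) \<omega>)) \<partial>M) \<le>
      (\<integral>\<^sup>+\<omega>. (\<Sum>i<N. \<Sum>j\<in>{1, 2}. good_past r n \<omega> * excess (pos n i \<omega> - envelope r n \<omega>) * tilt (Y n (2 * i + j) \<omega>)) \<partial>M)"
  proof (rule nn_integral_mono)
    fix \<omega>
    have "(\<Sum>i<N. good_past r (Suc n) \<omega> * excess (pos (Suc n) i \<omega> - envelope r (Suc n) \<omega>)) \<le>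
        (\<Sum>i<N. \<Sum>j\<in>{1, 2}. good_past r (Suc n) \<omega> * excess (pos n i \<omega> + Y n (2 * i + j) \<omega> - envelope r (Suc n) \<omega>))"
      using sum_pos_Suc_le[of "\<lambda>x. good_past r (Suc n) \<omega> * excess (x - envelope r (Suc n) \<omega>)" n \<omega>]
      by simp
    also have "\<dots> \<le> (\<Sum>i<N. \<Sum>j\<in>{1, 2}. good_past r n \<omega> * excess (pos n i \<omega> - envelope r n \<omega>) * tilt (Y n (2 * i + j) \<omega>))"
      by (intro sum_mono step) auto
    finally show "(\<Sum>i<N. good_past r (Suc n) \<omega> * excess (pos (Suc n) i \<omega> - envelope r (Suc n) \<omega>)) \<le> \<dots>" .
  qed
  also have "\<dots> = 2 * (\<integral>\<^sup>+\<omega>. (\<Sum>i<N. good_past r n \<omega> * excess (pos n i \<omega> - envelope r n \<omega>)) \<partial>M) * (\<integral>\<^sup>+y. tilt y \<partial>D)"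
    by (intro nn_integral_children excess_past tilt_measurable)
  also have "\<dots> \<le> 2 * ennreal (real N * (2 * q) ^ n) * ennreal q"
    by (intro mult_mono Suc.IH mgf) auto
  also have "\<dots> = ennreal (real N * (2 * q) ^ Suc n)"
    using q by (simp add: ennreal_mult ennreal_mult' mult_ac)
  finally show ?case .
qed

lemma prob_excess:
  "emeasure M {\<omega> \<in> space M. (\<forall>m\<in>{..<n}. \<not> bad_row r m \<omega>) \<and> H < top_pos n \<omega> - envelope r n \<omega>}
    \<le> ennreal (real N * (2 * q) ^ n * exp (- (\<Lambda> * H)))"
proof -
  let ?E = "{\<omega> \<in> space M. (\<forall>m\<in>{..<n}. \<not> bad_row r m \<omega>) \<and> H < top_pos n \<omega> - envelope r n \<omega>}"
  let ?W = "\<lambda>\<omega>. \<Sum>i<N. good_past r n \<omega> * excess (pos n i \<omega> - envelope r n \<omega>)"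
  have [measurable]: "top_pos n \<in> borel_measurable M" "envelope r n \<in> borel_measurable M"
    by (auto intro!: measurable_past[OF top_pos_past] measurable_past[OF envelope_past])
  have [measurable]: "Measurable.pred M (\<lambda>\<omega>. \<forall>m\<in>{..<n}. \<not> bad_row r m \<omega>)"
    by (intro pred_intros_finite pred_intros_logic measurable_past[OF bad_row_past]) auto
  have ev: "?E \<in> events"
    by measurable
  have W: "?W \<in> borel_measurable M"
    by (intro borel_measurable_sum measurable_past[OF excess_past]) auto
  have "emeasure M ?E = (\<integral>\<^sup>+\<omega>. indicator ?E \<omega> \<partial>M)"
    using ev by simp
  also have "\<dots> \<le> (\<integral>\<^sup>+\<omega>. ?W \<omega> * ennreal (exp (- (\<Lambda> * H))) \<partial>M)"
  proof (rule nn_integral_mono)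
    fix \<omega>
    show "indicator ?E \<omega> \<le> ?W \<omega> * ennreal (exp (- (\<Lambda> * H)))"
    proof (cases "\<omega> \<in> ?E")
      case True
      then have "H < pos n (N - 1) \<omega> - envelope r n \<omega>" "good_past r n \<omega> = 1"
        by (auto simp: top_pos_eq good_past_def)
      then have "ennreal (exp (\<Lambda> * H)) \<le> good_past r n \<omega> * excess (pos n (N - 1) \<omega> - envelope r n \<omega>)"
        using \<Lambda> by (auto simp: excess_def intro!: ennreal_leI mult_left_mono)
      also have "\<dots> \<le> ?W \<omega>"
        using N by (intro member_le_sum[where f = "\<lambda>i. good_past r n \<omega> * excess (pos n i \<omega> - envelope r n \<omega>)"]) auto
      finally have "ennreal (exp (\<Lambda> * H)) * ennreal (exp (- (\<Lambda> * H))) \<le> ?W \<omega> * ennreal (exp (- (\<Lambda> * H)))"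
        by (rule mult_right_mono) simp
      then show ?thesis
        using True by (simp add: ennreal_mult[symmetric] exp_add[symmetric])
    qed simp
  qed
  also have "\<dots> = (\<integral>\<^sup>+\<omega>. ?W \<omega> \<partial>M) * ennreal (exp (- (\<Lambda> * H)))"
    by (rule nn_integral_multc[OF W])
  also have "\<dots> \<le> ennreal (real N * (2 * q) ^ n) * ennreal (exp (- (\<Lambda> * H)))"
    by (intro mult_right_mono expect_excess) auto
  finally show ?thesis
    using q by (simp add: ennreal_mult[symmetric])
qed

text \<open>The exceptional set joins the bad rows, the outlying last particles and the excesses
  over the envelope. Outside it the leader is at most \<open>H\<close> above the envelope, which is
  0 or one large displacement added to \<open>H\<close> plus the lagged leader; hence the error
  \<open>2 * H\<close>.\<close>

lemma upper_recursion:
  obtains E where "E \<in> events"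
    "prob E \<le> real n1 * (2 * outlier_bound r * p) + real (Suc n1) * (outlier_bound r / real N)
      + real (Suc n1) * (real N * (2 * q) ^ n1 * exp (- (\<Lambda> * H)))"
    "\<And>\<omega> n. \<omega> \<in> space M - E \<Longrightarrow> n \<le> n1 \<Longrightarrow> bottom_pos n \<omega> \<le> top_pos (n - r) \<omega> + H"
    "\<And>\<omega> n. \<omega> \<in> space M - E \<Longrightarrow> n \<le> n1 \<Longrightarrow> top_pos n \<omega> \<le> H \<or>
      (\<exists>m<n. \<exists>k\<in>{1..2 * N}. A < Y m k \<omega> \<and> top_pos n \<omega> \<le> top_pos (m - r) \<omega> + Y m k \<omega> + 2 * H)"
proof -
  define E1 where "E1 n = {\<omega> \<in> space M. bad_row r n \<omega>}" for n
  define E2 where "E2 n = {\<omega> \<in> space M. H < bottom_pos n \<omega> - top_pos (n - r) \<omega>}" for n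
  define E3 where "E3 n = {\<omega> \<in> space M. (\<forall>m\<in>{..<n}. \<not> bad_row r m \<omega>) \<and> H < top_pos n \<omega> - envelope r n \<omega>}" for n
  have [measurable]: "top_pos n \<in> borel_measurable M" "envelope r n \<in> borel_measurable M" "pos n 0 \<in> borel_measurable M" for n
    using N by (auto intro!: measurable_past[OF top_pos_past] measurable_past[OF envelope_past] measurable_past[OF pos_past])
  have [measurable]: "Measurable.pred M (bad_row r n)" for n
    by (rule measurable_past[OF bad_row_past[of n "Suc n"]]) simp
  have ev: "E1 n \<in> events" "E2 n \<in> events" "E3 n \<in> events" for n
    unfolding E1_def E2_def E3_def bottom_pos_eq by measurable
  have p1: "prob (E1 n) \<le> 2 * outlier_bound r * p" for n
    using prob_bad_row[of r n] outlier_bound_nonneg p_nonneg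
    by (simp add: E1_def emeasure_eq_measure)
  have p2: "prob (E2 n) \<le> outlier_bound r / real N" for n
    using prob_bottom_outlier[of n r] outlier_bound_nonneg by (simp add: E2_def emeasure_eq_measure)
  have p3: "prob (E3 n) \<le> real N * (2 * q) ^ n1 * exp (- (\<Lambda> * H))" if "n \<le> n1" for n
  proof -
    have "prob (E3 n) \<le> real N * (2 * q) ^ n * exp (- (\<Lambda> * H))"
      using prob_excess[of n r] q by (simp add: E3_def emeasure_eq_measure)
    also have "\<dots> \<le> real N * (2 * q) ^ n1 * exp (- (\<Lambda> * H))"
      using q that by (intro mult_right_mono mult_left_mono power_increasing) auto
    finally show ?thesis .
  qed
  show thesis
  proof (rule that[of "(\<Union>n<n1. E1 n) \<union> (\<Union>n\<le>n1. E2 n) \<union> (\<Union>n\<le>n1. E3 n)"])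
    show "(\<Union>n<n1. E1 n) \<union> (\<Union>n\<le>n1. E2 n) \<union> (\<Union>n\<le>n1. E3 n) \<in> events"
      using ev by auto
    have "prob ((\<Union>n<n1. E1 n) \<union> (\<Union>n\<le>n1. E2 n) \<union> (\<Union>n\<le>n1. E3 n))
        \<le> prob (\<Union>n<n1. E1 n) + prob (\<Union>n\<le>n1. E2 n) + prob (\<Union>n\<le>n1. E3 n)"
      using ev by (intro order_trans[OF measure_Un_le] add_mono measure_Un_le sets.Un sets.finite_UN) auto
    also have "\<dots> \<le> (\<Sum>n<n1. prob (E1 n)) + (\<Sum>n\<le>n1. prob (E2 n)) + (\<Sum>n\<le>n1. prob (E3 n))"
      using ev by (intro add_mono measure_UNION_le) auto
    also have "\<dots> \<le> (\<Sum>n<n1. 2 * outlier_bound r * p) + (\<Sum>n\<le>n1. outlier_bound r / real N)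
        + (\<Sum>n\<le>n1. real N * (2 * q) ^ n1 * exp (- (\<Lambda> * H)))"
      by (intro add_mono sum_mono p1 p2 p3) auto
    finally show "prob ((\<Union>n<n1. E1 n) \<union> (\<Union>n\<le>n1. E2 n) \<union> (\<Union>n\<le>n1. E3 n)) \<le>
      real n1 * (2 * outlier_bound r * p) + real (Suc n1) * (outlier_bound r / real N)
      + real (Suc n1) * (real N * (2 * q) ^ n1 * exp (- (\<Lambda> * H)))"
      by simp
    fix \<omega> n assume \<omega>: "\<omega> \<in> space M - ((\<Union>n<n1. E1 n) \<union> (\<Union>n\<le>n1. E2 n) \<union> (\<Union>n\<le>n1. E3 n))" and n: "n \<le> n1"
    then have "\<omega> \<notin> E2 n" "\<omega> \<notin> E3 n" and good: "\<forall>m\<in>{..<n}. \<not> bad_row r m \<omega>" and sp: "\<omega> \<in> space M"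
      by (auto simp: E1_def)
    then show "bottom_pos n \<omega> \<le> top_pos (n - r) \<omega> + H"
      by (auto simp: E2_def)
    have "top_pos n \<omega> \<le> envelope r n \<omega> + H"
      using \<open>\<omega> \<notin> E3 n\<close> good sp by (auto simp: E3_def)
    then show "top_pos n \<omega> \<le> H \<or>
      (\<exists>m<n. \<exists>k\<in>{1..2 * N}. A < Y m k \<omega> \<and> top_pos n \<omega> \<le> top_pos (m - r) \<omega> + Y m k \<omega> + 2 * H)"
      using envelope_cases[of r n \<omega>] by auto force
  qed
qed

end

end

section \<open>The stairs process as a near-staircase\<close>

lemma skorokhod_space_monoI:
  fixes x :: "real \<Rightarrow> real"
  assumes mono: "mono x" and right: "\<And>t. 0 \<le> t \<Longrightarrow> (x \<longlongrightarrow> x t) (at_right t)"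
  shows "restrict x {0..} \<in> skorokhod_space"
  unfolding skorokhod_space_def
proof (intro CollectI conjI allI impI)
  show "restrict x {0..} \<in> extensional {0..}" by simp
  fix t :: real
  assume t: "0 \<le> t"
  have "\<forall>\<^sub>F u in at_right t. restrict x {0..} u = x u"
    using eventually_at_right_less[of t] by eventually_elim (use t in auto)
  then show "(restrict x {0..} \<longlongrightarrow> restrict x {0..} t) (at_right t)"
    using right[OF t] t by (simp add: tendsto_cong)
next
  fix t :: real
  assume t: "0 < t"
  have bdd: "bdd_above (x ` {..<t})"
    by (rule bdd_aboveI2[of _ _ "x t"]) (auto intro!: monoD[OF mono])
  have "(x \<longlongrightarrow> Sup (x ` {..<t})) (at_left t)"
  proof (rule increasing_tendsto)
    show "\<forall>\<^sub>F u in at_left t. x u \<le> Sup (x ` {..<t})"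
    proof -
      have "\<forall>\<^sub>F u in at_left t. u \<in> {t - 1<..<t}"
        by (rule eventually_at_left_real) simp
      then show ?thesis
        by eventually_elim (auto intro!: cSUP_upper bdd)
    qed
    fix v assume "v < Sup (x ` {..<t})"
    then obtain r where r: "r < t" "v < x r"
      using less_cSUP_iff[OF _ bdd] by auto
    show "\<forall>\<^sub>F u in at_left t. v < x u"
      using eventually_at_left_real[OF r(1)]
      by eventually_elim (use r(2) in \<open>auto intro: less_le_trans[OF _ monoD[OF mono]]\<close>)
  qed
  moreover have "\<forall>\<^sub>F u in at_left t. restrict x {0..} u = x u"
    using eventually_at_left_real[OF t] by eventually_elim auto
  ultimately show "\<exists>l. (restrict x {0..} \<longlongrightarrow> l) (at_left t)"
    by (auto simp: tendsto_cong)
qed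

lemma skorokhod_space_Pair:
  fixes x y :: "real \<Rightarrow> real"
  assumes x: "restrict x {0..} \<in> skorokhod_space" and y: "restrict y {0..} \<in> skorokhod_space"
  shows "(\<lambda>t\<in>{0..}. (x t, y t)) \<in> skorokhod_space"
proof -
  have eq: "(\<lambda>t\<in>{0..}. (x t, y t)) u = (restrict x {0..} u, restrict y {0..} u)" if "0 \<le> u" for u
    using that by simp
  have right: "\<forall>\<^sub>F u in at_right t. (restrict x {0..} u, restrict y {0..} u) = (\<lambda>t\<in>{0..}. (x t, y t)) u" if "0 \<le> t" for t
    using eventually_at_right_less[of t] by eventually_elim (use that in auto)
  have left: "\<forall>\<^sub>F u in at_left t. (restrict x {0..} u, restrict y {0..} u) = (\<lambda>t\<in>{0..}. (x t, y t)) u" if "0 < t" for t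
    using eventually_at_left_real[OF that] by eventually_elim auto
  show ?thesis
    unfolding skorokhod_space_def
  proof (intro CollectI conjI allI impI)
    fix t :: real
    assume t: "0 \<le> t"
    have "((\<lambda>u. (restrict x {0..} u, restrict y {0..} u)) \<longlongrightarrow> (restrict x {0..} t, restrict y {0..} t)) (at_right t)"
      using x y t unfolding skorokhod_space_def by (intro tendsto_Pair) blast+
    then show "((\<lambda>t\<in>{0..}. (x t, y t)) \<longlongrightarrow> (\<lambda>t\<in>{0..}. (x t, y t)) t) (at_right t)"
      unfolding eq[OF t] by (rule Lim_transform_eventually) (rule right[OF t])
  next
    fix t :: real
    assume t: "0 < t"
    obtain l l' where "(restrict x {0..} \<longlongrightarrow> l) (at_left t)" "(restrict y {0..} \<longlongrightarrow> l') (at_left t)"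
      using x y t unfolding skorokhod_space_def by blast
    then have "((\<lambda>u. (restrict x {0..} u, restrict y {0..} u)) \<longlongrightarrow> (l, l')) (at_left t)"
      by (rule tendsto_Pair)
    then have "((\<lambda>t\<in>{0..}. (x t, y t)) \<longlongrightarrow> (l, l')) (at_left t)"
      by (rule Lim_transform_eventually) (rule left[OF t])
    then show "\<exists>l. ((\<lambda>t\<in>{0..}. (x t, y t)) \<longlongrightarrow> l) (at_left t)"
      by blast
  qed simp
qed

lemma near_staircase_cong:
  assumes "\<And>t. 0 \<le> t \<Longrightarrow> x t = y t"
  shows "near_staircase m n d \<delta> \<epsilon> x \<longleftrightarrow> near_staircase m n d \<delta> \<epsilon> y"
proof -
  have imp: "near_staircase m n d \<delta> \<epsilon> y" if x: "near_staircase m n d \<delta> \<epsilon> x" and eq: "\<And>t. 0 \<le> t \<Longrightarrow> x t = y t" for x y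
  proof -
    have pos: "0 \<le> t" if "t \<in> {real i / m<..real (Suc i) / m}" for t i
      using that order_trans[of 0 "real i / m" t] by auto
    obtain s where s: "\<forall>i<n. s i \<in> {real i / m<..real (Suc i) / m} \<and>
        (\<forall>t\<in>{real i / m<..real (Suc i) / m}.
           \<bar>x t - \<delta> * heights m d (if s i \<le> t then Suc i else i)\<bar> \<le> \<epsilon>)"
      using x unfolding near_staircase_def by blast
    have "\<forall>i<n. s i \<in> {real i / m<..real (Suc i) / m} \<and>
        (\<forall>t\<in>{real i / m<..real (Suc i) / m}.
           \<bar>y t - \<delta> * heights m d (if s i \<le> t then Suc i else i)\<bar> \<le> \<epsilon>)"
      using s eq[OF pos] by metis
    moreover have "y 0 = 0" "mono_on {0..} y"
      using x eq unfolding near_staircase_def mono_on_def by auto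
    ultimately show ?thesis
      unfolding near_staircase_def by blast
  qed
  show ?thesis
    using imp[of x y] imp[of y x] assms by auto
qed

text \<open>To the right of \<open>t\<close> the staircase is constant up to the next jump position
  or the end of the cell, so the path oscillates there by at most twice the tolerance. In this way
  right continuity of the stairs process comes from its approximations.\<close>

lemma near_staircase_right_continuous:
  assumes near: "\<And>\<epsilon>. 0 < \<epsilon> \<Longrightarrow> \<exists>m n d \<delta> \<epsilon>'. 0 < m \<and> t < real n / m \<and> 0 \<le> \<epsilon>' \<and> \<epsilon>' \<le> \<epsilon> \<and> near_staircase m n d \<delta> \<epsilon>' x"
    and t: "0 \<le> t"
  shows "(x \<longlongrightarrow> x t) (at_right t)"
proof (rule tendstoI)
  fix e :: real assume e: "0 < e"
  obtain m n d \<delta> \<epsilon> where st: "0 < m" "t < real n / m" "0 \<le> \<epsilon>" "\<epsilon> \<le> e / 3" "near_staircase m n d \<delta> \<epsilon> x"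
    using near[of "e / 3"] e by auto
  obtain s where s: "\<And>i. i < n \<Longrightarrow> s i \<in> {real i / m<..real (Suc i) / m}"
      "\<And>i t. i < n \<Longrightarrow> t \<in> {real i / m<..real (Suc i) / m} \<Longrightarrow>
        \<bar>x t - \<delta> * heights m d (if s i \<le> t then Suc i else i)\<bar> \<le> \<epsilon>"
    using st(5) unfolding near_staircase_def by blast
  have m0: "0 < real m" using st(1) by simp
  define i where "i = nat \<lfloor>t * m\<rfloor>"
  have "0 \<le> t * m" using t m0 by simp
  then have "real i \<le> t * m" "t * m < real (Suc i)"
    by (auto simp: i_def) linarith+
  then have i: "real i / m \<le> t" "t < real (Suc i) / m"
    using m0 by (simp_all add: pos_divide_le_eq pos_less_divide_eq)
  have "real i / m < real n / m"
    using i(1) st(2) by simp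
  then have iN: "i < n"
    using m0 by (simp add: divide_less_cancel)
  define b where "b = (if t < s i then s i else real (Suc i) / m)"
  have b: "t < b" "b \<le> real (Suc i) / m"
    using i s(1)[OF iN] by (auto simp: b_def)
  define k where "k = (if t < s i then i else Suc i)"
  have xt: "\<bar>x t - \<delta> * heights m d k\<bar> \<le> \<epsilon>"
  proof (cases "t = real i / m")
    case True
    then have "t < s i" using s(1)[OF iN] by simp
    then show ?thesis
      using near_staircase_grid[OF st(5), of i] iN st True by (simp add: k_def)
  next
    case False
    then show ?thesis
      using s(2)[OF iN, of t] i by (auto simp: k_def not_less)
  qed
  have xu: "\<bar>x u - \<delta> * heights m d k\<bar> \<le> \<epsilon>" if "u \<in> {t<..<b}" for u
  proof -
    have "u \<in> {real i / m<..real (Suc i) / m}" "(s i \<le> u) \<longleftrightarrow> \<not> t < s i"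
      using that i b by (auto simp: b_def split: if_splits)
    then show ?thesis
      using s(2)[OF iN, of u] by (simp add: k_def split: if_splits del: heights.simps of_nat_Suc)
  qed
  show "\<forall>\<^sub>F u in at_right t. dist (x u) (x t) < e"
    using eventually_at_right_real[OF b(1)]
  proof eventually_elim
    case (elim u)
    then show ?case
      using xt xu[of u] st(4) e unfolding dist_real_def by linarith
  qed
qed

text \<open>Boundedness on left half-lines keeps the suprema in the recursion of
  \<open>stairs\<close> finite; an unbounded supremum of reals would be unspecified.\<close>

locale jump_path =
  fixes \<xi> :: "real \<Rightarrow> real"
  assumes nonneg: "0 \<le> \<xi> t" and zero: "t \<le> 0 \<Longrightarrow> \<xi> t = 0" and bounded: "\<exists>C. \<forall>t\<le>T. \<xi> t \<le> C"
begin

lemma stairs_nonpos: "t \<le> 0 \<Longrightarrow> stairs \<xi> t = 0"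
  by (simp add: stairs.simps[of \<xi> t])

lemma stairs_bounded: "\<exists>C. \<forall>t\<le>real n. 0 \<le> stairs \<xi> t \<and> stairs \<xi> t \<le> C"
proof (induction n)
  case 0
  then show ?case using stairs_nonpos by auto
next
  case (Suc n)
  then obtain C where C: "\<And>t. t \<le> real n \<Longrightarrow> 0 \<le> stairs \<xi> t \<and> stairs \<xi> t \<le> C" by blast
  obtain B where B: "\<And>t. t \<le> real (Suc n) \<Longrightarrow> \<xi> t \<le> B"
    using bounded[of "real (Suc n)"] by blast
  have "0 \<le> stairs \<xi> t \<and> stairs \<xi> t \<le> max 0 (C + B)" if t: "t \<le> real (Suc n)" for t
  proof (cases "t \<le> 0")
    case False
    have le: "stairs \<xi> (t - s - 1) + \<xi> (t - s) \<le> C + B" and ge: "0 \<le> stairs \<xi> (t - s - 1) + \<xi> (t - s)" if "s \<in> {0..1}" for s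
      using that t B[of "t - s"] C[of "t - s - 1"] nonneg[of "t - s"] by auto
    have eq: "stairs \<xi> t = (SUP s\<in>{0..1}. stairs \<xi> (t - s - 1) + \<xi> (t - s))"
      using False by (simp add: stairs.simps[of \<xi> t])
    have "stairs \<xi> t \<le> C + B"
      unfolding eq by (intro cSUP_least le) auto
    moreover have "stairs \<xi> (t - 0 - 1) + \<xi> (t - 0) \<le> stairs \<xi> t"
      unfolding eq by (intro cSUP_upper bdd_aboveI2[of _ _ "C + B"] le) auto
    ultimately show ?thesis
      using ge[of 0] by auto
  qed (simp add: stairs_nonpos)
  then show ?case by blast
qed

lemma stairs_nonneg: "0 \<le> stairs \<xi> t"
proof -
  obtain n where "t \<le> real n"
    using real_arch_simple by blast
  then show ?thesis
    using stairs_bounded[of n] by blast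
qed

lemma stairs_window_ge:
  assumes "0 < t" "s \<in> {0..1}"
  shows "stairs \<xi> (t - s - 1) + \<xi> (t - s) \<le> stairs \<xi> t"
proof -
  obtain n where n: "t \<le> real n"
    using real_arch_simple by blast
  obtain C where C: "\<And>t. t \<le> real n \<Longrightarrow> stairs \<xi> t \<le> C"
    using stairs_bounded[of n] by blast
  obtain B where B: "\<And>u. u \<le> t \<Longrightarrow> \<xi> u \<le> B"
    using bounded[of t] by blast
  have "bdd_above ((\<lambda>s. stairs \<xi> (t - s - 1) + \<xi> (t - s)) ` {0..1})"
    by (rule bdd_aboveI2[of _ _ "C + B"]) (use n in \<open>auto intro!: add_mono C B\<close>)
  from cSUP_upper[OF assms(2) this] show ?thesis
    using assms(1) by (simp add: stairs.simps[of \<xi> t])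
qed

text \<open>A jump time in the window of \<open>t\<close> lies either in the window of
  \<open>u\<close> or before \<open>u - 1\<close>. In the second case its contribution is at most
  the height at the jump time, which by induction is at most the height at \<open>u - 1\<close> and
  so at \<open>u\<close>.\<close>

lemma mono_stairs: "mono (stairs \<xi>)"
proof -
  have "stairs \<xi> t \<le> stairs \<xi> u" if "t \<le> u" "u \<le> real n" for t u n
    using that
  proof (induction n arbitrary: t u)
    case 0
    then show ?case using stairs_nonpos by simp
  next
    case (Suc n)
    show ?case
    proof (cases "t \<le> 0")
      case True
      then show ?thesis using stairs_nonpos stairs_nonneg by simp
    next
      case False
      have "stairs \<xi> (t - s - 1) + \<xi> (t - s) \<le> stairs \<xi> u" if s: "s \<in> {0..1}" for s
      proof (cases "u - 1 \<le> t - s")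
        case True
        then show ?thesis
          using stairs_window_ge[of u "u - (t - s)"] False Suc.prems s by simp
      next
        case *: False
        have "stairs \<xi> (t - s - 1) + \<xi> (t - s) \<le> stairs \<xi> (t - s)"
          using stairs_window_ge[of "t - s" 0] stairs_nonpos[of "t - s"] stairs_nonpos[of "t - s - 1"] zero[of "t - s"]
          by (cases "0 < t - s") auto
        also have "\<dots> \<le> stairs \<xi> (u - 1)"
          using * Suc.prems by (intro Suc.IH) auto
        also have "\<dots> \<le> stairs \<xi> u"
          using stairs_window_ge[of u 0] nonneg[of u] False Suc.prems by simp
        finally show ?thesis .
      qed
      then show ?thesis
        using False by (subst stairs.simps) (auto intro!: cSUP_least)
    qed
  qed
  then show ?thesis
    using real_arch_simple by (meson monoI)
qed

lemma stairs_ge: "s \<le> t \<Longrightarrow> stairs \<xi> (s - 1) + \<xi> s \<le> stairs \<xi> t"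
proof (cases "0 < s")
  case True
  assume "s \<le> t"
  then show ?thesis
    using stairs_window_ge[OF True, of 0] monoD[OF mono_stairs, of s t] by simp
next
  case False
  then show ?thesis
    using stairs_nonpos[of "s - 1"] zero[of s] stairs_nonneg[of t] by simp
qed

lemma stairs_le:
  assumes "0 < t" "\<And>s. t - 1 \<le> s \<Longrightarrow> s \<le> t \<Longrightarrow> stairs \<xi> (s - 1) + \<xi> s \<le> c"
  shows "stairs \<xi> t \<le> c"
  using assms(1) by (subst stairs.simps) (auto intro!: cSUP_least assms(2))

text \<open>A small jump contributes at most \<open>\<delta>\<close>, and rounding a large jump down
  loses at most \<open>\<delta>\<close>. Only one of these errors concerns a given jump, so the
  criterion applies with \<open>e = \<delta>\<close>.\<close>

lemma near_staircase_stairs: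
  assumes m: "3 \<le> m" and \<delta>: "0 \<le> \<delta>" and sep: "well_separated m n d"
    and unflagged: "\<And>i t. i < n \<Longrightarrow> d i = 0 \<Longrightarrow> t \<in> {real i / m<..real (Suc i) / m} \<Longrightarrow> \<xi> t \<le> \<delta>"
    and flagged: "\<And>i. i < n \<Longrightarrow> d i \<noteq> 0 \<Longrightarrow> \<exists>s\<in>{real i / m<..real (Suc i) / m}. \<delta> * d i \<le> \<xi> s \<and> \<xi> s \<le> \<delta> * (d i + 1) \<and>
      (\<forall>t\<in>{real i / m<..real (Suc i) / m}. t \<noteq> s \<longrightarrow> \<xi> t \<le> \<delta>)"
  shows "near_staircase m n d \<delta> ((2 * (real n / m) + 1) * \<delta>) (stairs \<xi>)"
proof -
  have m0: "0 < real m" using m by simp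
  have "\<exists>s\<in>{real i / m<..real (Suc i) / m}. d i \<noteq> 0 \<longrightarrow> \<delta> * d i \<le> \<xi> s \<and> \<xi> s \<le> \<delta> * (d i + 1) \<and>
      (\<forall>t\<in>{real i / m<..real (Suc i) / m}. t \<noteq> s \<longrightarrow> \<xi> t \<le> \<delta>)" if "i < n" for i
  proof (cases "d i = 0")
    case True
    then show ?thesis
      using m0 by (intro bexI[of _ "real (Suc i) / m"]) (auto intro!: divide_strict_right_mono)
  qed (use flagged[OF that] in auto)
  then obtain s where s: "\<And>i. i < n \<Longrightarrow> s i \<in> {real i / m<..real (Suc i) / m}"
      "\<And>i. i < n \<Longrightarrow> d i \<noteq> 0 \<Longrightarrow> \<delta> * d i \<le> \<xi> (s i) \<and> \<xi> (s i) \<le> \<delta> * (d i + 1)"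
      "\<And>i t. i < n \<Longrightarrow> d i \<noteq> 0 \<Longrightarrow> t \<in> {real i / m<..real (Suc i) / m} \<Longrightarrow> t \<noteq> s i \<Longrightarrow> \<xi> t \<le> \<delta>"
    by metis
  show ?thesis
  proof (rule near_staircaseI[OF m \<delta> \<delta> stairs_nonpos mono_stairs s(1) sep])
    fix i assume i: "i < n" "d i \<noteq> 0"
    have "stairs \<xi> (s i - 1 - 1 / m) \<le> stairs \<xi> (s i - 1)"
      using m0 by (intro monoD[OF mono_stairs]) simp
    then show "stairs \<xi> (s i - 1 - 1 / m) + \<delta> * d i \<le> stairs \<xi> (s i)"
      using s(2)[OF i] stairs_ge[of "s i" "s i"] by simp
  next
    fix t assume t: "0 < t" "t \<le> real n / m"
    define I where "I = {i. i < n \<and> d i \<noteq> 0 \<and> s i \<le> t}"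
    \<comment> \<open>The supremum in \<open>stairs\<close> is not known to be attained. Bounding it
      by the maximum of a finite set of candidates allows one of them to be selected.\<close>
    define S where "S = insert (stairs \<xi> (t - 1/2) + \<delta>) ((\<lambda>i. stairs \<xi> (s i - 1 + 1 / m) + \<delta> * d i + \<delta>) ` I)"
    have S: "finite S" "S \<noteq> {}"
      by (auto simp: S_def I_def)
    have "stairs \<xi> t \<le> Max S"
    proof (rule stairs_le[OF t(1)])
      fix u assume u: "t - 1 \<le> u" "u \<le> t"
      have small: "stairs \<xi> (u - 1) + \<xi> u \<le> Max S" if "\<xi> u \<le> \<delta>"
      proof -
        have "stairs \<xi> (u - 1) \<le> stairs \<xi> (t - 1/2)"
          using u by (intro monoD[OF mono_stairs]) simp
        then have "stairs \<xi> (u - 1) + \<xi> u \<le> stairs \<xi> (t - 1/2) + \<delta>"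
          using that by simp
        also have "\<dots> \<le> Max S"
          using S by (intro Max_ge) (auto simp: S_def)
        finally show ?thesis .
      qed
      show "stairs \<xi> (u - 1) + \<xi> u \<le> Max S"
      proof (cases "u \<le> 0")
        case True
        then show ?thesis using small zero[of u] \<delta> by simp
      next
        case False
        define i where "i = nat (\<lceil>u * m\<rceil> - 1)"
        have "0 < u * m" using False m0 by simp
        then have "1 \<le> \<lceil>u * m\<rceil>" by linarith
        then have "real i = of_int \<lceil>u * m\<rceil> - 1"
          by (simp add: i_def)
        then have "real i < u * m" "u * m \<le> real (Suc i)"
          by linarith+
        then have i: "u \<in> {real i / m<..real (Suc i) / m}"
          using m0 by (simp add: pos_divide_less_eq pos_le_divide_eq)
        have "real i / m < real n / m"
          using i u t by simp
        then have iN: "i < n"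
          using m0 by (simp add: divide_less_cancel)
        show ?thesis
        proof (cases "d i \<noteq> 0 \<and> u = s i")
          case True
          have "stairs \<xi> (u - 1) \<le> stairs \<xi> (s i - 1 + 1 / m)"
            using True m0 by (intro monoD[OF mono_stairs]) simp
          then have "stairs \<xi> (u - 1) + \<xi> u \<le> stairs \<xi> (s i - 1 + 1 / m) + \<delta> * d i + \<delta>"
            using s(2)[OF iN] True by (simp add: distrib_left)
          also have "\<dots> \<le> Max S"
            using S True iN u by (intro Max_ge) (auto simp: S_def I_def)
          finally show ?thesis .
        next
          case False
          then have "\<xi> u \<le> \<delta>"
            using unflagged[OF iN _ i] s(3)[OF iN _ i] by auto
          then show ?thesis
            by (rule small)
        qed
      qed
    qed
    moreover have "Max S \<in> S"
      using S by (rule Max_in)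
    ultimately show "stairs \<xi> t \<le> stairs \<xi> (t - 1/2) + \<delta> \<or>
      (\<exists>i<n. d i \<noteq> 0 \<and> s i \<le> t \<and> stairs \<xi> t \<le> stairs \<xi> (s i - 1 + 1 / m) + \<delta> * d i + \<delta>)"
      by (auto simp: S_def I_def)
  qed
qed

end

text \<open>For a decreasing predicate this is the largest level \<open>q \<le> Q\<close> that is exceeded, i.e. the size of the
  largest displacement in a cell, rounded down.\<close>

definition level_count :: "nat \<Rightarrow> (nat \<Rightarrow> bool) \<Rightarrow> nat" where
  "level_count Q ex = card {q \<in> {1..Q}. ex q}"

section \<open>Levels of cells and their joint law\<close>

lemma level_count_less_iff:
  assumes anti: "antimono ex" and q: "1 \<le> q" "q \<le> Q"
  shows "level_count Q ex < q \<longleftrightarrow> \<not> ex q"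
proof
  assume "\<not> ex q"
  then have "{r \<in> {1..Q}. ex r} \<subseteq> {1..<q}"
    using antimonoD[OF anti, of q] by (auto simp: not_le[symmetric])
  then have "level_count Q ex \<le> card {1..<q}"
    unfolding level_count_def by (intro card_mono) auto
  then show "level_count Q ex < q"
    using q by simp
next
  assume less: "level_count Q ex < q"
  show "\<not> ex q"
  proof
    assume "ex q"
    then have "{1..q} \<subseteq> {r \<in> {1..Q}. ex r}"
      using antimonoD[OF anti, of _ q] q by auto
    then have "card {1..q} \<le> level_count Q ex"
      unfolding level_count_def by (intro card_mono) auto
    then show False
      using less by simp
  qed
qed

lemma level_count_le: "level_count Q ex \<le> Q"
  unfolding level_count_def by (rule order_trans[OF card_mono[of "{1..Q}"]]) auto

lemma level_count_measurable [measurable]: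
  assumes [measurable]: "\<And>q. Measurable.pred M (ex q)"
  shows "(\<lambda>\<omega>. level_count Q (\<lambda>q. ex q \<omega>)) \<in> measurable M (count_space UNIV)"
proof -
  have "level_count Q (\<lambda>q. ex q \<omega>) = (\<Sum>q\<in>{1..Q}. if ex q \<omega> then 1 else 0)" for \<omega>
    by (simp add: level_count_def sum.If_cases Int_def)
  then show ?thesis
    by simp
qed

text \<open>The joint law of finitely many level counts is determined by the void probabilities.\<close>

lemma level_count_law_converges:
  fixes ex :: "nat \<Rightarrow> nat \<Rightarrow> 'v \<Rightarrow> bool" and exn :: "nat \<Rightarrow> nat \<Rightarrow> nat \<Rightarrow> 'w \<Rightarrow> bool"
  assumes M: "prob_space M" and Ms: "\<forall>\<^sub>F N in sequentially. prob_space (Ms N)"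
    and meas: "\<And>i q. Measurable.pred M (ex i q)"
    and measn: "\<forall>\<^sub>F N in sequentially. \<forall>i q. Measurable.pred (Ms N) (exn N i q)"
    and anti: "\<And>i \<omega>. antimono (\<lambda>q. ex i q \<omega>)" and antin: "\<And>N i \<omega>. antimono (\<lambda>q. exn N i q \<omega>)"
    and void: "\<And>A r. finite A \<Longrightarrow> (\<And>i. i \<in> A \<Longrightarrow> 1 \<le> r i) \<Longrightarrow>
      (\<lambda>N. measure (Ms N) {\<omega> \<in> space (Ms N). \<forall>i\<in>A. \<not> exn N i (r i) \<omega>}) \<longlonglongrightarrow>
        measure M {\<omega> \<in> space M. \<forall>i\<in>A. \<not> ex i (r i) \<omega>}"
    and Q: "1 \<le> Q" and B: "finite B"
  shows "finite A \<Longrightarrow> A \<inter> B = {} \<Longrightarrow> (\<And>i. i \<in> A \<Longrightarrow> 1 \<le> r i) \<Longrightarrow>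
    (\<lambda>N. measure (Ms N) {\<omega> \<in> space (Ms N). (\<forall>i\<in>A. \<not> exn N i (r i) \<omega>) \<and> (\<forall>i\<in>B. level_count Q (\<lambda>q. exn N i q \<omega>) = e i)})
    \<longlonglongrightarrow> measure M {\<omega> \<in> space M. (\<forall>i\<in>A. \<not> ex i (r i) \<omega>) \<and> (\<forall>i\<in>B. level_count Q (\<lambda>q. ex i q \<omega>) = e i)}"
  using B
proof (induction B arbitrary: A r rule: finite_induct)
  case empty
  then show ?case
    using void by simp
next
  case (insert b B)
  let ?F = "{\<omega> \<in> space M. (\<forall>i\<in>A. \<not> ex i (r i) \<omega>) \<and> (\<forall>i\<in>insert b B. level_count Q (\<lambda>q. ex i q \<omega>) = e i)}"
  let ?Fn = "\<lambda>N. {\<omega> \<in> space (Ms N). (\<forall>i\<in>A. \<not> exn N i (r i) \<omega>) \<and> (\<forall>i\<in>insert b B. level_count Q (\<lambda>q. exn N i q \<omega>) = e i)}"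
  define E where "E = (\<lambda>A r. {\<omega> \<in> space M. (\<forall>i\<in>A. \<not> ex i (r i) \<omega>) \<and> (\<forall>i\<in>B. level_count Q (\<lambda>q. ex i q \<omega>) = e i)})"
  define En where "En = (\<lambda>N A r. {\<omega> \<in> space (Ms N). (\<forall>i\<in>A. \<not> exn N i (r i) \<omega>) \<and> (\<forall>i\<in>B. level_count Q (\<lambda>q. exn N i q \<omega>) = e i)})"
  have conv: "(\<lambda>N. measure (Ms N) (En N A' r')) \<longlonglongrightarrow> measure M (E A' r')"
    if "finite A'" "A' \<inter> B = {}" "\<And>i. i \<in> A' \<Longrightarrow> 1 \<le> r' i" for A' r'
    unfolding E_def En_def by (rule insert.IH[OF that])
  have cI: "(\<lambda>N. measure (Ms N) (En N (insert b A) (r(b := k)))) \<longlonglongrightarrow> measure M (E (insert b A) (r(b := k)))" if "1 \<le> k" for k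
    using insert.prems insert.hyps that by (intro conv) auto
  have cA: "(\<lambda>N. measure (Ms N) (En N A r)) \<longlonglongrightarrow> measure M (E A r)"
    using insert.prems by (intro conv) auto
  have bA: "b \<notin> A" using insert.prems by auto
  have sets: "E A' r' \<in> sets M" if "finite A'" for A' r'
    unfolding E_def using insert.hyps(1) that meas by measurable
  have setsn: "\<forall>\<^sub>F N in sequentially. \<forall>A' r'. finite A' \<longrightarrow> En N A' r' \<in> sets (Ms N)"
    using measn
  proof eventually_elim
    case (elim N)
    then have [measurable]: "Measurable.pred (Ms N) (exn N i q)" for i q by blast
    show ?case
      unfolding En_def using insert.hyps(1) by (intro allI impI) measurable
  qed
  have split: "(\<forall>i\<in>insert b A. \<not> P i ((r(b := k)) i)) \<longleftrightarrow> (\<forall>i\<in>A. \<not> P i (r i)) \<and> \<not> P b k" for P :: "nat \<Rightarrow> nat \<Rightarrow> bool" and k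
    using bA by auto
  \<comment> \<open>Prescribing the level of the new cell \<open>b\<close> amounts to a void
    condition for level 0 and to a difference of two nested void events for the other possible
    levels. At the top level \<open>Q\<close> only a lower bound on the displacement is prescribed,
    so one of the two events leaves cell \<open>b\<close> free.\<close>
  consider (zero) "e b = 0" | (mid) "1 \<le> e b" "e b < Q" | (last) "e b = Q" | (none) "Q < e b"
    using Q by linarith
  then show ?case
  proof cases
    case zero
    have iff: "level_count Q f = e b \<longleftrightarrow> \<not> f 1" if "antimono f" for f
      using level_count_less_iff[OF that, of 1 Q] Q zero by auto
    have "?F = E (insert b A) (r(b := 1))"
      unfolding E_def split[of "\<lambda>i q. ex i q _"] using iff[of "\<lambda>q. ex b q _", OF anti] by auto
    moreover have "?Fn N = En N (insert b A) (r(b := 1))" for N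
      unfolding En_def split[of "\<lambda>i q. exn N i q _"] using iff[of "\<lambda>q. exn N b q _", OF antin] by auto
    ultimately show ?thesis
      using cI[of 1] by simp
  next
    case mid
    have iff: "level_count Q f = e b \<longleftrightarrow> \<not> f (Suc (e b)) \<and> f (e b)" if "antimono f" for f
      using level_count_less_iff[OF that, of "e b" Q] level_count_less_iff[OF that, of "Suc (e b)" Q] mid by auto
    have imp: "f (e b)" if "antimono f" "f (Suc (e b))" for f
      using antimonoD[OF that(1), of "e b" "Suc (e b)"] that(2) by simp
    have "?F =
        E (insert b A) (r(b := Suc (e b))) - E (insert b A) (r(b := e b))"
      unfolding E_def split[of "\<lambda>i q. ex i q _"] using iff[of "\<lambda>q. ex b q _", OF anti] by auto
    moreover have sub: "E (insert b A) (r(b := e b)) \<subseteq> E (insert b A) (r(b := Suc (e b)))"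
      unfolding E_def split[of "\<lambda>i q. ex i q _"] using imp[of "\<lambda>q. ex b q _", OF anti] by auto
    moreover have "?Fn N =
        En N (insert b A) (r(b := Suc (e b))) - En N (insert b A) (r(b := e b))" for N
      unfolding En_def split[of "\<lambda>i q. exn N i q _"] using iff[of "\<lambda>q. exn N b q _", OF antin] by auto
    moreover have subn: "En N (insert b A) (r(b := e b)) \<subseteq> En N (insert b A) (r(b := Suc (e b)))" for N
      unfolding En_def split[of "\<lambda>i q. exn N i q _"] using imp[of "\<lambda>q. exn N b q _", OF antin] by auto
    moreover have "\<forall>\<^sub>F N in sequentially. measure (Ms N) (En N (insert b A) (r(b := Suc (e b)))) - measure (Ms N) (En N (insert b A) (r(b := e b)))
        = measure (Ms N) (En N (insert b A) (r(b := Suc (e b))) - En N (insert b A) (r(b := e b)))"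
      using Ms setsn
      by eventually_elim (use insert.prems in \<open>auto intro!: finite_measure.finite_measure_Diff[OF prob_space.finite_measure, symmetric] subn\<close>)
    moreover have "measure M (E (insert b A) (r(b := Suc (e b)))) - measure M (E (insert b A) (r(b := e b)))
        = measure M (E (insert b A) (r(b := Suc (e b))) - E (insert b A) (r(b := e b)))"
      using insert.prems by (intro finite_measure.finite_measure_Diff[OF prob_space.finite_measure[OF M], symmetric] sub sets) auto
    ultimately show ?thesis
      using tendsto_diff[OF cI[of "Suc (e b)"] cI[of "e b"]] mid(1) by (auto elim: Lim_transform_eventually)
  next
    case last
    have iff: "level_count Q f = e b \<longleftrightarrow> f Q" if "antimono f" for f
      using level_count_less_iff[OF that, of Q Q] level_count_le[of Q f] last Q by auto
    have "?F =
        E A r - E (insert b A) (r(b := Q))"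
      unfolding E_def split[of "\<lambda>i q. ex i q _"] using iff[of "\<lambda>q. ex b q _", OF anti] by auto
    moreover have sub: "E (insert b A) (r(b := Q)) \<subseteq> E A r"
      unfolding E_def split[of "\<lambda>i q. ex i q _"] by auto
    moreover have "?Fn N =
        En N A r - En N (insert b A) (r(b := Q))" for N
      unfolding En_def split[of "\<lambda>i q. exn N i q _"] using iff[of "\<lambda>q. exn N b q _", OF antin] by auto
    moreover have subn: "En N (insert b A) (r(b := Q)) \<subseteq> En N A r" for N
      unfolding En_def split[of "\<lambda>i q. exn N i q _"] by auto
    moreover have "\<forall>\<^sub>F N in sequentially. measure (Ms N) (En N A r) - measure (Ms N) (En N (insert b A) (r(b := Q)))
        = measure (Ms N) (En N A r - En N (insert b A) (r(b := Q)))"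
      using Ms setsn
      by eventually_elim (use insert.prems in \<open>auto intro!: finite_measure.finite_measure_Diff[OF prob_space.finite_measure, symmetric] subn\<close>)
    moreover have "measure M (E A r) - measure M (E (insert b A) (r(b := Q)))
        = measure M (E A r - E (insert b A) (r(b := Q)))"
      using insert.prems by (intro finite_measure.finite_measure_Diff[OF prob_space.finite_measure[OF M], symmetric] sub sets) auto
    ultimately show ?thesis
      using tendsto_diff[OF cA cI[of Q]] Q by (auto elim: Lim_transform_eventually)
  next
    case none
    then have "level_count Q f \<noteq> e b" for f
      using level_count_le[of Q f] by simp
    then show ?thesis
      by simp
  qed
qed

text \<open>Almost surely all comparisons of \<open>f\<close> with rationals have their
  deterministic outcome. A point \<open>\<omega>0\<close> with these outcomes serves as reference: a
  different value would be separated from \<open>f \<omega>0\<close> by a rational.\<close>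

lemma (in prob_space) AE_const_if_rational_cdf_trivial:
  assumes f: "f \<in> borel_measurable M" and triv: "\<And>a. a \<in> \<rat> \<Longrightarrow> prob {\<omega> \<in> space M. f \<omega> \<le> a} = 0 \<or> prob {\<omega> \<in> space M. f \<omega> \<le> a} = (1::real)"
  obtains c where "AE \<omega> in M. f \<omega> = (c :: real)"
proof -
  let ?F = "\<lambda>a. {\<omega> \<in> space M. f \<omega> \<le> a}"
  have "AE \<omega> in M. (f \<omega> \<le> a) = (prob (?F a) = 1)" if "a \<in> \<rat>" for a
  proof (cases "prob (?F a) = 1")
    case True
    have "?F a \<in> events"
      using f by measurable
    then have "AE \<omega> in M. \<omega> \<in> (?F a)"
      using True prob_eq_1 by blast
    then show ?thesis
      by eventually_elim (use True in auto)
  next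
    case False
    then have "prob (?F a) = 0"
      using triv[OF that] by simp
    moreover have "?F a \<in> events"
      using f by measurable
    ultimately have "AE \<omega> in M. \<omega> \<notin> (?F a)"
      using prob_eq_0 by blast
    then show ?thesis
      using AE_space by eventually_elim (use False in auto)
  qed
  then have ae: "AE \<omega> in M. \<forall>a\<in>\<rat>. (f \<omega> \<le> a) = (prob (?F a) = 1)"
    by (intro AE_ball_countable[THEN iffD2] countable_rat) auto
  have "\<exists>\<omega>0. \<forall>a\<in>\<rat>. (f \<omega>0 \<le> a) = (prob (?F a) = 1)"
  proof (rule ccontr)
    assume no: "\<not> ?thesis"
    from ae have "AE \<omega> in M. False"
      by eventually_elim (use no in blast)
    then show False
      by simp
  qed
  then obtain \<omega>0 where \<omega>0: "\<forall>a\<in>\<rat>. (f \<omega>0 \<le> a) = (prob (?F a) = 1)"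
    by blast
  have "AE \<omega> in M. f \<omega> = f \<omega>0"
    using ae
  proof eventually_elim
    case (elim \<omega>)
    show ?case
    proof (rule ccontr)
      assume "f \<omega> \<noteq> f \<omega>0"
      then consider "f \<omega> < f \<omega>0" | "f \<omega>0 < f \<omega>" by linarith
      then show False
      proof cases
        case 1
        then obtain a where "a \<in> \<rat>" "f \<omega> < a" "a < f \<omega>0"
          using Rats_dense_in_real by blast
        then show False using elim \<omega>0 by fastforce
      next
        case 2
        then obtain a where "a \<in> \<rat>" "f \<omega>0 < a" "a < f \<omega>"
          using Rats_dense_in_real by blast
        then show False using elim \<omega>0 by fastforce
      qed
    qed
  qed
  then show thesis
    by (rule that)
qed

section \<open>The branching random walk as a near-staircase\<close>

definition generations :: "real \<Rightarrow> nat \<Rightarrow> nat \<Rightarrow> nat set" where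
  "generations L m i = {nat \<lfloor>real i / m * L\<rfloor>..<nat \<lfloor>real (Suc i) / m * L\<rfloor>}"

text \<open>Displacements of generation \<open>k\<close> become visible in generation
  \<open>k + 1\<close>, hence \<open>Suc k\<close>; with this shift the floors match cells that are
  open on the left.\<close>

lemma mem_generations_iff:
  assumes "0 < L"
  shows "k \<in> generations L m i \<longleftrightarrow> real (Suc k) / L \<in> {real i / m<..real (Suc i) / m}"
proof -
  have le: "nat \<lfloor>z\<rfloor> \<le> k \<longleftrightarrow> z < real (Suc k)" if "0 \<le> z" for z :: real
    using that by (simp add: nat_le_iff floor_le_iff add.commute)
  have less: "k < nat \<lfloor>z\<rfloor> \<longleftrightarrow> real (Suc k) \<le> z" for z :: real
    by (simp add: zless_nat_eq_int_zless less_floor_iff add.commute)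
  have 1: "nat \<lfloor>real i / m * L\<rfloor> \<le> k \<longleftrightarrow> real i / m * L < real (Suc k)"
    using assms by (intro le) simp
  have 2: "k < nat \<lfloor>real (Suc i) / m * L\<rfloor> \<longleftrightarrow> real (Suc k) \<le> real (Suc i) / m * L"
    by (rule less)
  show ?thesis
    unfolding generations_def using 1 2 assms by (simp add: pos_less_divide_eq pos_divide_le_eq del: of_nat_Suc)
qed

definition clock :: "real \<Rightarrow> real \<Rightarrow> nat" where "clock L t = nat \<lfloor>t * L\<rfloor>"

lemma clock_nonpos: "0 < L \<Longrightarrow> t \<le> 0 \<Longrightarrow> clock L t = 0"
  using mult_nonpos_nonneg[of t L] by (simp add: clock_def)

lemma mono_clock: "0 < L \<Longrightarrow> mono (clock L)"
  by (intro monoI) (auto simp: clock_def intro!: nat_mono floor_mono mult_right_mono)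

lemma clock_le: "0 < L \<Longrightarrow> 0 \<le> t \<Longrightarrow> real (clock L t) \<le> t * L"
  by (simp add: clock_def)

lemma le_clock: "real k \<le> t * L \<Longrightarrow> k \<le> clock L t"
  by (simp add: clock_def le_nat_floor)

lemma clock_less: "t * L < real k + 1 \<Longrightarrow> clock L t \<le> k"
  unfolding clock_def by (simp add: nat_le_iff floor_le_iff)

text \<open>The deterministic part of the comparison: \<open>r\<close> and \<open>l\<close> are the time lags of the upper and
  of the lower bound for the leading particle.\<close>

lemma brw_near_staircase:
  fixes y :: "nat \<Rightarrow> nat \<Rightarrow> real" and N m n :: nat and L c \<delta> \<eta> :: real
  defines "V \<equiv> brw_top N y" and "W \<equiv> brw_bottom N y"
  defines "x \<equiv> \<lambda>t. V (clock L t) / c" and "r \<equiv> nat \<lceil>(1 - 1 / m) * L\<rceil>"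
  assumes N: "1 \<le> N" and L: "0 < L" "real N \<le> 2 powr L" "2 * real m \<le> L" and c: "0 < c"
    and m: "3 \<le> m" and \<delta>: "0 < \<delta>" and \<eta>: "0 \<le> \<eta>"
    and nonneg: "\<And>k l. l \<in> {1..2 * N} \<Longrightarrow> 0 \<le> y k l"
    and bottom: "\<And>k. real k \<le> real n / m * L \<Longrightarrow> W k \<le> V (k - r) + \<eta> * c"
    and top: "\<And>k. real k \<le> real n / m * L \<Longrightarrow> V k \<le> \<eta> * c \<or>
      (\<exists>k'<k. \<exists>l\<in>{1..2 * N}. \<delta> * c < y k' l \<and> V k \<le> V (k' - r) + y k' l + 2 * (\<eta> * c))"
    and sep: "well_separated m n d"
    and unflagged: "\<And>i k l. i < n \<Longrightarrow> d i = 0 \<Longrightarrow> k \<in> generations L m i \<Longrightarrow> l \<in> {1..2 * N} \<Longrightarrow> y k l \<le> \<delta> * c"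
    and flagged: "\<And>i. i < n \<Longrightarrow> d i \<noteq> 0 \<Longrightarrow> \<exists>k\<in>generations L m i. \<exists>l\<in>{1..2 * N}.
      \<delta> * d i * c \<le> y k l \<and> y k l \<le> \<delta> * (real (d i) + 1) * c \<and>
      (\<forall>k'\<in>generations L m i. \<forall>l'\<in>{1..2 * N}. (k', l') \<noteq> (k, l) \<longrightarrow> y k' l' \<le> \<delta> * c)"
  shows "near_staircase m n d \<delta> ((2 * (real n / m) + 1) * (\<delta> + 2 * \<eta>)) x"
    and "\<And>t. t \<in> {0..real n / m} \<Longrightarrow> x (max 0 (t - 1 - 1 / m)) \<le> W (clock L t) / c"
    and "\<And>t. t \<in> {0..real n / m} \<Longrightarrow> W (clock L t) / c \<le> x (max 0 (t - 1 + 1 / m)) + \<eta>"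
proof -
  have m0: "0 < real m" using m by simp
  have Lm: "2 \<le> L / m"
    using L(3) m0 by (simp add: pos_le_divide_eq)
  have monoV: "mono V" and monoW: "mono W"
    unfolding V_def W_def using brw_top_mono[OF N nonneg] brw_bottom_mono[OF N nonneg] by auto
  have V0: "V 0 = 0" and W0: "W 0 = 0"
    using N by (simp_all add: V_def W_def)
  have Vnn: "0 \<le> V k" for k
    using monoD[OF monoV, of 0 k] V0 by simp
  have Wnn: "0 \<le> W k" for k
    using monoD[OF monoW, of 0 k] W0 by simp
  \<comment> \<open>After \<open>l\<close> generations the offspring of the leader fills the
    population; rounding \<open>L\<close> up costs less than one generation.\<close>
  define l where "l = nat \<lceil>L\<rceil>"
  have l: "L \<le> real l" "real l < L + 1"
    using L ceiling_correct[of L] by (auto simp: l_def)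
  have Nl: "N \<le> 2 ^ l"
  proof -
    have "real N \<le> 2 powr (real l)"
      using L(2) l(1) by (meson order_trans powr_mono one_le_numeral)
    then show ?thesis
      by (simp add: powr_realpow)
  qed
  have WV: "V (k - l) \<le> W k" for k
  proof (cases "l \<le> k")
    case True
    then show ?thesis
      using brw_bottom_ge_top[OF N nonneg Nl, where n = "k - l"] by (simp add: V_def W_def)
  next
    case False
    then show ?thesis using V0 Wnn by simp
  qed
  have r: "(1 - 1 / m) * L \<le> real r"
    by (simp add: r_def) (meson le_of_int_ceiling of_nat_ceiling)
  \<comment> \<open>The extra \<open>1 / m\<close> in the lag is worth at least two generations,
    since \<open>2 * real m \<le> L\<close>. This absorbs the rounding of \<open>l\<close> and of
    the clock.\<close>
  have lag_low: "clock L (t - 1 - 1 / m) \<le> k - l" if "t * L \<le> real k + 1" for t k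
  proof -
    have "(t - 1 - 1 / m) * L = t * L - L - L / m"
      by (simp add: algebra_simps)
    also have "\<dots> < real k - real l + 1"
      using that l(2) Lm by linarith
    finally have less: "(t - 1 - 1 / m) * L < real k - real l + 1" .
    show ?thesis
    proof (cases "l \<le> k")
      case True
      then show ?thesis
        using less by (intro clock_less) (simp add: of_nat_diff)
    next
      case False
      then have "real k - real l + 1 \<le> 0" by linarith
      then have "(t - 1 - 1 / m) * L \<le> 0" using less by linarith
      then show ?thesis
        by (simp add: clock_def)
    qed
  qed
  have lag_up: "k - r \<le> clock L (t - 1 + 1 / m)" if "real k \<le> t * L" for t k
  proof (cases "r \<le> k")
    case True
    have "real (k - r) \<le> t * L - (1 - 1 / m) * L"
      using that r True by (simp add: of_nat_diff)
    also have "\<dots> = (t - 1 + 1 / m) * L"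
      by (simp add: algebra_simps)
    finally show ?thesis by (rule le_clock)
  qed simp
  have x_nonpos: "x t = 0" if "t \<le> 0" for t
    using clock_nonpos[OF L(1) that] V0 by (simp add: x_def)
  have mono_x: "mono x"
    using c by (intro monoI) (auto simp: x_def intro!: divide_right_mono monoD[OF monoV] monoD[OF mono_clock[OF L(1)]])
  have x_max: "x (max 0 t) = x t" for t
    using x_nonpos by (cases "0 \<le> t") auto
  have xnn: "0 \<le> x t" for t
    using Vnn c by (simp add: x_def)
  show "x (max 0 (t - 1 - 1 / m)) \<le> W (clock L t) / c" if t: "t \<in> {0..real n / m}" for t
  proof -
    have "t * L \<le> real (clock L t) + 1"
      by (simp add: clock_def) linarith
    from monoD[OF monoV lag_low[OF this]] WV[of "clock L t"] show ?thesis
      unfolding x_max unfolding x_def using c by (intro divide_right_mono) auto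
  qed
  show "W (clock L t) / c \<le> x (max 0 (t - 1 + 1 / m)) + \<eta>" if t: "t \<in> {0..real n / m}" for t
  proof -
    have le: "real (clock L t) \<le> t * L"
      using clock_le[OF L(1)] t by simp
    also have "\<dots> \<le> real n / m * L"
      using t L by (intro mult_right_mono) auto
    finally have "W (clock L t) \<le> V (clock L t - r) + \<eta> * c"
      by (rule bottom)
    also have "V (clock L t - r) \<le> V (clock L (t - 1 + 1 / m))"
      by (rule monoD[OF monoV lag_up[OF le]])
    finally show ?thesis
      unfolding x_max unfolding x_def using c by (simp add: pos_divide_le_eq distrib_right)
  qed
  have "\<exists>k l. real (Suc k) / L \<in> {real i / m<..real (Suc i) / m} \<and> l \<in> {1..2 * N} \<and>
      \<delta> * d i * c \<le> y k l \<and> y k l \<le> \<delta> * (real (d i) + 1) * c \<and>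
      (\<forall>k'\<in>generations L m i. \<forall>l'\<in>{1..2 * N}. (k', l') \<noteq> (k, l) \<longrightarrow> y k' l' \<le> \<delta> * c)" if "i < n" "d i \<noteq> 0" for i
    using flagged[OF that] mem_generations_iff[OF L(1)] by blast
  then obtain K J where KJ: "\<And>i. i < n \<Longrightarrow> d i \<noteq> 0 \<Longrightarrow> real (Suc (K i)) / L \<in> {real i / m<..real (Suc i) / m} \<and> J i \<in> {1..2 * N} \<and>
      \<delta> * d i * c \<le> y (K i) (J i) \<and> y (K i) (J i) \<le> \<delta> * (real (d i) + 1) * c \<and>
      (\<forall>k'\<in>generations L m i. \<forall>l'\<in>{1..2 * N}. (k', l') \<noteq> (K i, J i) \<longrightarrow> y k' l' \<le> \<delta> * c)"
    by metis
  \<comment> \<open>In a cell without a large displacement any point of the cell would do.\<close>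
  define s where "s i = (if d i \<noteq> 0 then real (Suc (K i)) / L else real (Suc i) / m)" for i
  have s: "s i \<in> {real i / m<..real (Suc i) / m}" if "i < n" for i
    using KJ[OF that] m0 by (auto simp: s_def divide_strict_right_mono)
  show "near_staircase m n d \<delta> ((2 * (real n / m) + 1) * (\<delta> + 2 * \<eta>)) x"
  proof (rule near_staircaseI[OF m _ _ x_nonpos mono_x s sep])
    show "0 \<le> \<delta>" "0 \<le> \<delta> + 2 * \<eta>"
      using \<delta> \<eta> by auto
    fix i assume i: "i < n" "d i \<noteq> 0"
    have sL: "s i * L = real (K i) + 1"
      using i L(1) by (simp add: s_def)
    then have "clock L (s i) = Suc (K i)"
      by (simp add: clock_def nat_add_distrib)
    moreover have "W (K i) + y (K i) (J i) \<le> V (Suc (K i))"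
      unfolding V_def W_def using KJ[OF i] by (intro brw_top_Suc_ge[OF N]) auto
    moreover have "V (clock L (s i - 1 - 1 / m)) \<le> W (K i)"
      using monoD[OF monoV lag_low[of "s i" "K i"]] WV[of "K i"] sL by simp
    ultimately have "V (clock L (s i - 1 - 1 / m)) + \<delta> * d i * c \<le> V (clock L (s i))"
      using KJ[OF i] by simp
    then have "(V (clock L (s i - 1 - 1 / m)) + \<delta> * d i * c) / c \<le> V (clock L (s i)) / c"
      using c by (intro divide_right_mono) auto
    then show "x (s i - 1 - 1 / m) + \<delta> * d i \<le> x (s i)"
      using c by (simp add: x_def add_divide_distrib)
  next
    fix t assume t: "0 < t" "t \<le> real n / m"
    have le: "real (clock L t) \<le> t * L"
      using clock_le[OF L(1)] t by simp
    also have tn: "\<dots> \<le> real n / m * L"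
      using t L by (intro mult_right_mono) auto
    finally consider "V (clock L t) \<le> \<eta> * c"
      | k j where "k < clock L t" "j \<in> {1..2 * N}" "\<delta> * c < y k j" "V (clock L t) \<le> V (k - r) + y k j + 2 * (\<eta> * c)"
      using top by blast
    then show "x t \<le> x (t - 1/2) + (\<delta> + 2 * \<eta>) \<or>
      (\<exists>i<n. d i \<noteq> 0 \<and> s i \<le> t \<and> x t \<le> x (s i - 1 + 1 / m) + \<delta> * d i + (\<delta> + 2 * \<eta>))"
    proof cases
      case 1
      then have "x t \<le> \<eta>"
        using c by (simp add: x_def pos_divide_le_eq)
      then show ?thesis
        using xnn[of "t - 1/2"] \<delta> \<eta> by linarith
    next
      case 2
      have kt: "real (Suc k) \<le> t * L"
        using 2(1) le by linarith
      have pos: "0 < real (Suc k) / L" "real (Suc k) / L \<le> real n / m"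
        using kt tn L(1) by (auto simp: pos_divide_le_eq simp del: of_nat_Suc)
      define i where "i = nat (\<lceil>real (Suc k) / L * m\<rceil> - 1)"
      have "0 < real (Suc k) / L * m" using pos(1) m0 by (rule mult_pos_pos)
      then have "1 \<le> \<lceil>real (Suc k) / L * m\<rceil>" by linarith
      then have "real i = of_int \<lceil>real (Suc k) / L * m\<rceil> - 1"
        by (simp add: i_def)
      then have "real i < real (Suc k) / L * m" "real (Suc k) / L * m \<le> real (Suc i)"
        by linarith+
      then have i: "real (Suc k) / L \<in> {real i / m<..real (Suc i) / m}"
        using m0 by (simp add: pos_divide_less_eq pos_le_divide_eq)
      then have kr: "k \<in> generations L m i"
        using mem_generations_iff[OF L(1)] by blast
      have "real i / m < real n / m"
        using i pos by auto
      then have iN: "i < n"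
        using m0 by (simp add: divide_less_cancel)
      have di: "d i \<noteq> 0"
        using unflagged[OF iN _ kr 2(2)] 2(3) by auto
      have kj: "(k, j) = (K i, J i)"
        using KJ[OF iN di] kr 2(2,3) by (meson not_le)
      have "s i \<le> t"
        using di kj kt L(1) by (simp add: s_def pos_divide_le_eq)
      moreover have "V (k - r) \<le> V (clock L (s i - 1 + 1 / m))"
      proof (rule monoD[OF monoV lag_up])
        show "real k \<le> s i * L"
          using di kj L(1) by (simp add: s_def)
      qed
      moreover have "y k j \<le> \<delta> * (real (d i) + 1) * c"
        using KJ[OF iN di] kj by auto
      ultimately have "V (clock L t) \<le> V (clock L (s i - 1 + 1 / m)) + \<delta> * (real (d i) + 1) * c + 2 * (\<eta> * c)"
        using 2(4) by linarith
      then have "V (clock L t) / c \<le> (V (clock L (s i - 1 + 1 / m)) + \<delta> * (real (d i) + 1) * c + 2 * (\<eta> * c)) / c"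
        using c by (intro divide_right_mono) auto
      also have "\<dots> = x (s i - 1 + 1 / m) + \<delta> * d i + (\<delta> + 2 * \<eta>)"
        using c by (simp add: x_def add_divide_distrib distrib_left)
      finally show ?thesis
        using \<open>s i \<le> t\<close> iN di by (auto simp: x_def)
    qed
  qed
qed

section \<open>The Poisson point process\<close>

definition cell :: "nat \<Rightarrow> nat \<Rightarrow> real set" where
  "cell m i = {real i / m<..real (Suc i) / m}"

definition window :: "nat \<Rightarrow> nat \<Rightarrow> real \<Rightarrow> (real \<times> real) set" where
  "window m i y = cell m i \<times> {y<..}"

text \<open>The pairs excluded by \<open>well_separated\<close>, together with the pairs
  \<open>i = j\<close>, which account for two jumps in one cell.\<close>

definition near_pairs :: "nat \<Rightarrow> nat \<Rightarrow> (nat \<times> nat) set" where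
  "near_pairs m n = {(i, j). i \<le> j \<and> j < n \<and> (j \<le> i + 2 \<or> i + m \<le> j + 2 \<and> j \<le> i + m + 2)}"

text \<open>An upper bound for the probability that near cells contain two jumps above \<open>\<delta>\<close> or that a jump
  exceeds \<open>Q * \<delta>\<close>.\<close>

abbreviation crowding :: "real \<Rightarrow> nat \<Rightarrow> nat \<Rightarrow> real \<Rightarrow> nat \<Rightarrow> real" where
  "crowding \<alpha> m n \<delta> Q \<equiv> real n * 8 * (2 * \<delta> powr - \<alpha> / m)\<^sup>2 + real n * ((real Q * \<delta>) powr - \<alpha> / m)"

lemma near_pairs_subset: "near_pairs m n \<subseteq> Sigma {..<n} (\<lambda>i. {i..i + 2} \<union> {i + m - 2..i + m + 2})"
  by (auto simp: near_pairs_def)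

lemma finite_near_pairs: "finite (near_pairs m n)"
  by (rule finite_subset[OF near_pairs_subset]) auto

text \<open>Each \<open>i\<close> has at most 3 partners from \<open>i\<close> onwards and at most 5
  around distance \<open>m\<close>.\<close>

lemma card_near_pairs: "card (near_pairs m n) \<le> n * 8"
proof -
  have "card (near_pairs m n) \<le> card (Sigma {..<n} (\<lambda>i. {i..i + 2} \<union> {i + m - 2..i + m + 2}))"
    by (rule card_mono[OF _ near_pairs_subset]) auto
  also have "\<dots> = (\<Sum>i<n. card ({i..i + 2} \<union> {i + m - 2..i + m + 2}))"
    by (rule card_SigmaI) auto
  also have "\<dots> \<le> (\<Sum>i<n. 8)"
    by (intro sum_mono order_trans[OF card_Un_le]) auto
  finally show ?thesis by simp
qed

lemma cell_disjoint:
  assumes "i \<noteq> j" "0 < m"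
  shows "cell m i \<inter> cell m j = {}"
proof -
  have *: "cell m i \<inter> cell m j = {}" if "i < j" for i j
  proof -
    have "real (Suc i) / m \<le> real j / m"
      using that by (intro divide_right_mono) auto
    then show ?thesis
      by (auto simp: cell_def)
  qed
  show ?thesis
    using *[of i j] *[of j i] assms(1) by (cases i j rule: linorder_cases) auto
qed

lemma cell_cover:
  assumes "0 < m" "0 < t" "t \<le> real n / m"
  obtains i where "i < n" "t \<in> cell m i"
proof -
  have m0: "0 < real m" using assms by simp
  define i where "i = nat (\<lceil>t * m\<rceil> - 1)"
  have "0 < t * m" using assms m0 by simp
  then have "1 \<le> \<lceil>t * m\<rceil>" by linarith
  then have "real i = of_int \<lceil>t * m\<rceil> - 1"
    by (simp add: i_def)
  then have "real i < t * m" "t * m \<le> real (Suc i)"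
    by linarith+
  then have i: "t \<in> cell m i"
    using m0 by (simp add: cell_def pos_divide_less_eq pos_le_divide_eq)
  then have "real i / m < real n / m"
    using assms by (simp add: cell_def)
  then have "i < n"
    using m0 by (simp add: divide_less_cancel)
  then show thesis
    using i that by blast
qed

locale stairs_ppp = prob_space S for S :: "'s measure" +
  fixes \<mu> :: "real measure" and \<alpha> :: real and \<eta> :: "'s \<Rightarrow> (real \<times> real) measure"
  assumes \<alpha>: "0 < \<alpha>" and stairs_\<mu>: "stairs_measure \<mu>"
    and tail_\<mu>: "\<And>x. 0 < x \<Longrightarrow> emeasure \<mu> {x..} = ennreal (x powr (- \<alpha>))"
    and ppp: "poisson_point_process S (stairs_intensity \<mu>) \<eta>"
begin

abbreviation \<Lambda> :: "(real \<times> real) measure" where "\<Lambda> \<equiv> stairs_intensity \<mu>"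

lemma sets_\<mu>: "sets \<mu> = sets (restrict_space borel {0<..})"
  using stairs_\<mu> by (simp add: stairs_measure_def)

lemma space_\<mu>: "space \<mu> = {0<..}"
  using sets_eq_imp_space_eq[OF sets_\<mu>] by (simp add: space_restrict_space)

lemma space_\<Lambda>: "space \<Lambda> = {0<..} \<times> {0<..}"
  by (simp add: stairs_intensity_def space_pair_measure space_restrict_space space_\<mu>)

lemma sigma_finite_\<mu>: "sigma_finite_measure \<mu>"
proof
  let ?A = "(\<lambda>n. {1 / real (Suc n)..}) ` (UNIV :: nat set)"
  have "{1 / real (Suc n)..} \<in> sets \<mu>" for n
    unfolding sets_\<mu> by (subst sets_restrict_space_iff) (auto intro: less_le_trans[of 0 "1 / real (Suc n)"])
  moreover have "\<Union> ?A = {0<..}"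
  proof
    show "\<Union> ?A \<subseteq> {0<..}"
      by (auto intro: less_le_trans[of 0 "1 / real (Suc _)"])
    show "{0<..} \<subseteq> \<Union> ?A"
    proof
      fix x :: real assume "x \<in> {0<..}"
      then obtain n where "inverse (real (Suc n)) < x"
        using reals_Archimedean[of x] by auto
      then show "x \<in> \<Union> ?A"
        by (auto simp: inverse_eq_divide intro!: exI[of _ n])
    qed
  qed
  moreover have "emeasure \<mu> {1 / real (Suc n)..} \<noteq> \<infinity>" for n
    by (subst tail_\<mu>) auto
  ultimately show "\<exists>A. countable A \<and> A \<subseteq> sets \<mu> \<and> \<Union> A = space \<mu> \<and> (\<forall>a\<in>A. emeasure \<mu> a \<noteq> \<infinity>)"
    by (intro exI[of _ ?A]) (auto simp: space_\<mu>)
qed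

lemma emeasure_\<mu>_greaterThan:
  assumes y: "0 < y"
  shows "emeasure \<mu> {y<..} = ennreal (y powr - \<alpha>)"
proof -
  let ?A = "\<lambda>n. {y + 1 / real (Suc n)..}"
  have "?A n \<in> sets \<mu>" for n
    unfolding sets_\<mu> using y
    by (subst sets_restrict_space_iff) (simp_all add: Ici_subset_Ioi_iff add_pos_pos)
  moreover have "incseq ?A"
  proof (rule monoI)
    fix n n' :: nat assume "n \<le> n'"
    then have "1 / real (Suc n') \<le> 1 / real (Suc n)"
      by (simp add: frac_le)
    then show "?A n \<subseteq> ?A n'"
      by (auto simp del: of_nat_Suc)
  qed
  ultimately have lim: "(\<lambda>n. emeasure \<mu> (?A n)) \<longlonglongrightarrow> emeasure \<mu> (\<Union>n. ?A n)"
    by (intro Lim_emeasure_incseq) auto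
  have UN: "(\<Union>n. ?A n) = {y<..}"
  proof
    show "(\<Union>n. ?A n) \<subseteq> {y<..}"
      by (simp add: UN_subset_iff Ici_subset_Ioi_iff)
    show "{y<..} \<subseteq> (\<Union>n. ?A n)"
    proof
      fix x assume "x \<in> {y<..}"
      then obtain n where "inverse (real (Suc n)) < x - y"
        using reals_Archimedean[of "x - y"] by auto
      then show "x \<in> (\<Union>n. ?A n)"
        by (auto simp: inverse_eq_divide intro!: exI[of _ n])
    qed
  qed
  have em: "emeasure \<mu> (?A n) = ennreal ((y + 1 / real (Suc n)) powr - \<alpha>)" for n
    using y by (intro tail_\<mu> add_pos_pos) auto
  have "(\<lambda>n. ennreal ((y + 1 / real (Suc n)) powr - \<alpha>)) \<longlonglongrightarrow> ennreal ((y + 0) powr - \<alpha>)"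
    using y by (intro tendsto_ennrealI tendsto_intros LIMSEQ_Suc[OF lim_1_over_n]) auto
  from LIMSEQ_unique[OF lim[unfolded UN em] this] show ?thesis
    by simp
qed

lemma sets_times: "A \<in> sets borel \<Longrightarrow> B \<in> sets borel \<Longrightarrow> A \<subseteq> {0<..} \<Longrightarrow> B \<subseteq> {0<..} \<Longrightarrow> A \<times> B \<in> sets \<Lambda>"
  unfolding stairs_intensity_def by (rule pair_measureI) (auto simp: sets_\<mu> sets_restrict_space_iff)

lemma cell_pos: "cell m i \<subseteq> {0<..}"
  by (auto simp: cell_def intro: le_less_trans[of 0 "real i / m"])

lemma window_sets: "0 \<le> y \<Longrightarrow> window m i y \<in> sets \<Lambda>"
  unfolding window_def by (rule sets_times) (use cell_pos in \<open>auto simp: cell_def\<close>)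

lemma emeasure_window:
  assumes y: "0 < y" and m: "0 < m"
  shows "emeasure \<Lambda> (window m i y) = ennreal (y powr - \<alpha> / m)"
proof -
  interpret sigma_finite_measure \<mu> by (rule sigma_finite_\<mu>)
  have 1: "cell m i \<in> sets (restrict_space lborel {0<..})"
    using cell_pos by (auto simp: sets_restrict_space_iff cell_def)
  have 2: "{y<..} \<in> sets \<mu>"
    using y by (auto simp: sets_\<mu> sets_restrict_space_iff)
  have "real i / m \<le> real (Suc i) / m"
    by (intro divide_right_mono) auto
  then have "emeasure (restrict_space lborel {0<..}) (cell m i) = ennreal (1 / m)"
    using cell_pos by (subst emeasure_restrict_space) (auto simp: cell_def diff_divide_distrib[symmetric])
  then show ?thesis
    unfolding window_def stairs_intensity_def emeasure_pair_measure_Times[OF 1 2] emeasure_\<mu>_greaterThan[OF y]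
    by (simp add: ennreal_mult[symmetric])
qed

lemma emeasure_window_UN:
  assumes A: "finite A" and y: "\<And>i. i \<in> A \<Longrightarrow> 0 < y i" and m: "0 < m"
  shows "emeasure \<Lambda> (\<Union>i\<in>A. window m i (y i)) = ennreal (\<Sum>i\<in>A. y i powr - \<alpha> / m)"
proof -
  have "disjoint_family_on (\<lambda>i. window m i (y i)) A"
    using cell_disjoint[OF _ m] by (fastforce simp: disjoint_family_on_def window_def)
  then have "emeasure \<Lambda> (\<Union>i\<in>A. window m i (y i)) = (\<Sum>i\<in>A. emeasure \<Lambda> (window m i (y i)))"
  proof (intro sum_emeasure[symmetric] A)
    show "(\<lambda>i. window m i (y i)) ` A \<subseteq> sets \<Lambda>"
      using window_sets less_imp_le[OF y] by auto
  qed
  also have "\<dots> = (\<Sum>i\<in>A. ennreal (y i powr - \<alpha> / m))"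
    by (intro sum.cong refl emeasure_window y m)
  also have "\<dots> = ennreal (\<Sum>i\<in>A. y i powr - \<alpha> / m)"
    by (simp add: sum_ennreal)
  finally show ?thesis .
qed

section \<open>Counts of the point process\<close>

lemma sets_\<eta>: "\<omega> \<in> space S \<Longrightarrow> sets (\<eta> \<omega>) = sets \<Lambda>"
  using ppp by (simp add: poisson_point_process_def)

lemma \<eta>_measurable: "B \<in> sets \<Lambda> \<Longrightarrow> (\<lambda>\<omega>. emeasure (\<eta> \<omega>) B) \<in> borel_measurable S"
  using ppp by (simp add: poisson_point_process_def)

lemma \<eta>_poisson:
  "B \<in> sets \<Lambda> \<Longrightarrow> emeasure \<Lambda> B < \<infinity> \<Longrightarrow>
    prob {\<omega> \<in> space S. emeasure (\<eta> \<omega>) B = of_nat k} = measure \<Lambda> B ^ k / fact k * exp (- measure \<Lambda> B)"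
  using ppp unfolding poisson_point_process_def by blast

lemma \<eta>_void:
  "B \<in> sets \<Lambda> \<Longrightarrow> emeasure \<Lambda> B < \<infinity> \<Longrightarrow> prob {\<omega> \<in> space S. emeasure (\<eta> \<omega>) B = 0} = exp (- measure \<Lambda> B)"
  using \<eta>_poisson[of B 0] by simp

lemma \<eta>_event: "B \<in> sets \<Lambda> \<Longrightarrow> {\<omega> \<in> space S. emeasure (\<eta> \<omega>) B = c} \<in> events"
  using \<eta>_measurable[of B] by measurable

text \<open>With \<open>l\<close> the intensity of \<open>B\<close>, the complement has probability
  \<open>exp (- l) * (1 + l)\<close>, which is at least \<open>(1 - l) * (1 + l)\<close>.\<close>

lemma \<eta>_multiple:
  assumes B: "B \<in> sets \<Lambda>" "emeasure \<Lambda> B < \<infinity>"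
  shows "prob {\<omega> \<in> space S. emeasure (\<eta> \<omega>) B \<noteq> 0 \<and> emeasure (\<eta> \<omega>) B \<noteq> 1} \<le> (measure \<Lambda> B)\<^sup>2"
proof -
  let ?l = "measure \<Lambda> B"
  let ?E = "\<lambda>c. {\<omega> \<in> space S. emeasure (\<eta> \<omega>) B = c}"
  have ev: "?E c \<in> events" for c
    by (rule \<eta>_event[OF B(1)])
  have "prob (?E 0 \<union> ?E 1) = prob (?E 0) + prob (?E 1)"
    using ev by (intro finite_measure_Union) auto
  also have "\<dots> = exp (- ?l) * (1 + ?l)"
    using \<eta>_void[OF B] \<eta>_poisson[OF B, of 1] by (simp add: algebra_simps)
  also have "\<dots> \<ge> (1 - ?l) * (1 + ?l)"
    using exp_ge_add_one_self[of "- ?l"] by (intro mult_right_mono) auto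
  finally have "1 - ?l\<^sup>2 \<le> prob (?E 0 \<union> ?E 1)"
    by (simp add: power2_eq_square algebra_simps)
  moreover have "{\<omega> \<in> space S. emeasure (\<eta> \<omega>) B \<noteq> 0 \<and> emeasure (\<eta> \<omega>) B \<noteq> 1} = space S - (?E 0 \<union> ?E 1)"
    by auto
  ultimately show ?thesis
    using prob_compl[of "?E 0 \<union> ?E 1"] ev by auto
qed

text \<open>By definition the counts are merely values of random measures; they are integers almost
  surely because the Poisson probabilities add up to 1.\<close>

lemma \<eta>_integer:
  assumes B: "B \<in> sets \<Lambda>" "emeasure \<Lambda> B < \<infinity>"
  shows "AE \<omega> in S. \<exists>k::nat. emeasure (\<eta> \<omega>) B = of_nat k"
proof -
  let ?l = "measure \<Lambda> B"
  let ?E = "\<lambda>k::nat. {\<omega> \<in> space S. emeasure (\<eta> \<omega>) B = of_nat k}"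
  have ev: "?E k \<in> events" for k
    by (rule \<eta>_event[OF B(1)])
  have "(\<lambda>k. prob (?E k)) sums prob (\<Union>k. ?E k)"
    using ev by (intro finite_measure_UNION) (auto simp: disjoint_family_on_def)
  moreover have "(\<lambda>k. ?l ^ k / fact k * exp (- ?l)) sums (exp ?l * exp (- ?l))"
    using exp_converges[of ?l] by (intro sums_mult2) (simp add: divide_inverse_commute)
  ultimately have "prob (\<Union>k. ?E k) = exp ?l * exp (- ?l)"
    unfolding \<eta>_poisson[OF B] by (rule sums_unique2)
  then have "prob (\<Union>k. ?E k) = 1"
    by (simp add: exp_add[symmetric])
  then have "AE \<omega> in S. \<omega> \<in> (\<Union>k. ?E k)"
    using ev by (subst (asm) prob_eq_1) auto
  then show ?thesis
    by eventually_elim auto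
qed

definition exceeds :: "nat \<Rightarrow> real \<Rightarrow> nat \<Rightarrow> nat \<Rightarrow> 's \<Rightarrow> bool" where
  "exceeds m \<delta> i q \<omega> \<longleftrightarrow> emeasure (\<eta> \<omega>) (window m i (real q * \<delta>)) \<noteq> 0"

lemma exceeds_measurable: "0 \<le> \<delta> \<Longrightarrow> Measurable.pred S (exceeds m \<delta> i q)"
  unfolding exceeds_def[abs_def] using \<eta>_measurable[OF window_sets, of "real q * \<delta>" m i] by measurable

lemma antimono_exceeds: "\<omega> \<in> space S \<Longrightarrow> 0 \<le> d \<Longrightarrow> antimono (\<lambda>q. exceeds k d i q \<omega>)"
proof (rule antimonoI)
  fix q q' :: nat assume \<omega>: "\<omega> \<in> space S" and d: "0 \<le> d" and q: "q \<le> q'"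
  have "window k i (real q' * d) \<subseteq> window k i (real q * d)"
    using mult_right_mono[of "real q" "real q'" d] d q by (auto simp: window_def)
  then have "emeasure (\<eta> \<omega>) (window k i (real q' * d)) \<le> emeasure (\<eta> \<omega>) (window k i (real q * d))"
    using d sets_\<eta>[OF \<omega>] by (intro emeasure_mono) (auto intro!: window_sets)
  then show "exceeds k d i q' \<omega> \<le> exceeds k d i q \<omega>"
    by (auto simp: exceeds_def)
qed

text \<open>The windows are all void exactly if their union is, so a single Poisson probability
  suffices; the intensities add up because the cells are disjoint.\<close>

lemma prob_void:
  assumes A: "finite A" and r: "\<And>i. i \<in> A \<Longrightarrow> 1 \<le> r i" and m: "0 < m" and \<delta>: "0 < \<delta>"
  shows "prob {\<omega> \<in> space S. \<forall>i\<in>A. \<not> exceeds m \<delta> i (r i) \<omega>} = exp (- (\<Sum>i\<in>A. (real (r i) * \<delta>) powr - \<alpha> / m))"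
proof -
  let ?y = "\<lambda>i. real (r i) * \<delta>"
  let ?U = "\<Union>i\<in>A. window m i (?y i)"
  have y: "0 < ?y i" if "i \<in> A" for i
    using r[OF that] \<delta> by simp
  have windows: "window m i (?y i) \<in> sets \<Lambda>" if "i \<in> A" for i
    using y[OF that] by (intro window_sets) simp
  have U: "?U \<in> sets \<Lambda>"
    using A windows by (intro sets.finite_UN) auto
  have "{\<omega> \<in> space S. \<forall>i\<in>A. \<not> exceeds m \<delta> i (r i) \<omega>} = {\<omega> \<in> space S. emeasure (\<eta> \<omega>) ?U = 0}"
  proof (intro Collect_cong conj_cong refl)
    fix \<omega> assume "\<omega> \<in> space S"
    then have s: "sets (\<eta> \<omega>) = sets \<Lambda>" by (rule sets_\<eta>)
    show "(\<forall>i\<in>A. \<not> exceeds m \<delta> i (r i) \<omega>) \<longleftrightarrow> emeasure (\<eta> \<omega>) ?U = 0"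
    proof
      assume 0: "\<forall>i\<in>A. \<not> exceeds m \<delta> i (r i) \<omega>"
      then have "?U \<in> null_sets (\<eta> \<omega>)"
        using A windows s by (intro null_sets.finite_UN) (auto simp: exceeds_def null_sets_def)
      then show "emeasure (\<eta> \<omega>) ?U = 0" by auto
    next
      assume 0: "emeasure (\<eta> \<omega>) ?U = 0"
      have "emeasure (\<eta> \<omega>) (window m i (?y i)) \<le> emeasure (\<eta> \<omega>) ?U" if "i \<in> A" for i
        using U s that by (intro emeasure_mono) auto
      then show "\<forall>i\<in>A. \<not> exceeds m \<delta> i (r i) \<omega>"
        using 0 by (auto simp: exceeds_def)
    qed
  qed
  moreover have em: "emeasure \<Lambda> ?U = ennreal (\<Sum>i\<in>A. ?y i powr - \<alpha> / m)"
    by (rule emeasure_window_UN[OF A y m])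
  then have "measure \<Lambda> ?U = (\<Sum>i\<in>A. ?y i powr - \<alpha> / m)"
    unfolding measure_def by (simp add: sum_nonneg)
  moreover have "emeasure \<Lambda> ?U < \<infinity>"
    unfolding em by simp
  ultimately show ?thesis
    using \<eta>_void[OF U] by simp
qed

definition simple_config :: "nat \<Rightarrow> nat \<Rightarrow> real \<Rightarrow> nat \<Rightarrow> 's \<Rightarrow> bool" where
  "simple_config m n \<delta> Q \<omega> \<longleftrightarrow>
    (\<forall>p\<in>near_pairs m n. emeasure (\<eta> \<omega>) (window m (fst p) \<delta> \<union> window m (snd p) \<delta>) = 0 \<or>
       emeasure (\<eta> \<omega>) (window m (fst p) \<delta> \<union> window m (snd p) \<delta>) = 1) \<and>
    (\<forall>i\<in>{..<n}. emeasure (\<eta> \<omega>) (window m i (real Q * \<delta>)) = 0)"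

lemma prob_not_simple_config:
  assumes m: "0 < m" and \<delta>: "0 < \<delta>" and Q: "1 \<le> Q"
  shows "{\<omega> \<in> space S. \<not> simple_config m n \<delta> Q \<omega>} \<in> events"
    "prob {\<omega> \<in> space S. \<not> simple_config m n \<delta> Q \<omega>} \<le>
      crowding \<alpha> m n \<delta> Q"
proof -
  define E1 where "E1 p = {\<omega> \<in> space S. emeasure (\<eta> \<omega>) (window m (fst p) \<delta> \<union> window m (snd p) \<delta>) \<noteq> 0 \<and>
      emeasure (\<eta> \<omega>) (window m (fst p) \<delta> \<union> window m (snd p) \<delta>) \<noteq> 1}" for p
  define E2 where "E2 i = {\<omega> \<in> space S. emeasure (\<eta> \<omega>) (window m i (real Q * \<delta>)) \<noteq> 0}" for i
  have U: "window m i \<delta> \<union> window m j \<delta> \<in> sets \<Lambda>" for i j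
    using \<delta> by (intro sets.Un window_sets) auto
  have Ule: "emeasure \<Lambda> (window m i \<delta> \<union> window m j \<delta>) \<le> ennreal (2 * \<delta> powr - \<alpha> / m)" for i j
  proof -
    have "emeasure \<Lambda> (window m i \<delta> \<union> window m j \<delta>) \<le> emeasure \<Lambda> (window m i \<delta>) + emeasure \<Lambda> (window m j \<delta>)"
      using \<delta> by (intro emeasure_subadditive window_sets) auto
    also have "\<dots> = ennreal (2 * \<delta> powr - \<alpha> / m)"
      using \<delta> m by (simp add: emeasure_window ennreal_plus[symmetric] del: ennreal_plus)
    finally show ?thesis .
  qed
  have fin: "emeasure \<Lambda> (window m i \<delta> \<union> window m j \<delta>) < \<infinity>" for i j
    using le_less_trans[OF Ule] by simp
  have ev1: "E1 p \<in> events" for p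
    unfolding E1_def using \<eta>_measurable[OF U[of "fst p" "snd p"]] by measurable
  have B2: "window m i (real Q * \<delta>) \<in> sets \<Lambda>" for i
    using \<delta> by (intro window_sets) auto
  have ev2: "E2 i \<in> events" for i
    unfolding E2_def using \<eta>_measurable[OF B2[of i]] by measurable
  have p1: "prob (E1 p) \<le> (2 * \<delta> powr - \<alpha> / m)\<^sup>2" for p
  proof -
    have "prob (E1 p) \<le> (measure \<Lambda> (window m (fst p) \<delta> \<union> window m (snd p) \<delta>))\<^sup>2"
      unfolding E1_def by (rule \<eta>_multiple[OF U fin])
    also have "\<dots> \<le> (2 * \<delta> powr - \<alpha> / m)\<^sup>2"
      unfolding measure_def using enn2real_mono[OF Ule[of "fst p" "snd p"]]
      by (intro power_mono) auto
    finally show ?thesis .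
  qed
  have p2: "prob (E2 i) \<le> (real Q * \<delta>) powr - \<alpha> / m" for i
  proof -
    have Q\<delta>: "0 < real Q * \<delta>" using Q \<delta> by simp
    have "E2 i = space S - {\<omega> \<in> space S. emeasure (\<eta> \<omega>) (window m i (real Q * \<delta>)) = 0}"
      by (auto simp: E2_def)
    then have "prob (E2 i) = 1 - exp (- measure \<Lambda> (window m i (real Q * \<delta>)))"
      using \<eta>_void[OF B2[of i]] emeasure_window[OF Q\<delta> m] prob_compl[OF \<eta>_event[OF B2[of i], of 0]] by simp
    also have "measure \<Lambda> (window m i (real Q * \<delta>)) = (real Q * \<delta>) powr - \<alpha> / m"
      unfolding measure_def emeasure_window[OF Q\<delta> m] by simp
    finally show ?thesis
      using exp_ge_add_one_self[of "- ((real Q * \<delta>) powr - \<alpha> / m)"] by linarith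
  qed
  have eq: "{\<omega> \<in> space S. \<not> simple_config m n \<delta> Q \<omega>} = (\<Union>p\<in>near_pairs m n. E1 p) \<union> (\<Union>i<n. E2 i)"
    by (auto simp: simple_config_def E1_def E2_def)
  show "{\<omega> \<in> space S. \<not> simple_config m n \<delta> Q \<omega>} \<in> events"
    unfolding eq using ev1 ev2 finite_near_pairs by (intro sets.Un sets.finite_UN) auto
  have "prob {\<omega> \<in> space S. \<not> simple_config m n \<delta> Q \<omega>} \<le> prob (\<Union>p\<in>near_pairs m n. E1 p) + prob (\<Union>i<n. E2 i)"
    unfolding eq using ev1 ev2 finite_near_pairs by (intro measure_Un_le sets.finite_UN) auto
  also have "\<dots> \<le> (\<Sum>p\<in>near_pairs m n. prob (E1 p)) + (\<Sum>i<n. prob (E2 i))"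
    using ev1 ev2 finite_near_pairs by (intro add_mono measure_UNION_le) auto
  also have "\<dots> \<le> (\<Sum>p\<in>near_pairs m n. (2 * \<delta> powr - \<alpha> / m)\<^sup>2) + (\<Sum>i<n. (real Q * \<delta>) powr - \<alpha> / m)"
    by (intro add_mono sum_mono p1 p2)
  also have "\<dots> \<le> crowding \<alpha> m n \<delta> Q"
    using card_near_pairs[of m n] by (simp only: sum_constant card_lessThan) (intro add_mono mult_right_mono, auto)
  finally show "prob {\<omega> \<in> space S. \<not> simple_config m n \<delta> Q \<omega>} \<le>
      crowding \<alpha> m n \<delta> Q" .
qed

text \<open>Integer counts hold almost surely for one set at a time. The countably many slabs with
  rational boundary collected here suffice to locate the atom in a window.\<close>

definition integral_config :: "nat \<Rightarrow> nat \<Rightarrow> real \<Rightarrow> 's \<Rightarrow> bool" where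
  "integral_config m i \<delta> \<omega> \<longleftrightarrow> (\<forall>a\<in>\<rat>.
     (\<exists>k::nat. emeasure (\<eta> \<omega>) (window m i \<delta> \<inter> {..a} \<times> UNIV) = of_nat k) \<and>
     (\<exists>k::nat. emeasure (\<eta> \<omega>) (window m i \<delta> \<inter> UNIV \<times> {..a}) = of_nat k)) \<and>
     (\<exists>k::nat. emeasure (\<eta> \<omega>) (window m i \<delta>) = of_nat k)"

lemma slab_sets:
  assumes "0 \<le> \<delta>"
  shows "window m i \<delta> \<inter> {..a} \<times> UNIV \<in> sets \<Lambda>" "window m i \<delta> \<inter> UNIV \<times> {..a} \<in> sets \<Lambda>"
proof -
  have "window m i \<delta> \<inter> {..a} \<times> UNIV = (cell m i \<inter> {..a}) \<times> {\<delta><..}" "window m i \<delta> \<inter> UNIV \<times> {..a} = cell m i \<times> ({\<delta><..} \<inter> {..a})"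
    by (auto simp: window_def)
  then show "window m i \<delta> \<inter> {..a} \<times> UNIV \<in> sets \<Lambda>" "window m i \<delta> \<inter> UNIV \<times> {..a} \<in> sets \<Lambda>"
    using cell_pos[of m i] assms by (auto intro!: sets_times simp: cell_def)
qed

lemma AE_integral_config:
  assumes m: "0 < m" and \<delta>: "0 < \<delta>"
  shows "AE \<omega> in S. integral_config m i \<delta> \<omega>"
proof -
  have fin: "emeasure \<Lambda> B < \<infinity>" if "B \<subseteq> window m i \<delta>" for B
    using emeasure_mono[OF that window_sets[of \<delta> m i]] \<delta> emeasure_window[OF \<delta> m, of i] by (auto simp: less_top[symmetric] top_unique)
  have "AE \<omega> in S. (\<exists>k::nat. emeasure (\<eta> \<omega>) (window m i \<delta> \<inter> {..a} \<times> UNIV) = of_nat k) \<and>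
     (\<exists>k::nat. emeasure (\<eta> \<omega>) (window m i \<delta> \<inter> UNIV \<times> {..a}) = of_nat k)" for a
    using \<delta> by (intro AE_conjI \<eta>_integer slab_sets fin) auto
  then have "AE \<omega> in S. \<forall>a\<in>\<rat>. (\<exists>k::nat. emeasure (\<eta> \<omega>) (window m i \<delta> \<inter> {..a} \<times> UNIV) = of_nat k) \<and>
     (\<exists>k::nat. emeasure (\<eta> \<omega>) (window m i \<delta> \<inter> UNIV \<times> {..a}) = of_nat k)"
    by (intro AE_ball_countable[THEN iffD2] countable_rat) auto
  moreover have "AE \<omega> in S. \<exists>k::nat. emeasure (\<eta> \<omega>) (window m i \<delta>) = of_nat k"
    using \<delta> by (intro \<eta>_integer window_sets fin) auto
  ultimately show ?thesis
    unfolding integral_config_def by eventually_elim blast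
qed

lemma singleton_sets: "0 < t \<Longrightarrow> 0 < x \<Longrightarrow> {(t, x)} \<in> sets \<Lambda>"
  using sets_times[of "{t}" "{x}"] by simp

text \<open>A probability measure under which all half-planes with rational boundary have measure \<open>0\<close> or \<open>1\<close> is a
  point mass.\<close>

lemma single_atom:
  assumes \<omega>: "\<omega> \<in> space S" and \<delta>: "0 \<le> \<delta>" and int: "integral_config m i \<delta> \<omega>" and one: "emeasure (\<eta> \<omega>) (window m i \<delta>) = 1"
  obtains t x where "(t, x) \<in> window m i \<delta>" "emeasure (\<eta> \<omega>) {(t, x)} = 1" "emeasure (\<eta> \<omega>) (window m i \<delta> - {(t, x)}) = 0"
proof -
  let ?U = "window m i \<delta>"
  define K where "K = restrict_space (\<eta> \<omega>) ?U"
  have s: "sets (\<eta> \<omega>) = sets \<Lambda>" by (rule sets_\<eta>[OF \<omega>])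
  have U: "?U \<in> sets (\<eta> \<omega>)" using window_sets[OF \<delta>] s by simp
  have sp: "space K = ?U"
    using U sets.sets_into_space by (auto simp: K_def space_restrict_space)
  have emK: "emeasure K B = emeasure (\<eta> \<omega>) B" if "B \<subseteq> ?U" for B
    unfolding K_def by (rule emeasure_restrict_space) (use U sets.Int_space_eq2 that in auto)
  interpret K: prob_space K
    by (rule prob_spaceI) (simp add: sp emK one)
  have triv: "K.prob B = 0 \<or> K.prob B = 1" if "B \<subseteq> ?U" "emeasure (\<eta> \<omega>) B = of_nat k" for B and k :: nat
  proof -
    have "K.prob B = real k"
      unfolding measure_def emK[OF that(1)] that(2) by simp
    then show ?thesis
      using K.prob_le_1[of B] by (cases k) auto
  qed
  have f1: "fst \<in> borel_measurable \<Lambda>" and f2: "snd \<in> borel_measurable \<Lambda>"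
  proof -
    have "(\<lambda>x. x) \<in> measurable (restrict_space lborel {0<..}) borel"
      by (rule measurable_restrict_space1) simp
    from measurable_compose[OF measurable_fst this] show "fst \<in> borel_measurable \<Lambda>"
      by (simp add: stairs_intensity_def)
    have "(\<lambda>x. x) \<in> measurable \<mu> borel"
      unfolding measurable_cong_sets[OF sets_\<mu> refl] by (rule measurable_restrict_space1) simp
    from measurable_compose[OF measurable_snd this] show "snd \<in> borel_measurable \<Lambda>"
      by (simp add: stairs_intensity_def)
  qed
  have fK: "fst \<in> borel_measurable K" "snd \<in> borel_measurable K"
    unfolding K_def using f1 f2 by (auto intro!: measurable_restrict_space1 simp: measurable_cong_sets[OF s refl])
  have e1: "{p \<in> space K. fst p \<le> a} = ?U \<inter> {..a} \<times> UNIV" and e2: "{p \<in> space K. snd p \<le> a} = ?U \<inter> UNIV \<times> {..a}" for a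
    by (auto simp: sp)
  obtain t where t: "AE p in K. fst p = t"
  proof (rule K.AE_const_if_rational_cdf_trivial[OF fK(1)])
    fix a :: real assume "a \<in> \<rat>"
    then obtain k :: nat where "emeasure (\<eta> \<omega>) (?U \<inter> {..a} \<times> UNIV) = of_nat k"
      using int unfolding integral_config_def by blast
    then show "K.prob {p \<in> space K. fst p \<le> a} = 0 \<or> K.prob {p \<in> space K. fst p \<le> a} = 1"
      unfolding e1 by (intro triv) auto
  qed blast
  obtain x where x: "AE p in K. snd p = x"
  proof (rule K.AE_const_if_rational_cdf_trivial[OF fK(2)])
    fix a :: real assume "a \<in> \<rat>"
    then obtain k :: nat where "emeasure (\<eta> \<omega>) (?U \<inter> UNIV \<times> {..a}) = of_nat k"
      using int unfolding integral_config_def by blast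
    then show "K.prob {p \<in> space K. snd p \<le> a} = 0 \<or> K.prob {p \<in> space K. snd p \<le> a} = 1"
      unfolding e2 by (intro triv) auto
  qed blast
  have ae: "AE p in K. p = (t, x) \<and> p \<in> ?U"
    using t x AE_space[of K] by eventually_elim (auto simp: sp prod_eq_iff)
  have in_U: "(t, x) \<in> ?U"
  proof (rule ccontr)
    assume no: "(t, x) \<notin> ?U"
    from ae have "AE p in K. False"
      by eventually_elim (use no in auto)
    then show False by simp
  qed
  have "?U \<subseteq> {0<..} \<times> {0<..}"
    using cell_pos[of m i] \<delta> by (auto simp: window_def)
  then have sing: "{(t, x)} \<in> sets \<Lambda>"
    using in_U by (auto intro!: singleton_sets)
  have setsK: "{(t, x)} \<in> sets K" "?U - {(t, x)} \<in> sets K"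
    unfolding K_def using sing U s in_U by (auto simp: sets_restrict_space_iff sets.Int_space_eq2)
  have "K.prob {(t, x)} = 1"
    using setsK(1) ae by (subst K.prob_eq_1) (auto elim!: eventually_mono)
  then have "emeasure K {(t, x)} = 1"
    by (simp add: K.emeasure_eq_measure)
  then have 1: "emeasure (\<eta> \<omega>) {(t, x)} = 1"
    using emK[of "{(t, x)}"] in_U by simp
  have "K.prob (?U - {(t, x)}) = 0"
    using setsK(2) ae by (subst K.prob_eq_0) (auto elim!: eventually_mono)
  then have "emeasure K (?U - {(t, x)}) = 0"
    by (simp add: K.emeasure_eq_measure)
  then have 2: "emeasure (\<eta> \<omega>) (?U - {(t, x)}) = 0"
    using emK[of "?U - {(t, x)}"] by simp
  show thesis
    by (rule that[OF in_U 1 2])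
qed

lemma simple_config_cases:
  assumes \<omega>: "\<omega> \<in> space S" and simple: "simple_config m n \<delta> Q \<omega>" and int: "integral_config m i \<delta> \<omega>"
    and i: "i < n" and \<delta>: "0 \<le> \<delta>"
  obtains (empty) "emeasure (\<eta> \<omega>) (window m i \<delta>) = 0"
  | (atom) t x where "(t, x) \<in> window m i \<delta>" "emeasure (\<eta> \<omega>) {(t, x)} = 1" "emeasure (\<eta> \<omega>) (window m i \<delta> - {(t, x)}) = 0"
proof -
  have "(i, i) \<in> near_pairs m n"
    using i by (simp add: near_pairs_def)
  then have "emeasure (\<eta> \<omega>) (window m i \<delta>) = 0 \<or> emeasure (\<eta> \<omega>) (window m i \<delta>) = 1"
    using simple unfolding simple_config_def by fastforce
  then show thesis
    using single_atom[OF \<omega> \<delta> int] empty atom by metis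
qed

lemma atom_pos:
  assumes "\<omega> \<in> space S" "emeasure (\<eta> \<omega>) {(t, x)} \<noteq> 0"
  shows "0 < t" "0 < x"
proof -
  have "{(t, x)} \<in> sets \<Lambda>"
    using assms emeasure_notin_sets[of "{(t, x)}" "\<eta> \<omega>"] sets_\<eta> by auto
  then have "(t, x) \<in> space \<Lambda>"
    using sets.sets_into_space by blast
  then show "0 < t" "0 < x"
    by (auto simp: space_\<Lambda>)
qed

lemma emeasure_ge_atom:
  assumes "\<omega> \<in> space S" "B \<in> sets \<Lambda>" "(t, x) \<in> B"
  shows "emeasure (\<eta> \<omega>) {(t, x)} \<le> emeasure (\<eta> \<omega>) B"
  using assms sets_\<eta> by (intro emeasure_mono) auto

definition regular_config :: "(nat \<Rightarrow> nat) \<Rightarrow> (nat \<Rightarrow> nat) \<Rightarrow> (nat \<Rightarrow> real) \<Rightarrow> (nat \<Rightarrow> nat) \<Rightarrow> 's \<Rightarrow> bool" where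
  "regular_config m n \<delta> Q \<omega> \<longleftrightarrow> \<omega> \<in> space S \<and> (\<forall>j i. integral_config (m j) i (\<delta> j) \<omega>) \<and>
     (\<forall>\<^sub>F j in sequentially. simple_config (m j) (n j) (\<delta> j) (Q j) \<omega>)"

text \<open>By Borel-Cantelli, since the failure probabilities are summable over the
  resolutions.\<close>

lemma AE_regular_config:
  assumes m: "\<And>j. 0 < m j" and \<delta>: "\<And>j. 0 < \<delta> j" and Q: "\<And>j. 1 \<le> Q j"
    and sm: "summable (\<lambda>j. crowding \<alpha> (m j) (n j) (\<delta> j) (Q j))"
  shows "AE \<omega> in S. regular_config m n \<delta> Q \<omega>"
proof -
  have "AE \<omega> in S. \<forall>\<^sub>F j in sequentially. \<omega> \<in> space S - {\<omega> \<in> space S. \<not> simple_config (m j) (n j) (\<delta> j) (Q j) \<omega>}"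
  proof (rule borel_cantelli_AE1)
    show "{\<omega> \<in> space S. \<not> simple_config (m j) (n j) (\<delta> j) (Q j) \<omega>} \<in> events" for j
      by (rule prob_not_simple_config(1)[OF m \<delta> Q])
    show "summable (\<lambda>j. prob {\<omega> \<in> space S. \<not> simple_config (m j) (n j) (\<delta> j) (Q j) \<omega>})"
      by (rule summable_comparison_test'[OF sm, of 0]) (use prob_not_simple_config(2)[OF m \<delta> Q] in auto)
  qed (simp add: less_top[symmetric])
  moreover have "AE \<omega> in S. \<forall>j i. integral_config (m j) i (\<delta> j) \<omega>"
    unfolding AE_all_countable using AE_integral_config[OF m \<delta>] by blast
  ultimately show ?thesis
    using AE_space
  proof eventually_elim
    case (elim \<omega>)
    then have "\<forall>\<^sub>F j in sequentially. simple_config (m j) (n j) (\<delta> j) (Q j) \<omega>"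
      by (auto elim: eventually_mono)
    then show ?case
      using elim by (simp add: regular_config_def)
  qed
qed

section \<open>Stairs processes driven by regular configurations\<close>

context
  fixes m n Q :: "nat \<Rightarrow> nat" and \<delta> :: "nat \<Rightarrow> real" and \<omega>
  assumes m: "\<And>j. 3 \<le> m j" and \<delta>: "\<And>j. 0 < \<delta> j" and Q: "\<And>j. 1 \<le> Q j"
    and \<delta>0: "\<delta> \<longlonglongrightarrow> 0" and T: "filterlim (\<lambda>j. real (n j) / m j) at_top sequentially"
    and regular: "regular_config m n \<delta> Q \<omega>"
begin

lemma \<omega>_space: "\<omega> \<in> space S"
  using regular by (simp add: regular_config_def)

lemma integral_all: "integral_config (m j) i (\<delta> j) \<omega>"
  using regular by (simp add: regular_config_def)

lemma m_pos: "0 < m j"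
  using m[of j] by simp

text \<open>At a resolution so fine that both heights exceed the threshold and \<open>t\<close> is
  before the horizon, the two atoms share a window that carries at most one.\<close>

lemma atom_unique:
  assumes a: "emeasure (\<eta> \<omega>) {(t, x)} \<noteq> 0" and b: "emeasure (\<eta> \<omega>) {(t, y)} \<noteq> 0"
  shows "x = y"
proof -
  note pos = atom_pos[OF \<omega>_space a] atom_pos[OF \<omega>_space b]
  have "\<forall>\<^sub>F j in sequentially. \<delta> j < min x y"
    using pos by (intro order_tendstoD(2)[OF \<delta>0]) auto
  moreover have "\<forall>\<^sub>F j in sequentially. t \<le> real (n j) / m j"
    using T unfolding filterlim_at_top by blast
  moreover have "\<forall>\<^sub>F j in sequentially. simple_config (m j) (n j) (\<delta> j) (Q j) \<omega>"
    using regular by (simp add: regular_config_def)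
  ultimately have "\<forall>\<^sub>F j in sequentially. \<delta> j < min x y \<and> t \<le> real (n j) / m j \<and> simple_config (m j) (n j) (\<delta> j) (Q j) \<omega>"
    by eventually_elim simp
  then obtain j where j: "\<delta> j < min x y" "t \<le> real (n j) / m j" "simple_config (m j) (n j) (\<delta> j) (Q j) \<omega>"
    by (auto simp: eventually_sequentially)
  obtain i where i: "i < n j" "t \<in> cell (m j) i"
    using cell_cover[OF m_pos pos(1) j(2)] by blast
  have in_w: "(t, x) \<in> window (m j) i (\<delta> j)" "(t, y) \<in> window (m j) i (\<delta> j)"
    using i j by (auto simp: window_def)
  have w: "window (m j) i (\<delta> j) \<in> sets \<Lambda>"
    using \<delta>[of j] by (intro window_sets) simp
  have \<delta>': "0 \<le> \<delta> j" using \<delta>[of j] by simp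
  show ?thesis
  proof (rule simple_config_cases[OF \<omega>_space j(3) integral_all i(1) \<delta>'])
    assume "emeasure (\<eta> \<omega>) (window (m j) i (\<delta> j)) = 0"
    then show ?thesis
      using emeasure_ge_atom[OF \<omega>_space w in_w(1)] a by simp
  next
    fix t0 x0 assume p: "(t0, x0) \<in> window (m j) i (\<delta> j)" "emeasure (\<eta> \<omega>) {(t0, x0)} = 1"
      "emeasure (\<eta> \<omega>) (window (m j) i (\<delta> j) - {(t0, x0)}) = 0"
    have sing: "{(t0, x0)} \<in> sets \<Lambda>"
      using p(2) by (intro singleton_sets atom_pos[OF \<omega>_space, of t0 x0]) auto
    have "z = x0" if z: "emeasure (\<eta> \<omega>) {(t, z)} \<noteq> 0" "(t, z) \<in> window (m j) i (\<delta> j)" for z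
    proof (rule ccontr)
      assume "z \<noteq> x0"
      then have "emeasure (\<eta> \<omega>) {(t, z)} \<le> emeasure (\<eta> \<omega>) (window (m j) i (\<delta> j) - {(t0, x0)})"
        using z w sing by (intro emeasure_ge_atom[OF \<omega>_space]) auto
      then show False
        using p(3) z(1) by simp
    qed
    then show ?thesis
      using a b in_w by metis
  qed
qed

lemma jump_atom: "emeasure (\<eta> \<omega>) {(t, x)} \<noteq> 0 \<Longrightarrow> jump (\<eta> \<omega>) t = x"
  unfolding jump_def using someI[of "\<lambda>x. emeasure (\<eta> \<omega>) {(t, x)} \<noteq> 0" x] atom_unique by auto

lemma jump_pos_atom: "jump (\<eta> \<omega>) t \<noteq> 0 \<Longrightarrow> emeasure (\<eta> \<omega>) {(t, jump (\<eta> \<omega>) t)} \<noteq> 0"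
proof -
  assume "jump (\<eta> \<omega>) t \<noteq> 0"
  then obtain x where "emeasure (\<eta> \<omega>) {(t, x)} \<noteq> 0"
    unfolding jump_def by (metis (mono_tags))
  then show ?thesis
    using jump_atom by simp
qed

lemma jump_nonneg: "0 \<le> jump (\<eta> \<omega>) t"
  using atom_pos(2)[OF \<omega>_space jump_pos_atom, of t] by (cases "jump (\<eta> \<omega>) t = 0") auto

lemma jump_nonpos: "t \<le> 0 \<Longrightarrow> jump (\<eta> \<omega>) t = 0"
  using atom_pos(1)[OF \<omega>_space jump_pos_atom, of t] by (cases "jump (\<eta> \<omega>) t = 0") auto

lemma jump_le_if_null:
  assumes "emeasure (\<eta> \<omega>) (window k i y) = 0" "0 \<le> y" "t \<in> cell k i"
  shows "jump (\<eta> \<omega>) t \<le> y"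
proof (rule ccontr)
  assume gt: "\<not> jump (\<eta> \<omega>) t \<le> y"
  then have "(t, jump (\<eta> \<omega>) t) \<in> window k i y"
    using assms by (simp add: window_def)
  from emeasure_ge_atom[OF \<omega>_space window_sets[OF assms(2)] this] show False
    using assms(1,2) jump_pos_atom[of t] gt by simp
qed

lemma jump_path_regular: "jump_path (jump (\<eta> \<omega>))"
proof
  fix T' :: real
  have "\<forall>\<^sub>F j in sequentially. T' \<le> real (n j) / m j"
    using T unfolding filterlim_at_top by blast
  moreover have "\<forall>\<^sub>F j in sequentially. simple_config (m j) (n j) (\<delta> j) (Q j) \<omega>"
    using regular by (simp add: regular_config_def)
  ultimately have "\<forall>\<^sub>F j in sequentially. T' \<le> real (n j) / m j \<and> simple_config (m j) (n j) (\<delta> j) (Q j) \<omega>"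
    by eventually_elim simp
  then obtain j where j: "T' \<le> real (n j) / m j" "simple_config (m j) (n j) (\<delta> j) (Q j) \<omega>"
    by (auto simp: eventually_sequentially)
  have Q\<delta>: "0 \<le> real (Q j) * \<delta> j"
    using \<delta>[of j] by simp
  have "jump (\<eta> \<omega>) t \<le> real (Q j) * \<delta> j" if tT: "t \<le> T'" for t
  proof (cases "t \<le> 0")
    case True
    then show ?thesis using jump_nonpos Q\<delta> by simp
  next
    case False
    obtain i where i: "i < n j" "t \<in> cell (m j) i"
      using cell_cover[OF m_pos, of t "n j" j] False tT j(1) by auto
    then show ?thesis
      using j(2) by (intro jump_le_if_null[OF _ Q\<delta> i(2)]) (simp add: simple_config_def)
  qed
  then show "\<exists>C. \<forall>t\<le>T'. jump (\<eta> \<omega>) t \<le> C"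
    by blast
qed (rule jump_nonneg, rule jump_nonpos)

text \<open>The level of a cell is the height of its unique atom in units of
  \<open>\<delta> j\<close>, rounded down. Two atoms in near cells would give the union of their
  windows mass at least 2, against \<open>simple_config\<close>.\<close>

lemma regular_near_staircase:
  assumes simple: "simple_config (m j) (n j) (\<delta> j) (Q j) \<omega>"
  defines "d \<equiv> \<lambda>i. level_count (Q j) (\<lambda>q. exceeds (m j) (\<delta> j) i q \<omega>)"
  shows "well_separated (m j) (n j) d"
    "near_staircase (m j) (n j) d (\<delta> j) ((2 * (real (n j) / m j) + 1) * \<delta> j) (stairs (jump (\<eta> \<omega>)))"
proof -
  interpret jump_path "jump (\<eta> \<omega>)" by (rule jump_path_regular)
  have \<delta>': "0 \<le> \<delta> j" using \<delta>[of j] by simp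
  have d_less: "d i < q \<longleftrightarrow> \<not> exceeds (m j) (\<delta> j) i q \<omega>" if "1 \<le> q" "q \<le> Q j" for i q
    unfolding d_def by (rule level_count_less_iff[OF antimono_exceeds[OF \<omega>_space \<delta>'] that])
  have unflagged: "emeasure (\<eta> \<omega>) (window (m j) i (\<delta> j)) = 0" if "d i = 0" for i
    using d_less[of 1 i] that Q[of j] by (simp add: exceeds_def)
  have flagged: "\<exists>t x. t \<in> cell (m j) i \<and> emeasure (\<eta> \<omega>) {(t, x)} = 1 \<and> jump (\<eta> \<omega>) t = x \<and> \<delta> j < x \<and> \<delta> j * d i \<le> x \<and> x \<le> \<delta> j * (d i + 1) \<and>
      (\<forall>u\<in>cell (m j) i. u \<noteq> t \<longrightarrow> jump (\<eta> \<omega>) u \<le> \<delta> j)" if i: "i < n j" "d i \<noteq> 0" for i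
  proof (rule simple_config_cases[OF \<omega>_space simple integral_all i(1) \<delta>'])
    assume "emeasure (\<eta> \<omega>) (window (m j) i (\<delta> j)) = 0"
    then have "d i < 1"
      using d_less[of 1 i] Q[of j] by (simp add: exceeds_def)
    then show ?thesis
      using i(2) by simp
  next
    fix t x assume p: "(t, x) \<in> window (m j) i (\<delta> j)" "emeasure (\<eta> \<omega>) {(t, x)} = 1"
      "emeasure (\<eta> \<omega>) (window (m j) i (\<delta> j) - {(t, x)}) = 0"
    have jt: "jump (\<eta> \<omega>) t = x"
      using p(2) by (intro jump_atom) simp
    have t: "t \<in> cell (m j) i" and x\<delta>: "\<delta> j < x"
      using p(1) by (auto simp: window_def)
    have sing: "{(t, x)} \<in> sets \<Lambda>"
      using p(2) by (intro singleton_sets atom_pos[OF \<omega>_space, of t x]) auto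
    have diff: "window (m j) i (\<delta> j) - {(t, x)} \<in> sets \<Lambda>"
      using sing window_sets[OF \<delta>'] by auto
    have ex: "exceeds (m j) (\<delta> j) i q \<omega> \<longleftrightarrow> real q * \<delta> j < x" if q: "1 \<le> q" for q
    proof
      have q\<delta>: "\<delta> j \<le> real q * \<delta> j" "0 \<le> real q * \<delta> j"
        using q \<delta>' mult_right_mono[of 1 "real q" "\<delta> j"] by auto
      show "real q * \<delta> j < x" if "exceeds (m j) (\<delta> j) i q \<omega>"
      proof (rule ccontr)
        assume "\<not> real q * \<delta> j < x"
        then have "window (m j) i (real q * \<delta> j) \<subseteq> window (m j) i (\<delta> j) - {(t, x)}"
          using q\<delta>(1) by (auto simp: window_def)
        then have "emeasure (\<eta> \<omega>) (window (m j) i (real q * \<delta> j)) \<le> emeasure (\<eta> \<omega>) (window (m j) i (\<delta> j) - {(t, x)})"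
          using diff sets_\<eta>[OF \<omega>_space] by (intro emeasure_mono) auto
        then show False
          using p(3) that by (simp add: exceeds_def)
      qed
      show "exceeds (m j) (\<delta> j) i q \<omega>" if "real q * \<delta> j < x"
        using emeasure_ge_atom[OF \<omega>_space window_sets[OF q\<delta>(2)], of t x "m j" i] p(2) t that
        by (auto simp: exceeds_def window_def)
    qed
    \<comment> \<open>No atom lies above \<open>Q j * \<delta> j\<close>, so the cap on the levels
      does not cut off the recorded height.\<close>
    have notQ: "\<not> exceeds (m j) (\<delta> j) i (Q j) \<omega>"
      using simple i(1) by (simp add: simple_config_def exceeds_def)
    have dQ: "d i < Q j"
      using d_less[of "Q j" i] notQ Q[of j] by simp
    have "real (d i) * \<delta> j < x"
      using d_less[of "d i" i] ex[of "d i"] dQ i(2) by simp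
    moreover have "\<not> real (Suc (d i)) * \<delta> j < x"
      using d_less[of "Suc (d i)" i] ex[of "Suc (d i)"] dQ by simp
    moreover have "jump (\<eta> \<omega>) u \<le> \<delta> j" if u: "u \<in> cell (m j) i" "u \<noteq> t" for u
    proof (rule ccontr)
      assume gt: "\<not> jump (\<eta> \<omega>) u \<le> \<delta> j"
      then have "emeasure (\<eta> \<omega>) {(u, jump (\<eta> \<omega>) u)} \<le> emeasure (\<eta> \<omega>) (window (m j) i (\<delta> j) - {(t, x)})"
        using u diff by (intro emeasure_ge_atom[OF \<omega>_space]) (auto simp: window_def)
      then show False
        using p(3) jump_pos_atom[of u] gt \<delta>' by simp
    qed
    ultimately show ?thesis
      using jt t x\<delta> p(2) by (intro exI[of _ t] exI[of _ x]) (auto simp: algebra_simps)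
  qed
  show sep: "well_separated (m j) (n j) d"
    unfolding well_separated_def
  proof (intro allI impI)
    fix i k assume ik: "i < k" "k < n j" "d i \<noteq> 0" "d k \<noteq> 0"
    show "i + 2 < k \<and> (k + 2 < i + m j \<or> i + m j + 2 < k)"
    proof (rule ccontr)
      assume "\<not> ?thesis"
      then have "(i, k) \<in> near_pairs (m j) (n j)"
        using ik by (auto simp: near_pairs_def)
      then have le1: "emeasure (\<eta> \<omega>) (window (m j) i (\<delta> j) \<union> window (m j) k (\<delta> j)) \<le> 1"
        using simple unfolding simple_config_def by fastforce
      obtain t x where a: "t \<in> cell (m j) i" "emeasure (\<eta> \<omega>) {(t, x)} = 1" "\<delta> j < x"
        using flagged[of i] ik by auto
      obtain u y where b: "u \<in> cell (m j) k" "emeasure (\<eta> \<omega>) {(u, y)} = 1" "\<delta> j < y"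
        using flagged[of k] ik by auto
      have tu: "t \<noteq> u"
        using cell_disjoint[of i k "m j"] ik(1) m_pos a(1) b(1) by auto
      have sing: "{(t, x)} \<in> sets \<Lambda>" "{(u, y)} \<in> sets \<Lambda>"
        using a(2) b(2) by (auto intro!: singleton_sets atom_pos[OF \<omega>_space, of t x] atom_pos[OF \<omega>_space, of u y])
      have "emeasure (\<eta> \<omega>) {(t, x)} + emeasure (\<eta> \<omega>) {(u, y)} = emeasure (\<eta> \<omega>) ({(t, x)} \<union> {(u, y)})"
        using sing sets_\<eta>[OF \<omega>_space] tu by (intro plus_emeasure) auto
      also have "\<dots> \<le> emeasure (\<eta> \<omega>) (window (m j) i (\<delta> j) \<union> window (m j) k (\<delta> j))"
        using a b window_sets[OF \<delta>'] sets_\<eta>[OF \<omega>_space] by (intro emeasure_mono) (auto simp: window_def)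
      finally have "emeasure (\<eta> \<omega>) {(t, x)} + emeasure (\<eta> \<omega>) {(u, y)} \<le> 1"
        using le1 by (rule order_trans)
      then show False
        using a(2) b(2) by simp
    qed
  qed
  show "near_staircase (m j) (n j) d (\<delta> j) ((2 * (real (n j) / m j) + 1) * \<delta> j) (stairs (jump (\<eta> \<omega>)))"
  proof (rule near_staircase_stairs[OF m \<delta>' sep])
    show "jump (\<eta> \<omega>) t \<le> \<delta> j" if "i < n j" "d i = 0" "t \<in> {real i / m j<..real (Suc i) / m j}" for i t
      by (rule jump_le_if_null[OF unflagged[OF that(2)] \<delta>']) (use that in \<open>simp add: cell_def\<close>)
    show "\<exists>s\<in>{real i / m j<..real (Suc i) / m j}. \<delta> j * d i \<le> jump (\<eta> \<omega>) s \<and> jump (\<eta> \<omega>) s \<le> \<delta> j * (d i + 1) \<and>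
      (\<forall>t\<in>{real i / m j<..real (Suc i) / m j}. t \<noteq> s \<longrightarrow> jump (\<eta> \<omega>) t \<le> \<delta> j)" if "i < n j" "d i \<noteq> 0" for i
      using flagged[OF that] unfolding cell_def by auto
  qed
qed

end

end

section \<open>Large displacements of the branching random walk\<close>

lemma card_generations: "0 \<le> L \<Longrightarrow> real (card (generations L m i)) \<le> L / m + 1"
proof -
  assume L: "0 \<le> L"
  have "real (Suc i) / m * L = real i / m * L + L / m"
    by (simp add: add_divide_distrib distrib_right)
  moreover have "0 \<le> real i / m * L" "0 \<le> L / m"
    using L by auto
  ultimately have "real_of_int \<lfloor>real (Suc i) / m * L\<rfloor> - real_of_int \<lfloor>real i / m * L\<rfloor> < L / m + 1"
    by linarith
  then show ?thesis
    using L by (simp add: generations_def of_nat_diff_if nat_mono floor_mono divide_right_mono mult_right_mono)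
qed

lemma generations_disjoint: "i \<noteq> j \<Longrightarrow> 0 < m \<Longrightarrow> 0 < L \<Longrightarrow> generations L m i \<inter> generations L m j = {}"
  using cell_disjoint[of i j m] mem_generations_iff[of L] unfolding cell_def by blast

context brw_model
begin

definition tail :: "real \<Rightarrow> real" where "tail z = measure D {z<..}"

lemma tail_nonneg: "0 \<le> tail z"
  by (simp add: tail_def)

lemma prob_Y_greater: "i \<in> {1..2 * N} \<Longrightarrow> prob {\<omega> \<in> space M. z < Y k i \<omega>} = tail z"
proof -
  assume i: "i \<in> {1..2 * N}"
  have "tail z = measure (distr M borel (Y k i)) {z<..}"
    using distr_Y[OF i] by (simp add: tail_def)
  also have "\<dots> = prob (Y k i -` {z<..} \<inter> space M)"
    by (rule measure_distr[OF Y_measurable[OF i]]) simp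
  finally show ?thesis
    by (simp add: vimage_def Int_def conj_commute)
qed

lemma prob_Y_le: "i \<in> {1..2 * N} \<Longrightarrow> prob {\<omega> \<in> space M. Y k i \<omega> \<le> z} = 1 - tail z"
proof -
  assume i: "i \<in> {1..2 * N}"
  have "{\<omega> \<in> space M. Y k i \<omega> \<le> z} = space M - {\<omega> \<in> space M. z < Y k i \<omega>}"
    by auto
  moreover have "{\<omega> \<in> space M. z < Y k i \<omega>} \<in> events"
    using Y_measurable[OF i, of k] by measurable
  ultimately show ?thesis
    using prob_compl prob_Y_greater[OF i] by simp
qed

lemma prob_Y_void:
  assumes A: "finite A" and G: "\<And>i. i \<in> A \<Longrightarrow> finite (G i)" and disj: "\<And>i j. i \<in> A \<Longrightarrow> j \<in> A \<Longrightarrow> i \<noteq> j \<Longrightarrow> G i \<inter> G j = {}"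
  shows "prob {\<omega> \<in> space M. \<forall>i\<in>A. \<forall>k\<in>G i. \<forall>l\<in>{1..2 * N}. Y k l \<omega> \<le> z i} =
    (\<Prod>i\<in>A. (1 - tail (z i)) ^ (card (G i) * (2 * N)))"
proof -
  let ?E = "{\<omega> \<in> space M. \<forall>i\<in>A. \<forall>k\<in>G i. \<forall>l\<in>{1..2 * N}. Y k l \<omega> \<le> z i}"
  define J where "J = (\<Union>i\<in>A. G i \<times> {1..2 * N})"
  \<comment> \<open>A half-line for the indices in \<open>J\<close>, since the sets
    \<open>G i\<close> are disjoint, and the whole line elsewhere.\<close>
  define B where "B = (\<lambda>(k, l :: nat). {y. \<forall>i\<in>A. k \<in> G i \<longrightarrow> y \<le> z i})"
  let ?C = "\<lambda>p. (case p of (k, l) \<Rightarrow> Y k l) -` B p \<inter> space M"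
  have finJ: "finite J"
    using A G by (auto simp: J_def)
  have Bk: "B (k, l) = {..z i}" if "i \<in> A" "k \<in> G i" for i k l
    using that disj by (auto simp: B_def)
  have prod: "(\<Prod>p\<in>J. prob (?C p)) = (\<Prod>i\<in>A. (1 - tail (z i)) ^ (card (G i) * (2 * N)))"
  proof -
    have "(\<Prod>p\<in>J. prob (?C p)) =
        (\<Prod>i\<in>A. \<Prod>p\<in>G i \<times> {1..2 * N}. prob (?C p))"
      unfolding J_def using A G disj by (intro prod.UNION_disjoint) (auto simp: disjoint_iff)
    also have "\<dots> = (\<Prod>i\<in>A. \<Prod>p\<in>G i \<times> {1..2 * N}. (1 - tail (z i)))"
    proof (intro prod.cong refl)
      fix i p assume i: "i \<in> A" and p: "p \<in> G i \<times> {1..2 * N}"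
      then obtain k l where kl: "p = (k, l)" "k \<in> G i" "l \<in> {1..2 * N}" by blast
      have "?C p = {\<omega> \<in> space M. Y k l \<omega> \<le> z i}"
        using Bk[OF i kl(2), of l] kl(1) by auto
      then show "prob (?C p) = 1 - tail (z i)"
        using prob_Y_le[OF kl(3)] by simp
    qed
    also have "\<dots> = (\<Prod>i\<in>A. (1 - tail (z i)) ^ (card (G i) * (2 * N)))"
      by (simp add: card_cartesian_product)
    finally show ?thesis .
  qed
  show ?thesis
  proof (cases "J = {}")
    case True
    then have "?E = space M"
      using N by (auto simp: J_def)
    then show ?thesis
      using prod True prob_space by simp
  next
    case False
    have "prob (\<Inter>p\<in>J. ?C p) =
        (\<Prod>p\<in>J. prob (?C p))"
    proof (rule indep_varsD[OF indep])
      show "B p \<in> sets borel" if "p \<in> J" for p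
        using that Bk by (auto simp: J_def)
    qed (use False finJ in \<open>auto simp: J_def\<close>)
    moreover have "(\<Inter>p\<in>J. ?C p) =
        ?E"
    proof (intro set_eqI iffI)
      fix \<omega> assume \<omega>: "\<omega> \<in> (\<Inter>p\<in>J. ?C p)"
      then have "\<omega> \<in> space M" using False by auto
      moreover have "Y k l \<omega> \<le> z i" if "i \<in> A" "k \<in> G i" "l \<in> {1..2 * N}" for i k l
      proof -
        have "(k, l) \<in> J" using that by (auto simp: J_def)
        from INT_D[OF \<omega> this] have "Y k l \<omega> \<in> B (k, l)" by simp
        then show ?thesis using Bk[OF that(1,2)] by simp
      qed
      ultimately show "\<omega> \<in> ?E" by blast
    next
      fix \<omega> assume \<omega>: "\<omega> \<in> ?E"
      then show "\<omega> \<in> (\<Inter>p\<in>J. ?C p)"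
        using Bk by (auto simp: J_def)
    qed
    ultimately show ?thesis
      using prod by simp
  qed
qed

text \<open>A union bound over ordered pairs: distinct indices have independent displacements, and
  equal indices give the empty event.\<close>

lemma prob_two_big:
  assumes G: "finite G" "G \<subseteq> UNIV \<times> {1..2 * N}"
  shows "{\<omega> \<in> space M. \<exists>p\<in>G. \<exists>p'\<in>G. p \<noteq> p' \<and> a < Y (fst p) (snd p) \<omega> \<and> a < Y (fst p') (snd p') \<omega>} \<in> events" (is "?E \<in> _")
    and "prob {\<omega> \<in> space M. \<exists>p\<in>G. \<exists>p'\<in>G. p \<noteq> p' \<and> a < Y (fst p) (snd p) \<omega> \<and> a < Y (fst p') (snd p') \<omega>} \<le> (real (card G) * tail a)\<^sup>2"
proof -
  define E where "E q = {\<omega> \<in> space M. fst q \<noteq> snd q \<and> a < Y (fst (fst q)) (snd (fst q)) \<omega> \<and> a < Y (fst (snd q)) (snd (snd q)) \<omega>}" for q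
  have Ym: "Y (fst p) (snd p) \<in> borel_measurable M" if "p \<in> G" for p
    using G(2) that by (intro Y_measurable) auto
  have ev: "E q \<in> events" if "q \<in> G \<times> G" for q
  proof -
    have [measurable]: "Y (fst (fst q)) (snd (fst q)) \<in> borel_measurable M" "Y (fst (snd q)) (snd (snd q)) \<in> borel_measurable M"
      using that by (auto intro: Ym)
    show ?thesis unfolding E_def by measurable
  qed
  have eq: "?E = (\<Union>q\<in>G \<times> G. E q)"
  proof -
    have "(\<exists>p\<in>G. \<exists>p'\<in>G. R p p') \<longleftrightarrow> (\<exists>q\<in>G \<times> G. R (fst q) (snd q))" for R :: "nat \<times> nat \<Rightarrow> nat \<times> nat \<Rightarrow> bool"
      by (metis SigmaE SigmaI fst_conv snd_conv)
    note pairs = this[of "\<lambda>p p'. p \<noteq> p' \<and> a < Y (fst p) (snd p) _ \<and> a < Y (fst p') (snd p') _"]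
    have bex: "(P \<and> (\<exists>q\<in>G \<times> G. R q)) \<longleftrightarrow> (\<exists>q\<in>G \<times> G. P \<and> R q)" for P R
      by blast
    show ?thesis
      by (intro set_eqI) (simp only: mem_Collect_eq UN_iff E_def pairs bex)
  qed
  show "?E \<in> events"
    unfolding eq using G ev by (intro sets.finite_UN) auto
  have le: "prob (E q) \<le> (tail a)\<^sup>2" if q: "q \<in> G \<times> G" for q
  proof (cases "fst q = snd q")
    case True
    then show ?thesis by (simp add: E_def)
  next
    case False
    define p p' where "p = fst q" and "p' = snd q"
    have pp: "p \<noteq> p'" "p \<in> G" "p' \<in> G" "p \<in> UNIV \<times> {1..2 * N}" "p' \<in> UNIV \<times> {1..2 * N}"
      using False q G(2) by (auto simp: p_def p'_def)
    have single: "prob ((case j of (k, l) \<Rightarrow> Y k l) -` {a<..} \<inter> space M) = tail a" if "j \<in> UNIV \<times> {1..2 * N}" for j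
    proof -
      have "(case j of (k, l) \<Rightarrow> Y k l) -` {a<..} \<inter> space M = {\<omega> \<in> space M. a < Y (fst j) (snd j) \<omega>}"
        by (auto simp: case_prod_beta)
      then show ?thesis
        using prob_Y_greater[of "snd j" a "fst j"] that by auto
    qed
    have "E q = (\<Inter>j\<in>{p, p'}. (case j of (k, l) \<Rightarrow> Y k l) -` {a<..} \<inter> space M)"
      using pp(1) by (auto simp: E_def p_def p'_def case_prod_beta)
    also have "prob \<dots> = (\<Prod>j\<in>{p, p'}. prob ((case j of (k, l) \<Rightarrow> Y k l) -` {a<..} \<inter> space M))"
      using pp by (intro indep_varsD[OF indep]) auto
    also have "\<dots> = (\<Prod>j\<in>{p, p'}. tail a)"
      using pp by (intro prod.cong refl single) auto
    also have "\<dots> = (tail a)\<^sup>2"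
      using pp(1) by (simp add: power2_eq_square)
    finally show ?thesis by simp
  qed
  have "prob (\<Union>q\<in>G \<times> G. E q) \<le> (\<Sum>q\<in>G \<times> G. prob (E q))"
    using G ev by (intro measure_UNION_le) auto
  also have "\<dots> \<le> (\<Sum>q\<in>G \<times> G. (tail a)\<^sup>2)"
    by (intro sum_mono le)
  also have "\<dots> = (real (card G) * tail a)\<^sup>2"
    by (simp add: card_cartesian_product power2_eq_square)
  finally show "prob ?E \<le> (real (card G) * tail a)\<^sup>2"
    unfolding eq .
qed

definition big :: "real \<Rightarrow> nat \<Rightarrow> nat \<Rightarrow> real \<Rightarrow> 'q \<Rightarrow> (nat \<times> nat) set" where
  "big L m i a \<omega> = {p \<in> generations L m i \<times> {1..2 * N}. a < Y (fst p) (snd p) \<omega>}"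

definition block_exceeds :: "real \<Rightarrow> nat \<Rightarrow> real \<Rightarrow> nat \<Rightarrow> nat \<Rightarrow> 'q \<Rightarrow> bool" where
  "block_exceeds L m a i q \<omega> \<longleftrightarrow> big L m i (real q * a) \<omega> \<noteq> {}"

lemma finite_generations: "finite (generations L m i)"
  by (simp add: generations_def)

lemma block_exceeds_iff:
  "block_exceeds L m a i q \<omega> \<longleftrightarrow> (\<exists>k\<in>generations L m i. \<exists>l\<in>{1..2 * N}. real q * a < Y k l \<omega>)"
  by (force simp: block_exceeds_def big_def)

lemma block_exceeds_measurable: "Measurable.pred M (block_exceeds L m a i q)"
  unfolding block_exceeds_iff[abs_def]
proof (intro pred_intros_finite finite_generations finite_atLeastAtMost)
  fix k l assume "l \<in> {1..2 * N}"
  then have [measurable]: "Y k l \<in> borel_measurable M" by (rule Y_measurable)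
  show "Measurable.pred M (\<lambda>\<omega>. real q * a < Y k l \<omega>)" by measurable
qed

lemma antimono_block_exceeds: "0 \<le> a \<Longrightarrow> antimono (\<lambda>q. block_exceeds L m a i q \<omega>)"
proof (rule antimonoI)
  fix q q' :: nat assume "0 \<le> a" "q \<le> q'"
  then have "real q * a \<le> real q' * a"
    by (intro mult_right_mono) auto
  then show "block_exceeds L m a i q' \<omega> \<le> block_exceeds L m a i q \<omega>"
    by (force simp: block_exceeds_iff)
qed

lemma prob_block_void:
  assumes "finite A" "0 < m" "0 < L"
  shows "prob {\<omega> \<in> space M. \<forall>i\<in>A. \<not> block_exceeds L m a i (r i) \<omega>} =
    (\<Prod>i\<in>A. (1 - tail (real (r i) * a)) ^ (card (generations L m i) * (2 * N)))"
proof -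
  have "{\<omega> \<in> space M. \<forall>i\<in>A. \<not> block_exceeds L m a i (r i) \<omega>} =
      {\<omega> \<in> space M. \<forall>i\<in>A. \<forall>k\<in>generations L m i. \<forall>l\<in>{1..2 * N}. Y k l \<omega> \<le> real (r i) * a}"
    by (auto simp: block_exceeds_iff not_less)
  moreover have "prob {\<omega> \<in> space M. \<forall>i\<in>A. \<forall>k\<in>generations L m i. \<forall>l\<in>{1..2 * N}. Y k l \<omega> \<le> real (r i) * a} =
      (\<Prod>i\<in>A. (1 - tail (real (r i) * a)) ^ (card (generations L m i) * (2 * N)))"
    by (intro prob_Y_void assms finite_generations generations_disjoint)
  ultimately show ?thesis
    by simp
qed

text \<open>The counterpart of \<open>simple_config\<close> for the walk, with large displacements
  in place of atoms.\<close>

definition simple_blocks :: "real \<Rightarrow> nat \<Rightarrow> nat \<Rightarrow> real \<Rightarrow> nat \<Rightarrow> 'q \<Rightarrow> bool" where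
  "simple_blocks L m n a Q \<omega> \<longleftrightarrow>
    (\<forall>ij\<in>near_pairs m n. \<forall>p\<in>big L m (fst ij) a \<omega> \<union> big L m (snd ij) a \<omega>.
       \<forall>p'\<in>big L m (fst ij) a \<omega> \<union> big L m (snd ij) a \<omega>. p = p') \<and>
    (\<forall>i\<in>{..<n}. \<not> block_exceeds L m a i Q \<omega>)"

lemma prob_not_simple_blocks:
  assumes L: "0 \<le> L"
  shows "{\<omega> \<in> space M. \<not> simple_blocks L m n a Q \<omega>} \<in> events"
    "prob {\<omega> \<in> space M. \<not> simple_blocks L m n a Q \<omega>} \<le>
      real n * 8 * (2 * (2 * real N * (L / m + 1) * tail a))\<^sup>2 + real n * (2 * real N * (L / m + 1) * tail (real Q * a))"
proof -
  define G where "G ij = (generations L m (fst ij) \<union> generations L m (snd ij)) \<times> {1..2 * N}" for ij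
  define E1 where "E1 ij = {\<omega> \<in> space M. \<exists>p\<in>G ij. \<exists>p'\<in>G ij. p \<noteq> p' \<and> a < Y (fst p) (snd p) \<omega> \<and> a < Y (fst p') (snd p') \<omega>}" for ij
  define E2 where "E2 i = {\<omega> \<in> space M. block_exceeds L m a i Q \<omega>}" for i
  have G: "finite (G ij)" "G ij \<subseteq> UNIV \<times> {1..2 * N}" for ij
    by (auto simp: G_def finite_generations)
  have cardG: "real (card (G ij)) \<le> 2 * (2 * real N * (L / m + 1))" for ij
  proof -
    have "card (G ij) = card (generations L m (fst ij) \<union> generations L m (snd ij)) * (2 * N)"
      by (simp add: G_def card_cartesian_product)
    also have "\<dots> \<le> (card (generations L m (fst ij)) + card (generations L m (snd ij))) * (2 * N)"
      by (intro mult_right_mono card_Un_le) auto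
    finally have "real (card (G ij)) \<le> real ((card (generations L m (fst ij)) + card (generations L m (snd ij))) * (2 * N))"
      by (rule of_nat_mono)
    also have "\<dots> \<le> ((L / m + 1) + (L / m + 1)) * (2 * real N)"
      using card_generations[OF L] by (simp only: of_nat_mult of_nat_add of_nat_numeral) (intro mult_right_mono add_mono, auto)
    finally show ?thesis by (simp add: algebra_simps)
  qed
  have ev1: "E1 ij \<in> events" for ij
    unfolding E1_def by (rule prob_two_big(1)[OF G])
  have ev2: "E2 i \<in> events" for i
    unfolding E2_def using block_exceeds_measurable[of L m a i Q] by (simp add: pred_def)
  have p1: "prob (E1 ij) \<le> (2 * (2 * real N * (L / m + 1) * tail a))\<^sup>2" for ij
  proof -
    have "prob (E1 ij) \<le> (real (card (G ij)) * tail a)\<^sup>2"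
      unfolding E1_def by (rule prob_two_big(2)[OF G])
    also have "\<dots> \<le> (2 * (2 * real N * (L / m + 1)) * tail a)\<^sup>2"
      using cardG tail_nonneg by (intro power_mono mult_right_mono) auto
    finally show ?thesis by (simp add: mult.assoc)
  qed
  have p2: "prob (E2 i) \<le> 2 * real N * (L / m + 1) * tail (real Q * a)" for i
  proof -
    let ?I = "generations L m i \<times> {1..2 * N}"
    have Ym: "{\<omega> \<in> space M. real Q * a < Y (fst p) (snd p) \<omega>} \<in> events" if "p \<in> ?I" for p
    proof -
      have [measurable]: "Y (fst p) (snd p) \<in> borel_measurable M" using that by (intro Y_measurable) auto
      show ?thesis by measurable
    qed
    have "E2 i = (\<Union>p\<in>?I. {\<omega> \<in> space M. real Q * a < Y (fst p) (snd p) \<omega>})"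
      by (force simp: E2_def block_exceeds_iff)
    then have "prob (E2 i) \<le> (\<Sum>p\<in>?I. prob {\<omega> \<in> space M. real Q * a < Y (fst p) (snd p) \<omega>})"
      using Ym finite_generations by (simp only:) (intro measure_UNION_le, auto)
    also have "\<dots> = (\<Sum>p\<in>?I. tail (real Q * a))"
      by (intro sum.cong refl prob_Y_greater) auto
    also have "\<dots> = real (card (generations L m i)) * (2 * real N) * tail (real Q * a)"
      by (simp add: card_cartesian_product)
    also have "\<dots> \<le> (L / m + 1) * (2 * real N) * tail (real Q * a)"
      using card_generations[OF L] tail_nonneg by (intro mult_right_mono) auto
    finally show ?thesis by (simp add: algebra_simps)
  qed
  have eq: "{\<omega> \<in> space M. \<not> simple_blocks L m n a Q \<omega>} = (\<Union>ij\<in>near_pairs m n. E1 ij) \<union> (\<Union>i<n. E2 i)"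
  proof -
    define W where "W ij \<omega> \<longleftrightarrow> (\<exists>p\<in>G ij. \<exists>p'\<in>G ij. p \<noteq> p' \<and> a < Y (fst p) (snd p) \<omega> \<and> a < Y (fst p') (snd p') \<omega>)" for ij \<omega>
    have single: "(\<forall>p\<in>{p \<in> G'. R p}. \<forall>p'\<in>{p \<in> G'. R p}. p = p') \<longleftrightarrow> \<not> (\<exists>p\<in>G'. \<exists>p'\<in>G'. p \<noteq> p' \<and> R p \<and> R p')"
      for G' :: "(nat \<times> nat) set" and R
      by blast
    have "big L m (fst ij) a \<omega> \<union> big L m (snd ij) a \<omega> = {p \<in> G ij. a < Y (fst p) (snd p) \<omega>}" for ij \<omega>
      by (auto simp: big_def G_def)
    then have iff: "simple_blocks L m n a Q \<omega> \<longleftrightarrow>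
        (\<forall>ij\<in>near_pairs m n. \<not> W ij \<omega>) \<and> (\<forall>i\<in>{..<n}. \<not> block_exceeds L m a i Q \<omega>)" for \<omega>
      unfolding simple_blocks_def W_def by (simp only: single)
    have "E1 ij = {\<omega> \<in> space M. W ij \<omega>}" for ij
      by (simp only: E1_def W_def)
    then show ?thesis
      unfolding E2_def iff by blast
  qed
  show "{\<omega> \<in> space M. \<not> simple_blocks L m n a Q \<omega>} \<in> events"
    unfolding eq using ev1 ev2 finite_near_pairs by (intro sets.Un sets.finite_UN) auto
  have "prob {\<omega> \<in> space M. \<not> simple_blocks L m n a Q \<omega>} \<le> prob (\<Union>ij\<in>near_pairs m n. E1 ij) + prob (\<Union>i<n. E2 i)"
    unfolding eq using ev1 ev2 finite_near_pairs by (intro measure_Un_le sets.finite_UN) auto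
  also have "\<dots> \<le> (\<Sum>ij\<in>near_pairs m n. prob (E1 ij)) + (\<Sum>i<n. prob (E2 i))"
    using ev1 ev2 finite_near_pairs by (intro add_mono measure_UNION_le) auto
  also have "\<dots> \<le> (\<Sum>ij\<in>near_pairs m n. (2 * (2 * real N * (L / m + 1) * tail a))\<^sup>2) + (\<Sum>i<n. 2 * real N * (L / m + 1) * tail (real Q * a))"
    by (intro add_mono sum_mono p1 p2)
  also have "\<dots> \<le> real n * 8 * (2 * (2 * real N * (L / m + 1) * tail a))\<^sup>2 + real n * (2 * real N * (L / m + 1) * tail (real Q * a))"
    using card_near_pairs[of m n] by (simp only: sum_constant card_lessThan) (rule add_mono[OF mult_right_mono order_refl], auto)
  finally show "prob {\<omega> \<in> space M. \<not> simple_blocks L m n a Q \<omega>} \<le>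
      real n * 8 * (2 * (2 * real N * (L / m + 1) * tail a))\<^sup>2 + real n * (2 * real N * (L / m + 1) * tail (real Q * a))" .
qed

text \<open>As for the Poisson process, uniqueness within a cell comes from the pairs
  \<open>(i, i)\<close> and separation from the other near pairs.\<close>

lemma simple_blocks_structure:
  assumes simple: "simple_blocks L m n a Q \<omega>" and a: "0 < a" and Q: "1 \<le> Q" and m: "0 < m" and L: "0 < L"
  defines "d \<equiv> \<lambda>i. level_count Q (\<lambda>q. block_exceeds L m a i q \<omega>)"
  shows "well_separated m n d"
    "\<And>i k l. i < n \<Longrightarrow> d i = 0 \<Longrightarrow> k \<in> generations L m i \<Longrightarrow> l \<in> {1..2 * N} \<Longrightarrow> Y k l \<omega> \<le> a"
    "\<And>i. i < n \<Longrightarrow> d i \<noteq> 0 \<Longrightarrow> \<exists>k\<in>generations L m i. \<exists>l\<in>{1..2 * N}.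
      a * d i \<le> Y k l \<omega> \<and> Y k l \<omega> \<le> a * (real (d i) + 1) \<and>
      (\<forall>k'\<in>generations L m i. \<forall>l'\<in>{1..2 * N}. (k', l') \<noteq> (k, l) \<longrightarrow> Y k' l' \<omega> \<le> a)"
proof -
  have d_less: "d i < q \<longleftrightarrow> \<not> block_exceeds L m a i q \<omega>" if "1 \<le> q" "q \<le> Q" for i q
    unfolding d_def using a by (intro level_count_less_iff[OF antimono_block_exceeds that]) simp
  have d0: "d i = 0 \<longleftrightarrow> big L m i a \<omega> = {}" for i
    using d_less[of 1 i] Q by (simp add: block_exceeds_def)
  show "Y k l \<omega> \<le> a" if "i < n" "d i = 0" "k \<in> generations L m i" "l \<in> {1..2 * N}" for i k l
    using that d0[of i] by (force simp: big_def)
  show "\<exists>k\<in>generations L m i. \<exists>l\<in>{1..2 * N}.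
      a * d i \<le> Y k l \<omega> \<and> Y k l \<omega> \<le> a * (real (d i) + 1) \<and>
      (\<forall>k'\<in>generations L m i. \<forall>l'\<in>{1..2 * N}. (k', l') \<noteq> (k, l) \<longrightarrow> Y k' l' \<omega> \<le> a)" if i: "i < n" "d i \<noteq> 0" for i
  proof -
    have "(i, i) \<in> near_pairs m n"
      using i by (simp add: near_pairs_def)
    then have uniq: "p = p'" if "p \<in> big L m i a \<omega>" "p' \<in> big L m i a \<omega>" for p p'
      using simple that unfolding simple_blocks_def by fastforce
    have notQ: "\<not> block_exceeds L m a i Q \<omega>"
      using simple i(1) by (simp add: simple_blocks_def)
    have dQ: "d i < Q"
      using d_less[of Q i] notQ Q by simp
    have "block_exceeds L m a i (d i) \<omega>"
      using d_less[of "d i" i] dQ i(2) by simp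
    then obtain k l where kl: "k \<in> generations L m i" "l \<in> {1..2 * N}" "real (d i) * a < Y k l \<omega>"
      unfolding block_exceeds_iff by blast
    have "\<not> block_exceeds L m a i (Suc (d i)) \<omega>"
      using d_less[of "Suc (d i)" i] dQ by simp
    then have up: "Y k l \<omega> \<le> real (Suc (d i)) * a"
      using kl(1,2) unfolding block_exceeds_iff by (meson not_le)
    have "a \<le> real (d i) * a"
      using i(2) a mult_right_mono[of 1 "real (d i)" a] by simp
    then have klb: "(k, l) \<in> big L m i a \<omega>"
      using kl by (auto simp: big_def)
    have "Y k' l' \<omega> \<le> a" if "k' \<in> generations L m i" "l' \<in> {1..2 * N}" "(k', l') \<noteq> (k, l)" for k' l'
      using uniq[OF klb, of "(k', l')"] that by (force simp: big_def)
    then show ?thesis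
      using kl up by (intro bexI[of _ k] bexI[of _ l]) (auto simp: algebra_simps)
  qed
  show "well_separated m n d"
    unfolding well_separated_def
  proof (intro allI impI)
    fix i k assume ik: "i < k" "k < n" "d i \<noteq> 0" "d k \<noteq> 0"
    show "i + 2 < k \<and> (k + 2 < i + m \<or> i + m + 2 < k)"
    proof (rule ccontr)
      assume "\<not> ?thesis"
      then have "(i, k) \<in> near_pairs m n"
        using ik by (auto simp: near_pairs_def)
      moreover obtain p p' where p: "p \<in> big L m i a \<omega>" "p' \<in> big L m k a \<omega>"
        using d0[of i] d0[of k] ik(3,4) by auto
      ultimately have "p = p'"
        using simple unfolding simple_blocks_def by fastforce
      then show False
        using p generations_disjoint[of i k m L] ik(1) m L by (auto simp: big_def)
    qed
  qed
qed

end

section \<open>Limits for the rescaled branching random walk\<close>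

text \<open>After taking logarithms, \<open>ln (1 - p)\<close> lies between
  \<open>- p - 2 * p^2\<close> and \<open>- p\<close> for small \<open>p\<close>. The quadratic term
  remains negligible after multiplication by \<open>K\<close>, since \<open>K * p\<close> converges
  and \<open>p\<close> tends to 0.\<close>

lemma power_one_minus_tendsto:
  fixes p :: "nat \<Rightarrow> real" and K :: "nat \<Rightarrow> nat"
  assumes p: "p \<longlonglongrightarrow> 0" "\<forall>\<^sub>F N in sequentially. 0 \<le> p N" and Kp: "(\<lambda>N. real (K N) * p N) \<longlonglongrightarrow> l"
  shows "(\<lambda>N. (1 - p N) ^ K N) \<longlonglongrightarrow> exp (- l)"
proof -
  have half: "\<forall>\<^sub>F N in sequentially. p N < 1/2"
    using p(1) by (rule order_tendstoD(2)) simp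
  have "(\<lambda>N. real (K N) * ln (1 - p N)) \<longlonglongrightarrow> - l"
  proof (rule tendsto_sandwich)
    show "\<forall>\<^sub>F N in sequentially. real (K N) * (- p N - 2 * (p N)\<^sup>2) \<le> real (K N) * ln (1 - p N)"
      using half p(2) by eventually_elim (intro mult_left_mono ln_one_minus_pos_lower_bound, auto)
    show "\<forall>\<^sub>F N in sequentially. real (K N) * ln (1 - p N) \<le> real (K N) * (- p N)"
      using half p(2) by eventually_elim (intro mult_left_mono ln_one_minus_pos_upper_bound, auto)
    have "(\<lambda>N. - (real (K N) * p N) - 2 * (real (K N) * p N) * p N) \<longlonglongrightarrow> - l - 2 * l * 0"
      by (intro tendsto_intros Kp p(1))
    then show "(\<lambda>N. real (K N) * (- p N - 2 * (p N)\<^sup>2)) \<longlonglongrightarrow> - l"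
      by (simp add: algebra_simps power2_eq_square)
    show "(\<lambda>N. real (K N) * (- p N)) \<longlonglongrightarrow> - l"
      using tendsto_minus[OF Kp] by simp
  qed
  then have "(\<lambda>N. exp (real (K N) * ln (1 - p N))) \<longlonglongrightarrow> exp (- l)"
    by (rule tendsto_exp)
  moreover have "\<forall>\<^sub>F N in sequentially. exp (real (K N) * ln (1 - p N)) = (1 - p N) ^ K N"
    using half by eventually_elim (simp add: exp_of_nat_mult)
  ultimately show ?thesis
    by (rule Lim_transform_eventually)
qed

locale rescaled_brw = heavy_tail h \<alpha> for h :: "real \<Rightarrow> real" and \<alpha> :: real +
  fixes D :: "real measure" and Q :: "nat \<Rightarrow> 'q measure" and Y :: "nat \<Rightarrow> nat \<Rightarrow> nat \<Rightarrow> 'q \<Rightarrow> real"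
  assumes brw: "\<And>N. 1 \<le> N \<Longrightarrow> brw_model (Q N) N (Y N) D"
    and D_tail: "\<And>z. 0 \<le> z \<Longrightarrow> measure D {z<..} = 1 / h z"
    and D_nonneg: "AE y in D. 0 \<le> y"
begin

abbreviation c :: "nat \<Rightarrow> real" where "c \<equiv> scaling h"

abbreviation L :: "nat \<Rightarrow> real" where "L N \<equiv> log 2 (real N)"

lemma L_at_top: "filterlim L at_top sequentially"
  by real_asymp

lemma c_pos: "\<forall>\<^sub>F N in sequentially. 0 < c N"
  using scaling_at_top by (simp add: filterlim_at_top_dense)

lemma N_large: "\<forall>\<^sub>F N in sequentially. 2 \<le> N"
  by (rule eventually_ge_at_top)

lemma tail_eq: "1 \<le> N \<Longrightarrow> 0 \<le> z \<Longrightarrow> brw_model.tail D z = 1 / h z"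
  using brw_model.tail_def[OF brw[of 1], of z] D_tail[of z] by simp

lemma prob_space_D: "prob_space D"
  using brw_model.prob_space_D[OF brw[of 1]] by simp

lemma sets_D: "sets D = sets borel"
  using brw_model.sets_D[OF brw[of 1]] by simp

text \<open>The mean number of displacements above \<open>z * c N\<close> per time unit.\<close>

definition intensity :: "real \<Rightarrow> nat \<Rightarrow> real" where "intensity z N = level N / h (z * c N)"

lemma intensity_limit: "0 < z \<Longrightarrow> intensity z \<longlonglongrightarrow> z powr - \<alpha>"
  unfolding intensity_def[abs_def] by (rule tail_limit)

lemma inverse_L: "(\<lambda>N. 1 / L N) \<longlonglongrightarrow> 0"
  by real_asymp

lemma L_pos: "2 \<le> N \<Longrightarrow> 0 < L N"
  by (intro zero_less_log_cancel_iff[THEN iffD2]) auto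

lemma tail_scaled:
  assumes "2 \<le> N"
  shows "1 / h (z * c N) = intensity z N / (2 * real N * L N)"
proof -
  have "L N \<noteq> 0" using L_pos[OF assms] by linarith
  then show ?thesis
    using assms by (simp add: intensity_def level_def)
qed

lemma tail_to_0: "0 < z \<Longrightarrow> (\<lambda>N. 1 / h (z * c N)) \<longlonglongrightarrow> 0"
proof -
  assume z: "0 < z"
  have "(\<lambda>N. intensity z N * (1 / (2 * real N * L N))) \<longlonglongrightarrow> z powr - \<alpha> * 0"
    by (intro tendsto_mult intensity_limit z) real_asymp
  moreover have "\<forall>\<^sub>F N in sequentially. intensity z N * (1 / (2 * real N * L N)) = 1 / h (z * c N)"
    using N_large by eventually_elim (simp add: tail_scaled)
  ultimately show ?thesis
    by (auto elim: Lim_transform_eventually)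
qed

lemma card_generations_ratio:
  assumes m: "0 < m"
  shows "(\<lambda>N. real (card (generations (L N) m i)) / L N) \<longlonglongrightarrow> 1 / m"
proof (rule tendsto_sandwich)
  have ev: "\<forall>\<^sub>F N in sequentially. 1 \<le> L N"
    using L_at_top unfolding filterlim_at_top by blast
  show "\<forall>\<^sub>F N in sequentially. real (card (generations (L N) m i)) / L N \<le> 1 / m + 1 / L N"
    using ev
  proof eventually_elim
    case (elim N)
    have "real (card (generations (L N) m i)) / L N \<le> (L N / m + 1) / L N"
      using elim card_generations[of "L N" m i] by (intro divide_right_mono) auto
    then show ?case
      using elim by (simp add: add_divide_distrib)
  qed
  show "\<forall>\<^sub>F N in sequentially. 1 / m - 1 / L N \<le> real (card (generations (L N) m i)) / L N"
    using ev
  proof eventually_elim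
    case (elim N)
    have "real (Suc i) / m * L N = real i / m * L N + L N / m"
      by (simp add: add_divide_distrib distrib_right)
    moreover have "0 \<le> real i / m * L N" "0 \<le> L N / m"
      using elim by auto
    ultimately have "L N / m - 1 \<le> real (card (generations (L N) m i))"
      by (simp add: generations_def) linarith
    then have "(L N / m - 1) / L N \<le> real (card (generations (L N) m i)) / L N"
      using elim by (intro divide_right_mono) auto
    then show ?case
      using elim by (simp add: diff_divide_distrib)
  qed
  have "(\<lambda>N. 1 / m + 1 / L N) \<longlonglongrightarrow> 1 / m + 0" "(\<lambda>N. 1 / m - 1 / L N) \<longlonglongrightarrow> 1 / m - 0"
    by (intro tendsto_intros inverse_L)+
  then show "(\<lambda>N. 1 / m + 1 / L N) \<longlonglongrightarrow> 1 / m" "(\<lambda>N. 1 / m - 1 / L N) \<longlonglongrightarrow> 1 / m"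
    by simp_all
qed

text \<open>Cell \<open>i\<close> comprises about \<open>L N / m\<close> generations of
  \<open>2 * N\<close> independent displacements, so the mean number of those above
  \<open>r i * \<delta> * c N\<close> tends to the Poisson intensity of the corresponding
  window.\<close>

lemma void_limit:
  assumes m: "0 < m" and \<delta>: "0 < \<delta>" and A: "finite A" and r: "\<And>i. i \<in> A \<Longrightarrow> 1 \<le> r i"
  shows "(\<lambda>N. measure (Q N) {\<omega> \<in> space (Q N). \<forall>i\<in>A. \<not> brw_model.block_exceeds N (Y N) (L N) m (\<delta> * c N) i (r i) \<omega>})
    \<longlonglongrightarrow> exp (- (\<Sum>i\<in>A. (real (r i) * \<delta>) powr - \<alpha> / m))"
proof -
  have "(\<lambda>N. (1 - 1 / h (real (r i) * \<delta> * c N)) ^ (card (generations (L N) m i) * (2 * N))) \<longlonglongrightarrow> exp (- ((real (r i) * \<delta>) powr - \<alpha> / m))"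
    if i: "i \<in> A" for i
  proof (rule power_one_minus_tendsto)
    have pos: "0 < real (r i) * \<delta>"
      using r[OF i] \<delta> by simp
    show "(\<lambda>N. 1 / h (real (r i) * \<delta> * c N)) \<longlonglongrightarrow> 0"
      by (rule tail_to_0[OF pos])
    show "\<forall>\<^sub>F N in sequentially. 0 \<le> 1 / h (real (r i) * \<delta> * c N)"
      using c_pos by eventually_elim (use pos h_pos in \<open>simp add: less_imp_le\<close>)
    have "(\<lambda>N. (real (card (generations (L N) m i)) / L N) * intensity (real (r i) * \<delta>) N) \<longlonglongrightarrow> 1 / m * (real (r i) * \<delta>) powr - \<alpha>"
      by (intro tendsto_mult card_generations_ratio m intensity_limit pos)
    moreover have "\<forall>\<^sub>F N in sequentially. (real (card (generations (L N) m i)) / L N) * intensity (real (r i) * \<delta>) N =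
        real (card (generations (L N) m i) * (2 * N)) * (1 / h (real (r i) * \<delta> * c N))"
      using N_large by eventually_elim (simp add: tail_scaled)
    ultimately show "(\<lambda>N. real (card (generations (L N) m i) * (2 * N)) * (1 / h (real (r i) * \<delta> * c N))) \<longlonglongrightarrow> (real (r i) * \<delta>) powr - \<alpha> / m"
      by (auto elim: Lim_transform_eventually)
  qed
  then have "(\<lambda>N. \<Prod>i\<in>A. (1 - 1 / h (real (r i) * \<delta> * c N)) ^ (card (generations (L N) m i) * (2 * N))) \<longlonglongrightarrow> (\<Prod>i\<in>A. exp (- ((real (r i) * \<delta>) powr - \<alpha> / m)))"
    by (rule tendsto_prod)
  also have "(\<Prod>i\<in>A. exp (- ((real (r i) * \<delta>) powr - \<alpha> / m))) = exp (- (\<Sum>i\<in>A. (real (r i) * \<delta>) powr - \<alpha> / m))"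
    using A by (simp add: exp_sum[symmetric] sum_negf)
  finally show ?thesis
  proof (rule Lim_transform_eventually)
    show "\<forall>\<^sub>F N in sequentially. (\<Prod>i\<in>A. (1 - 1 / h (real (r i) * \<delta> * c N)) ^ (card (generations (L N) m i) * (2 * N))) =
        measure (Q N) {\<omega> \<in> space (Q N). \<forall>i\<in>A. \<not> brw_model.block_exceeds N (Y N) (L N) m (\<delta> * c N) i (r i) \<omega>}"
      using N_large c_pos
    proof eventually_elim
      case (elim N)
      then have N1: "1 \<le> N" and L0: "0 < L N" by auto
      show ?case
        unfolding brw_model.prob_block_void[OF brw[OF N1] A m L0]
        using elim \<delta> by (intro prod.cong refl) (simp add: tail_eq[OF N1] mult.assoc)
    qed
  qed
qed

text \<open>The exponential is split at \<open>cut N\<close>. Up to there its exponent is at most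
  that of \<open>cut N\<close>; beyond it the value is at most \<open>N powr (K * \<delta>)\<close>,
  on an event of probability \<open>1 / h (cut N)\<close>. \<open>small_jumps_mgf_limit\<close>
  applies to the sum.\<close>

lemma mgf_bound:
  assumes K: "0 \<le> K" "K * \<delta> \<le> 1/4" and \<delta>: "0 < \<delta>" and q: "1 < q"
  shows "\<forall>\<^sub>F N in sequentially. (\<integral>\<^sup>+y. ennreal (exp (K * ln (real N) / c N * (if y \<le> \<delta> * c N then max 0 y else 0))) \<partial>D) \<le> ennreal q"
proof -
  let ?g = "- 1 / (2 * (\<alpha> + 1))"
  have "\<forall>\<^sub>F N in sequentially. exp (K * ln (real N) * real N powr ?g) + real N powr (K * \<delta>) / h (cut N) < q"
    using small_jumps_mgf_limit(1)[OF K] q by (rule order_tendstoD(2))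
  then show ?thesis
    using small_jumps_mgf_limit(2)[OF K] c_pos N_large
  proof eventually_elim
    case (elim N)
    let ?\<Lambda> = "K * ln (real N) / c N"
    have \<Lambda>: "0 \<le> ?\<Lambda>"
      using K elim by simp
    have e1: "?\<Lambda> * cut N = K * ln (real N) * real N powr ?g"
      using elim by (simp add: cut_def)
    have e2: "exp (?\<Lambda> * (\<delta> * c N)) = real N powr (K * \<delta>)"
      using elim by (simp add: powr_def mult_ac)
    have le: "exp (?\<Lambda> * (if y \<le> \<delta> * c N then max 0 y else 0)) \<le> exp (?\<Lambda> * cut N) + exp (?\<Lambda> * (\<delta> * c N)) * indicator {cut N<..} y" for y
    proof (cases "cut N < y \<and> y \<le> \<delta> * c N")
      case True
      then have "exp (?\<Lambda> * max 0 y) \<le> exp (?\<Lambda> * (\<delta> * c N))"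
        using \<Lambda> elim(2) by (simp only: exp_le_cancel_iff) (intro mult_left_mono, auto)
      moreover have "0 \<le> exp (?\<Lambda> * cut N)" by simp
      ultimately show ?thesis
        using True by (simp add: add_increasing)
    next
      case False
      then have "(if y \<le> \<delta> * c N then max 0 y else 0) \<le> cut N"
        using elim(2) by auto
      then have "exp (?\<Lambda> * (if y \<le> \<delta> * c N then max 0 y else 0)) \<le> exp (?\<Lambda> * cut N)"
        using \<Lambda> by (simp only: exp_le_cancel_iff) (intro mult_left_mono, auto)
      moreover have "0 \<le> exp (?\<Lambda> * (\<delta> * c N)) * indicator {cut N<..} y"
        by (intro mult_nonneg_nonneg) auto
      ultimately show ?thesis by linarith
    qed
    interpret D: prob_space D by (rule prob_space_D)
    have "(\<integral>\<^sup>+y. ennreal (exp (?\<Lambda> * (if y \<le> \<delta> * c N then max 0 y else 0))) \<partial>D) \<le>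
        (\<integral>\<^sup>+y. ennreal (exp (?\<Lambda> * cut N)) + ennreal (exp (?\<Lambda> * (\<delta> * c N))) * indicator {cut N<..} y \<partial>D)"
    proof (rule nn_integral_mono)
      fix y
      have "ennreal (exp (?\<Lambda> * (if y \<le> \<delta> * c N then max 0 y else 0))) \<le> ennreal (exp (?\<Lambda> * cut N) + exp (?\<Lambda> * (\<delta> * c N)) * indicator {cut N<..} y)"
        by (rule ennreal_leI[OF le])
      also have "\<dots> = ennreal (exp (?\<Lambda> * cut N)) + ennreal (exp (?\<Lambda> * (\<delta> * c N))) * indicator {cut N<..} y"
        by (auto simp: indicator_def)
      finally show "ennreal (exp (?\<Lambda> * (if y \<le> \<delta> * c N then max 0 y else 0))) \<le> \<dots>" .
    qed
    also have "\<dots> = ennreal (exp (?\<Lambda> * cut N)) + ennreal (exp (?\<Lambda> * (\<delta> * c N))) * emeasure D {cut N<..}"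
      using sets_D by (subst nn_integral_add) (auto simp: D.emeasure_space_1 nn_integral_cmult_indicator)
    also have "emeasure D {cut N<..} = ennreal (1 / h (cut N))"
      using D_tail[OF elim(2)] by (simp add: D.emeasure_eq_measure)
    also have "ennreal (exp (?\<Lambda> * cut N)) + ennreal (exp (?\<Lambda> * (\<delta> * c N))) * ennreal (1 / h (cut N)) =
        ennreal (exp (K * ln (real N) * real N powr ?g) + real N powr (K * \<delta>) / h (cut N))"
      using h_pos[OF elim(2)] unfolding e1 e2 by (simp add: ennreal_mult[symmetric] ennreal_plus[symmetric] del: ennreal_plus)
    also have "\<dots> \<le> ennreal q"
      using elim(1) by (intro ennreal_leI) simp
    finally show ?case .
  qed
qed

definition simple_bound :: "nat \<Rightarrow> nat \<Rightarrow> real \<Rightarrow> nat \<Rightarrow> nat \<Rightarrow> real" where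
  "simple_bound m n \<delta> Qc N = real n * 8 * (2 * (2 * real N * (L N / m + 1) * (1 / h (\<delta> * c N))))\<^sup>2
     + real n * (2 * real N * (L N / m + 1) * (1 / h (real Qc * \<delta> * c N)))"

lemma simple_bound_limit:
  assumes \<delta>: "0 < \<delta>" and Qc: "1 \<le> Qc"
  shows "simple_bound m n \<delta> Qc \<longlonglongrightarrow> crowding \<alpha> m n \<delta> Qc"
proof -
  have lim: "(\<lambda>N. 2 * real N * (L N / m + 1) * (1 / h (z * c N))) \<longlonglongrightarrow> z powr - \<alpha> / m" if z: "0 < z" for z
  proof -
    have "(\<lambda>N. intensity z N * (1 / m + 1 / L N)) \<longlonglongrightarrow> z powr - \<alpha> * (1 / m + 0)"
      by (intro tendsto_intros intensity_limit z inverse_L)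
    moreover have "\<forall>\<^sub>F N in sequentially. intensity z N * (1 / m + 1 / L N) = 2 * real N * (L N / m + 1) * (1 / h (z * c N))"
      using N_large
    proof eventually_elim
      case (elim N)
      then have nz: "L N \<noteq> 0" "real N \<noteq> 0" using L_pos[of N] by linarith+
      have "1 / m + 1 / L N = (L N / m + 1) / L N"
        using nz(1) by (simp add: add_divide_distrib)
      moreover have "u * (v / w) = 2 * x * v * (u / (2 * x * w))" if "x \<noteq> 0" for u v w x :: real
        using that by simp
      ultimately show ?case
        unfolding tail_scaled[OF elim] using nz(2) by metis
    qed
    ultimately show ?thesis
      by (auto elim: Lim_transform_eventually)
  qed
  have "(\<lambda>N. real n * 8 * (2 * (2 * real N * (L N / m + 1) * (1 / h (\<delta> * c N))))\<^sup>2
     + real n * (2 * real N * (L N / m + 1) * (1 / h (real Qc * \<delta> * c N)))) \<longlonglongrightarrow>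
     real n * 8 * (2 * (\<delta> powr - \<alpha> / m))\<^sup>2 + real n * ((real Qc * \<delta>) powr - \<alpha> / m)"
    using Qc \<delta> by (intro tendsto_intros lim) auto
  then show ?thesis
    by (simp add: simple_bound_def[abs_def])
qed

text \<open>The product up to \<open>1 + 2 * intensity \<delta> N\<close> bounds
  \<open>outlier_bound\<close> divided by \<open>N\<close>. It is multiplied by
  \<open>T * intensity \<delta> N\<close> for the bad rows and by \<open>T * L N + 1\<close>, a
  bound for the number of generations, for the last particle. The final summand is for the excess
  over the envelope.\<close>

definition recursion_bound :: "real \<Rightarrow> nat \<Rightarrow> real \<Rightarrow> nat \<Rightarrow> real" where
  "recursion_bound T m \<delta> N = 4 * real N powr (- 1 / (2 * real m)) * (1 + 2 * intensity \<delta> N) * (T * intensity \<delta> N + (T * L N + 1)) + (T * L N + 1) / real N"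

lemma recursion_bound_limit:
  assumes \<delta>: "0 < \<delta>" and m: "0 < m"
  shows "recursion_bound T m \<delta> \<longlonglongrightarrow> 0"
proof -
  let ?k = "1 / (2 * real m)"
  have k: "0 < ?k" using m by simp
  have 1: "(\<lambda>N. real N powr (- ?k)) \<longlonglongrightarrow> 0" "(\<lambda>N. real N powr (- ?k) * (T * L N + 1)) \<longlonglongrightarrow> 0" "(\<lambda>N. (T * L N + 1) / real N) \<longlonglongrightarrow> 0"
    using k by real_asymp+
  have "(\<lambda>N. 4 * (1 + 2 * intensity \<delta> N) * (T * intensity \<delta> N * real N powr (- ?k) + real N powr (- ?k) * (T * L N + 1)) + (T * L N + 1) / real N)
      \<longlonglongrightarrow> 4 * (1 + 2 * \<delta> powr - \<alpha>) * (T * \<delta> powr - \<alpha> * 0 + 0) + 0"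
    by (intro tendsto_intros 1 intensity_limit \<delta>)
  then show ?thesis
    unfolding recursion_bound_def[abs_def] by (simp add: algebra_simps)
qed

section \<open>The lagged recursion with high probability\<close>

abbreviation V :: "nat \<Rightarrow> 'q \<Rightarrow> nat \<Rightarrow> real" where "V N \<omega> \<equiv> brw_top N (\<lambda>i j. Y N i j \<omega>)"

abbreviation W :: "nat \<Rightarrow> 'q \<Rightarrow> nat \<Rightarrow> real" where "W N \<omega> \<equiv> brw_bottom N (\<lambda>i j. Y N i j \<omega>)"

definition lagged_recursion :: "real \<Rightarrow> nat \<Rightarrow> real \<Rightarrow> real \<Rightarrow> nat \<Rightarrow> 'q \<Rightarrow> bool" where
  "lagged_recursion T m \<eta> \<delta> N \<omega> \<longleftrightarrow> (\<forall>k. real k \<le> T * L N \<longrightarrow>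
     W N \<omega> k \<le> V N \<omega> (k - nat \<lceil>(1 - 1 / m) * L N\<rceil>) + \<eta> * c N \<and>
     (V N \<omega> k \<le> \<eta> * c N \<or> (\<exists>k'<k. \<exists>l\<in>{1..2 * N}. \<delta> * c N < Y N k' l \<omega> \<and>
        V N \<omega> k \<le> V N \<omega> (k' - nat \<lceil>(1 - 1 / m) * L N\<rceil>) + Y N k' l \<omega> + 2 * (\<eta> * c N))))"

text \<open>With \<open>K * \<eta> = T + 3\<close> Markov's inequality gains
  \<open>N powr (- (T + 3))\<close>. The growth over the horizon is at most
  \<open>N powr (T + 2)\<close>, including the initial \<open>N\<close> particles, which leaves
  \<open>1 / N\<close> per generation. Over the lag, \<open>(2 * q) ^ r\<close> is at most
  \<open>4 * N powr (1 - 1 / (2 * m))\<close>, so the fraction of outliers decays polynomially. The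
  condition on \<open>\<delta>\<close> says \<open>K * \<delta> \<le> 1/4\<close>, as
  \<open>mgf_bound\<close> requires.\<close>

lemma upper_recursion_rescaled:
  assumes m: "3 \<le> m" and \<eta>: "0 < \<eta>" and \<delta>: "0 < \<delta>" "\<delta> * (4 * (T + 3)) \<le> \<eta>" and T: "0 \<le> T"
  shows "\<forall>\<^sub>F N in sequentially. \<exists>E\<in>sets (Q N). measure (Q N) E \<le> recursion_bound T m \<delta> N \<and>
    (\<forall>\<omega>\<in>space (Q N) - E. lagged_recursion T m \<eta> \<delta> N \<omega>)"
proof -
  define K where "K = (T + 3) / \<eta>"
  have K: "0 \<le> K" "K * \<eta> = T + 3" "K * \<delta> \<le> 1/4"
    using \<eta> T \<delta> by (auto simp: K_def field_simps)
  have m0: "0 < real m" using m by simp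
  \<comment> \<open>The first term keeps the moment factors over the lag below the gain
    \<open>N powr (- 1 / m)\<close>, the second keeps those over the horizon below one power of
    \<open>N\<close>.\<close>
  define \<theta> where "\<theta> = min (1 / (2 * real m)) (1 / (T + 1))"
  have \<theta>: "0 < \<theta>" "\<theta> \<le> 1 / (2 * real m)" "\<theta> * T \<le> 1"
  proof -
    show "0 < \<theta>" "\<theta> \<le> 1 / (2 * real m)"
      using m0 T by (auto simp: \<theta>_def)
    have "\<theta> * T \<le> 1 / (T + 1) * T"
      using T by (intro mult_right_mono) (auto simp: \<theta>_def)
    also have "\<dots> \<le> 1" using T by (simp add: field_simps)
    finally show "\<theta> * T \<le> 1" .
  qed
  define q where "q = (2::real) powr \<theta>"
  have q: "1 < q"
    using \<theta>(1) by (simp add: q_def)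
  have "\<forall>\<^sub>F N in sequentially. 1 \<le> L N"
    using L_at_top unfolding filterlim_at_top by blast
  then show ?thesis
    using mgf_bound[OF K(1,3) \<delta>(1) q] c_pos N_large
  proof eventually_elim
    case (elim N)
    have N1: "1 \<le> N" and N0: "0 < real N" "1 \<le> real N" using elim by auto
    interpret brw_model "Q N" N "Y N" D
      by (rule brw[OF N1])
    define \<Lambda> where "\<Lambda> = K * ln (real N) / c N"
    define r where "r = nat \<lceil>(1 - 1 / m) * L N\<rceil>"
    define p where "p = 1 / h (\<delta> * c N)"
    define u where "u = intensity \<delta> N"
    define n1 where "n1 = nat \<lfloor>T * L N\<rfloor>"
    have \<Lambda>: "0 \<le> \<Lambda>" and H: "0 \<le> \<eta> * c N" and q1: "1 \<le> q"
      using K elim \<eta> q by (auto simp: \<Lambda>_def)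
    have \<delta>c: "0 \<le> \<delta> * c N" using \<delta>(1) elim by simp
    have p: "0 \<le> p"
      using h_pos[OF \<delta>c] by (simp add: p_def)
    have pu: "p = u / (2 * real N * L N)"
      unfolding p_def u_def by (rule tail_scaled) (use elim in simp)
    have u: "0 \<le> u" "2 * real N * L N * p = u"
    proof -
      show "2 * real N * L N * p = u"
        using elim L_pos[of N] by (simp add: pu del: zero_less_log_cancel_iff)
      then show "0 \<le> u"
        using p elim by (metis mult_nonneg_nonneg of_nat_0_le_iff zero_le_numeral order_trans zero_le_one)
    qed
    have mgf: "(\<integral>\<^sup>+y. ennreal (exp (\<Lambda> * (if y \<le> \<delta> * c N then max 0 y else 0))) \<partial>D) \<le> ennreal q"
      using elim(2) by (simp add: \<Lambda>_def)
    have tl: "measure D {\<delta> * c N<..} \<le> p"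
      using D_tail[OF \<delta>c] by (simp add: p_def)
    have eH: "exp (- (\<Lambda> * (\<eta> * c N))) = real N powr (- (T + 3))"
    proof -
      have "\<Lambda> * (\<eta> * c N) = (K * \<eta>) * ln (real N)"
        using elim by (simp add: \<Lambda>_def)
      then show ?thesis
        using N0 unfolding K(2) by (simp add: powr_def algebra_simps)
    qed
    define U where "U = outlier_bound \<Lambda> (\<eta> * c N) q p r"
    have U_eq: "U = (2 * q) ^ r * (real N * real N powr (- (T + 3)) + 2 * real N * p * real r)"
      using outlier_bound_def[OF \<Lambda> H q1 mgf tl, of r] by (simp add: U_def eH)
    have twoq: "2 * q = 2 powr (1 + \<theta>)"
      by (simp add: q_def powr_add)
    have powL: "2 powr (x * L N) = real N powr x" for x
      using N0 powr_powr[of 2 "L N" x] by (simp add: mult.commute)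
    have n1: "real n1 \<le> T * L N"
      using T elim by (simp add: n1_def)
    have r: "real r \<le> (1 - 1 / m) * L N + 1" "real r \<le> 2 * L N"
    proof -
      have "0 \<le> (1 - 1 / m) * L N"
        using elim m0 m by (intro mult_nonneg_nonneg) (auto simp: field_simps)
      then show 1: "real r \<le> (1 - 1 / m) * L N + 1"
        using ceiling_correct[of "(1 - 1 / m) * L N"] by (simp add: r_def)
      have "(1 - 1 / m) * L N \<le> 1 * L N"
        using elim m0 by (intro mult_right_mono) auto
      then show "real r \<le> 2 * L N"
        using 1 elim(1) by linarith
    qed
    have qr: "(2 * q) ^ r \<le> 4 * real N powr (1 - 1 / (2 * real m))"
    proof -
      have "(2 * q) ^ r = 2 powr ((1 + \<theta>) * real r)"
        unfolding twoq by (simp add: powr_powr[symmetric] powr_realpow)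
      also have "\<dots> \<le> 2 powr ((1 + \<theta>) * ((1 - 1 / m) * L N + 1))"
        using r(1) \<theta>(1) by (intro powr_mono mult_left_mono) auto
      also have "\<dots> = 2 powr (1 + \<theta>) * 2 powr (((1 + \<theta>) * (1 - 1 / m)) * L N)"
        by (simp add: powr_add[symmetric] algebra_simps)
      also have "\<dots> \<le> 4 * real N powr (1 - 1 / (2 * real m))"
        unfolding powL
      proof (intro mult_mono)
        have "1 / (2 * real m) \<le> 1"
          using m0 m by (simp add: field_simps)
        then have "2 powr (1 + \<theta>) \<le> (2::real) powr 2"
          using \<theta>(2) by (intro powr_mono) auto
        then show "2 powr (1 + \<theta>) \<le> (4::real)"
          by simp
        have "(1 + \<theta>) * (1 - 1 / m) \<le> (1 + 1 / (2 * real m)) * (1 - 1 / m)"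
          using \<theta>(2) m by (intro mult_right_mono) (auto simp: field_simps)
        also have "\<dots> = 1 - 1 / (2 * real m) - 1 / (2 * real m * real m)"
          using m0 by (simp add: field_simps)
        also have "\<dots> \<le> 1 - 1 / (2 * real m)"
          using m0 by simp
        finally show "real N powr ((1 + \<theta>) * (1 - 1 / m)) \<le> real N powr (1 - 1 / (2 * real m))"
          using N0 by (intro powr_mono) auto
      qed auto
      finally show ?thesis .
    qed
    have ON: "U / real N \<le> 4 * real N powr (- 1 / (2 * real m)) * (1 + 2 * u)"
    proof -
      have "real N * real N powr (- (T + 3)) = real N powr (- (T + 2))"
        using N0 powr_add[of "real N" 1 "- (T + 3)"] by (simp add: algebra_simps)
      also have "\<dots> \<le> real N powr 0"
        using N0 T by (intro powr_mono) auto
      finally have a: "real N * real N powr (- (T + 3)) \<le> 1"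
        using N0 by simp
      have "2 * real N * p * real r \<le> 2 * real N * p * (2 * L N)"
        using r(2) p by (intro mult_left_mono) auto
      also have "\<dots> = 2 * u"
        using u(2) by (simp add: algebra_simps)
      finally have b: "2 * real N * p * real r \<le> 2 * u" .
      have "U \<le> 4 * real N powr (1 - 1 / (2 * real m)) * (1 + 2 * u)"
        unfolding U_eq using p N0 q by (intro mult_mono[OF qr] add_mono[OF a b]) auto
      then have "U / real N \<le> 4 * real N powr (1 - 1 / (2 * real m)) * (1 + 2 * u) / real N"
        using N0 by (intro divide_right_mono) auto
      also have "\<dots> = 4 * real N powr (- 1 / (2 * real m)) * (1 + 2 * u)"
        using N0 by (simp add: powr_diff powr_minus_divide)
      finally show ?thesis .
    qed
    have O0: "0 \<le> U"
      using outlier_bound_nonneg[OF \<Lambda> H q1 mgf tl, of r] by (simp add: U_def)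
    have bound: "real n1 * (2 * U * p) + real (Suc n1) * (U / real N) + real (Suc n1) * (real N * (2 * q) ^ n1 * exp (- (\<Lambda> * (\<eta> * c N))))
        \<le> recursion_bound T m \<delta> N"
    proof -
      have "real n1 * (2 * U * p) \<le> (T * L N) * (2 * U * p)"
        using n1 O0 p by (intro mult_right_mono) auto
      also have "\<dots> = T * u * (U / real N)"
        using N0 L_pos[OF elim(4)] by (simp add: pu del: zero_less_log_cancel_iff)
      finally have 1: "real n1 * (2 * U * p) \<le> T * u * (U / real N)" .
      have 2: "real (Suc n1) * (U / real N) \<le> (T * L N + 1) * (U / real N)"
        using n1 O0 by (intro mult_right_mono) auto
      have "(2 * q) ^ n1 = 2 powr ((1 + \<theta>) * real n1)"
        unfolding twoq by (simp add: powr_powr[symmetric] powr_realpow)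
      also have "\<dots> \<le> 2 powr ((1 + \<theta>) * (T * L N))"
        using n1 \<theta>(1) by (intro powr_mono mult_left_mono) auto
      also have "\<dots> = real N powr ((1 + \<theta>) * T)"
        using powL[of "(1 + \<theta>) * T"] by (simp add: mult.assoc)
      also have "\<dots> \<le> real N powr (T + 1)"
        using \<theta>(3) N0 by (intro powr_mono) (auto simp: distrib_right)
      finally have q3: "(2 * q) ^ n1 \<le> real N powr (T + 1)" .
      have "real N * (2 * q) ^ n1 * exp (- (\<Lambda> * (\<eta> * c N))) \<le> real N * real N powr (T + 1) * real N powr (- (T + 3))"
        unfolding eH using q3 by (intro mult_right_mono mult_left_mono) auto
      also have "\<dots> = real N powr (1 + (T + 1) + (- (T + 3)))"
        using N0 by (simp only: powr_add) simp
      also have "\<dots> = 1 / real N"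
        using N0 by (simp add: powr_minus_divide)
      finally have "real N * (2 * q) ^ n1 * exp (- (\<Lambda> * (\<eta> * c N))) \<le> 1 / real N" .
      then have 3: "real (Suc n1) * (real N * (2 * q) ^ n1 * exp (- (\<Lambda> * (\<eta> * c N)))) \<le> (T * L N + 1) * (1 / real N)"
        using n1 q1 by (intro mult_mono) auto
      have "T * u * (U / real N) + (T * L N + 1) * (U / real N) = (U / real N) * (T * u + (T * L N + 1))"
        by (simp add: algebra_simps)
      also have "\<dots> \<le> 4 * real N powr (- 1 / (2 * real m)) * (1 + 2 * u) * (T * u + (T * L N + 1))"
        using ON T u elim(1) by (intro mult_right_mono) auto
      finally show ?thesis
        using 1 2 3 by (simp add: recursion_bound_def u_def)
    qed
    obtain E where E: "E \<in> events"
      "prob E \<le> real n1 * (2 * U * p) + real (Suc n1) * (U / real N)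
        + real (Suc n1) * (real N * (2 * q) ^ n1 * exp (- (\<Lambda> * (\<eta> * c N))))"
      "\<And>\<omega> n. \<omega> \<in> space (Q N) - E \<Longrightarrow> n \<le> n1 \<Longrightarrow> bottom_pos n \<omega> \<le> top_pos (n - r) \<omega> + \<eta> * c N"
      "\<And>\<omega> n. \<omega> \<in> space (Q N) - E \<Longrightarrow> n \<le> n1 \<Longrightarrow> top_pos n \<omega> \<le> \<eta> * c N \<or>
        (\<exists>m<n. \<exists>k\<in>{1..2 * N}. \<delta> * c N < Y N m k \<omega> \<and> top_pos n \<omega> \<le> top_pos (m - r) \<omega> + Y N m k \<omega> + 2 * (\<eta> * c N))"
      by (rule upper_recursion[OF \<Lambda> H q1 mgf tl, of n1 r, folded U_def]) blast
    show ?case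
      unfolding lagged_recursion_def
    proof (intro bexI[OF _ E(1)] conjI ballI allI impI)
      show "prob E \<le> recursion_bound T m \<delta> N"
        using E(2) bound by linarith
      fix \<omega> k assume \<omega>: "\<omega> \<in> space (Q N) - E" and k: "real k \<le> T * L N"
      have kn: "k \<le> n1"
        using k by (simp add: n1_def le_nat_floor)
      show "W N \<omega> k \<le> V N \<omega> (k - nat \<lceil>(1 - 1 / m) * L N\<rceil>) + \<eta> * c N"
        using E(3)[OF \<omega> kn] by (simp add: bottom_pos_def top_pos_def r_def)
      show "V N \<omega> k \<le> \<eta> * c N \<or> (\<exists>k'<k. \<exists>l\<in>{1..2 * N}. \<delta> * c N < Y N k' l \<omega> \<and>
        V N \<omega> k \<le> V N \<omega> (k' - nat \<lceil>(1 - 1 / m) * L N\<rceil>) + Y N k' l \<omega> + 2 * (\<eta> * c N))"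
        using E(4)[OF \<omega> kn] by (simp add: top_pos_def r_def)
    qed
  qed
qed

end

context rescaled_brw
begin

definition block_level :: "nat \<Rightarrow> real \<Rightarrow> nat \<Rightarrow> nat \<Rightarrow> 'q \<Rightarrow> nat \<Rightarrow> nat" where
  "block_level m \<delta> Qc N \<omega> i = level_count Qc (\<lambda>q. brw_model.block_exceeds N (Y N) (L N) m (\<delta> * c N) i q \<omega>)"

definition top_path :: "nat \<Rightarrow> 'q \<Rightarrow> real \<Rightarrow> real" where
  "top_path N \<omega> t = V N \<omega> (clock (L N) t) / c N"

definition bottom_path :: "nat \<Rightarrow> 'q \<Rightarrow> real \<Rightarrow> real" where
  "bottom_path N \<omega> t = W N \<omega> (clock (L N) t) / c N"

definition near_levels :: "nat \<Rightarrow> nat \<Rightarrow> real \<Rightarrow> real \<Rightarrow> nat \<Rightarrow> nat \<Rightarrow> 'q \<Rightarrow> bool" where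
  "near_levels m n \<delta> \<eta> Qc N \<omega> \<longleftrightarrow> well_separated m n (block_level m \<delta> Qc N \<omega>) \<and>
    near_staircase m n (block_level m \<delta> Qc N \<omega>) \<delta> ((2 * (real n / m) + 1) * (\<delta> + 2 * \<eta>)) (top_path N \<omega>) \<and>
    (\<forall>t\<in>{0..real n / m}. top_path N \<omega> (max 0 (t - 1 - 1 / m)) \<le> bottom_path N \<omega> t \<and>
      bottom_path N \<omega> t \<le> top_path N \<omega> (max 0 (t - 1 + 1 / m)) + \<eta>)"

lemma AE_Y_nonneg:
  assumes "1 \<le> N"
  shows "AE \<omega> in Q N. \<forall>k. \<forall>l\<in>{1..2 * N}. 0 \<le> Y N k l \<omega>"
proof -
  interpret brw_model "Q N" N "Y N" D by (rule brw[OF assms])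
  have "AE \<omega> in Q N. 0 \<le> Y N k l \<omega>" if l: "l \<in> {1..2 * N}" for k l
    using AE_distrD[OF Y_measurable[OF l], of "\<lambda>y. 0 \<le> y" k] D_nonneg unfolding distr_Y[OF l] by blast
  then show ?thesis
    by (simp add: AE_all_countable AE_ball_countable)
qed

text \<open>The exceptional probability is at most a recursion bound that tends to 0 plus a bound
  that tends to the crowding term, so any \<open>b\<close> above that term eventually
  suffices.\<close>

lemma eventually_near_staircase:
  assumes m: "3 \<le> m" and \<eta>: "0 < \<eta>" and \<delta>: "0 < \<delta>" "\<delta> * (4 * (real n / m + 3)) \<le> \<eta>" and Qc: "1 \<le> Qc"
    and b: "crowding \<alpha> m n \<delta> Qc < b"
  shows "\<forall>\<^sub>F N in sequentially. \<exists>E\<in>sets (Q N). measure (Q N) E \<le> b \<and> (AE \<omega> in Q N. \<omega> \<notin> E \<longrightarrow> near_levels m n \<delta> \<eta> Qc N \<omega>)"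
proof -
  have m0: "0 < m" using m by simp
  have lim: "(\<lambda>N. recursion_bound (real n / m) m \<delta> N + simple_bound m n \<delta> Qc N)
      \<longlonglongrightarrow> 0 + (crowding \<alpha> m n \<delta> Qc)"
    by (intro tendsto_add recursion_bound_limit simple_bound_limit \<delta> Qc m0)
  have T: "0 \<le> real n / m" by simp
  have "\<forall>\<^sub>F N in sequentially. recursion_bound (real n / m) m \<delta> N + simple_bound m n \<delta> Qc N < b"
    by (rule order_tendstoD(2)[OF lim]) (use b in simp)
  moreover have "\<forall>\<^sub>F N in sequentially. 2 * real m \<le> L N"
    using L_at_top unfolding filterlim_at_top by blast
  ultimately show ?thesis
    using upper_recursion_rescaled[OF m \<eta> \<delta> T] c_pos N_large
  proof eventually_elim
    case (elim N)
    then have N1: "1 \<le> N" by simp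
    have L0: "0 < L N" using L_pos[OF elim(5)] .
    have a0: "0 < \<delta> * c N" using \<delta>(1) elim(4) by simp
    interpret brw_model "Q N" N "Y N" D by (rule brw[OF N1])
    obtain E1 where E1: "E1 \<in> events" "prob E1 \<le> recursion_bound (real n / m) m \<delta> N" and
      rec: "\<forall>\<omega>\<in>space (Q N) - E1. lagged_recursion (real n / m) m \<eta> \<delta> N \<omega>"
      using elim(3) by blast
    define E2 where "E2 = {\<omega> \<in> space (Q N). \<not> simple_blocks (L N) m n (\<delta> * c N) Qc \<omega>}"
    have E2: "E2 \<in> events" "prob E2 \<le> simple_bound m n \<delta> Qc N"
    proof -
      have t: "tail (\<delta> * c N) = 1 / h (\<delta> * c N)" "tail (real Qc * (\<delta> * c N)) = 1 / h (real Qc * \<delta> * c N)"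
        using a0 by (simp_all add: tail_eq[OF N1] mult.assoc)
      show "E2 \<in> events" "prob E2 \<le> simple_bound m n \<delta> Qc N"
        using prob_not_simple_blocks[of "L N" m n "\<delta> * c N" Qc] L0
        unfolding E2_def simple_bound_def t by auto
    qed
    show ?case
    proof (intro bexI[of _ "E1 \<union> E2"] conjI)
      show "E1 \<union> E2 \<in> events" using E1 E2 by auto
      have "prob (E1 \<union> E2) \<le> prob E1 + prob E2"
        using E1 E2 by (intro measure_subadditive) auto
      then show "prob (E1 \<union> E2) \<le> b"
        using E1 E2 elim(1) by linarith
      show "AE \<omega> in Q N. \<omega> \<notin> E1 \<union> E2 \<longrightarrow> near_levels m n \<delta> \<eta> Qc N \<omega>"
        using AE_Y_nonneg[OF N1] AE_space
      proof eventually_elim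
        case (elim \<omega>)
        show ?case
        proof
        assume good: "\<omega> \<notin> E1 \<union> E2"
        have \<omega>: "\<omega> \<in> space (Q N) - E1" and simple: "simple_blocks (L N) m n (\<delta> * c N) Qc \<omega>"
          using elim good by (auto simp: E2_def)
        have d: "block_level m \<delta> Qc N \<omega> i = level_count Qc (\<lambda>q. block_exceeds (L N) m (\<delta> * c N) i q \<omega>)" for i
          by (simp add: block_level_def)
        note str = simple_blocks_structure[OF simple a0 Qc m0 L0, folded d]
        have fl: "\<exists>k\<in>generations (L N) m i. \<exists>l\<in>{1..2 * N}.
            \<delta> * real (block_level m \<delta> Qc N \<omega> i) * c N \<le> Y N k l \<omega> \<and> Y N k l \<omega> \<le> \<delta> * (real (block_level m \<delta> Qc N \<omega> i) + 1) * c N \<and>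
            (\<forall>k'\<in>generations (L N) m i. \<forall>l'\<in>{1..2 * N}. (k', l') \<noteq> (k, l) \<longrightarrow> Y N k' l' \<omega> \<le> \<delta> * c N)"
          if "i < n" "block_level m \<delta> Qc N \<omega> i \<noteq> 0" for i
        proof -
          have "\<delta> * x * c N = \<delta> * c N * x" for x by simp
          then show ?thesis using str(3)[OF that] by (simp only:)
        qed
        have NL: "real N \<le> 2 powr L N"
          using N1 by simp
        have rec1: "W N \<omega> k \<le> V N \<omega> (k - nat \<lceil>(1 - 1 / m) * L N\<rceil>) + \<eta> * c N"
          if "real k \<le> real n / m * L N" for k
          using rec \<omega> that unfolding lagged_recursion_def by blast
        have rec2: "V N \<omega> k \<le> \<eta> * c N \<or> (\<exists>k'<k. \<exists>l\<in>{1..2 * N}. \<delta> * c N < Y N k' l \<omega> \<and>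
          V N \<omega> k \<le> V N \<omega> (k' - nat \<lceil>(1 - 1 / m) * L N\<rceil>) + Y N k' l \<omega> + 2 * (\<eta> * c N))"
          if "real k \<le> real n / m * L N" for k
          using rec \<omega> that unfolding lagged_recursion_def by blast
        have nn: "0 \<le> Y N k l \<omega>" if "l \<in> {1..2 * N}" for k l
          using elim(1) that by blast
        note hyps = N1 L0 NL \<open>2 * real m \<le> L N\<close> \<open>0 < c N\<close> m \<delta>(1) less_imp_le[OF \<eta>] nn rec1 rec2 str(1,2) fl
        note res = brw_near_staircase[where y = "\<lambda>i j. Y N i j \<omega>" and d = "block_level m \<delta> Qc N \<omega>" and n = n
            and N = N and L = "L N" and m = m and \<delta> = \<delta> and \<eta> = \<eta> and c = "c N"]
        have "near_staircase m n (block_level m \<delta> Qc N \<omega>) \<delta> ((2 * (real n / m) + 1) * (\<delta> + 2 * \<eta>)) (top_path N \<omega>)"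
          unfolding top_path_def[abs_def] by (rule res(1)) (assumption | rule hyps)+
        moreover have "top_path N \<omega> (max 0 (t - 1 - 1 / m)) \<le> bottom_path N \<omega> t" if t: "t \<in> {0..real n / m}" for t
          unfolding top_path_def bottom_path_def by (rule res(2)) (assumption | rule hyps t)+
        moreover have "bottom_path N \<omega> t \<le> top_path N \<omega> (max 0 (t - 1 + 1 / m)) + \<eta>" if t: "t \<in> {0..real n / m}" for t
          unfolding top_path_def bottom_path_def by (rule res(3)) (assumption | rule hyps t)+
        ultimately
        show "near_levels m n \<delta> \<eta> Qc N \<omega>"
          using str(1) unfolding near_levels_def by blast
        qed
      qed
    qed
  qed
qed

end

section \<open>Convergence in law\<close>

text \<open>Parameters at resolution \<open>j\<close>: cells of length \<open>1 / m j\<close> up to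
  the horizon \<open>j + 1\<close>, threshold \<open>\<delta> j\<close>, levels up to
  \<open>K j\<close> and allowance \<open>\<kappa> j\<close> in the lagged recursion. The relation
  between \<open>\<delta>\<close> and \<open>\<kappa>\<close> is that of the moment bound. The
  quadratic decay of \<open>\<kappa>\<close> outweighs the number of steps back, which is
  proportional to the horizon.\<close>

locale staircase_levels =
  fixes \<alpha> :: real and m n K :: "nat \<Rightarrow> nat" and \<delta> \<kappa> :: "nat \<Rightarrow> real"
  assumes m_ge: "3 \<le> m j" "j \<le> m j" and n_eq: "n j = Suc j * m j" and K_ge: "1 \<le> K j"
    and \<delta>_pos: "0 < \<delta> j" and \<kappa>_pos: "0 < \<kappa> j" and \<delta>_\<kappa>: "\<delta> j * (4 * (real (n j) / m j + 3)) \<le> \<kappa> j"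
    and \<kappa>_le: "\<kappa> j \<le> 1 / (real j + 1)\<^sup>2"
    and failure: "crowding \<alpha> (m j) (n j) (\<delta> j) (K j) \<le> 2 * (1/2) ^ j"
begin

definition tol :: "nat \<Rightarrow> real" where
  "tol j = (2 * (real (n j) / m j) + 1) * (\<delta> j + 2 * \<kappa> j)"

lemma horizon: "real (n j) / m j = real j + 1"
  using m_ge(1)[of j] by (simp add: n_eq field_simps)

lemma horizon_at_top: "filterlim (\<lambda>j. real (n j) / m j) at_top sequentially"
  unfolding horizon by real_asymp

lemma \<delta>_le_\<kappa>: "\<delta> j \<le> \<kappa> j"
proof -
  have "\<delta> j * 1 \<le> \<delta> j * (4 * (real (n j) / m j + 3))"
    using \<delta>_pos[of j] by (intro mult_left_mono) (auto simp: horizon)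
  then show ?thesis using \<delta>_\<kappa>[of j] by simp
qed

lemma tol_pos: "0 < tol j"
  using \<delta>_pos[of j] \<kappa>_pos[of j] by (simp add: tol_def horizon)

lemma \<delta>_limit: "\<delta> \<longlonglongrightarrow> 0"
proof (rule tendsto_sandwich)
  show "\<forall>\<^sub>F j in sequentially. 0 \<le> \<delta> j"
    using \<delta>_pos by (intro always_eventually allI less_imp_le)
  show "\<forall>\<^sub>F j in sequentially. \<delta> j \<le> 1 / (real j + 1)\<^sup>2"
    using \<delta>_le_\<kappa> \<kappa>_le by (intro always_eventually allI) (rule order_trans)
qed (simp, real_asymp)

lemma tol_limit: "tol \<longlonglongrightarrow> 0"
proof (rule tendsto_sandwich)
  show "\<forall>\<^sub>F j in sequentially. 0 \<le> tol j"
    using tol_pos by (intro always_eventually allI less_imp_le)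
  show "\<forall>\<^sub>F j in sequentially. tol j \<le> (2 * (real j + 1) + 1) * (3 * (1 / (real j + 1)\<^sup>2))"
  proof (intro always_eventually allI)
    fix j
    have "\<delta> j + 2 * \<kappa> j \<le> 3 * (1 / (real j + 1)\<^sup>2)"
      using \<delta>_le_\<kappa>[of j] \<kappa>_le[of j] by linarith
    then show "tol j \<le> (2 * (real j + 1) + 1) * (3 * (1 / (real j + 1)\<^sup>2))"
      unfolding tol_def horizon by (intro mult_left_mono) auto
  qed
qed (simp, real_asymp)

lemma mesh_limit: "(\<lambda>j. 1 / real (m j)) \<longlonglongrightarrow> 0"
proof (rule tendsto_sandwich)
  show "\<forall>\<^sub>F j in sequentially. 0 \<le> 1 / real (m j)"
    by simp
  show "\<forall>\<^sub>F j in sequentially. 1 / real (m j) \<le> 1 / real j"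
    using eventually_gt_at_top[of 0]
    by eventually_elim (use m_ge in \<open>auto intro!: frac_le\<close>)
qed (auto intro: lim_1_over_n)

lemma summable_failure:
  "summable (\<lambda>j. crowding \<alpha> (m j) (n j) (\<delta> j) (K j))"
proof (rule summable_comparison_test')
  show "summable (\<lambda>j. 2 * (1/2) ^ j :: real)"
    by (intro summable_mult summable_geometric) simp
  show "norm (crowding \<alpha> (m j) (n j) (\<delta> j) (K j)) \<le> 2 * (1/2) ^ j" for j
    using failure[of j] by (simp only: real_norm_def) (subst abs_of_nonneg, auto)
qed

text \<open>The recorded list is read as a function through \<open>(!)\<close>, of which the values
  below \<open>n j\<close> enter.\<close>

definition J1_level :: "nat \<Rightarrow> nat list \<Rightarrow> (real \<Rightarrow> real) set" where
  "J1_level j l = {x \<in> skorokhod_space. well_separated (m j) (n j) ((!) l) \<and> near_staircase (m j) (n j) ((!) l) (\<delta> j) (tol j) x}"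

definition SM1_level :: "nat \<Rightarrow> nat list \<Rightarrow> (real \<Rightarrow> real \<times> real) set" where
  "SM1_level j l = {z \<in> skorokhod_space. well_separated (m j) (n j) ((!) l) \<and> near_staircase_pair (m j) (n j) ((!) l) (\<delta> j) (tol j) z}"

lemma eventually_fine:
  assumes e: "0 < e" and r: "0 < r"
  shows "\<forall>\<^sub>F j in sequentially. 3 / m j \<le> e \<and> 3 / m j < r \<and> 4 * tol j \<le> e \<and> (T :: real) * m j + 3 \<le> real (n j)"
proof -
  have 1: "(\<lambda>j. 3 * (1 / real (m j))) \<longlonglongrightarrow> 3 * 0" and 2: "(\<lambda>j. 4 * tol j) \<longlonglongrightarrow> 4 * 0"
    by (intro tendsto_intros mesh_limit tol_limit)+
  have "\<forall>\<^sub>F j in sequentially. 3 * (1 / real (m j)) < min e r"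
    by (rule order_tendstoD(2)[OF 1]) (use e r in simp)
  moreover have "\<forall>\<^sub>F j in sequentially. 4 * tol j < e"
    by (rule order_tendstoD(2)[OF 2]) (use e in simp)
  moreover have "\<forall>\<^sub>F j in sequentially. T \<le> real j"
    using filterlim_real_sequentially unfolding filterlim_at_top by blast
  ultimately show ?thesis
  proof eventually_elim
    case (elim j)
    have "T * m j \<le> real j * m j"
      using elim(3) by (intro mult_right_mono) auto
    moreover have "real (n j) = real j * m j + m j"
      by (simp add: n_eq algebra_simps)
    ultimately have "T * m j + 3 \<le> real (n j)"
      using m_ge(1)[of j] by linarith
    then show ?case using elim by simp
  qed
qed

lemma isCont_modulus:
  fixes x :: "real \<Rightarrow> 'a::metric_space"
  assumes "isCont x T" "0 < e"
  obtains r where "0 < r" "\<And>t. \<bar>t - T\<bar> < r \<Longrightarrow> dist (x t) (x T) < e"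
  using assms unfolding continuous_at_eps_delta dist_real_def by blast

text \<open>Both \<open>xs j\<close> and \<open>z\<close> are near-staircases for the same data, so
  \<open>J1_dist_near_staircase\<close> applies; continuity of \<open>z\<close> at \<open>T\<close>
  supplies the modulus at the final time.\<close>

lemma J1_discretely_approximated:
  assumes z: "z \<in> skorokhod_space" and near: "\<forall>\<^sub>F j in sequentially. z \<in> J1_level j (D j)"
  shows "discretely_approximated J1_dist J1_level D z"
  unfolding discretely_approximated_def skorokhod_converges_def
proof (intro conjI allI impI z near)
  fix xs T assume xs: "\<forall>\<^sub>F j in sequentially. xs j \<in> J1_level j (D j)" and T: "0 < T" and cont: "isCont z T"
  show "(\<lambda>j. J1_dist T (xs j) z) \<longlonglongrightarrow> 0"
  proof (rule tendstoI)
    fix e :: real assume e: "0 < e"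
    have e': "0 < e / 2" using e by simp
    obtain r where r: "0 < r" "\<And>t. \<bar>t - T\<bar> < r \<Longrightarrow> dist (z t) (z T) < e / 8"
      using isCont_modulus[OF cont, of "e / 8"] e by auto
    note fine = eventually_fine[OF e' r(1), of T]
    show "\<forall>\<^sub>F j in sequentially. dist (J1_dist T (xs j) z) 0 < e"
      using xs near fine
    proof eventually_elim
      case (elim j)
      have "J1_dist T (xs j) z \<le> e / 2"
      proof (rule J1_dist_near_staircase)
        show "near_staircase (m j) (n j) ((!) (D j)) (\<delta> j) (tol j) (xs j)" "near_staircase (m j) (n j) ((!) (D j)) (\<delta> j) (tol j) z"
          using elim by (auto simp: J1_level_def)
        show "D j ! Suc i = 0" if "Suc i < n j" "D j ! i \<noteq> 0" for i
          using elim(1) well_separatedD(1)[of "m j" "n j" "(!) (D j)" i "Suc i"] that by (auto simp: J1_level_def)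
        have fine: "3 / m j \<le> e / 2" "3 / m j < r" "4 * tol j \<le> e / 2" "T * m j + 3 \<le> real (n j)"
          using elim(3) by auto
        have le: "2 / m j \<le> 3 / m j" by (simp add: divide_right_mono)
        show "0 < m j" using m_ge(1)[of j] by simp
        show "2 / m j \<le> e / 2" using fine(1) le by linarith
        show "2 * tol j + e / 4 \<le> e / 2" using fine(3) by linarith
        show "0 \<le> tol j" using tol_pos[of j] by simp
        show "T * m j < real (n j) - 1" using fine(4) by linarith
        show "0 \<le> T" using T by simp
        show "\<bar>z t - z u\<bar> \<le> e / 4" if "\<bar>t - T\<bar> \<le> 2 / m j" "\<bar>u - T\<bar> \<le> 2 / m j" for t u
          using r(2)[of t] r(2)[of u] that le fine(2) unfolding dist_real_def by linarith
      qed
      then show ?case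
        using J1_dist_nonneg[of T "xs j" z] T e by simp
    qed
  qed
qed

lemma SM1_discretely_approximated:
  assumes z: "z \<in> skorokhod_space" and near: "\<forall>\<^sub>F j in sequentially. z \<in> SM1_level j (D j)"
  shows "discretely_approximated SM1_dist SM1_level D z"
  unfolding discretely_approximated_def skorokhod_converges_def
proof (intro conjI allI impI z near)
  fix xs T assume xs: "\<forall>\<^sub>F j in sequentially. xs j \<in> SM1_level j (D j)" and T: "0 < T" and cont: "isCont z T"
  show "(\<lambda>j. SM1_dist T (xs j) z) \<longlonglongrightarrow> 0"
  proof (rule tendstoI)
    fix e :: real assume e: "0 < e"
    \<comment> \<open>The comparison of pairs multiplies the tolerance by 24, so a fiftieth of
      \<open>e\<close> leads to less than \<open>e / 2\<close>.\<close>
    have e': "0 < e / 50" using e by simp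
    obtain r where r: "0 < r" "\<And>t. \<bar>t - T\<bar> < r \<Longrightarrow> dist (z t) (z T) < e / 400"
      using isCont_modulus[OF cont, of "e / 400"] e by auto
    note fine = eventually_fine[OF e' r(1), of T]
    show "\<forall>\<^sub>F j in sequentially. dist (SM1_dist T (xs j) z) 0 < e"
      using xs near fine
    proof eventually_elim
      case (elim j)
      have fine: "3 / m j \<le> e / 50" "3 / m j < r" "4 * tol j \<le> e / 50" "T * m j + 3 \<le> real (n j)"
        using elim(3) by auto
      have pairs: "near_staircase_pair (m j) (n j) ((!) (D j)) (\<delta> j) (tol j) (xs j)" "near_staircase_pair (m j) (n j) ((!) (D j)) (\<delta> j) (tol j) z"
        using elim by (auto simp: SM1_level_def)
      have "SM1_dist T (xs j) z \<le> 24 * (e / 50)"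
      proof (rule SM1_dist_near_staircase_pair[OF pairs m_ge(1)])
        show "well_separated (m j) (n j) ((!) (D j))"
          using elim by (auto simp: SM1_level_def)
        show "3 / m j \<le> e / 50" by fact
        show "3 * tol j + e / 200 \<le> e / 50" using fine(3) by linarith
        show "0 \<le> tol j" "0 \<le> \<delta> j" using tol_pos[of j] \<delta>_pos[of j] by simp_all
        show "T * m j + 3 \<le> real (n j)" by fact
        show "0 \<le> T" using T by simp
        fix t u assume tu: "t \<le> u" "T - 3 / m j \<le> t" "u \<le> T + 3 / m j"
        then have "\<bar>t - T\<bar> < r" "\<bar>u - T\<bar> < r"
          using fine(2) by auto
        then have "dist (z t) (z u) < e / 200"
          using r(2)[of t] r(2)[of u] dist_triangle2[of "z t" "z u" "z T"] by linarith
        then show "fst (z u) - fst (z t) \<le> e / 200 \<and> snd (z u) - snd (z t) \<le> e / 200"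
          using dist_fst_le[of "z t" "z u"] dist_snd_le[of "z t" "z u"] unfolding dist_real_def by linarith
      qed
      moreover have "0 \<le> SM1_dist T (xs j) z"
        using pairs T by (intro SM1_dist_nonneg) (auto simp: near_staircase_pair_def)
      ultimately show ?case
        using e by simp
    qed
  qed
qed

end

text \<open>The parameters are chosen in the order \<open>\<kappa>\<close>, \<open>\<delta>\<close>,
  \<open>m\<close>, \<open>K\<close>. For fixed \<open>\<delta>\<close> there are of order
  \<open>m\<close> near pairs of cells, each crowded with probability of order \<open>1 / m\<close>
  squared, so a fine mesh makes crowding rare; a large \<open>K\<close> then makes jumps above
  \<open>K * \<delta>\<close> rare.\<close>

lemma staircase_levels_exist:
  assumes \<alpha>: "0 < \<alpha>"
  shows "\<exists>m n K \<delta> \<kappa>. staircase_levels \<alpha> m n K \<delta> \<kappa>"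
proof -
  define \<kappa> :: "nat \<Rightarrow> real" where "\<kappa> j = 1 / (real j + 1)\<^sup>2" for j
  define \<delta> where "\<delta> j = \<kappa> j / (4 * (real j + 4))" for j
  \<comment> \<open>The factor 32 arises from the 8 in \<open>crowding\<close> and the square of the
    2 there.\<close>
  define m where "m j = max 3 (max j (nat \<lceil>32 * (real j + 1) * (\<delta> j powr - \<alpha>)\<^sup>2 * 2 ^ j\<rceil>))" for j
  define K where "K j = max 1 (nat \<lceil>((real j + 1) * 2 ^ j) powr (1 / \<alpha>) / \<delta> j\<rceil>)" for j
  have \<kappa>: "0 < \<kappa> j" and \<delta>: "0 < \<delta> j" for j
    by (simp_all add: \<kappa>_def \<delta>_def)
  have m0: "0 < real (m j)" for j by (simp add: m_def)
  have "staircase_levels \<alpha> m (\<lambda>j. Suc j * m j) K \<delta> \<kappa>"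
  proof
    fix j
    show "3 \<le> m j" "j \<le> m j" "1 \<le> K j" "0 < \<delta> j" "0 < \<kappa> j" "\<kappa> j \<le> 1 / (real j + 1)\<^sup>2"
      using \<kappa> \<delta> by (auto simp: m_def K_def \<kappa>_def)
    have hor: "real (Suc j * m j) / m j = real j + 1"
      using m0[of j] by (simp add: field_simps)
    show "\<delta> j * (4 * (real (Suc j * m j) / m j + 3)) \<le> \<kappa> j"
      unfolding hor by (simp add: \<delta>_def add.commute)
    have "32 * (real j + 1) * (\<delta> j powr - \<alpha>)\<^sup>2 * 2 ^ j \<le> real (m j)"
      unfolding m_def by linarith
    then have "32 * (real j + 1) * (\<delta> j powr - \<alpha>)\<^sup>2 / m j \<le> (1/2) ^ j"
      using m0[of j] by (simp add: field_simps power_divide)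
    moreover have "real (Suc j * m j) * 8 * (2 * \<delta> j powr - \<alpha> / m j)\<^sup>2 = 32 * (real j + 1) * (\<delta> j powr - \<alpha>)\<^sup>2 / m j"
      using m0[of j] by (simp add: power2_eq_square field_simps)
    moreover have "real (Suc j * m j) * ((real (K j) * \<delta> j) powr - \<alpha> / m j) \<le> (1/2) ^ j"
    proof -
      define u where "u = (real j + 1) * 2 ^ j"
      have u: "0 < u" by (simp add: u_def)
      have "u powr (1 / \<alpha>) / \<delta> j \<le> real (K j)"
        unfolding K_def u_def by linarith
      then have "u powr (1 / \<alpha>) \<le> real (K j) * \<delta> j"
        using \<delta>[of j] by (simp add: pos_divide_le_eq)
      then have "(real (K j) * \<delta> j) powr - \<alpha> \<le> (u powr (1 / \<alpha>)) powr - \<alpha>"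
        using u \<alpha> by (intro powr_mono2') auto
      also have "\<dots> = 1 / u"
        using u \<alpha> by (simp add: powr_powr powr_minus_divide)
      finally have "(real j + 1) * (real (K j) * \<delta> j) powr - \<alpha> \<le> (real j + 1) * (1 / u)"
        by (intro mult_left_mono) auto
      also have "\<dots> = (1/2) ^ j"
        by (simp add: u_def power_divide)
      finally have "(real j + 1) * (real (K j) * \<delta> j) powr - \<alpha> \<le> (1/2) ^ j" .
      moreover have "real (Suc j * m j) * (x / m j) = (real j + 1) * x" for x
        using m0[of j] by (simp add: field_simps)
      ultimately show ?thesis by simp
    qed
    ultimately show "crowding \<alpha> (m j) (Suc j * m j) (\<delta> j) (K j) \<le> 2 * (1/2) ^ j"
      by linarith
  qed simp
  then show ?thesis by blast
qed

section \<open>Rescaled walks as random elements of the path spaces\<close>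

lemma clock_eventually_at_right:
  assumes L: "0 < L" and t: "0 \<le> t"
  shows "\<forall>\<^sub>F s in at_right t. clock L s = clock L t"
proof -
  define k where "k = clock L t"
  have k: "real k \<le> t * L" "t * L < real k + 1"
    using t L by (auto simp: k_def clock_def)
  then have "t < (real k + 1) / L"
    using L by (simp add: pos_less_divide_eq)
  then have "\<forall>\<^sub>F s in at_right t. s < (real k + 1) / L \<and> t < s"
    by (intro eventually_conj eventually_at_rightI[of t "(real k + 1) / L"] eventually_at_right_less) auto
  then show ?thesis
  proof eventually_elim
    case (elim s)
    have "t * L \<le> s * L" using elim L by (intro mult_right_mono) auto
    moreover have "s * L < real k + 1"
      using elim L by (simp add: pos_less_divide_eq)
    ultimately have "real k \<le> s * L" "s * L < real k + 1"
      using k by linarith+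
    then have "\<lfloor>s * L\<rfloor> = int k" by (intro floor_unique) auto
    then show ?case unfolding k_def[symmetric] by (simp add: clock_def)
  qed
qed

lemma step_path_skorokhod:
  fixes v :: "nat \<Rightarrow> real"
  assumes L: "0 < L" and v: "mono v"
  shows "(\<lambda>t\<in>{0..}. v (clock L t)) \<in> skorokhod_space"
proof (rule skorokhod_space_monoI)
  show "mono (\<lambda>t. v (clock L t))"
    using monoD[OF v] monoD[OF mono_clock[OF L]] by (intro monoI) blast
  show "((\<lambda>t. v (clock L t)) \<longlongrightarrow> v (clock L t)) (at_right t)" if "0 \<le> t" for t
    by (rule tendsto_eventually) (rule eventually_mono[OF clock_eventually_at_right[OF L that]], simp)
qed

lemma measurable_map_list:
  fixes g :: "'i \<Rightarrow> 'w \<Rightarrow> 'd::countable"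
  assumes "\<And>i. g i \<in> measurable M (count_space UNIV)"
  shows "(\<lambda>\<omega>. map (\<lambda>i. g i \<omega>) xs) \<in> measurable M (count_space UNIV)"
proof (induction xs)
  case (Cons x xs)
  have "(\<lambda>\<omega>. g x \<omega> # l) \<in> measurable M (count_space UNIV)" for l
    by (rule measurable_compose[OF assms]) simp
  then show ?case
    using measurable_compose_countable[OF _ Cons.IH, of "\<lambda>l \<omega>. g x \<omega> # l"] by simp
qed simp

definition increasing_from_0 :: "(nat \<Rightarrow> real) \<Rightarrow> bool" where
  "increasing_from_0 v \<longleftrightarrow> mono v \<and> v 0 = 0"

text \<open>The path is approximated through the binary digits of the first \<open>k\<close> values of the two sequences.\<close>

lemma random_element_sequences:
  fixes \<Phi> :: "(nat \<Rightarrow> real) \<Rightarrow> (nat \<Rightarrow> real) \<Rightarrow> real \<Rightarrow> 'a::topological_space"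
    and V W :: "nat \<Rightarrow> 'w \<Rightarrow> real"
  assumes V [measurable]: "\<And>i. V i \<in> borel_measurable M" and W [measurable]: "\<And>i. W i \<in> borel_measurable M"
    and incr: "AE \<omega> in M. increasing_from_0 (\<lambda>i. V i \<omega>) \<and> increasing_from_0 (\<lambda>i. W i \<omega>)"
    and \<Phi>: "\<And>v w. increasing_from_0 v \<Longrightarrow> increasing_from_0 w \<Longrightarrow> \<Phi> v w \<in> skorokhod_space"
    and C: "0 < C" and close: "\<And>T e v w v' w'. 0 < T \<Longrightarrow> increasing_from_0 v \<Longrightarrow> increasing_from_0 w \<Longrightarrow>
      increasing_from_0 v' \<Longrightarrow> increasing_from_0 w' \<Longrightarrow>
      (\<And>i. i \<le> k T \<Longrightarrow> \<bar>v i - v' i\<bar> \<le> e \<and> \<bar>w i - w' i\<bar> \<le> e) \<Longrightarrow> \<bar>d T (\<Phi> v w) (\<Phi> v' w')\<bar> \<le> C * e"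
  shows "random_element (skorokhod_topology d) M (\<lambda>\<omega>. \<Phi> (\<lambda>i. V i \<omega>) (\<lambda>i. W i \<omega>))"
proof -
  define digits :: "nat \<Rightarrow> (nat \<Rightarrow> real) \<Rightarrow> (nat \<Rightarrow> real) \<Rightarrow> (int \<times> int) list"
    where "digits k v w = map (\<lambda>i. (\<lfloor>2 ^ k * v i\<rfloor>, \<lfloor>2 ^ k * w i\<rfloor>)) [0..<k]" for k v w
  define B where "B k l = {\<Phi> v w | v w. increasing_from_0 v \<and> increasing_from_0 w \<and> digits k v w = l}" for k l
  have digits_close: "\<bar>v i - v' i\<bar> \<le> (1/2) ^ k" "\<bar>w i - w' i\<bar> \<le> (1/2) ^ k"
    if eq: "digits k v w = digits k v' w'" and i: "i < k" for k v w v' w' i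
  proof -
    have eqs: "\<lfloor>2 ^ k * v i\<rfloor> = \<lfloor>2 ^ k * v' i\<rfloor>" "\<lfloor>2 ^ k * w i\<rfloor> = \<lfloor>2 ^ k * w' i\<rfloor>"
      using eq i by (auto simp: digits_def)
    have fl: "\<bar>a - b\<bar> \<le> (1/2) ^ k" if "\<lfloor>2 ^ k * a\<rfloor> = \<lfloor>2 ^ k * b\<rfloor>" for a b :: real
    proof -
      have "\<bar>2 ^ k * a - 2 ^ k * b\<bar> \<le> 1"
        using that by linarith
      then have "2 ^ k * \<bar>a - b\<bar> \<le> 1"
        by (simp add: abs_mult right_diff_distrib[symmetric])
      then show ?thesis
        by (simp add: power_divide field_simps)
    qed
    show "\<bar>v i - v' i\<bar> \<le> (1/2) ^ k" "\<bar>w i - w' i\<bar> \<le> (1/2) ^ k"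
      using fl eqs by blast+
  qed
  show ?thesis
  proof (rule random_element_discretely_approximated)
    show "(\<lambda>\<omega>. digits k (\<lambda>i. V i \<omega>) (\<lambda>i. W i \<omega>)) \<in> measurable M (count_space UNIV)" for k
      unfolding digits_def by (rule measurable_map_list) measurable
    show "B k l \<subseteq> skorokhod_space" for k l
      using \<Phi> by (auto simp: B_def)
    show "AE \<omega> in M. discretely_approximated d B (\<lambda>k. digits k (\<lambda>i. V i \<omega>) (\<lambda>i. W i \<omega>)) (\<Phi> (\<lambda>i. V i \<omega>) (\<lambda>i. W i \<omega>))"
      using incr
    proof eventually_elim
      case (elim \<omega>)
      define v w where "v = (\<lambda>i. V i \<omega>)" and "w = (\<lambda>i. W i \<omega>)"
      have vw: "increasing_from_0 v" "increasing_from_0 w"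
        using elim by (simp_all add: v_def w_def)
      have "discretely_approximated d B (\<lambda>k. digits k v w) (\<Phi> v w)"
        unfolding discretely_approximated_def skorokhod_converges_def
      proof (intro conjI allI impI)
        show "\<Phi> v w \<in> skorokhod_space" by (rule \<Phi>[OF vw])
        show "\<forall>\<^sub>F k in sequentially. \<Phi> v w \<in> B k (digits k v w)"
          using vw unfolding B_def by (intro always_eventually) blast
        fix xs T assume xs: "\<forall>\<^sub>F k in sequentially. xs k \<in> B k (digits k v w)" and T: "(0::real) < T"
        show "(\<lambda>k. d T (xs k) (\<Phi> v w)) \<longlonglongrightarrow> 0"
        proof (rule tendstoI)
          fix e :: real assume "0 < e"
          define e' where "e' = e / (2 * C)"
          have e': "0 < e'" "C * e' < e"
            using C \<open>0 < e\<close> by (auto simp: e'_def)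
          have "(\<lambda>k. (1/2 :: real) ^ k) \<longlonglongrightarrow> 0"
            by (rule LIMSEQ_realpow_zero) auto
          then have "\<forall>\<^sub>F k in sequentially. (1/2 :: real) ^ k < e'"
            by (rule order_tendstoD(2)) (rule e'(1))
          then show "\<forall>\<^sub>F k in sequentially. dist (d T (xs k) (\<Phi> v w)) 0 < e"
            using xs eventually_gt_at_top[of "k T"]
          proof eventually_elim
            case (elim l)
            obtain v' w' where x: "xs l = \<Phi> v' w'" "increasing_from_0 v'" "increasing_from_0 w'" and dg: "digits l v' w' = digits l v w"
              using elim(2) unfolding B_def by blast
            have "\<bar>d T (\<Phi> v' w') (\<Phi> v w)\<bar> \<le> C * e'"
            proof (rule close[OF T x(2,3) vw])
              fix i assume "i \<le> k T"
              then have "i < l" using elim(3) by simp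
              then show "\<bar>v' i - v i\<bar> \<le> e' \<and> \<bar>w' i - w i\<bar> \<le> e'"
                using digits_close[OF dg] elim(1) by (meson less_imp_le order_trans)
            qed
            then show ?case
              using e'(2) by (simp add: x(1))
          qed
        qed
      qed
      then show ?case
        by (simp add: v_def w_def)
    qed
  qed
qed

lemma J1_dist_step_path:
  assumes T: "0 < T" and L: "0 < L" and close: "\<And>i. i \<le> clock L T \<Longrightarrow> \<bar>v i - v' i\<bar> \<le> e \<and> \<bar>w i - w' i\<bar> \<le> e"
  shows "\<bar>J1_dist T (\<lambda>t\<in>{0..}. v (clock L t)) (\<lambda>t\<in>{0..}. v' (clock L t) :: real)\<bar> \<le> 12 * e"
proof -
  let ?x = "\<lambda>t\<in>{0..}. v (clock L t)" and ?y = "\<lambda>t\<in>{0..}. v' (clock L t)"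
  have e: "0 \<le> e" using close[of 0] by (meson abs_ge_zero le0 order_trans)
  have "J1_dist T ?x ?y \<le> e"
  proof (rule J1_dist_le[OF less_imp_le[OF T]])
    show "(\<lambda>t. t) \<in> time_changes T"
      by (auto simp: time_changes_def strict_mono_on_def)
    show "\<bar>t - t\<bar> \<le> e" for t :: real using e by simp
    show "dist (?x t) (?y t) \<le> e" if "t \<in> {0..T}" for t
      using that close[of "clock L t"] monoD[OF mono_clock[OF L], of t T] by (simp add: dist_real_def)
  qed
  moreover have "0 \<le> J1_dist T ?x ?y"
    using T by (intro J1_dist_nonneg) simp
  ultimately show ?thesis
    using e by linarith
qed

lemma monotone_path_step:
  assumes L: "0 < L" and v: "increasing_from_0 v" and w: "increasing_from_0 w"
  shows "monotone_path (\<lambda>t\<in>{0..}. (v (clock L t), w (clock L t)))"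
  unfolding monotone_path_def
proof (intro conjI)
  have m: "mono v" "mono w" and z: "v 0 = 0" "w 0 = 0"
    using v w by (auto simp: increasing_from_0_def)
  show "(\<lambda>t\<in>{0..}. (v (clock L t), w (clock L t))) \<in> skorokhod_space"
    using m by (intro skorokhod_space_Pair step_path_skorokhod L)
  show "(\<lambda>t\<in>{0..}. (v (clock L t), w (clock L t))) 0 = 0"
    using z clock_nonpos[OF L, of 0] by (simp add: zero_prod_def)
  show "mono_on {0..} (\<lambda>t. fst ((\<lambda>t\<in>{0..}. (v (clock L t), w (clock L t))) t))"
    "mono_on {0..} (\<lambda>t. snd ((\<lambda>t\<in>{0..}. (v (clock L t), w (clock L t))) t))"
    unfolding mono_on_def using m monoD[OF mono_clock[OF L]] by (auto dest: monoD)
qed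

lemma SM1_dist_step_path:
  assumes T: "0 < T" and L: "0 < L" and vw: "increasing_from_0 v" "increasing_from_0 w" "increasing_from_0 v'" "increasing_from_0 w'"
    and close: "\<And>i. i \<le> clock L T \<Longrightarrow> \<bar>v i - v' i\<bar> \<le> e \<and> \<bar>w i - w' i\<bar> \<le> e"
  shows "\<bar>SM1_dist T (\<lambda>t\<in>{0..}. (v (clock L t), w (clock L t))) (\<lambda>t\<in>{0..}. (v' (clock L t), w' (clock L t)))\<bar> \<le> 12 * e"
proof -
  let ?x = "\<lambda>t\<in>{0..}. (v (clock L t), w (clock L t))" and ?y = "\<lambda>t\<in>{0..}. (v' (clock L t), w' (clock L t))"
  note xy = monotone_path_step[OF L vw(1,2)] monotone_path_step[OF L vw(3,4)] less_imp_le[OF T]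
  have "SM1_dist T ?x ?y \<le> 12 * e"
  proof (rule SM1_dist_le_uniform[OF xy])
    show "0 \<le> e" using close[of 0] by (meson abs_ge_zero le0 order_trans)
    show "\<bar>fst (?x t) - fst (?y t)\<bar> \<le> e \<and> \<bar>snd (?x t) - snd (?y t)\<bar> \<le> e" if "0 \<le> t" "t \<le> T" for t
      using that close[of "clock L t"] monoD[OF mono_clock[OF L], of t T] by simp
  qed
  then show ?thesis
    using SM1_dist_nonneg[OF xy] by linarith
qed

lemma random_element_step_path:
  assumes L: "0 < L" and V: "\<And>i. V i \<in> borel_measurable M" and W: "\<And>i. W i \<in> borel_measurable M"
    and incr: "AE \<omega> in M. increasing_from_0 (\<lambda>i. V i \<omega>) \<and> increasing_from_0 (\<lambda>i. W i \<omega>)"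
  shows "random_element (skorokhod_topology J1_dist) M (\<lambda>\<omega>. \<lambda>t\<in>{0..}. V (clock L t) \<omega> :: real)"
    and "random_element (skorokhod_topology SM1_dist) M (\<lambda>\<omega>. \<lambda>t\<in>{0..}. (V (clock L t) \<omega>, W (clock L t) \<omega> :: real))"
proof -
  show "random_element (skorokhod_topology J1_dist) M (\<lambda>\<omega>. \<lambda>t\<in>{0..}. V (clock L t) \<omega>)"
  proof (rule random_element_sequences[where \<Phi> = "\<lambda>v w. \<lambda>t\<in>{0..}. v (clock L t)" and k = "clock L" and C = 12, OF V W incr])
    show "(\<lambda>t\<in>{0..}. v (clock L t)) \<in> skorokhod_space" if "increasing_from_0 v" for v
      using that by (intro step_path_skorokhod L) (simp add: increasing_from_0_def)
  qed (simp, rule J1_dist_step_path[OF _ L], assumption, blast)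
  show "random_element (skorokhod_topology SM1_dist) M (\<lambda>\<omega>. \<lambda>t\<in>{0..}. (V (clock L t) \<omega>, W (clock L t) \<omega>))"
  proof (rule random_element_sequences[where \<Phi> = "\<lambda>v w. \<lambda>t\<in>{0..}. (v (clock L t), w (clock L t))" and k = "clock L" and C = 12, OF V W incr])
    show "(\<lambda>t\<in>{0..}. (v (clock L t), w (clock L t))) \<in> skorokhod_space" if "increasing_from_0 v" "increasing_from_0 w" for v w
      using monotone_path_step[OF L that] by (simp add: monotone_path_def)
    show "\<bar>SM1_dist T (\<lambda>t\<in>{0..}. (v (clock L t), w (clock L t))) (\<lambda>t\<in>{0..}. (v' (clock L t), w' (clock L t)))\<bar> \<le> 12 * e"
      if "0 < T" "increasing_from_0 v" "increasing_from_0 w" "increasing_from_0 v'" "increasing_from_0 w'"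
        "\<And>i. i \<le> clock L T \<Longrightarrow> \<bar>v i - v' i\<bar> \<le> e \<and> \<bar>w i - w' i\<bar> \<le> e" for T e v w v' w'
      by (rule SM1_dist_step_path[OF that(1) L that(2-6)])
  qed simp
qed

text \<open>The recorded lists agree with the levels of the cells only below the horizon; this and
  the next congruence lemmas justify exchanging the two.\<close>

lemma heights_cong: "(\<And>i. i < k \<Longrightarrow> d i = d' i) \<Longrightarrow> heights m d k = heights m d' k"
proof (induction k rule: less_induct)
  case (less k)
  then show ?case
    by (cases k) (auto simp: less_Suc_eq_le)
qed

lemma near_staircase_levels_cong:
  assumes "\<And>i. i < n \<Longrightarrow> d i = d' i"
  shows "near_staircase m n d \<delta> \<epsilon> x \<longleftrightarrow> near_staircase m n d' \<delta> \<epsilon> x"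
proof -
  have "heights m d (if b then Suc i else i) = heights m d' (if b then Suc i else i)" if "i < n" for i b
    by (rule heights_cong) (use assms that in \<open>auto split: if_splits\<close>)
  then show ?thesis
    unfolding near_staircase_def by auto
qed

lemma well_separated_cong:
  assumes "well_separated m n d" "\<And>i. i < n \<Longrightarrow> d i = d' i"
  shows "well_separated m n d'"
  unfolding well_separated_def
proof (intro allI impI)
  fix i j assume ij: "i < j" "j < n" "d' i \<noteq> 0" "d' j \<noteq> 0"
  then have "d i \<noteq> 0" "d j \<noteq> 0"
    using assms(2)[of i] assms(2)[of j] by auto
  then show "i + 2 < j \<and> (j + 2 < i + m \<or> i + m + 2 < j)"
    using well_separatedD[OF assms(1) ij(1,2)] by blast
qed

lemma near_staircase_tolerance:
  assumes x: "near_staircase m n d \<delta> \<epsilon> x" and \<epsilon>: "\<epsilon> \<le> \<epsilon>'"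
  shows "near_staircase m n d \<delta> \<epsilon>' x"
proof -
  obtain s where "x 0 = 0" "mono_on {0..} x" and s: "\<forall>i<n. s i \<in> {real i / m<..real (Suc i) / m} \<and>
        (\<forall>t\<in>{real i / m<..real (Suc i) / m}. \<bar>x t - \<delta> * heights m d (if s i \<le> t then Suc i else i)\<bar> \<le> \<epsilon>)"
    using x unfolding near_staircase_def by blast
  moreover have "\<forall>i<n. s i \<in> {real i / m<..real (Suc i) / m} \<and>
        (\<forall>t\<in>{real i / m<..real (Suc i) / m}. \<bar>x t - \<delta> * heights m d (if s i \<le> t then Suc i else i)\<bar> \<le> \<epsilon>')"
    using s order_trans[OF _ \<epsilon>] by blast
  ultimately show ?thesis
    unfolding near_staircase_def by blast
qed

context rescaled_brw
begin

lemma increasing_paths: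
  assumes N: "1 \<le> N" and c: "0 < c N"
  shows "AE \<omega> in Q N. increasing_from_0 (\<lambda>k. V N \<omega> k / c N) \<and> increasing_from_0 (\<lambda>k. W N \<omega> k / c N)"
  using AE_Y_nonneg[OF N]
proof eventually_elim
  case (elim \<omega>)
  then have "mono (V N \<omega>)" "mono (W N \<omega>)"
    by (intro brw_top_mono brw_bottom_mono N; blast)+
  then show ?case
    using N c by (simp add: increasing_from_0_def mono_def divide_right_mono)
qed

abbreviation front :: "nat \<Rightarrow> 'q \<Rightarrow> real \<Rightarrow> real" where
  "front N \<omega> \<equiv> \<lambda>t\<in>{0..}. top_path N \<omega> t"

abbreviation fronts :: "nat \<Rightarrow> 'q \<Rightarrow> real \<Rightarrow> real \<times> real" where
  "fronts N \<omega> \<equiv> \<lambda>t\<in>{0..}. (top_path N \<omega> t, bottom_path N \<omega> t)"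

lemma random_element_paths:
  "\<forall>\<^sub>F N in sequentially. random_element (skorokhod_topology J1_dist) (Q N) (front N)"
  "\<forall>\<^sub>F N in sequentially. random_element (skorokhod_topology SM1_dist) (Q N) (fronts N)"
proof -
  have key: "random_element (skorokhod_topology J1_dist) (Q N) (front N) \<and>
      random_element (skorokhod_topology SM1_dist) (Q N) (fronts N)"
    if N2: "2 \<le> N" and c: "0 < c N" for N
  proof -
    have N1: "1 \<le> N" using N2 by simp
    interpret brw_model "Q N" N "Y N" D by (rule brw[OF N1])
    have meas: "(\<lambda>\<omega>. brw_list N (\<lambda>i j. Y N i j \<omega>) k ! i) \<in> borel_measurable (Q N)" if "i < N" for k i
      using that by (intro borel_measurable_brw_list Y_measurable)
    have V: "(\<lambda>\<omega>. V N \<omega> k / c N) \<in> borel_measurable (Q N)" for k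
      unfolding brw_top_def using N2 by (intro borel_measurable_divide meas borel_measurable_const) simp
    have W: "(\<lambda>\<omega>. W N \<omega> k / c N) \<in> borel_measurable (Q N)" for k
      unfolding brw_bottom_def using N2 by (intro borel_measurable_divide meas borel_measurable_const) simp
    show ?thesis
      unfolding top_path_def bottom_path_def
      using random_element_step_path[OF L_pos[OF N2] V W increasing_paths[OF N1 c]] by blast
  qed
  have "\<forall>\<^sub>F N in sequentially. random_element (skorokhod_topology J1_dist) (Q N) (front N) \<and>
      random_element (skorokhod_topology SM1_dist) (Q N) (fronts N)"
    by (rule eventually_mono[OF eventually_conj[OF N_large c_pos]]) (use key in blast)
  then show "\<forall>\<^sub>F N in sequentially. random_element (skorokhod_topology J1_dist) (Q N) (front N)"
    "\<forall>\<^sub>F N in sequentially. random_element (skorokhod_topology SM1_dist) (Q N) (fronts N)"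
    unfolding eventually_conj_iff by blast+
qed

end

section \<open>Convergence of the records and of the paths\<close>

locale scaling_limit = rescaled_brw h \<alpha> D Q Y + stairs_ppp S \<mu> \<alpha> \<eta> + staircase_levels \<alpha> m n K \<delta> \<kappa>
  for h \<alpha> D and Q :: "nat \<Rightarrow> 'q measure" and Y and S :: "'s measure" and \<mu> \<eta> m n K \<delta> \<kappa>
begin

definition limit_data :: "nat \<Rightarrow> 's \<Rightarrow> nat list" where
  "limit_data j \<omega> = map (\<lambda>i. level_count (K j) (\<lambda>q. exceeds (m j) (\<delta> j) i q \<omega>)) [0..<n j]"

definition brw_data :: "nat \<Rightarrow> nat \<Rightarrow> 'q \<Rightarrow> nat list" where
  "brw_data j N \<omega> = map (block_level (m j) (\<delta> j) (K j) N \<omega>) [0..<n j]"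

definition data_range :: "nat \<Rightarrow> nat list set" where
  "data_range j = {l. set l \<subseteq> {0..K j} \<and> length l = n j}"

lemma finite_data_range: "finite (data_range j)"
  unfolding data_range_def by (rule finite_lists_length_eq) simp

lemma data_in_range: "limit_data j \<omega> \<in> data_range j" "brw_data j N \<omega>' \<in> data_range j"
  by (auto simp: limit_data_def brw_data_def data_range_def block_level_def level_count_le)

lemma m_pos': "0 < m j"
  using m_ge(1)[of j] by simp

lemma limit_data_measurable: "limit_data j \<in> measurable S (count_space UNIV)"
  unfolding limit_data_def[abs_def]
  by (rule measurable_map_list, rule level_count_measurable, rule exceeds_measurable, rule less_imp_le, rule \<delta>_pos)

lemma brw_data_measurable:
  assumes "1 \<le> N"
  shows "brw_data j N \<in> measurable (Q N) (count_space UNIV)"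
  unfolding brw_data_def[abs_def] block_level_def
  by (rule measurable_map_list, rule level_count_measurable, rule brw_model.block_exceeds_measurable, rule brw, rule assms)

lemma prob_space_Q: "1 \<le> N \<Longrightarrow> prob_space (Q N)"
  using brw[of N] by (simp add: brw_model_def)

lemma data_law_converges:
  assumes e: "e \<in> data_range j"
  shows "(\<lambda>N. measure (Q N) {\<omega> \<in> space (Q N). brw_data j N \<omega> = e}) \<longlonglongrightarrow> measure S {\<omega> \<in> space S. limit_data j \<omega> = e}"
proof -
  \<comment> \<open>The guards here and in \<open>exn\<close> make both families antitone in
    \<open>q\<close> for every argument, including points outside the space and small
    \<open>N\<close>, as \<open>level_count_law_converges\<close> demands.\<close>
  define ex where "ex i q \<omega> \<longleftrightarrow> \<omega> \<in> space S \<and> exceeds (m j) (\<delta> j) i q \<omega>" for i q \<omega>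
  define exn where "exn N i q \<omega> \<longleftrightarrow> (1 \<le> N \<and> 0 < c N) \<and> brw_model.block_exceeds N (Y N) (L N) (m j) (\<delta> j * c N) i q \<omega>" for N i q \<omega>
  have \<delta>0: "0 \<le> \<delta> j" using \<delta>_pos[of j] by simp
  have N1: "\<forall>\<^sub>F N in sequentially. 1 \<le> N \<and> 0 < c N"
    using eventually_ge_at_top[of 1] c_pos by (rule eventually_conj)
  let ?p = "\<lambda>N. measure (Q N) {\<omega> \<in> space (Q N). (\<forall>i\<in>{}. \<not> exn N i (0::nat) \<omega>) \<and> (\<forall>i\<in>{..<n j}. level_count (K j) (\<lambda>q. exn N i q \<omega>) = e ! i)}" and ?p' = "measure S {\<omega> \<in> space S. (\<forall>i\<in>{}. \<not> ex i (0::nat) \<omega>) \<and> (\<forall>i\<in>{..<n j}. level_count (K j) (\<lambda>q. ex i q \<omega>) = e ! i)}"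
  have conv: "(\<lambda>N. ?p N)
    \<longlonglongrightarrow> ?p'"
  proof (rule level_count_law_converges)
    show "prob_space S" by unfold_locales
    show "\<forall>\<^sub>F N in sequentially. prob_space (Q N)"
      by (rule eventually_mono[OF eventually_ge_at_top[of 1]]) (rule prob_space_Q)
    show "Measurable.pred S (ex i q)" for i q
      using exceeds_measurable[OF \<delta>0, of "m j" i q] unfolding ex_def[abs_def] by measurable
    show "\<forall>\<^sub>F N in sequentially. \<forall>i q. Measurable.pred (Q N) (exn N i q)"
    proof (rule eventually_mono[OF N1], intro allI)
      fix N i q assume N: "1 \<le> N \<and> 0 < c N"
      show "Measurable.pred (Q N) (exn N i q)"
        using brw_model.block_exceeds_measurable[OF brw[OF conjunct1[OF N]], of "L N" "m j" "\<delta> j * c N" i q]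
        unfolding exn_def[abs_def] by simp
    qed
    show "antimono (\<lambda>q. ex i q \<omega>)" for i \<omega>
      using antimono_exceeds[OF _ \<delta>0, of \<omega> "m j" i] by (cases "\<omega> \<in> space S") (auto simp: ex_def monotone_def)
    show "antimono (\<lambda>q. exn N i q \<omega>)" for N i \<omega>
    proof (cases "1 \<le> N \<and> 0 < c N")
      case True
      then have "0 \<le> \<delta> j * c N" using \<delta>0 by simp
      then show ?thesis
        using brw_model.antimono_block_exceeds[OF brw, of N] True unfolding exn_def by simp
    next
      case False
      then show ?thesis by (auto simp: exn_def monotone_def)
    qed
    show "(\<lambda>N. measure (Q N) {\<omega> \<in> space (Q N). \<forall>i\<in>A. \<not> exn N i (r i) \<omega>}) \<longlonglongrightarrow> measure S {\<omega> \<in> space S. \<forall>i\<in>A. \<not> ex i (r i) \<omega>}"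
      if A: "finite A" and r: "\<And>i. i \<in> A \<Longrightarrow> 1 \<le> r i" for A r
    proof -
      have "measure S {\<omega> \<in> space S. \<forall>i\<in>A. \<not> ex i (r i) \<omega>} = prob {\<omega> \<in> space S. \<forall>i\<in>A. \<not> exceeds (m j) (\<delta> j) i (r i) \<omega>}"
        by (rule arg_cong[where f = prob]) (auto simp: ex_def)
      also have "\<dots> = exp (- (\<Sum>i\<in>A. (real (r i) * \<delta> j) powr - \<alpha> / m j))"
        by (rule prob_void[OF A r m_pos' \<delta>_pos])
      finally have eq: "measure S {\<omega> \<in> space S. \<forall>i\<in>A. \<not> ex i (r i) \<omega>} = exp (- (\<Sum>i\<in>A. (real (r i) * \<delta> j) powr - \<alpha> / m j))" .
      show ?thesis
        unfolding eq
      proof (rule Lim_transform_eventually[OF void_limit[OF m_pos' \<delta>_pos A r]])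
        show "\<forall>\<^sub>F N in sequentially. measure (Q N) {\<omega> \<in> space (Q N). \<forall>i\<in>A. \<not> brw_model.block_exceeds N (Y N) (L N) (m j) (\<delta> j * c N) i (r i) \<omega>} =
            measure (Q N) {\<omega> \<in> space (Q N). \<forall>i\<in>A. \<not> exn N i (r i) \<omega>}"
          using N1 by (rule eventually_mono) (simp add: exn_def)
      qed
    qed
  qed (use K_ge in auto)
  have len: "length e = n j" using e by (simp add: data_range_def)
  have "?p' =
      measure S {\<omega> \<in> space S. limit_data j \<omega> = e}"
    by (rule arg_cong[where f = prob]) (auto simp: ex_def limit_data_def list_eq_iff_nth_eq len)
  moreover have "\<forall>\<^sub>F N in sequentially. ?p N =
      measure (Q N) {\<omega> \<in> space (Q N). brw_data j N \<omega> = e}"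
  proof (rule eventually_mono[OF N1])
    fix N assume N: "1 \<le> N \<and> 0 < c N"
    show "?p N =
      measure (Q N) {\<omega> \<in> space (Q N). brw_data j N \<omega> = e}"
      using N by (intro arg_cong[where f = "measure (Q N)"]) (auto simp: exn_def brw_data_def block_level_def list_eq_iff_nth_eq len)
  qed
  ultimately show ?thesis
    using Lim_transform_eventually[OF conv] by simp
qed

lemma brw_near_levels:
  "\<forall>\<^sub>F N in sequentially. \<exists>A\<in>sets (Q N). measure (Q N) A \<le> 2 * (1/2) ^ j + 1 / (real j + 1) \<and>
    (AE \<omega> in Q N. \<omega> \<notin> A \<longrightarrow> front N \<omega> \<in> J1_level j (brw_data j N \<omega>)) \<and> (AE \<omega> in Q N. \<omega> \<notin> A \<longrightarrow> fronts N \<omega> \<in> SM1_level j (brw_data j N \<omega>))"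
proof -
  \<comment> \<open>The bound for the walk only converges to the crowding term; the summand
    \<open>1 / (real j + 1)\<close> makes the inequality strict and tends to 0 as \<open>j\<close>
    grows.\<close>
  have b: "crowding \<alpha> (m j) (n j) (\<delta> j) (K j) < 2 * (1/2) ^ j + 1 / (real j + 1)"
    by (rule le_less_trans[OF failure]) simp
  show ?thesis
    using eventually_near_staircase[OF m_ge(1) \<kappa>_pos \<delta>_pos \<delta>_\<kappa> K_ge b] N_large c_pos
  proof eventually_elim
    case (elim N)
    have N1: "1 \<le> N" using elim(2) by simp
    note L = L_pos[OF elim(2)]
    obtain E where E: "E \<in> sets (Q N)" "measure (Q N) E \<le> 2 * (1/2) ^ j + 1 / (real j + 1)"
      and AE: "AE \<omega> in Q N. \<omega> \<notin> E \<longrightarrow> near_levels (m j) (n j) (\<delta> j) (\<kappa> j) (K j) N \<omega>"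
      using elim(1) by blast
    have near: "AE \<omega> in Q N. \<omega> \<notin> E \<longrightarrow> front N \<omega> \<in> J1_level j (brw_data j N \<omega>) \<and> fronts N \<omega> \<in> SM1_level j (brw_data j N \<omega>)"
      using AE increasing_paths[OF N1 elim(3)]
    proof eventually_elim
      case (elim \<omega>)
      show ?case
      proof
        assume "\<omega> \<notin> E"
        then have sep: "well_separated (m j) (n j) (block_level (m j) (\<delta> j) (K j) N \<omega>)"
          and near: "near_staircase (m j) (n j) (block_level (m j) (\<delta> j) (K j) N \<omega>) (\<delta> j) (tol j) (top_path N \<omega>)"
          and pair: "\<And>t. t \<in> {0..real (n j) / m j} \<Longrightarrow> top_path N \<omega> (max 0 (t - 1 - 1 / m j)) \<le> bottom_path N \<omega> t \<and>
            bottom_path N \<omega> t \<le> top_path N \<omega> (max 0 (t - 1 + 1 / m j)) + \<kappa> j"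
          using elim(1) unfolding tol_def near_levels_def by blast+
        have nth: "block_level (m j) (\<delta> j) (K j) N \<omega> i = brw_data j N \<omega> ! i" if "i < n j" for i
          using that by (simp add: brw_data_def)
        have sep': "well_separated (m j) (n j) ((!) (brw_data j N \<omega>))"
          by (rule well_separated_cong[OF sep]) (rule nth)
        have near': "near_staircase (m j) (n j) ((!) (brw_data j N \<omega>)) (\<delta> j) (tol j) (top_path N \<omega>)"
          by (rule near_staircase_levels_cong[THEN iffD1, OF _ near]) (rule nth)
        have mp: "monotone_path (fronts N \<omega>)"
          unfolding top_path_def bottom_path_def
          using monotone_path_step[OF L conjunct1[OF elim(2)] conjunct2[OF elim(2)]] .
        have "front N \<omega> \<in> skorokhod_space"
          unfolding top_path_def using elim(2) unfolding increasing_from_0_def by (intro step_path_skorokhod[OF L]) blast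
        moreover have "near_staircase (m j) (n j) ((!) (brw_data j N \<omega>)) (\<delta> j) (tol j) (front N \<omega>)"
          by (rule near_staircase_cong[THEN iffD1, OF _ near']) simp
        ultimately have J1: "front N \<omega> \<in> J1_level j (brw_data j N \<omega>)"
          using sep' by (simp add: J1_level_def)
        have "\<kappa> j \<le> tol j"
          using \<kappa>_pos[of j] \<delta>_pos[of j] mult_mono[of 1 "2 * (real (n j) / m j) + 1" "\<kappa> j" "\<delta> j + 2 * \<kappa> j"] by (simp add: tol_def)
        have "near_staircase_pair (m j) (n j) ((!) (brw_data j N \<omega>)) (\<delta> j) (tol j) (fronts N \<omega>)"
          unfolding near_staircase_pair_def
        proof (intro conjI mp ballI)
          show "near_staircase (m j) (n j) ((!) (brw_data j N \<omega>)) (\<delta> j) (tol j) (\<lambda>t. fst (fronts N \<omega> t))"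
            by (rule near_staircase_cong[THEN iffD1, OF _ near']) simp
          fix t assume t: "t \<in> {0..real (n j) / m j}"
          show "fst ((fronts N \<omega>) (max 0 (t - 1 - 1 / real (m j)))) \<le> snd (fronts N \<omega> t)"
            using pair[OF t] t by simp
          show "snd (fronts N \<omega> t) \<le> fst ((fronts N \<omega>) (max 0 (t - 1 + 1 / real (m j)))) + tol j"
            using pair[OF t] t \<open>\<kappa> j \<le> tol j\<close> by simp
        qed
        then have "fronts N \<omega> \<in> SM1_level j (brw_data j N \<omega>)"
          using sep' mp by (simp add: SM1_level_def monotone_path_def)
        then show "front N \<omega> \<in> J1_level j (brw_data j N \<omega>) \<and>
          fronts N \<omega> \<in> SM1_level j (brw_data j N \<omega>)"
          using J1 by blast
      qed
    qed
    have "AE \<omega> in Q N. \<omega> \<notin> E \<longrightarrow> front N \<omega> \<in> J1_level j (brw_data j N \<omega>)"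
      using near by eventually_elim blast
    moreover have "AE \<omega> in Q N. \<omega> \<notin> E \<longrightarrow> fronts N \<omega> \<in> SM1_level j (brw_data j N \<omega>)"
      using near by eventually_elim blast
    ultimately show ?case
      using E by blast
  qed
qed

abbreviation R :: "'s \<Rightarrow> real \<Rightarrow> real" where "R \<omega> \<equiv> stairs (jump (\<eta> \<omega>))"

abbreviation delayed_R :: "'s \<Rightarrow> real \<Rightarrow> real \<times> real" where
  "delayed_R \<omega> \<equiv> \<lambda>t\<in>{0..}. (R \<omega> t, R \<omega> (t - 1))"

text \<open>Right continuity, and with it membership in the Skorokhod space, is drawn from the
  near-staircases themselves. For the delayed pair the sandwich of the second coordinate follows
  from monotonicity, the delay being exactly one time unit.\<close>

lemma stairs_near_levels:
  assumes regular: "regular_config m n \<delta> K \<omega>"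
  shows "(\<lambda>t\<in>{0..}. R \<omega> t) \<in> skorokhod_space" "delayed_R \<omega> \<in> skorokhod_space"
    "\<forall>\<^sub>F j in sequentially. (\<lambda>t\<in>{0..}. R \<omega> t) \<in> J1_level j (limit_data j \<omega>)"
    "\<forall>\<^sub>F j in sequentially. delayed_R \<omega> \<in> SM1_level j (limit_data j \<omega>)"
proof -
  note reg = m_ge(1) \<delta>_pos K_ge \<delta>_limit horizon_at_top regular
  interpret jump_path "jump (\<eta> \<omega>)" by (rule jump_path_regular[OF reg])
  note mono = mono_stairs
  have good: "\<forall>\<^sub>F j in sequentially. simple_config (m j) (n j) (\<delta> j) (K j) \<omega>"
    using regular by (simp add: regular_config_def)
  have near: "well_separated (m j) (n j) ((!) (limit_data j \<omega>)) \<and> near_staircase (m j) (n j) ((!) (limit_data j \<omega>)) (\<delta> j) (tol j) (R \<omega>)"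
    if simple: "simple_config (m j) (n j) (\<delta> j) (K j) \<omega>" for j
  proof -
    note ns = regular_near_staircase[OF reg simple]
    have nth: "level_count (K j) (\<lambda>q. exceeds (m j) (\<delta> j) i q \<omega>) = limit_data j \<omega> ! i" if "i < n j" for i
      using that by (simp add: limit_data_def)
    have "(2 * (real (n j) / m j) + 1) * \<delta> j \<le> tol j"
      unfolding tol_def using \<kappa>_pos[of j] \<delta>_pos[of j] by (intro mult_left_mono) auto
    then have t: "near_staircase (m j) (n j) (\<lambda>i. level_count (K j) (\<lambda>q. exceeds (m j) (\<delta> j) i q \<omega>)) (\<delta> j) (tol j) (R \<omega>)"
      by (rule near_staircase_tolerance[OF ns(2)])
    show ?thesis
    proof
      show "well_separated (m j) (n j) ((!) (limit_data j \<omega>))"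
        by (rule well_separated_cong[OF ns(1)]) (rule nth)
      show "near_staircase (m j) (n j) ((!) (limit_data j \<omega>)) (\<delta> j) (tol j) (R \<omega>)"
        by (rule near_staircase_levels_cong[THEN iffD1, OF _ t]) (rule nth)
    qed
  qed
  have right: "(R \<omega> \<longlongrightarrow> R \<omega> t) (at_right t)" if t: "0 \<le> t" for t
  proof (rule near_staircase_right_continuous[OF _ t])
    fix \<epsilon> :: real assume "0 < \<epsilon>"
    then have "\<forall>\<^sub>F j in sequentially. tol j < \<epsilon>"
      by (rule order_tendstoD(2)[OF tol_limit])
    moreover have "\<forall>\<^sub>F j in sequentially. t < real (n j) / m j"
      using horizon_at_top unfolding filterlim_at_top_dense by blast
    ultimately have "\<forall>\<^sub>F j in sequentially. tol j < \<epsilon> \<and> t < real (n j) / m j \<and> simple_config (m j) (n j) (\<delta> j) (K j) \<omega>"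
      using good by (intro eventually_conj)
    then obtain j where j: "tol j < \<epsilon>" "t < real (n j) / m j" "simple_config (m j) (n j) (\<delta> j) (K j) \<omega>"
      using eventually_happens'[OF sequentially_bot] by blast
    show "\<exists>m n d \<delta> \<epsilon>'. 0 < m \<and> t < real n / real m \<and> 0 \<le> \<epsilon>' \<and> \<epsilon>' \<le> \<epsilon> \<and> near_staircase m n d \<delta> \<epsilon>' (R \<omega>)"
      using j m_pos'[of j] near[OF j(3)] less_imp_le[OF tol_pos[of j]] by (metis less_imp_le)
  qed
  \<comment> \<open>Before time 1 the delayed path vanishes; from time 1 on right continuity is
    transported by the shift.\<close>
  have right': "((\<lambda>t. R \<omega> (t - 1)) \<longlongrightarrow> R \<omega> (t - 1)) (at_right t)" if t: "0 \<le> t" for t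
  proof (cases "t < 1")
    case True
    have "\<forall>\<^sub>F s in at_right t. R \<omega> (s - 1) = R \<omega> (t - 1)"
      by (rule eventually_at_rightI[of t 1]) (use True in \<open>auto simp: stairs_nonpos\<close>)
    then show ?thesis by (rule tendsto_eventually)
  next
    case False
    have "filterlim (\<lambda>s. s - 1) (at_right (t - 1)) (at_right t)"
      by (rule filterlim_at_withinI) (auto intro!: tendsto_eq_intros eventually_at_rightI[of t "t + 1"])
    then show ?thesis
      using filterlim_compose[OF right[of "t - 1"]] False by simp
  qed
  show sk: "(\<lambda>t\<in>{0..}. R \<omega> t) \<in> skorokhod_space"
    using skorokhod_space_monoI[OF mono right] .
  have "mono (\<lambda>t. R \<omega> (t - 1))"
    using monoD[OF mono] by (intro monoI) simp
  then have "(\<lambda>t\<in>{0..}. R \<omega> (t - 1)) \<in> skorokhod_space"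
    by (rule skorokhod_space_monoI[OF _ right'])
  then show sk2: "delayed_R \<omega> \<in> skorokhod_space"
    by (rule skorokhod_space_Pair[OF sk])
  show "\<forall>\<^sub>F j in sequentially. (\<lambda>t\<in>{0..}. R \<omega> t) \<in> J1_level j (limit_data j \<omega>)"
    using good
  proof eventually_elim
    case (elim j)
    have "near_staircase (m j) (n j) ((!) (limit_data j \<omega>)) (\<delta> j) (tol j) (\<lambda>t\<in>{0..}. R \<omega> t)"
      by (rule near_staircase_cong[THEN iffD1, OF _ conjunct2[OF near[OF elim]]]) simp
    then show ?case
      using near[OF elim] sk by (simp add: J1_level_def)
  qed
  have mp: "monotone_path (delayed_R \<omega>)"
    unfolding monotone_path_def
  proof (intro conjI sk2)
    show "(delayed_R \<omega>) 0 = 0"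
      by (simp add: stairs_nonpos zero_prod_def)
    show "mono_on {0..} (\<lambda>t. fst (delayed_R \<omega> t))"
      "mono_on {0..} (\<lambda>t. snd (delayed_R \<omega> t))"
      unfolding mono_on_def using monoD[OF mono] by simp_all
  qed
  show "\<forall>\<^sub>F j in sequentially. delayed_R \<omega> \<in> SM1_level j (limit_data j \<omega>)"
    using good
  proof eventually_elim
    case (elim j)
    have "near_staircase_pair (m j) (n j) ((!) (limit_data j \<omega>)) (\<delta> j) (tol j) (delayed_R \<omega>)"
      unfolding near_staircase_pair_def
    proof (intro conjI mp ballI)
      show "near_staircase (m j) (n j) ((!) (limit_data j \<omega>)) (\<delta> j) (tol j) (\<lambda>t. fst (delayed_R \<omega> t))"
        by (rule near_staircase_cong[THEN iffD1, OF _ conjunct2[OF near[OF elim]]]) simp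
      fix t assume t: "t \<in> {0..real (n j) / m j}"
      have "R \<omega> (max 0 (t - 1 - 1 / m j)) \<le> R \<omega> (t - 1)"
        using monoD[OF mono, of "t - 1 - 1 / m j" "t - 1"] stairs_nonneg[of "t - 1"]
        by (cases "0 \<le> t - 1 - 1 / m j") (auto simp: max_def stairs_nonpos)
      then show "fst ((delayed_R \<omega>) (max 0 (t - 1 - 1 / real (m j)))) \<le> snd (delayed_R \<omega> t)"
        using t by simp
      have "R \<omega> (t - 1) \<le> R \<omega> (max 0 (t - 1 + 1 / m j))"
      proof (rule monoD[OF mono])
        have "0 \<le> 1 / real (m j)" by simp
        then show "t - 1 \<le> max 0 (t - 1 + 1 / m j)" by linarith
      qed
      then show "snd (delayed_R \<omega> t) \<le> fst ((delayed_R \<omega>) (max 0 (t - 1 + 1 / real (m j)))) + tol j"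
        using t tol_pos[of j] by simp
    qed
    then show ?case
      using near[OF elim] sk2 by (simp add: SM1_level_def)
  qed
qed

text \<open>Both limits rest on the same records and their laws; they differ in the sets of
  compatible paths.\<close>

lemma scaling_limits:
  "converges_in_law J1_topology Q front S (\<lambda>\<omega>. \<lambda>t\<in>{0..}. R \<omega> t)"
  "converges_in_law SM1_topology Q fronts S delayed_R"
proof -
  have regular: "AE \<omega> in S. regular_config m n \<delta> K \<omega>"
    by (rule AE_regular_config[OF m_pos' \<delta>_pos K_ge summable_failure])
  have N1: "\<forall>\<^sub>F N::nat in sequentially. 1 \<le> N"
    by (rule eventually_ge_at_top)
  have S: "prob_space S" by unfold_locales
  have QN: "\<forall>\<^sub>F N in sequentially. prob_space (Q N)"
    by (rule eventually_mono[OF N1]) (rule prob_space_Q)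
  have Dn: "\<forall>\<^sub>F N in sequentially. brw_data j N \<in> measurable (Q N) (count_space UNIV)" for j
    by (rule eventually_mono[OF N1]) (rule brw_data_measurable)
  have range: "\<forall>\<^sub>F N in sequentially. \<forall>\<omega>\<in>space (Q N). brw_data j N \<omega> \<in> data_range j" for j
    using data_in_range(2) by (intro always_eventually) blast
  have b: "(\<lambda>j. 2 * (1/2) ^ j + 1 / (real j + 1)) \<longlonglongrightarrow> 0"
    by real_asymp
  note common = S QN limit_data_measurable Dn finite_data_range data_in_range(1) range
  show "converges_in_law J1_topology Q front S (\<lambda>\<omega>. \<lambda>t\<in>{0..}. R \<omega> t)"
    unfolding J1_topology_def
  proof (rule converges_in_law_discretely_approximated[OF common])
    show "J1_level j e \<subseteq> skorokhod_space" for j e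
      by (auto simp: J1_level_def)
    show "AE \<omega> in S. discretely_approximated J1_dist J1_level (\<lambda>j. limit_data j \<omega>) (\<lambda>t\<in>{0..}. R \<omega> t)"
      using regular
    proof eventually_elim
      case (elim \<omega>)
      show ?case by (rule J1_discretely_approximated[OF stairs_near_levels(1,3)[OF elim]])
    qed
    show "\<forall>\<^sub>F N in sequentially. \<exists>A\<in>sets (Q N). measure (Q N) A \<le> 2 * (1/2) ^ j + 1 / (real j + 1) \<and>
        (AE \<omega> in Q N. \<omega> \<notin> A \<longrightarrow> front N \<omega> \<in> J1_level j (brw_data j N \<omega>))" for j
      by (rule eventually_mono[OF brw_near_levels[of j]]) blast
  qed (rule random_element_paths data_law_converges b | assumption)+
  show "converges_in_law SM1_topology Q fronts S delayed_R"
    unfolding SM1_topology_def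
  proof (rule converges_in_law_discretely_approximated[OF common])
    show "SM1_level j e \<subseteq> skorokhod_space" for j e
      by (auto simp: SM1_level_def)
    show "AE \<omega> in S. discretely_approximated SM1_dist SM1_level (\<lambda>j. limit_data j \<omega>) (delayed_R \<omega>)"
      using regular
    proof eventually_elim
      case (elim \<omega>)
      show ?case by (rule SM1_discretely_approximated[OF stairs_near_levels(2,4)[OF elim]])
    qed
    show "\<forall>\<^sub>F N in sequentially. \<exists>A\<in>sets (Q N). measure (Q N) A \<le> 2 * (1/2) ^ j + 1 / (real j + 1) \<and>
        (AE \<omega> in Q N. \<omega> \<notin> A \<longrightarrow> fronts N \<omega> \<in> SM1_level j (brw_data j N \<omega>))" for j
      by (rule eventually_mono[OF brw_near_levels[of j]]) blast
  qed (rule random_element_paths data_law_converges b | assumption)+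
qed

end

theorem theorem1p1:
  fixes P :: "'p measure" and X :: "'p \<Rightarrow> real"
    and h :: "real \<Rightarrow> real" and \<alpha> :: real
    and Q :: "nat \<Rightarrow> 'q measure" and Y :: "nat \<Rightarrow> nat \<Rightarrow> nat \<Rightarrow> 'q \<Rightarrow> real"
    and S :: "'s measure" and \<mu> :: "real measure" and \<eta> :: "'s \<Rightarrow> (real \<times> real) measure"
  assumes "prob_space P"
    and "X \<in> borel_measurable P" and "\<And>\<omega>. \<omega> \<in> space P \<Longrightarrow> 0 \<le> X \<omega>"
    and "\<And>x. 0 \<le> x \<Longrightarrow> measure P {\<omega> \<in> space P. x < X \<omega>} = 1 / h x"
    and "0 < \<alpha>" and "regularly_varying h \<alpha>"
    and "\<And>N. 1 \<le> N \<Longrightarrow> prob_space (Q N)"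
    and "\<And>N. 1 \<le> N \<Longrightarrow>
           prob_space.indep_vars (Q N) (\<lambda>_. borel) (\<lambda>(n, i). Y N n i) (UNIV \<times> {1..2 * N})"
    and "\<And>N n i. 1 \<le> N \<Longrightarrow> i \<in> {1..2 * N} \<Longrightarrow> distr (Q N) borel (Y N n i) = distr P borel X"
    and "prob_space S"
    and "stairs_measure \<mu>" and "\<And>x. 0 < x \<Longrightarrow> emeasure \<mu> {x..} = ennreal (x powr (- \<alpha>))"
    and "poisson_point_process S (stairs_intensity \<mu>) \<eta>"
  defines "c \<equiv> scaling h"
    and "\<X> \<equiv> (\<lambda>N i n \<omega>. brw N (\<lambda>m k. Y N m k \<omega>) i n)"
    and "\<R> \<equiv> (\<lambda>\<omega>. stairs (jump (\<eta> \<omega>)))"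
  shows "converges_in_law J1_topology
           Q (\<lambda>N \<omega>. \<lambda>t\<in>{0..}. \<X> N N (nat \<lfloor>t * log 2 (real N)\<rfloor>) \<omega> / c N)
           S (\<lambda>\<omega>. \<lambda>t\<in>{0..}. \<R> \<omega> t)
       \<and> converges_in_law SM1_topology
           Q (\<lambda>N \<omega>. \<lambda>t\<in>{0..}. (\<X> N N (nat \<lfloor>t * log 2 (real N)\<rfloor>) \<omega> / c N,
                                  \<X> N 1 (nat \<lfloor>t * log 2 (real N)\<rfloor>) \<omega> / c N))
           S (\<lambda>\<omega>. \<lambda>t\<in>{0..}. (\<R> \<omega> t, \<R> \<omega> (t - 1)))"
proof -
  interpret P: prob_space P by (rule assms(1))
  let ?D = "distr P borel X"
  have heavy: "heavy_tail h \<alpha>"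
    by (rule P.heavy_tailI[OF assms(2,4,5,6)])
  have brw: "brw_model (Q N) N (Y N) ?D" if "1 \<le> N" for N
    using assms(7,8,9)[OF that] that by (simp add: brw_model_def brw_model_axioms_def)
  have tail: "measure ?D {z<..} = 1 / h z" if "0 \<le> z" for z
  proof -
    have "measure ?D {z<..} = measure P {\<omega> \<in> space P. z < X \<omega>}"
      using assms(2) by (simp add: measure_distr) (intro arg_cong[where f = "measure P"], auto)
    then show ?thesis using assms(4)[OF that] by simp
  qed
  have nonneg: "AE y in ?D. 0 \<le> y"
    using assms(2,3) by (subst AE_distr_iff) auto
  \<comment> \<open>The resolutions depend on \<open>\<alpha>\<close> alone and serve the walk and
    the limit alike.\<close>
  obtain m n K \<delta> \<kappa> where levels: "staircase_levels \<alpha> m n K \<delta> \<kappa>"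
    using staircase_levels_exist[OF assms(5)] by blast
  interpret scaling_limit h \<alpha> ?D Q Y S \<mu> \<eta> m n K \<delta> \<kappa>
    by (intro scaling_limit.intro rescaled_brw.intro rescaled_brw_axioms.intro stairs_ppp.intro stairs_ppp_axioms.intro
        heavy brw tail nonneg levels assms)
  have top: "\<X> N N (nat \<lfloor>t * log 2 (real N)\<rfloor>) \<omega> / c N = top_path N \<omega> t" for N t \<omega>
    by (simp add: \<X>_def c_def top_path_def clock_def brw_eq)
  have bottom: "\<X> N 1 (nat \<lfloor>t * log 2 (real N)\<rfloor>) \<omega> / c N = bottom_path N \<omega> t" for N t \<omega>
    by (simp only: \<X>_def c_def bottom_path_def clock_def brw_eq)
  show ?thesis
    unfolding top bottom \<R>_def using scaling_limits by blast
qed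

end
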